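(* Let $k$ be an algebraically closed field of characteristic zero and $G$ a finite group. Let $V\subset\mathrm{Aut}_{Hopf}(DG)$ be the subgroup of automorphisms $e_g\times h\mapsto e_{v(g)}\times v(h)$, $v\in\mathrm{Aut}(G)$. (i) Consider the subgroup $\underline{\mathcal V}_L:=V\times\{1\}$ of $\mathrm{Aut}_{Hopf}(DG)\ltimes\mathrm Z^2_L(DG^* )$. For an element $(v,1)\in\underline{\mathcal V}_L$ the corresponding monoidal functor $\Psi(v,1)=(F_v,J^{triv})$, with trivial monoidal structure, is given on simple objects by $$F_v(\mathcal O_g^\rho)=\mathcal O_{v(g)}^{v^{-1*}(\rho)},\qquad v^{-1*}(\rho)=\rho\circ v^{-1}.$$ (ii) Every $\Psi(v,1)$ is braided. (iii) Let $\widetilde{\mathcal V}_L$ be the image of $\underline{\mathcal V}_L$ in $\mathrm{Out}_{Hopf}(DG)\ltimes\mathrm H^2_L(DG^* )$. Then $\widetilde{\mathcal V}_L\cong\mathrm{Out}(G)$.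
   Context: **Drinfeld double.** $k^G=(kG)^*$ has basis $e_x$ ($e_x(y)=\delta_{x,y}$); $g^h=h^{-1}gh$, ${}^hg=hgh^{-1}$. $DG$ has basis $e_x\times y$, $(e_x\times y)(e_{x'}\times y')=e_x({}^yx')(e_x\times yy')$, $\Delta(e_x\times y)=\sum_{x_1x_2=x}(e_{x_1}\times y)\otimes(e_{x_2}\times y)$, $\epsilon(e_x\times y)=\delta_{x,1}$. $DG^*$ has dual basis $g\times e_x$ (dual to $e_g\times x$), $(x\times e_y)(x'\times e_{y'})=xx'\times e_ye_{y'}$, $\Delta(x\times e_y)=\sum_{y_1y_2=y}(x\times e_{y_1})\otimes(x^{y_1}\times e_{y_2})$. $DG\text{-mod}$ is braided by $c_{M,N}(m\otimes n)=R_2.n\otimes R_1.m$, $R=\sum_g(e_g\times1)\otimes(1\times g)$. **Simple objects.** $\mathcal O_g^\rho=kG\otimes_{k\mathrm{Cent}(g)}W$ for $g\in G$ (a representative of its conjugacy class) and $\rho:\mathrm{Cent}(g)\to\mathrm{GL}(W)$ irreducible, with $(e_h\times t).(y\otimes w)=e_h((ty)g(ty)^{-1})\,(ty\otimes w)$. **Lazy cocycles.** A 2-cocycle on a Hopf algebra $K$ is a convolution invertible $\sigma:K\otimes K\to k$ with $\sigma(1,b)=\epsilon(b)=\sigma(b,1)$ and $\sigma(a_1,b_1)\sigma(a_2b_2,c)=\sigma(b_1,c_1)\sigma(a,b_2c_2)$; it is lazy if $\sigma(a_1,b_1)a_2b_2=a_1b_1\sigma(a_2,b_2)$. $\mathrm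 Z^2_L(K)$ is the group (under convolution) of lazy 2-cocycles. $\mathrm{Reg}^1_L(K)$ is the group of convolution invertible $\eta:K\to k$ with $\eta(1)=1$ and $\eta(a_1)a_2=a_1\eta(a_2)$; $\mathrm d\eta(a,b)=\eta(a_1)\eta(b_1)\eta^{-1}(a_2b_2)$; $\mathrm H^2_L(K)=\mathrm Z^2_L(K)/\mathrm d(\mathrm{Reg}^1_L(K))$. A cocycle $\sigma$ on $DG^*$ is identified with $\sigma_1\otimes\sigma_2=\sum\sigma(g\times e_x,h\times e_y)(e_g\times x)\otimes(e_h\times y)\in DG\otimes DG$. **Functors.** Every $\phi\in\mathrm{Aut}_{Hopf}(DG)$ is uniquely of the form $\phi(f\times g)=u(f_{(1)})b(g)\times a(f_{(2)})v(g)$ with $u\in\mathrm{End}_{Hopf}(k^G)$, Hopf maps $b:kG\to k^G$, $a:k^G\to kG$ and $v\in\mathrm{End}(G)$; put $\phi^\dagger(f\times g)=v^*(f_{(1)})b^*(g)\times a^*(f_{(2)})u^*(g)$ ($*$ = dual map). $\Psi(\phi,\sigma)=(F_\phi,J^\sigma)$, where $F_\phi(M)={}_\phi M$ is $M$ with $h\in DG$ acting by $\phi^\dagger(h)$, and $J^\sigma_{M,N}:{}_\phi M\otimes{}_\phi N\to{}_\phi(M\otimes N)$, $m\otimes n\mapsto\sigma_1.m\otimes\sigma_2.n$ (original actions). The group law on $\mathrm{Aut}_{Hopf}(DG)\ltimes\mathrm Z^2_L(DG^* )$ corresponds to composition of functors: $(\phi,\sigma)(\phi',\sigma')=(\phi\phi',\sigma'\cdot(\phi'^\dagger\otimes\phi'^\dagger)(\sigma))$,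 product in $DG\otimes DG$. $\mathrm{Out}_{Hopf}(DG)$ is $\mathrm{Aut}_{Hopf}(DG)$ modulo conjugations by group-like elements of $DG$. *)

theory Defs
  imports "HOL-Algebra.Algebra" "HOL-Algebra.Algebraic_Closure_Type"
begin

section \<open>Hopf algebras with a finite basis\<close>

text \<open>
  Every Hopf algebra below comes with a finite basis.  An element is its coordinate function,
  vanishing outside the basis, and the structure maps are given on basis elements; in particular
  \<open>K \<otimes> K\<close> consists of coordinate functions on pairs.  A linear form on \<open>K\<close> is likewise stored as
  the function of its values on the basis, so that the dual space has the same coordinates with
  respect to the dual basis.  The antipode is not recorded: it is determined by the bialgebra
  structure, and bialgebra maps between Hopf algebras preserve it.
\<close>

record ('b, 'k) hopf =
  basis :: "'b set"
  bmul :: "'b \<Rightarrow> 'b \<Rightarrow> 'b \<Rightarrow> 'k"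
  hone :: "'b \<Rightarrow> 'k"
  bcomul :: "'b \<Rightarrow> 'b \<times> 'b \<Rightarrow> 'k"
  bcounit :: "'b \<Rightarrow> 'k"

definition bv :: "'b \<Rightarrow> 'b \<Rightarrow> 'k::field" where
  "bv x = (\<lambda>y. of_bool (y = x))"

definition hcar :: "('b, 'k::field) hopf \<Rightarrow> ('b \<Rightarrow> 'k) set" where
  "hcar H = {a. \<forall>x. x \<notin> basis H \<longrightarrow> a x = 0}"

definition mul :: "('b, 'k::field) hopf \<Rightarrow> ('b \<Rightarrow> 'k) \<Rightarrow> ('b \<Rightarrow> 'k) \<Rightarrow> 'b \<Rightarrow> 'k" where
  "mul H a b = (\<lambda>z. \<Sum>x\<in>basis H. \<Sum>y\<in>basis H. a x * b y * bmul H x y z)"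

definition comul :: "('b, 'k::field) hopf \<Rightarrow> ('b \<Rightarrow> 'k) \<Rightarrow> 'b \<times> 'b \<Rightarrow> 'k" where
  "comul H a = (\<lambda>p. \<Sum>x\<in>basis H. a x * bcomul H x p)"

definition counit :: "('b, 'k::field) hopf \<Rightarrow> ('b \<Rightarrow> 'k) \<Rightarrow> 'k" where
  "counit H a = (\<Sum>x\<in>basis H. a x * bcounit H x)"

text \<open>The element \<open>a \<otimes> b\<close>.\<close>

definition tensor :: "('a \<Rightarrow> 'k::field) \<Rightarrow> ('b \<Rightarrow> 'k) \<Rightarrow> 'a \<times> 'b \<Rightarrow> 'k" where
  "tensor a b = (\<lambda>(x, y). a x * b y)"

text \<open>The product of the algebra \<open>H \<otimes> H\<close>.\<close>

definition mul2 ::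
  "('b, 'k::field) hopf \<Rightarrow> ('b \<times> 'b \<Rightarrow> 'k) \<Rightarrow> ('b \<times> 'b \<Rightarrow> 'k) \<Rightarrow> 'b \<times> 'b \<Rightarrow> 'k" where
  "mul2 H s t = (\<lambda>(z, w). \<Sum>(x, y)\<in>basis H \<times> basis H. \<Sum>(x', y')\<in>basis H \<times> basis H.
      s (x, y) * t (x', y') * bmul H x x' z * bmul H y y' w)"

definition map2 ::
  "('b, 'k::field) hopf \<Rightarrow> (('b \<Rightarrow> 'k) \<Rightarrow> 'c \<Rightarrow> 'k) \<Rightarrow> ('b \<times> 'b \<Rightarrow> 'k) \<Rightarrow> 'c \<times> 'c \<Rightarrow> 'k" where
  "map2 H f s = (\<lambda>(z, w). \<Sum>(x, y)\<in>basis H \<times> basis H. s (x, y) * f (bv x) z * f (bv y) w)"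

text \<open>The Sweedler sum \<open>F a\<^sub>1 a\<^sub>2\<close> for a bilinear \<open>F\<close>.\<close>

definition sw ::
  "('b, 'k::field) hopf \<Rightarrow> ('b \<Rightarrow> 'k) \<Rightarrow> (('b \<Rightarrow> 'k) \<Rightarrow> ('b \<Rightarrow> 'k) \<Rightarrow> 'k) \<Rightarrow> 'k" where
  "sw H a F = (\<Sum>(p, q)\<in>basis H \<times> basis H. comul H a (p, q) * F (bv p) (bv q))"

definition hopf_maps ::
  "('b, 'k::field) hopf \<Rightarrow> ('c, 'k) hopf \<Rightarrow> (('b \<Rightarrow> 'k) \<Rightarrow> 'c \<Rightarrow> 'k) set" where
  "hopf_maps H L = {f \<in> hcar H \<rightarrow>\<^sub>E hcar L.
      (\<forall>a\<in>hcar H. \<forall>b\<in>hcar H. f (\<lambda>x. a x + b x) = (\<lambda>x. f a x + f b x)) \<and>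
      (\<forall>c. \<forall>a\<in>hcar H. f (\<lambda>x. c * a x) = (\<lambda>x. c * f a x)) \<and>
      (\<forall>a\<in>hcar H. \<forall>b\<in>hcar H. f (mul H a b) = mul L (f a) (f b)) \<and>
      f (hone H) = hone L \<and>
      (\<forall>a\<in>hcar H. comul L (f a) = map2 H f (comul H a)) \<and>
      (\<forall>a\<in>hcar H. counit L (f a) = counit H a)}"

definition Aut_Hopf :: "('b, 'k::field) hopf \<Rightarrow> (('b \<Rightarrow> 'k) \<Rightarrow> 'b \<Rightarrow> 'k) monoid" where
  "Aut_Hopf H = BijGroup (hcar H) \<lparr>carrier := hopf_maps H H \<inter> Bij (hcar H)\<rparr>"

definition grouplikes :: "('b, 'k::field) hopf \<Rightarrow> ('b \<Rightarrow> 'k) set" where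
  "grouplikes H = {h \<in> hcar H. comul H h = tensor h h \<and> counit H h = 1}"

text \<open>Conjugations by group-like elements.\<close>

definition Inn_Hopf :: "('b, 'k::field) hopf \<Rightarrow> (('b \<Rightarrow> 'k) \<Rightarrow> 'b \<Rightarrow> 'k) set" where
  "Inn_Hopf H = {(\<lambda>x\<in>hcar H. mul H (mul H h x) h') | h h'.
      h \<in> grouplikes H \<and> h' \<in> hcar H \<and> mul H h h' = hone H \<and> mul H h' h = hone H}"

definition Out_Hopf :: "('b, 'k::field) hopf \<Rightarrow> (('b \<Rightarrow> 'k) \<Rightarrow> 'b \<Rightarrow> 'k) set monoid" where
  "Out_Hopf H = Aut_Hopf H Mod Inn_Hopf H"


section \<open>Lazy cocycles\<close>

definition ev :: "('b, 'k::field) hopf \<Rightarrow> ('b \<Rightarrow> 'k) \<Rightarrow> ('b \<Rightarrow> 'k) \<Rightarrow> 'k" where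
  "ev K \<eta> a = (\<Sum>x\<in>basis K. \<eta> x * a x)"

definition ev2 :: "('b, 'k::field) hopf \<Rightarrow> ('b \<times> 'b \<Rightarrow> 'k) \<Rightarrow> ('b \<Rightarrow> 'k) \<Rightarrow> ('b \<Rightarrow> 'k) \<Rightarrow> 'k" where
  "ev2 K \<sigma> a b = (\<Sum>(x, y)\<in>basis K \<times> basis K. \<sigma> (x, y) * a x * b y)"

definition forms2 :: "('b, 'k::field) hopf \<Rightarrow> ('b \<times> 'b \<Rightarrow> 'k) set" where
  "forms2 K = {\<sigma>. \<forall>p. p \<notin> basis K \<times> basis K \<longrightarrow> \<sigma> p = 0}"

text \<open>Convolution of linear forms on \<open>K\<close> and on \<open>K \<otimes> K\<close>, with their units.\<close>

definition conv :: "('b, 'k::field) hopf \<Rightarrow> ('b \<Rightarrow> 'k) \<Rightarrow> ('b \<Rightarrow> 'k) \<Rightarrow> 'b \<Rightarrow> 'k" where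
  "conv K \<eta> \<theta> = (\<lambda>x. sw K (bv x) (\<lambda>a\<^sub>1 a\<^sub>2. ev K \<eta> a\<^sub>1 * ev K \<theta> a\<^sub>2))"

definition conv_one :: "('b, 'k::field) hopf \<Rightarrow> 'b \<Rightarrow> 'k" where
  "conv_one K = (\<lambda>x. counit K (bv x))"

definition conv2 ::
  "('b, 'k::field) hopf \<Rightarrow> ('b \<times> 'b \<Rightarrow> 'k) \<Rightarrow> ('b \<times> 'b \<Rightarrow> 'k) \<Rightarrow> 'b \<times> 'b \<Rightarrow> 'k" where
  "conv2 K \<sigma> \<tau> = (\<lambda>(x, y). sw K (bv x) (\<lambda>a\<^sub>1 a\<^sub>2. sw K (bv y) (\<lambda>b\<^sub>1 b\<^sub>2.
      ev2 K \<sigma> a\<^sub>1 b\<^sub>1 * ev2 K \<tau> a\<^sub>2 b\<^sub>2)))"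

definition conv2_one :: "('b, 'k::field) hopf \<Rightarrow> 'b \<times> 'b \<Rightarrow> 'k" where
  "conv2_one K = (\<lambda>(x, y). counit K (bv x) * counit K (bv y))"

definition two_cocycle :: "('b, 'k::field) hopf \<Rightarrow> ('b \<times> 'b \<Rightarrow> 'k) \<Rightarrow> bool" where
  "two_cocycle K \<sigma> \<longleftrightarrow> \<sigma> \<in> forms2 K \<and>
    (\<exists>\<tau>\<in>forms2 K. conv2 K \<sigma> \<tau> = conv2_one K \<and> conv2 K \<tau> \<sigma> = conv2_one K) \<and>
    (\<forall>b\<in>hcar K. ev2 K \<sigma> (hone K) b = counit K b \<and> ev2 K \<sigma> b (hone K) = counit K b) \<and>
    (\<forall>a\<in>hcar K. \<forall>b\<in>hcar K. \<forall>c\<in>hcar K.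
      sw K a (\<lambda>a\<^sub>1 a\<^sub>2. sw K b (\<lambda>b\<^sub>1 b\<^sub>2. ev2 K \<sigma> a\<^sub>1 b\<^sub>1 * ev2 K \<sigma> (mul K a\<^sub>2 b\<^sub>2) c)) =
      sw K b (\<lambda>b\<^sub>1 b\<^sub>2. sw K c (\<lambda>c\<^sub>1 c\<^sub>2. ev2 K \<sigma> b\<^sub>1 c\<^sub>1 * ev2 K \<sigma> a (mul K b\<^sub>2 c\<^sub>2))))"

definition lazy2 :: "('b, 'k::field) hopf \<Rightarrow> ('b \<times> 'b \<Rightarrow> 'k) \<Rightarrow> bool" where
  "lazy2 K \<sigma> \<longleftrightarrow> (\<forall>a\<in>hcar K. \<forall>b\<in>hcar K. \<forall>z.
      sw K a (\<lambda>a\<^sub>1 a\<^sub>2. sw K b (\<lambda>b\<^sub>1 b\<^sub>2. ev2 K \<sigma> a\<^sub>1 b\<^sub>1 * mul K a\<^sub>2 b\<^sub>2 z)) =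
      sw K a (\<lambda>a\<^sub>1 a\<^sub>2. sw K b (\<lambda>b\<^sub>1 b\<^sub>2. mul K a\<^sub>1 b\<^sub>1 z * ev2 K \<sigma> a\<^sub>2 b\<^sub>2)))"

definition Z2L :: "('b, 'k::field) hopf \<Rightarrow> ('b \<times> 'b \<Rightarrow> 'k) monoid" where
  "Z2L K = \<lparr>carrier = {\<sigma>. two_cocycle K \<sigma> \<and> lazy2 K \<sigma>}, monoid.mult = conv2 K, one = conv2_one K\<rparr>"

definition Reg1L :: "('b, 'k::field) hopf \<Rightarrow> ('b \<Rightarrow> 'k) set" where
  "Reg1L K = {\<eta> \<in> hcar K.
      (\<exists>\<theta>\<in>hcar K. conv K \<eta> \<theta> = conv_one K \<and> conv K \<theta> \<eta> = conv_one K) \<and>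
      ev K \<eta> (hone K) = 1 \<and>
      (\<forall>a\<in>hcar K. \<forall>z. sw K a (\<lambda>a\<^sub>1 a\<^sub>2. ev K \<eta> a\<^sub>1 * a\<^sub>2 z) = sw K a (\<lambda>a\<^sub>1 a\<^sub>2. a\<^sub>1 z * ev K \<eta> a\<^sub>2))}"

definition conv_inv :: "('b, 'k::field) hopf \<Rightarrow> ('b \<Rightarrow> 'k) \<Rightarrow> 'b \<Rightarrow> 'k" where
  "conv_inv K \<eta> = (THE \<theta>. \<theta> \<in> hcar K \<and> conv K \<eta> \<theta> = conv_one K \<and> conv K \<theta> \<eta> = conv_one K)"

definition cobound :: "('b, 'k::field) hopf \<Rightarrow> ('b \<Rightarrow> 'k) \<Rightarrow> 'b \<times> 'b \<Rightarrow> 'k" where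
  "cobound K \<eta> = (\<lambda>(x, y). sw K (bv x) (\<lambda>a\<^sub>1 a\<^sub>2. sw K (bv y) (\<lambda>b\<^sub>1 b\<^sub>2.
      ev K \<eta> a\<^sub>1 * ev K \<eta> b\<^sub>1 * ev K (conv_inv K \<eta>) (mul K a\<^sub>2 b\<^sub>2))))"

definition H2L :: "('b, 'k::field) hopf \<Rightarrow> ('b \<times> 'b \<Rightarrow> 'k) set monoid" where
  "H2L K = Z2L K Mod (cobound K ` Reg1L K)"


section \<open>The Drinfeld double of a finite group\<close>

text \<open>\<open>kG\<close>, and \<open>k^G\<close> with basis element \<open>x\<close> standing for \<open>e_x\<close>.\<close>

definition kG :: "('g, 'x) monoid_scheme \<Rightarrow> ('g, 'k::field) hopf" where
  "kG G = \<lparr>basis = carrier G,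
     bmul = (\<lambda>x y. bv (x \<otimes>\<^bsub>G\<^esub> y)),
     hone = bv \<one>\<^bsub>G\<^esub>,
     bcomul = (\<lambda>x. bv (x, x)),
     bcounit = (\<lambda>x. 1)\<rparr>"

definition kdG :: "('g, 'x) monoid_scheme \<Rightarrow> ('g, 'k::field) hopf" where
  "kdG G = \<lparr>basis = carrier G,
     bmul = (\<lambda>x y z. of_bool (x = y \<and> z = x)),
     hone = (\<lambda>x. of_bool (x \<in> carrier G)),
     bcomul = (\<lambda>x (p, q). of_bool (p \<in> carrier G \<and> q \<in> carrier G \<and> p \<otimes>\<^bsub>G\<^esub> q = x)),
     bcounit = (\<lambda>x. of_bool (x = \<one>\<^bsub>G\<^esub>))\<rparr>"

text \<open>The pair \<open>(x, y)\<close> stands for \<open>e_x \<times> y\<close> in \<open>DG\<close> and for \<open>x \<times> e_y\<close> in \<open>DG*\<close>.\<close>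

definition DG :: "('g, 'x) monoid_scheme \<Rightarrow> ('g \<times> 'g, 'k::field) hopf" where
  "DG G = \<lparr>basis = carrier G \<times> carrier G,
     bmul = (\<lambda>(x, y) (x', y') z.
       of_bool (x = y \<otimes>\<^bsub>G\<^esub> x' \<otimes>\<^bsub>G\<^esub> inv\<^bsub>G\<^esub> y \<and> z = (x, y \<otimes>\<^bsub>G\<^esub> y'))),
     hone = (\<lambda>(x, y). of_bool (x \<in> carrier G \<and> y = \<one>\<^bsub>G\<^esub>)),
     bcomul = (\<lambda>(x, y) ((p, q), (r, s)).
       of_bool (p \<in> carrier G \<and> r \<in> carrier G \<and> p \<otimes>\<^bsub>G\<^esub> r = x \<and> q = y \<and> s = y)),
     bcounit = (\<lambda>(x, y). of_bool (x = \<one>\<^bsub>G\<^esub>))\<rparr>"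

definition DGd :: "('g, 'x) monoid_scheme \<Rightarrow> ('g \<times> 'g, 'k::field) hopf" where
  "DGd G = \<lparr>basis = carrier G \<times> carrier G,
     bmul = (\<lambda>(x, y) (x', y') z. of_bool (y = y' \<and> z = (x \<otimes>\<^bsub>G\<^esub> x', y))),
     hone = (\<lambda>(x, y). of_bool (x = \<one>\<^bsub>G\<^esub> \<and> y \<in> carrier G)),
     bcomul = (\<lambda>(x, y) ((p, q), (r, s)).
       of_bool (q \<in> carrier G \<and> s \<in> carrier G \<and> q \<otimes>\<^bsub>G\<^esub> s = y \<and>
         p = x \<and> r = inv\<^bsub>G\<^esub> q \<otimes>\<^bsub>G\<^esub> x \<otimes>\<^bsub>G\<^esub> q)),
     bcounit = (\<lambda>(x, y). of_bool (y = \<one>\<^bsub>G\<^esub>))\<rparr>"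

text \<open>
  Dual of a linear map \<open>H \<rightarrow> L\<close>, in the coordinates of the dual bases; this uses that \<open>kG\<close> and
  \<open>k^G\<close> are dual to each other with dual bases indexed by the same set.
\<close>

definition dual_map ::
  "('b, 'k::field) hopf \<Rightarrow> ('c, 'k) hopf \<Rightarrow> (('b \<Rightarrow> 'k) \<Rightarrow> 'c \<Rightarrow> 'k) \<Rightarrow> ('c \<Rightarrow> 'k) \<Rightarrow> 'b \<Rightarrow> 'k" where
  "dual_map H L f l = (\<lambda>x. if x \<in> basis H then \<Sum>y\<in>basis L. l y * f (bv x) y else 0)"

text \<open>Linear extension to \<open>kG\<close> of a map \<open>v\<close> of \<open>G\<close> to itself.\<close>

definition kmap :: "('g, 'x) monoid_scheme \<Rightarrow> ('g \<Rightarrow> 'g) \<Rightarrow> ('g \<Rightarrow> 'k::field) \<Rightarrow> 'g \<Rightarrow> 'k" where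
  "kmap G v a = (\<lambda>z. \<Sum>x\<in>carrier G. a x * bv (v x) z)"

text \<open>The map \<open>f \<times> g \<mapsto> u(f\<^sub>1) b(g) \<times> a(f\<^sub>2) v(g)\<close> on \<open>DG\<close>, with \<open>v\<close> linear on \<open>kG\<close>.\<close>

definition matrix_map ::
  "('g, 'x) monoid_scheme \<Rightarrow> (('g \<Rightarrow> 'k::field) \<Rightarrow> 'g \<Rightarrow> 'k) \<Rightarrow> (('g \<Rightarrow> 'k) \<Rightarrow> 'g \<Rightarrow> 'k) \<Rightarrow>
    (('g \<Rightarrow> 'k) \<Rightarrow> 'g \<Rightarrow> 'k) \<Rightarrow> (('g \<Rightarrow> 'k) \<Rightarrow> 'g \<Rightarrow> 'k) \<Rightarrow> ('g \<times> 'g \<Rightarrow> 'k) \<Rightarrow> 'g \<times> 'g \<Rightarrow> 'k" where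
  "matrix_map G u b a v h = (\<lambda>z. \<Sum>(x, g)\<in>carrier G \<times> carrier G. h (x, g) *
      sw (kdG G) (bv x) (\<lambda>f\<^sub>1 f\<^sub>2.
        tensor (mul (kdG G) (u f\<^sub>1) (b (bv g))) (mul (kG G) (a f\<^sub>2) (v (bv g))) z))"

text \<open>\<open>dagger G \<phi>\<close> is \<open>\<phi>\<^sup>\<dagger>\<close>; \<open>b\<close> and \<open>a\<close> change places and so do \<open>u\<close> and \<open>v\<close>.\<close>

definition dagger ::
  "('g, 'x) monoid_scheme \<Rightarrow> (('g \<times> 'g \<Rightarrow> 'k::field) \<Rightarrow> 'g \<times> 'g \<Rightarrow> 'k) \<Rightarrow>
    ('g \<times> 'g \<Rightarrow> 'k) \<Rightarrow> 'g \<times> 'g \<Rightarrow> 'k" where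
  "dagger G \<phi> = (case (THE (u, b, a, v).
        u \<in> hopf_maps (kdG G) (kdG G) \<and> b \<in> hopf_maps (kG G) (kdG G) \<and>
        a \<in> hopf_maps (kdG G) (kG G) \<and> v \<in> hom G G \<and> v \<in> extensional (carrier G) \<and>
        (\<forall>h\<in>hcar (DG G). \<phi> h = matrix_map G u b a (kmap G v) h))
      of (u, b, a, v) \<Rightarrow> matrix_map G
        (dual_map (kG G) (kG G) (kmap G v)) (dual_map (kG G) (kdG G) b)
        (dual_map (kdG G) (kG G) a) (dual_map (kdG G) (kdG G) u))"


section \<open>Vector spaces and tensor products\<close>

abbreviation kring :: "'k::field ring" where
  "kring \<equiv> ring_of_type_algebra"

definition lin_maps ::
  "('k::field, 'm, 'x) module_scheme \<Rightarrow> ('k, 'n, 'y) module_scheme \<Rightarrow> ('m \<Rightarrow> 'n) set" where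
  "lin_maps M N = {f \<in> carrier M \<rightarrow> carrier N.
      (\<forall>x\<in>carrier M. \<forall>y\<in>carrier M. f (x \<oplus>\<^bsub>M\<^esub> y) = f x \<oplus>\<^bsub>N\<^esub> f y) \<and>
      (\<forall>c. \<forall>x\<in>carrier M. f (c \<odot>\<^bsub>M\<^esub> x) = c \<odot>\<^bsub>N\<^esub> f x)}"

text \<open>The linear map \<open>M \<rightarrow> N\<close> with value \<open>f i\<close> on the generator \<open>gen i\<close>, for all \<open>i \<in> I\<close>.\<close>

definition lin_by ::
  "('k::field, 'm, 'x) module_scheme \<Rightarrow> ('k, 'n, 'y) module_scheme \<Rightarrow>
    'i set \<Rightarrow> ('i \<Rightarrow> 'm) \<Rightarrow> ('i \<Rightarrow> 'n) \<Rightarrow> 'm \<Rightarrow> 'n" where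
  "lin_by M N I gen f =
    (THE T. T \<in> lin_maps M N \<and> T \<in> extensional (carrier M) \<and> (\<forall>i\<in>I. T (gen i) = f i))"

text \<open>The fields \<open>mult\<close> and \<open>one\<close> of the library's module record play no role.\<close>

definition free_space :: "'i set \<Rightarrow> ('k::field, 'i \<Rightarrow> 'k) module" where
  "free_space I = \<lparr>carrier = {s. finite {i. s i \<noteq> 0} \<and> {i. s i \<noteq> 0} \<subseteq> I},
     monoid.mult = undefined, one = undefined, ring.zero = (\<lambda>i. 0), add = (\<lambda>s t i. s i + t i),
     module.smult = (\<lambda>c s i. c * s i)\<rparr>"

definition subspace_gen :: "('k::field, 'm, 'x) module_scheme \<Rightarrow> 'm set \<Rightarrow> 'm set" where
  "subspace_gen M S = \<Inter>{N. submodule N kring M \<and> S \<subseteq> N}"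

definition quot_space :: "('k::field, 'm, 'x) module_scheme \<Rightarrow> 'm set \<Rightarrow> ('k, 'm set) module" where
  "quot_space M N = \<lparr>carrier = a_rcosets\<^bsub>M\<^esub> N,
     monoid.mult = undefined, one = undefined, ring.zero = N, add = set_add M,
     module.smult = (\<lambda>c S. set_add M N (module.smult M c ` S))\<rparr>"

definition tensor_rels ::
  "('k::field, 'm, 'x) module_scheme \<Rightarrow> ('k, 'n, 'y) module_scheme \<Rightarrow> ('m \<times> 'n \<Rightarrow> 'k) set" where
  "tensor_rels M N =
    {(\<lambda>p. bv (m \<oplus>\<^bsub>M\<^esub> m', n) p - bv (m, n) p - bv (m', n) p) | m m' n.
        m \<in> carrier M \<and> m' \<in> carrier M \<and> n \<in> carrier N} \<union>
    {(\<lambda>p. bv (m, n \<oplus>\<^bsub>N\<^esub> n') p - bv (m, n) p - bv (m, n') p) | m n n'.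
        m \<in> carrier M \<and> n \<in> carrier N \<and> n' \<in> carrier N} \<union>
    {(\<lambda>p. bv (c \<odot>\<^bsub>M\<^esub> m, n) p - c * bv (m, n) p) | c m n. m \<in> carrier M \<and> n \<in> carrier N} \<union>
    {(\<lambda>p. bv (m, c \<odot>\<^bsub>N\<^esub> n) p - c * bv (m, n) p) | c m n. m \<in> carrier M \<and> n \<in> carrier N}"

definition tensor_null ::
  "('k::field, 'm, 'x) module_scheme \<Rightarrow> ('k, 'n, 'y) module_scheme \<Rightarrow> ('m \<times> 'n \<Rightarrow> 'k) set" where
  "tensor_null M N = subspace_gen (free_space (carrier M \<times> carrier N)) (tensor_rels M N)"

definition tensor_space ::
  "('k::field, 'm, 'x) module_scheme \<Rightarrow> ('k, 'n, 'y) module_scheme \<Rightarrow>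
    ('k, ('m \<times> 'n \<Rightarrow> 'k) set) module" where
  "tensor_space M N = quot_space (free_space (carrier M \<times> carrier N)) (tensor_null M N)"

text \<open>The element \<open>m \<otimes> n\<close> of \<open>M \<otimes> N\<close>.\<close>

definition tens ::
  "('k::field, 'm, 'x) module_scheme \<Rightarrow> ('k, 'n, 'y) module_scheme \<Rightarrow> 'm \<Rightarrow> 'n \<Rightarrow>
    ('m \<times> 'n \<Rightarrow> 'k) set" where
  "tens M N m n = tensor_null M N +>\<^bsub>free_space (carrier M \<times> carrier N)\<^esub> bv (m, n)"

definition tensor_map ::
  "('k::field, 'm, 'x) module_scheme \<Rightarrow> ('k, 'n, 'y) module_scheme \<Rightarrow>
    ('k, 'm1, 'x1) module_scheme \<Rightarrow> ('k, 'n1, 'y1) module_scheme \<Rightarrow>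
    ('m \<Rightarrow> 'm1) \<Rightarrow> ('n \<Rightarrow> 'n1) \<Rightarrow> ('m \<times> 'n \<Rightarrow> 'k) set \<Rightarrow> ('m1 \<times> 'n1 \<Rightarrow> 'k) set" where
  "tensor_map M N M' N' f g = lin_by (tensor_space M N) (tensor_space M' N')
    (carrier M \<times> carrier N) (\<lambda>(m, n). tens M N m n) (\<lambda>(m, n). tens M' N' (f m) (g n))"


section \<open>Modules over a Hopf algebra\<close>

record ('k, 'h, 'm) hmodule = "('k, 'm) module" +
  act :: "'h \<Rightarrow> 'm \<Rightarrow> 'm"

definition with_act ::
  "('k, 'm, 'x) module_scheme \<Rightarrow> ('h \<Rightarrow> 'm \<Rightarrow> 'm) \<Rightarrow> ('k, 'h, 'm) hmodule" where
  "with_act V a = \<lparr>carrier = carrier V, monoid.mult = monoid.mult V, one = monoid.one V,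
     ring.zero = ring.zero V, add = ring.add V, module.smult = module.smult V, act = a\<rparr>"

definition is_hmodule ::
  "('b, 'k::field) hopf \<Rightarrow> ('k, 'b \<Rightarrow> 'k, 'm) hmodule \<Rightarrow> bool" where
  "is_hmodule H M \<longleftrightarrow> module kring M \<and>
    (\<forall>h\<in>hcar H. act M h \<in> lin_maps M M) \<and>
    (\<forall>h\<in>hcar H. \<forall>h'\<in>hcar H. \<forall>m\<in>carrier M.
       act M (\<lambda>x. h x + h' x) m = act M h m \<oplus>\<^bsub>M\<^esub> act M h' m) \<and>
    (\<forall>c. \<forall>h\<in>hcar H. \<forall>m\<in>carrier M. act M (\<lambda>x. c * h x) m = c \<odot>\<^bsub>M\<^esub> act M h m) \<and>
    (\<forall>h\<in>hcar H. \<forall>h'\<in>hcar H. \<forall>m\<in>carrier M. act M (mul H h h') m = act M h (act M h' m)) \<and>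
    (\<forall>m\<in>carrier M. act M (hone H) m = m)"

definition hmod_homs ::
  "('b, 'k::field) hopf \<Rightarrow> ('k, 'b \<Rightarrow> 'k, 'm) hmodule \<Rightarrow> ('k, 'b \<Rightarrow> 'k, 'n) hmodule \<Rightarrow>
    ('m \<Rightarrow> 'n) set" where
  "hmod_homs H M N = {f \<in> lin_maps M N. \<forall>h\<in>hcar H. \<forall>m\<in>carrier M. f (act M h m) = act N h (f m)}"

definition hmod_isos ::
  "('b, 'k::field) hopf \<Rightarrow> ('k, 'b \<Rightarrow> 'k, 'm) hmodule \<Rightarrow> ('k, 'b \<Rightarrow> 'k, 'n) hmodule \<Rightarrow>
    ('m \<Rightarrow> 'n) set" where
  "hmod_isos H M N = {f \<in> hmod_homs H M N. bij_betw f (carrier M) (carrier N)}"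

definition hmod_isomorphic ::
  "('b, 'k::field) hopf \<Rightarrow> ('k, 'b \<Rightarrow> 'k, 'm) hmodule \<Rightarrow> ('k, 'b \<Rightarrow> 'k, 'n) hmodule \<Rightarrow> bool" where
  "hmod_isomorphic H M N \<longleftrightarrow> hmod_isos H M N \<noteq> {}"

text \<open>The element \<open>s\<^sub>1.m \<otimes> s\<^sub>2.n\<close> of \<open>M \<otimes> N\<close>, for \<open>s \<in> H \<otimes> H\<close>.\<close>

definition act2 ::
  "('b, 'k::field) hopf \<Rightarrow> ('k, 'b \<Rightarrow> 'k, 'm) hmodule \<Rightarrow> ('k, 'b \<Rightarrow> 'k, 'n) hmodule \<Rightarrow>
    ('b \<times> 'b \<Rightarrow> 'k) \<Rightarrow> 'm \<Rightarrow> 'n \<Rightarrow> ('m \<times> 'n \<Rightarrow> 'k) set" where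
  "act2 H M N s m n = (\<Oplus>\<^bsub>tensor_space M N\<^esub> p \<in> basis H \<times> basis H.
      s p \<odot>\<^bsub>tensor_space M N\<^esub> tens M N (act M (bv (fst p)) m) (act N (bv (snd p)) n))"

definition hmod_tensor ::
  "('b, 'k::field) hopf \<Rightarrow> ('k, 'b \<Rightarrow> 'k, 'm) hmodule \<Rightarrow> ('k, 'b \<Rightarrow> 'k, 'n) hmodule \<Rightarrow>
    ('k, 'b \<Rightarrow> 'k, ('m \<times> 'n \<Rightarrow> 'k) set) hmodule" where
  "hmod_tensor H M N = with_act (tensor_space M N) (\<lambda>h.
      lin_by (tensor_space M N) (tensor_space M N) (carrier M \<times> carrier N)
        (\<lambda>(m, n). tens M N m n) (\<lambda>(m, n). act2 H M N (comul H h) m n))"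

text \<open>The unit object \<open>k\<close> and the constraints of the monoidal category of \<open>H\<close>-modules.\<close>

definition hmod_unit :: "('b, 'k::field) hopf \<Rightarrow> ('k, 'b \<Rightarrow> 'k, 'k) hmodule" where
  "hmod_unit H = \<lparr>carrier = UNIV, monoid.mult = undefined, one = undefined, ring.zero = 0, add = (+),
     module.smult = (*), act = (\<lambda>h c. counit H h * c)\<rparr>"

definition assoc ::
  "('b, 'k::field) hopf \<Rightarrow> ('k, 'b \<Rightarrow> 'k, 'm) hmodule \<Rightarrow> ('k, 'b \<Rightarrow> 'k, 'n) hmodule \<Rightarrow>
    ('k, 'b \<Rightarrow> 'k, 'p) hmodule \<Rightarrow>
    (('m \<times> 'n \<Rightarrow> 'k) set \<times> 'p \<Rightarrow> 'k) set \<Rightarrow> ('m \<times> ('n \<times> 'p \<Rightarrow> 'k) set \<Rightarrow> 'k) set" where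
  "assoc H M N P =
    lin_by (tensor_space (hmod_tensor H M N) P) (tensor_space M (hmod_tensor H N P))
      (carrier M \<times> carrier N \<times> carrier P)
      (\<lambda>(m, n, p). tens (hmod_tensor H M N) P (tens M N m n) p)
      (\<lambda>(m, n, p). tens M (hmod_tensor H N P) m (tens N P n p))"

definition lunit ::
  "('b, 'k::field) hopf \<Rightarrow> ('k, 'b \<Rightarrow> 'k, 'm) hmodule \<Rightarrow> ('k \<times> 'm \<Rightarrow> 'k) set \<Rightarrow> 'm" where
  "lunit H M = lin_by (tensor_space (hmod_unit H) M) M (UNIV \<times> carrier M)
    (\<lambda>(c, m). tens (hmod_unit H) M c m) (\<lambda>(c, m). c \<odot>\<^bsub>M\<^esub> m)"

definition runit ::
  "('b, 'k::field) hopf \<Rightarrow> ('k, 'b \<Rightarrow> 'k, 'm) hmodule \<Rightarrow> ('m \<times> 'k \<Rightarrow> 'k) set \<Rightarrow> 'm" where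
  "runit H M = lin_by (tensor_space M (hmod_unit H)) M (carrier M \<times> UNIV)
    (\<lambda>(m, c). tens M (hmod_unit H) m c) (\<lambda>(m, c). c \<odot>\<^bsub>M\<^esub> m)"


section \<open>The functors \<open>\<Psi>(\<phi>, \<sigma>)\<close>\<close>

definition R_matrix :: "('g, 'x) monoid_scheme \<Rightarrow> ('g \<times> 'g) \<times> ('g \<times> 'g) \<Rightarrow> 'k::field" where
  "R_matrix G = (\<lambda>z. \<Sum>g\<in>carrier G.
      tensor (bv (g, \<one>\<^bsub>G\<^esub>)) (\<lambda>(x, y). of_bool (x \<in> carrier G \<and> y = g)) z)"

text \<open>The braiding \<open>m \<otimes> n \<mapsto> R\<^sub>2.n \<otimes> R\<^sub>1.m\<close>.\<close>

definition braiding ::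
  "('g, 'x) monoid_scheme \<Rightarrow> ('k::field, 'g \<times> 'g \<Rightarrow> 'k, 'm) hmodule \<Rightarrow>
    ('k, 'g \<times> 'g \<Rightarrow> 'k, 'n) hmodule \<Rightarrow> ('m \<times> 'n \<Rightarrow> 'k) set \<Rightarrow> ('n \<times> 'm \<Rightarrow> 'k) set" where
  "braiding G M N = lin_by (tensor_space M N) (tensor_space N M) (carrier M \<times> carrier N)
    (\<lambda>(m, n). tens M N m n)
    (\<lambda>(m, n). act2 (DG G) N M (\<lambda>(p, q). R_matrix G (q, p)) n m)"

text \<open>
  \<open>F_\<phi>\<close> on objects; on morphisms it is the identity, as is its unit constraint.
  The form \<open>\<sigma>\<close> on \<open>DG* \<otimes> DG*\<close> and the element \<open>\<sigma>\<^sub>1 \<otimes> \<sigma>\<^sub>2\<close> of \<open>DG \<otimes> DG\<close> identified with it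
  have the same coordinates.
\<close>

definition F_obj ::
  "('g, 'x) monoid_scheme \<Rightarrow> (('g \<times> 'g \<Rightarrow> 'k::field) \<Rightarrow> 'g \<times> 'g \<Rightarrow> 'k) \<Rightarrow>
    ('k, 'g \<times> 'g \<Rightarrow> 'k, 'm) hmodule \<Rightarrow> ('k, 'g \<times> 'g \<Rightarrow> 'k, 'm) hmodule" where
  "F_obj G \<phi> M = M\<lparr>act := (\<lambda>h. act M (dagger G \<phi> h))\<rparr>"

definition J_map ::
  "('g, 'x) monoid_scheme \<Rightarrow> (('g \<times> 'g \<Rightarrow> 'k::field) \<Rightarrow> 'g \<times> 'g \<Rightarrow> 'k) \<Rightarrow>
    (('g \<times> 'g) \<times> ('g \<times> 'g) \<Rightarrow> 'k) \<Rightarrow>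
    ('k, 'g \<times> 'g \<Rightarrow> 'k, 'm) hmodule \<Rightarrow> ('k, 'g \<times> 'g \<Rightarrow> 'k, 'n) hmodule \<Rightarrow>
    ('m \<times> 'n \<Rightarrow> 'k) set \<Rightarrow> ('m \<times> 'n \<Rightarrow> 'k) set" where
  "J_map G \<phi> \<sigma> M N =
    lin_by (tensor_space (F_obj G \<phi> M) (F_obj G \<phi> N)) (F_obj G \<phi> (hmod_tensor (DG G) M N))
      (carrier M \<times> carrier N)
      (\<lambda>(m, n). tens (F_obj G \<phi> M) (F_obj G \<phi> N) m n) (\<lambda>(m, n). act2 (DG G) M N \<sigma> m n)"

text \<open>
  The axioms of a (strong) monoidal functor for \<open>(F_\<phi>, J^\<sigma>)\<close> at given modules: functoriality,
  \<open>J\<close> is a natural isomorphism of modules, and compatibility with the associativity and unit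
  constraints.  The modules are parameters because tensor products live on different types.
\<close>

definition monoidal_functor_at ::
  "('g, 'x) monoid_scheme \<Rightarrow> (('g \<times> 'g \<Rightarrow> 'k::field) \<Rightarrow> 'g \<times> 'g \<Rightarrow> 'k) \<Rightarrow>
    (('g \<times> 'g) \<times> ('g \<times> 'g) \<Rightarrow> 'k) \<Rightarrow>
    ('k, 'g \<times> 'g \<Rightarrow> 'k, 'm) hmodule \<Rightarrow> ('k, 'g \<times> 'g \<Rightarrow> 'k, 'n) hmodule \<Rightarrow>
    ('k, 'g \<times> 'g \<Rightarrow> 'k, 'p) hmodule \<Rightarrow>
    ('k, 'g \<times> 'g \<Rightarrow> 'k, 'm1) hmodule \<Rightarrow> ('k, 'g \<times> 'g \<Rightarrow> 'k, 'n1) hmodule \<Rightarrow> bool" where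
  "monoidal_functor_at G \<phi> \<sigma> M N P M' N' \<longleftrightarrow>
    (let D = DG G; FM = F_obj G \<phi> M; FN = F_obj G \<phi> N; FP = F_obj G \<phi> P;
         FM' = F_obj G \<phi> M'; FN' = F_obj G \<phi> N' in
      is_hmodule D FM \<and>
      hmod_homs D M M' \<subseteq> hmod_homs D FM FM' \<and>
      J_map G \<phi> \<sigma> M N \<in> hmod_isos D (hmod_tensor D FM FN) (F_obj G \<phi> (hmod_tensor D M N)) \<and>
      (\<forall>f \<in> hmod_homs D M M'. \<forall>g \<in> hmod_homs D N N'. \<forall>t \<in> carrier (hmod_tensor D FM FN).
         tensor_map M N M' N' f g (J_map G \<phi> \<sigma> M N t) =
         J_map G \<phi> \<sigma> M' N' (tensor_map FM FN FM' FN' f g t)) \<and>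
      (\<forall>t \<in> carrier (hmod_tensor D (hmod_tensor D FM FN) FP).
         assoc D M N P (J_map G \<phi> \<sigma> (hmod_tensor D M N) P
           (tensor_map (hmod_tensor D FM FN) FP (F_obj G \<phi> (hmod_tensor D M N)) FP
              (J_map G \<phi> \<sigma> M N) id t)) =
         J_map G \<phi> \<sigma> M (hmod_tensor D N P)
           (tensor_map FM (hmod_tensor D FN FP) FM (F_obj G \<phi> (hmod_tensor D N P))
              id (J_map G \<phi> \<sigma> N P) (assoc D FM FN FP t))) \<and>
      id \<in> hmod_isos D (hmod_unit D) (F_obj G \<phi> (hmod_unit D)) \<and>
      (\<forall>t \<in> carrier (hmod_tensor D (hmod_unit D) FM).
         lunit D M (J_map G \<phi> \<sigma> (hmod_unit D) M
           (tensor_map (hmod_unit D) FM (F_obj G \<phi> (hmod_unit D)) FM id id t)) =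
         lunit D FM t) \<and>
      (\<forall>t \<in> carrier (hmod_tensor D FM (hmod_unit D)).
         runit D M (J_map G \<phi> \<sigma> M (hmod_unit D)
           (tensor_map FM (hmod_unit D) FM (F_obj G \<phi> (hmod_unit D)) id id t)) =
         runit D FM t))"

text \<open>\<open>F_\<phi>(c_{M,N}) \<circ> J_{M,N} = J_{N,M} \<circ> c_{F_\<phi>(M),F_\<phi>(N)}\<close>.\<close>

definition braided_at ::
  "('g, 'x) monoid_scheme \<Rightarrow> (('g \<times> 'g \<Rightarrow> 'k::field) \<Rightarrow> 'g \<times> 'g \<Rightarrow> 'k) \<Rightarrow>
    (('g \<times> 'g) \<times> ('g \<times> 'g) \<Rightarrow> 'k) \<Rightarrow>
    ('k, 'g \<times> 'g \<Rightarrow> 'k, 'm) hmodule \<Rightarrow> ('k, 'g \<times> 'g \<Rightarrow> 'k, 'n) hmodule \<Rightarrow> bool" where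
  "braided_at G \<phi> \<sigma> M N \<longleftrightarrow>
    (\<forall>t \<in> carrier (hmod_tensor (DG G) (F_obj G \<phi> M) (F_obj G \<phi> N)).
       braiding G M N (J_map G \<phi> \<sigma> M N t) =
       J_map G \<phi> \<sigma> N M (braiding G (F_obj G \<phi> M) (F_obj G \<phi> N) t))"


section \<open>Simple objects\<close>

definition Cent :: "('g, 'x) monoid_scheme \<Rightarrow> 'g \<Rightarrow> 'g set" where
  "Cent G g = {c \<in> carrier G. c \<otimes>\<^bsub>G\<^esub> g = g \<otimes>\<^bsub>G\<^esub> c}"

definition GL :: "('k::field, 'w) module \<Rightarrow> ('w \<Rightarrow> 'w) monoid" where
  "GL W = BijGroup (carrier W) \<lparr>carrier := lin_maps W W \<inter> Bij (carrier W)\<rparr>"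

definition irrep :: "('g, 'x) monoid_scheme \<Rightarrow> ('k::field, 'w) module \<Rightarrow> ('g \<Rightarrow> 'w \<Rightarrow> 'w) \<Rightarrow> bool" where
  "irrep C W \<rho> \<longleftrightarrow> module kring W \<and> \<rho> \<in> hom C (GL W) \<and> carrier W \<noteq> {\<zero>\<^bsub>W\<^esub>} \<and>
    (\<forall>U. submodule U kring W \<and> (\<forall>c\<in>carrier C. \<rho> c ` U \<subseteq> U) \<longrightarrow> U = {\<zero>\<^bsub>W\<^esub>} \<or> U = carrier W)"

text \<open>
  \<open>kG \<otimes>\<^bsub>k Cent(g)\<^esub> W\<close> is the quotient of \<open>kG \<otimes>\<^sub>k W\<close> by the span of all \<open>yc \<otimes> w - y \<otimes> \<rho>(c)w\<close>;
  as a vector space, \<open>kG\<close> is the free space on \<open>G\<close>.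
\<close>

definition ind_null ::
  "('g, 'x) monoid_scheme \<Rightarrow> 'g \<Rightarrow> ('k::field, 'w) module \<Rightarrow> ('g \<Rightarrow> 'w \<Rightarrow> 'w) \<Rightarrow>
    (('g \<Rightarrow> 'k) \<times> 'w \<Rightarrow> 'k) set set" where
  "ind_null G g W \<rho> = (let A = free_space (carrier G); T = tensor_space A W in
    subspace_gen T {tens A W (bv (y \<otimes>\<^bsub>G\<^esub> c)) w \<ominus>\<^bsub>T\<^esub> tens A W (bv y) (\<rho> c w) | y c w.
      y \<in> carrier G \<and> c \<in> Cent G g \<and> w \<in> carrier W})"

definition ind_space ::
  "('g, 'x) monoid_scheme \<Rightarrow> 'g \<Rightarrow> ('k::field, 'w) module \<Rightarrow> ('g \<Rightarrow> 'w \<Rightarrow> 'w) \<Rightarrow>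
    ('k, (('g \<Rightarrow> 'k) \<times> 'w \<Rightarrow> 'k) set set) module" where
  "ind_space G g W \<rho> = quot_space (tensor_space (free_space (carrier G)) W) (ind_null G g W \<rho>)"

text \<open>The element \<open>y \<otimes> w\<close> of \<open>kG \<otimes>\<^bsub>k Cent(g)\<^esub> W\<close>, for \<open>y \<in> G\<close>.\<close>

definition ind_tens ::
  "('g, 'x) monoid_scheme \<Rightarrow> 'g \<Rightarrow> ('k::field, 'w) module \<Rightarrow> ('g \<Rightarrow> 'w \<Rightarrow> 'w) \<Rightarrow> 'g \<Rightarrow> 'w \<Rightarrow>
    (('g \<Rightarrow> 'k) \<times> 'w \<Rightarrow> 'k) set set" where
  "ind_tens G g W \<rho> y w = ind_null G g W \<rho> +>\<^bsub>tensor_space (free_space (carrier G)) W\<^esub>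
    tens (free_space (carrier G)) W (bv y) w"

definition simple_obj ::
  "('g, 'x) monoid_scheme \<Rightarrow> 'g \<Rightarrow> ('k::field, 'w) module \<Rightarrow> ('g \<Rightarrow> 'w \<Rightarrow> 'w) \<Rightarrow>
    ('k, 'g \<times> 'g \<Rightarrow> 'k, (('g \<Rightarrow> 'k) \<times> 'w \<Rightarrow> 'k) set set) hmodule" where
  "simple_obj G g W \<rho> = (let V = ind_space G g W \<rho> in
    with_act V (\<lambda>a. lin_by V V (carrier G \<times> carrier W) (\<lambda>(y, w). ind_tens G g W \<rho> y w)
      (\<lambda>(y, w). \<Oplus>\<^bsub>V\<^esub> p \<in> carrier G \<times> carrier G. (case p of (h, t) \<Rightarrow>
         (a (h, t) * of_bool (h = (t \<otimes>\<^bsub>G\<^esub> y) \<otimes>\<^bsub>G\<^esub> g \<otimes>\<^bsub>G\<^esub> inv\<^bsub>G\<^esub> (t \<otimes>\<^bsub>G\<^esub> y)))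
           \<odot>\<^bsub>V\<^esub> ind_tens G g W \<rho> (t \<otimes>\<^bsub>G\<^esub> y) w))))"


section \<open>Semidirect products and the subgroup \<open>V\<close>\<close>

definition Inn_group :: "('g, 'x) monoid_scheme \<Rightarrow> ('g \<Rightarrow> 'g) set" where
  "Inn_group G = {(\<lambda>x\<in>carrier G. g \<otimes>\<^bsub>G\<^esub> x \<otimes>\<^bsub>G\<^esub> inv\<^bsub>G\<^esub> g) | g. g \<in> carrier G}"

definition Out_group :: "('g, 'x) monoid_scheme \<Rightarrow> ('g \<Rightarrow> 'g) set monoid" where
  "Out_group G = AutoGroup G Mod Inn_group G"

text \<open>The linear map \<open>e_g \<times> h \<mapsto> e_{v(g)} \<times> v(h)\<close>.\<close>

definition V_map ::
  "('g, 'x) monoid_scheme \<Rightarrow> ('g \<Rightarrow> 'g) \<Rightarrow> ('g \<times> 'g \<Rightarrow> 'k::field) \<Rightarrow> 'g \<times> 'g \<Rightarrow> 'k" where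
  "V_map G v = (\<lambda>a\<in>hcar (DG G).
      (\<lambda>z. \<Sum>(g, h)\<in>carrier G \<times> carrier G. a (g, h) * bv (v g, v h) z))"

definition V_set :: "('g, 'x) monoid_scheme \<Rightarrow> (('g \<times> 'g \<Rightarrow> 'k::field) \<Rightarrow> 'g \<times> 'g \<Rightarrow> 'k) set" where
  "V_set G = V_map G ` carrier (AutoGroup G)"

text \<open>\<open>Aut_Hopf(DG) \<ltimes> Z\<^sup>2_L(DG*)\<close>; cocycles are multiplied as elements of \<open>DG \<otimes> DG\<close>.\<close>

definition Aut_Z2L ::
  "('g, 'x) monoid_scheme \<Rightarrow>
    ((('g \<times> 'g \<Rightarrow> 'k::field) \<Rightarrow> 'g \<times> 'g \<Rightarrow> 'k) \<times> (('g \<times> 'g) \<times> ('g \<times> 'g) \<Rightarrow> 'k)) monoid" where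
  "Aut_Z2L G = \<lparr>carrier = carrier (Aut_Hopf (DG G)) \<times> carrier (Z2L (DGd G)),
     monoid.mult = (\<lambda>(\<phi>, \<sigma>) (\<phi>', \<sigma>').
       (\<phi> \<otimes>\<^bsub>Aut_Hopf (DG G)\<^esub> \<phi>', mul2 (DG G) \<sigma>' (map2 (DG G) (dagger G \<phi>') \<sigma>))),
     one = (\<one>\<^bsub>Aut_Hopf (DG G)\<^esub>, \<one>\<^bsub>Z2L (DGd G)\<^esub>)\<rparr>"

text \<open>
  \<open>Out_Hopf(DG) \<ltimes> H\<^sup>2_L(DG*)\<close>: the same law on cosets, the product of two cosets being the set of
  products of their representatives.
\<close>

definition Out_H2L ::
  "('g, 'x) monoid_scheme \<Rightarrow>
    ((('g \<times> 'g \<Rightarrow> 'k::field) \<Rightarrow> 'g \<times> 'g \<Rightarrow> 'k) set \<times>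
     (('g \<times> 'g) \<times> ('g \<times> 'g) \<Rightarrow> 'k) set) monoid" where
  "Out_H2L G = \<lparr>carrier = carrier (Out_Hopf (DG G)) \<times> carrier (H2L (DGd G)),
     monoid.mult = (\<lambda>(A, S) (A', S').
       (A \<otimes>\<^bsub>Out_Hopf (DG G)\<^esub> A',
        {mul2 (DG G) \<sigma>' (map2 (DG G) (dagger G \<phi>') \<sigma>) | \<sigma> \<sigma>' \<phi>'. \<sigma> \<in> S \<and> \<sigma>' \<in> S' \<and> \<phi>' \<in> A'})),
     one = (\<one>\<^bsub>Out_Hopf (DG G)\<^esub>, \<one>\<^bsub>H2L (DGd G)\<^esub>)\<rparr>"

definition proj_Out ::
  "('g, 'x) monoid_scheme \<Rightarrow>
    (('g \<times> 'g \<Rightarrow> 'k::field) \<Rightarrow> 'g \<times> 'g \<Rightarrow> 'k) \<times> (('g \<times> 'g) \<times> ('g \<times> 'g) \<Rightarrow> 'k) \<Rightarrow>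
    (('g \<times> 'g \<Rightarrow> 'k) \<Rightarrow> 'g \<times> 'g \<Rightarrow> 'k) set \<times> (('g \<times> 'g) \<times> ('g \<times> 'g) \<Rightarrow> 'k) set" where
  "proj_Out G = (\<lambda>(\<phi>, \<sigma>). (Inn_Hopf (DG G) #>\<^bsub>Aut_Hopf (DG G)\<^esub> \<phi>,
      (cobound (DGd G) ` Reg1L (DGd G)) #>\<^bsub>Z2L (DGd G)\<^esub> \<sigma>))"

text \<open>\<open>V \<times> {1}\<close> and its image in the quotient.\<close>

definition V_L ::
  "('g, 'x) monoid_scheme \<Rightarrow>
    ((('g \<times> 'g \<Rightarrow> 'k::field) \<Rightarrow> 'g \<times> 'g \<Rightarrow> 'k) \<times> (('g \<times> 'g) \<times> ('g \<times> 'g) \<Rightarrow> 'k)) set" where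
  "V_L G = V_set G \<times> {\<one>\<^bsub>Z2L (DGd G)\<^esub>}"

definition V_L_image ::
  "('g, 'x) monoid_scheme \<Rightarrow>
    ((('g \<times> 'g \<Rightarrow> 'k::field) \<Rightarrow> 'g \<times> 'g \<Rightarrow> 'k) set \<times>
     (('g \<times> 'g) \<times> ('g \<times> 'g) \<Rightarrow> 'k) set) set" where
  "V_L_image G = proj_Out G ` V_L G"

end

theory Submission
  imports Defs
begin

text \<open>
  Write \<open>v\<close> also for the automorphism \<open>e_g \<times> h \<mapsto> e_{v(g)} \<times> v(h)\<close> of \<open>DG\<close>.  Its matrix has \<open>v\<close> and the
  dual of \<open>v\<^sup>-\<^sup>1\<close> on the diagonal and trivial \<open>a\<close>, \<open>b\<close>; the components of a Hopf endomorphism are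
  recovered by applying a counit to one tensor factor, so the matrix is unique
  (\<open>matrix_unique\<close>) and \<open>v\<^sup>\<dagger>\<close> is the automorphism attached to \<open>v\<^sup>-\<^sup>1\<close> (\<open>dagger_V_map\<close>).  Hence
  \<open>F_v(M)\<close> is \<open>M\<close> with \<open>h\<close> acting as \<open>v\<^sup>-\<^sup>1(h)\<close>.

  The trivial cocycle corresponds to \<open>1 \<otimes> 1\<close>, so \<open>J\<close> is the identity of \<open>M \<otimes> N\<close>
  (\<open>J_map_trivial\<close>).  The monoidal axioms then reduce to \<open>\<Delta>\<close> and \<open>\<epsilon>\<close> being compatible with \<open>v\<close>, and
  the functor is braided because \<open>(v \<otimes> v)(R) = R\<close>.  On simple objects, \<open>y \<otimes> w \<mapsto> v(y) \<otimes> w\<close> is an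
  isomorphism from \<open>F_v(\<O>_g\<^sup>\<rho>)\<close> to the object attached to \<open>v(g)\<close> and \<open>\<rho> \<circ> v\<^sup>-\<^sup>1\<close>
  (\<open>simple_obj_F_obj_iso\<close>).

  For the image in the quotient, a group-like element of \<open>DG\<close> is \<open>\<chi> \<times> g\<close> with a linear character
  \<open>\<chi>\<close>; as \<open>\<chi>\<close> is a class function it drops out of the conjugation, which is the automorphism
  attached to conjugation by \<open>g\<close> (\<open>Inn_Hopf_eq\<close>).  So the kernel of \<open>v \<mapsto> (v, 1)\<close> modulo inner
  automorphisms and coboundaries is \<open>Inn(G)\<close>.  In \<open>DG \<otimes> DG\<close> the coboundaries of lazy
  cochains are the elements \<open>(\<eta> \<otimes> \<eta>) \<Delta>(\<eta>\<^sup>-\<^sup>1)\<close> with \<open>\<eta>\<close> central, invertible and of counit 1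
  (\<open>cobounds_eq\<close>); they form a group that is stable under every \<open>v \<otimes> v\<close> (\<open>cobounds_closed\<close>),
  so the second component is the trivial class throughout.
\<close>

section \<open>Vector spaces, quotients and tensor products\<close>

lemma kring_simps [simp]:
  "carrier (kring :: 'k::field ring) = UNIV"
  "\<zero>\<^bsub>kring\<^esub> = (0::'k)" "\<one>\<^bsub>kring\<^esub> = (1::'k)"
  "(a::'k) \<otimes>\<^bsub>kring\<^esub> b = a * b" "a \<oplus>\<^bsub>kring\<^esub> b = a + b"
  by (simp_all add: ring_of_type_algebra_def)

lemma kring_minus [simp]: "\<ominus>\<^bsub>kring\<^esub> (a::'k::field) = - a"
proof -
  interpret cring "kring :: 'k ring" by (rule cring_from_type_algebra)
  show ?thesis by (rule minus_equality) auto
qed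

lemma module_kringI:
  fixes M :: "('k::field, 'm, 'x) module_scheme"
  assumes "abelian_group M"
    and "\<And>c x. x \<in> carrier M \<Longrightarrow> c \<odot>\<^bsub>M\<^esub> x \<in> carrier M"
    and "\<And>a b x. x \<in> carrier M \<Longrightarrow> (a + b) \<odot>\<^bsub>M\<^esub> x = a \<odot>\<^bsub>M\<^esub> x \<oplus>\<^bsub>M\<^esub> b \<odot>\<^bsub>M\<^esub> x"
    and "\<And>a x y. x \<in> carrier M \<Longrightarrow> y \<in> carrier M \<Longrightarrow>
      a \<odot>\<^bsub>M\<^esub> (x \<oplus>\<^bsub>M\<^esub> y) = a \<odot>\<^bsub>M\<^esub> x \<oplus>\<^bsub>M\<^esub> a \<odot>\<^bsub>M\<^esub> y"
    and "\<And>a b x. x \<in> carrier M \<Longrightarrow> (a * b) \<odot>\<^bsub>M\<^esub> x = a \<odot>\<^bsub>M\<^esub> (b \<odot>\<^bsub>M\<^esub> x)"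
    and "\<And>x. x \<in> carrier M \<Longrightarrow> 1 \<odot>\<^bsub>M\<^esub> x = x"
  shows "module kring M"
  by (rule moduleI) (use assms in \<open>auto intro: cring_from_type_algebra\<close>)

lemma module_kring_simps:
  fixes M :: "('k::field, 'm, 'x) module_scheme"
  assumes "module kring M" "x \<in> carrier M"
  shows "c \<odot>\<^bsub>M\<^esub> x \<in> carrier M" "(a + b) \<odot>\<^bsub>M\<^esub> x = a \<odot>\<^bsub>M\<^esub> x \<oplus>\<^bsub>M\<^esub> b \<odot>\<^bsub>M\<^esub> x"
    "(a * b) \<odot>\<^bsub>M\<^esub> x = a \<odot>\<^bsub>M\<^esub> (b \<odot>\<^bsub>M\<^esub> x)" "1 \<odot>\<^bsub>M\<^esub> x = x" "0 \<odot>\<^bsub>M\<^esub> x = \<zero>\<^bsub>M\<^esub>"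
    "y \<in> carrier M \<Longrightarrow> c \<odot>\<^bsub>M\<^esub> (x \<oplus>\<^bsub>M\<^esub> y) = c \<odot>\<^bsub>M\<^esub> x \<oplus>\<^bsub>M\<^esub> c \<odot>\<^bsub>M\<^esub> y"
    "(-1) \<odot>\<^bsub>M\<^esub> x = \<ominus>\<^bsub>M\<^esub> x"
proof -
  interpret module kring M by fact
  show "c \<odot>\<^bsub>M\<^esub> x \<in> carrier M" using assms by simp
  show "(a + b) \<odot>\<^bsub>M\<^esub> x = a \<odot>\<^bsub>M\<^esub> x \<oplus>\<^bsub>M\<^esub> b \<odot>\<^bsub>M\<^esub> x" using smult_l_distr[of a b x] assms by simp
  show "(a * b) \<odot>\<^bsub>M\<^esub> x = a \<odot>\<^bsub>M\<^esub> (b \<odot>\<^bsub>M\<^esub> x)" using smult_assoc1[of a b x] assms by simp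
  show 1: "1 \<odot>\<^bsub>M\<^esub> x = x" using smult_one[of x] assms by simp
  show "0 \<odot>\<^bsub>M\<^esub> x = \<zero>\<^bsub>M\<^esub>" using smult_l_null[of x] assms by simp
  show "(-1) \<odot>\<^bsub>M\<^esub> x = \<ominus>\<^bsub>M\<^esub> x" using smult_l_minus[of 1 x] assms 1 by simp
  show "c \<odot>\<^bsub>M\<^esub> (x \<oplus>\<^bsub>M\<^esub> y) = c \<odot>\<^bsub>M\<^esub> x \<oplus>\<^bsub>M\<^esub> c \<odot>\<^bsub>M\<^esub> y" if "y \<in> carrier M"
    using smult_r_distr[of c x y] assms that by simp
qed

lemma lin_mapsD:
  assumes "f \<in> lin_maps M N"
  shows "x \<in> carrier M \<Longrightarrow> f x \<in> carrier N"
    "x \<in> carrier M \<Longrightarrow> y \<in> carrier M \<Longrightarrow> f (x \<oplus>\<^bsub>M\<^esub> y) = f x \<oplus>\<^bsub>N\<^esub> f y"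
    "x \<in> carrier M \<Longrightarrow> f (c \<odot>\<^bsub>M\<^esub> x) = c \<odot>\<^bsub>N\<^esub> f x"
  using assms by (auto simp: lin_maps_def)

lemma lin_mapsI:
  assumes "\<And>x. x \<in> carrier M \<Longrightarrow> f x \<in> carrier N"
    "\<And>x y. x \<in> carrier M \<Longrightarrow> y \<in> carrier M \<Longrightarrow> f (x \<oplus>\<^bsub>M\<^esub> y) = f x \<oplus>\<^bsub>N\<^esub> f y"
    "\<And>c x. x \<in> carrier M \<Longrightarrow> f (c \<odot>\<^bsub>M\<^esub> x) = c \<odot>\<^bsub>N\<^esub> f x"
  shows "f \<in> lin_maps M N"
  using assms by (auto simp: lin_maps_def)

lemma lin_maps_zero:
  assumes "f \<in> lin_maps M N" "module kring M" "module kring N"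
  shows "f \<zero>\<^bsub>M\<^esub> = \<zero>\<^bsub>N\<^esub>"
proof -
  interpret M: module kring M by fact
  have "f (0 \<odot>\<^bsub>M\<^esub> \<zero>\<^bsub>M\<^esub>) = 0 \<odot>\<^bsub>N\<^esub> f \<zero>\<^bsub>M\<^esub>" using lin_mapsD[OF assms(1)] by blast
  then show ?thesis
    by (metis M.M.zero_closed assms lin_mapsD(1) module_kring_simps(5))
qed

lemma lin_maps_comp:
  "f \<in> lin_maps M N \<Longrightarrow> g \<in> lin_maps N P \<Longrightarrow> (\<lambda>x. g (f x)) \<in> lin_maps M P"
  by (rule lin_mapsI) (simp_all add: lin_mapsD)

lemma lin_maps_cong:
  assumes "f \<in> lin_maps M N" "module kring M" "\<And>x. x \<in> carrier M \<Longrightarrow> f x = g x"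
  shows "g \<in> lin_maps M N"
proof -
  interpret M: module kring M by fact
  have eq: "g x = f x" if "x \<in> carrier M" for x using assms(3)[OF that] by simp
  show ?thesis
    by (rule lin_mapsI)
      (simp_all add: eq lin_mapsD[OF assms(1)] module_kring_simps[OF assms(2)])
qed

lemma lin_maps_add:
  assumes "f \<in> lin_maps M N" "g \<in> lin_maps M N" "module kring M" "module kring N"
  shows "(\<lambda>x. f x \<oplus>\<^bsub>N\<^esub> g x) \<in> lin_maps M N"
proof -
  interpret N: module kring N by fact
  show ?thesis
    by (rule lin_mapsI)
      (simp_all add: lin_mapsD[OF assms(1)] lin_mapsD[OF assms(2)] module_kring_simps[OF assms(4)] N.M.add.m_ac)
qed

lemma lin_maps_smult:
  assumes "f \<in> lin_maps M N" "module kring M" "module kring N"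
  shows "(\<lambda>x. c \<odot>\<^bsub>N\<^esub> f x) \<in> lin_maps M N"
  by (rule lin_mapsI)
    (simp_all add: lin_mapsD[OF assms(1)] module_kring_simps(1,6)[OF assms(3)] mult.commute
      flip: module_kring_simps(3)[OF assms(3)])

lemma lin_maps_const_zero:
  assumes "module kring N"
  shows "(\<lambda>x. \<zero>\<^bsub>N\<^esub>) \<in> lin_maps M N"
proof -
  interpret N: module kring N by fact
  show ?thesis by (rule lin_mapsI) (use N.smult_r_null in auto)
qed

lemma lin_maps_finsum:
  assumes "\<And>i. i \<in> I \<Longrightarrow> f i \<in> lin_maps M N" "module kring M" "module kring N"
  shows "(\<lambda>x. \<Oplus>\<^bsub>N\<^esub>i\<in>I. f i x) \<in> lin_maps M N"
proof -
  interpret N: module kring N by fact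
  interpret M: module kring M by fact
  show ?thesis
  proof (cases "finite I")
    case True
    then show ?thesis using assms(1)
    proof (induction I)
      case empty
      then show ?case by (simp add: lin_maps_const_zero assms)
    next
      case (insert i I)
      have "(\<lambda>x. f i x \<oplus>\<^bsub>N\<^esub> (\<Oplus>\<^bsub>N\<^esub>i\<in>I. f i x)) \<in> lin_maps M N"
        by (rule lin_maps_add) (use insert assms in auto)
      then show ?case
      proof (rule lin_maps_cong)
        fix x assume "x \<in> carrier M"
        then have "(\<lambda>i. f i x) \<in> I \<rightarrow> carrier N" "f i x \<in> carrier N"
          using lin_mapsD(1)[OF insert(4)] by auto
        then show "f i x \<oplus>\<^bsub>N\<^esub> (\<Oplus>\<^bsub>N\<^esub>i\<in>I. f i x) = (\<Oplus>\<^bsub>N\<^esub>j\<in>insert i I. f j x)"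
          using insert(1,2) by simp
      qed fact
    qed
  qed (simp add: N.M.finsum_infinite lin_maps_const_zero assms)
qed

lemma lin_maps_apply_finsum:
  assumes "f \<in> lin_maps M N" "module kring M" "module kring N" "g \<in> I \<rightarrow> carrier M"
  shows "f (\<Oplus>\<^bsub>M\<^esub>i\<in>I. g i) = (\<Oplus>\<^bsub>N\<^esub>i\<in>I. f (g i))"
proof -
  interpret N: module kring N by fact
  interpret M: module kring M by fact
  show ?thesis
  proof (cases "finite I")
    case True
    then show ?thesis using assms(4)
    proof (induction I)
      case empty
      then show ?case by (simp add: lin_maps_zero assms)
    next
      case (insert i I)
      then have g: "g i \<in> carrier M" "g \<in> I \<rightarrow> carrier M" by auto
      then have "(\<lambda>i. f (g i)) \<in> I \<rightarrow> carrier N" "f (g i) \<in> carrier N"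
        using lin_mapsD(1)[OF assms(1)] by auto
      with insert g show ?case
        by (simp add: lin_mapsD[OF assms(1)])
    qed
  qed (simp add: N.M.finsum_infinite M.M.finsum_infinite lin_maps_zero assms)
qed

text \<open>A spanning subset, as one that lies in no proper subspace.\<close>

definition spanning :: "('k::field, 'm, 'x) module_scheme \<Rightarrow> 'm set \<Rightarrow> bool" where
  "spanning M S \<longleftrightarrow> S \<subseteq> carrier M \<and>
     (\<forall>N. submodule N kring M \<longrightarrow> S \<subseteq> N \<longrightarrow> carrier M \<subseteq> N)"

lemma spanningD:
  "spanning M S \<Longrightarrow> submodule N kring M \<Longrightarrow> S \<subseteq> N \<Longrightarrow> carrier M \<subseteq> N"
  unfolding spanning_def by simp

lemma spanning_subset: "spanning M S \<Longrightarrow> S \<subseteq> carrier M"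
  unfolding spanning_def by simp

lemma submodule_kringI:
  assumes "module kring M" "N \<subseteq> carrier M" "\<zero>\<^bsub>M\<^esub> \<in> N"
    "\<And>x y. x \<in> N \<Longrightarrow> y \<in> N \<Longrightarrow> x \<oplus>\<^bsub>M\<^esub> y \<in> N" "\<And>c x. x \<in> N \<Longrightarrow> c \<odot>\<^bsub>M\<^esub> x \<in> N"
  shows "submodule N kring M"
proof -
  interpret M: module kring M by fact
  show ?thesis
  proof (rule M.submoduleI)
    show "\<ominus>\<^bsub>M\<^esub> a \<in> N" if "a \<in> N" for a
      using assms(2) assms(5)[OF that, of "-1"] that module_kring_simps(7)[OF assms(1), of a] by auto
  qed (use assms in auto)
qed

lemma submodule_kringD:
  assumes "module kring M" "submodule N kring M"
  shows "N \<subseteq> carrier M" "\<zero>\<^bsub>M\<^esub> \<in> N" "x \<in> N \<Longrightarrow> y \<in> N \<Longrightarrow> x \<oplus>\<^bsub>M\<^esub> y \<in> N"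
    "x \<in> N \<Longrightarrow> c \<odot>\<^bsub>M\<^esub> x \<in> N" "x \<in> N \<Longrightarrow> \<ominus>\<^bsub>M\<^esub> x \<in> N"
proof -
  interpret M: module kring M by fact
  note E = M.submoduleE[OF assms(2)]
  show "N \<subseteq> carrier M" "x \<in> N \<Longrightarrow> y \<in> N \<Longrightarrow> x \<oplus>\<^bsub>M\<^esub> y \<in> N" "x \<in> N \<Longrightarrow> \<ominus>\<^bsub>M\<^esub> x \<in> N"
    "x \<in> N \<Longrightarrow> c \<odot>\<^bsub>M\<^esub> x \<in> N"
    using E by auto
  obtain x where "x \<in> N" using E(2) by auto
  then show "\<zero>\<^bsub>M\<^esub> \<in> N"
    using E(4)[of 0 x] E(1) module_kring_simps(5)[OF assms(1), of x] by auto
qed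

lemma lin_maps_eq_on_spanning:
  assumes "f \<in> lin_maps M N" "g \<in> lin_maps M N" "module kring M" "module kring N"
    "spanning M S" "\<And>x. x \<in> S \<Longrightarrow> f x = g x" "m \<in> carrier M"
  shows "f m = g m"
proof -
  interpret M: module kring M by fact
  have "submodule {x \<in> carrier M. f x = g x} kring M"
    by (rule submodule_kringI)
      (simp_all add: subset_iff assms(3) lin_mapsD[OF assms(1)] lin_mapsD[OF assms(2)]
        lin_maps_zero[OF assms(1,3,4)] lin_maps_zero[OF assms(2,3,4)] module_kring_simps(1)[OF assms(3)])
  moreover have "S \<subseteq> {x \<in> carrier M. f x = g x}"
    using spanning_subset[OF assms(5)] assms(6) by auto
  ultimately have "carrier M \<subseteq> {x \<in> carrier M. f x = g x}"
    by (rule spanningD[OF assms(5)])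
  then show ?thesis using assms(7) by auto
qed

lemma submodule_vimage:
  assumes "f \<in> lin_maps M P" "module kring M" "module kring P" "submodule N kring P"
  shows "submodule {x \<in> carrier M. f x \<in> N} kring M"
proof (rule submodule_kringI[OF assms(2)])
  show "\<zero>\<^bsub>M\<^esub> \<in> {x \<in> carrier M. f x \<in> N}"
    using submodule_kringD(2)[OF assms(3,4)] abelian_monoid.zero_closed[of M] assms(2)
    by (simp add: lin_maps_zero[OF assms(1-3)] module_def abelian_group_def)
  show "x \<oplus>\<^bsub>M\<^esub> y \<in> {x \<in> carrier M. f x \<in> N}"
    if "x \<in> {x \<in> carrier M. f x \<in> N}" "y \<in> {x \<in> carrier M. f x \<in> N}" for x y
    using that submodule_kringD(3)[OF assms(3,4), of "f x" "f y"] abelian_monoid.a_closed[of M x y] assms(2)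
    by (simp add: lin_mapsD[OF assms(1)] module_def abelian_group_def)
  show "c \<odot>\<^bsub>M\<^esub> x \<in> {x \<in> carrier M. f x \<in> N}" if "x \<in> {x \<in> carrier M. f x \<in> N}" for c x
    using that submodule_kringD(4)[OF assms(3,4), of "f x" c]
    by (simp add: lin_mapsD[OF assms(1)] module_kring_simps(1)[OF assms(2)])
qed auto

lemma spanning_image:
  assumes "spanning M S" "f \<in> lin_maps M P" "f ` carrier M = carrier P" "module kring M" "module kring P"
  shows "spanning P (f ` S)"
  unfolding spanning_def
proof (intro conjI allI impI)
  show "f ` S \<subseteq> carrier P" using spanning_subset[OF assms(1)] assms(3) by auto
next
  fix N assume N: "submodule N kring P" "f ` S \<subseteq> N"
  have "S \<subseteq> {x \<in> carrier M. f x \<in> N}"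
    using spanning_subset[OF assms(1)] N(2) by auto
  then have "carrier M \<subseteq> {x \<in> carrier M. f x \<in> N}"
    by (rule spanningD[OF assms(1) submodule_vimage[OF assms(2,4,5) N(1)]])
  then show "carrier P \<subseteq> N" unfolding assms(3)[symmetric] by auto
qed

lemma subspace_gen_submodule:
  assumes "module kring M" "S \<subseteq> carrier M"
  shows "submodule (subspace_gen M S) kring M"
proof -
  interpret M: module kring M by fact
  have *: "carrier M \<in> {N. submodule N kring M \<and> S \<subseteq> N}"
    using assms M.carrier_is_submodule by auto
  show ?thesis
    unfolding subspace_gen_def
  proof (rule submodule_kringI[OF assms(1)])
    show "\<Inter>{N. submodule N kring M \<and> S \<subseteq> N} \<subseteq> carrier M"
      by (rule Inter_lower[OF *])
  qed (auto simp: submodule_kringD(2-4)[OF assms(1)])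
qed

lemma subspace_gen_incl: "S \<subseteq> subspace_gen M S"
  unfolding subspace_gen_def by blast

lemma lin_maps_vanish_subspace_gen:
  assumes "module kring M" "module kring P" "S \<subseteq> carrier M" "f \<in> lin_maps M P"
    "\<And>x. x \<in> S \<Longrightarrow> f x = \<zero>\<^bsub>P\<^esub>" "x \<in> subspace_gen M S"
  shows "f x = \<zero>\<^bsub>P\<^esub>"
proof -
  interpret M: module kring M by fact
  interpret P: module kring P by fact
  have "submodule {x \<in> carrier M. f x = \<zero>\<^bsub>P\<^esub>} kring M"
    by (rule submodule_kringI)
      (simp_all add: subset_iff assms(1) lin_mapsD[OF assms(4)] lin_maps_zero[OF assms(4,1,2)]
        module_kring_simps(1)[OF assms(1)] P.smult_r_null)
  moreover have "S \<subseteq> {x \<in> carrier M. f x = \<zero>\<^bsub>P\<^esub>}" using assms(3,5) by auto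
  ultimately have "x \<in> {x \<in> carrier M. f x = \<zero>\<^bsub>P\<^esub>}"
    using assms(6) unfolding subspace_gen_def by (metis (no_types, lifting) InterD mem_Collect_eq)
  then show ?thesis by simp
qed

subsection \<open>Quotients\<close>

lemma submodule_abelian_subgroup:
  assumes "module kring M" "submodule N kring M"
  shows "abelian_subgroup N M"
proof -
  interpret M: module kring M by fact
  show ?thesis
    by (rule abelian_subgroupI3)
      (use assms(2) in \<open>auto simp: additive_subgroup_def submodule_def M.M.abelian_group_axioms\<close>)
qed

lemma quot_space_facts:
  fixes M :: "('k::field, 'm, 'x) module_scheme"
  assumes "module kring M" "submodule N kring M"
  shows "module kring (quot_space M N)"
    and "(\<lambda>x. N +>\<^bsub>M\<^esub> x) \<in> lin_maps M (quot_space M N)"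
    and "(\<lambda>x. N +>\<^bsub>M\<^esub> x) ` carrier M = carrier (quot_space M N)"
proof -
  interpret M: module kring M by fact
  interpret N: abelian_subgroup N M using submodule_abelian_subgroup[OF assms] .
  interpret F: comm_group "M A_Mod N" by (rule N.a_factorgroup_is_comm_group)
  let ?Q = "quot_space M N"
  note sub = submodule_kringD[OF assms]
  have car: "carrier ?Q = (\<lambda>x. N +>\<^bsub>M\<^esub> x) ` carrier M"
    by (auto simp: quot_space_def A_RCOSETS_def RCOSETS_def a_r_coset_def)
  then show "(\<lambda>x. N +>\<^bsub>M\<^esub> x) ` carrier M = carrier ?Q" by simp
  have add: "(N +>\<^bsub>M\<^esub> x) \<oplus>\<^bsub>?Q\<^esub> (N +>\<^bsub>M\<^esub> y) = N +>\<^bsub>M\<^esub> (x \<oplus>\<^bsub>M\<^esub> y)"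
    if "x \<in> carrier M" "y \<in> carrier M" for x y
    using that N.a_rcos_sum by (simp add: quot_space_def)
  have smult: "c \<odot>\<^bsub>?Q\<^esub> (N +>\<^bsub>M\<^esub> x) = N +>\<^bsub>M\<^esub> (c \<odot>\<^bsub>M\<^esub> x)" if x: "x \<in> carrier M" for c x
  proof -
    have "c \<odot>\<^bsub>?Q\<^esub> (N +>\<^bsub>M\<^esub> x) = {n \<oplus>\<^bsub>M\<^esub> (c \<odot>\<^bsub>M\<^esub> (n' \<oplus>\<^bsub>M\<^esub> x)) | n n'. n \<in> N \<and> n' \<in> N}"
      by (auto simp: quot_space_def set_add_def' a_r_coset_def')
    also have "\<dots> = {n \<oplus>\<^bsub>M\<^esub> c \<odot>\<^bsub>M\<^esub> x | n. n \<in> N}"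
    proof safe
      fix n n' assume "n \<in> N" "n' \<in> N"
      then show "\<exists>k. n \<oplus>\<^bsub>M\<^esub> c \<odot>\<^bsub>M\<^esub> (n' \<oplus>\<^bsub>M\<^esub> x) = k \<oplus>\<^bsub>M\<^esub> c \<odot>\<^bsub>M\<^esub> x \<and> k \<in> N"
        using x sub
        by (intro exI[of _ "n \<oplus>\<^bsub>M\<^esub> c \<odot>\<^bsub>M\<^esub> n'"])
          (auto simp: module_kring_simps[OF assms(1)] M.M.a_assoc subset_iff)
    next
      fix n assume "n \<in> N"
      then show "\<exists>k n'. n \<oplus>\<^bsub>M\<^esub> c \<odot>\<^bsub>M\<^esub> x = k \<oplus>\<^bsub>M\<^esub> c \<odot>\<^bsub>M\<^esub> (n' \<oplus>\<^bsub>M\<^esub> x) \<and> k \<in> N \<and> n' \<in> N"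
        using x sub by (intro exI[of _ n] exI[of _ "\<zero>\<^bsub>M\<^esub>"]) auto
    qed
    also have "\<dots> = N +>\<^bsub>M\<^esub> (c \<odot>\<^bsub>M\<^esub> x)" by (auto simp: a_r_coset_def')
    finally show ?thesis .
  qed
  show "(\<lambda>x. N +>\<^bsub>M\<^esub> x) \<in> lin_maps M ?Q"
    by (rule lin_mapsI) (auto simp: car add smult)
  have "abelian_group ?Q"
  proof (rule abelian_groupI)
    fix S assume "S \<in> carrier ?Q"
    then obtain x where "x \<in> carrier M" "S = N +>\<^bsub>M\<^esub> x" using car by auto
    moreover have "\<zero>\<^bsub>?Q\<^esub> = N +>\<^bsub>M\<^esub> \<zero>\<^bsub>M\<^esub>" using sub by (simp add: quot_space_def)
    ultimately show "\<exists>y\<in>carrier ?Q. y \<oplus>\<^bsub>?Q\<^esub> S = \<zero>\<^bsub>?Q\<^esub>"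
      by (intro bexI[of _ "N +>\<^bsub>M\<^esub> (\<ominus>\<^bsub>M\<^esub> x)"]) (auto simp: add car M.M.l_neg)
    show "\<zero>\<^bsub>?Q\<^esub> \<oplus>\<^bsub>?Q\<^esub> S = S"
      using \<open>\<zero>\<^bsub>?Q\<^esub> = N +>\<^bsub>M\<^esub> \<zero>\<^bsub>M\<^esub>\<close> \<open>S = N +>\<^bsub>M\<^esub> x\<close> \<open>x \<in> carrier M\<close> by (simp add: add)
  next
    have "\<zero>\<^bsub>?Q\<^esub> = N +>\<^bsub>M\<^esub> \<zero>\<^bsub>M\<^esub>" using sub by (simp add: quot_space_def)
    then show "\<zero>\<^bsub>?Q\<^esub> \<in> carrier ?Q" by (auto simp: car)
  qed (auto simp: car add M.M.a_ac)
  then show "module kring ?Q"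
    by (rule module_kringI)
      (auto simp: car add smult module_kring_simps[OF assms(1)])
qed

lemma quot_space_zero:
  assumes "module kring M" "submodule N kring M" "x \<in> N"
  shows "N +>\<^bsub>M\<^esub> x = \<zero>\<^bsub>quot_space M N\<^esub>"
proof -
  interpret M: module kring M by fact
  interpret N: abelian_subgroup N M using submodule_abelian_subgroup[OF assms(1,2)] .
  show ?thesis using assms N.a_rcos_const by (simp add: quot_space_def)
qed

text \<open>Universal property of the quotient.\<close>

lemma quot_space_factor:
  fixes M :: "('k::field, 'm, 'x) module_scheme"
  assumes "module kring M" "submodule N kring M" "module kring P" "f \<in> lin_maps M P"
    "\<And>x. x \<in> N \<Longrightarrow> f x = \<zero>\<^bsub>P\<^esub>"
  shows "\<exists>g \<in> lin_maps (quot_space M N) P. \<forall>x\<in>carrier M. g (N +>\<^bsub>M\<^esub> x) = f x"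
proof -
  interpret M: module kring M by fact
  interpret P: module kring P by fact
  interpret N: abelian_subgroup N M using submodule_abelian_subgroup[OF assms(1,2)] .
  note Q = quot_space_facts[OF assms(1,2)]
  define g where "g S = f (SOME x. x \<in> carrier M \<and> N +>\<^bsub>M\<^esub> x = S)" for S
  have g: "g (N +>\<^bsub>M\<^esub> x) = f x" if x: "x \<in> carrier M" for x
  proof -
    define y where "y = (SOME y. y \<in> carrier M \<and> N +>\<^bsub>M\<^esub> y = N +>\<^bsub>M\<^esub> x)"
    have y: "y \<in> carrier M \<and> N +>\<^bsub>M\<^esub> y = N +>\<^bsub>M\<^esub> x"
      unfolding y_def by (rule someI[of _ x]) (use x in simp)
    then have "y \<in> N +>\<^bsub>M\<^esub> x" using N.a_rcos_self by auto
    then obtain n where n: "n \<in> N" "y = n \<oplus>\<^bsub>M\<^esub> x" by (auto simp: a_r_coset_def')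
    then have "f y = f x"
      using assms(5)[OF n(1)] lin_mapsD[OF assms(4)] x N.a_subset by auto
    then show ?thesis unfolding g_def y_def .
  qed
  have "g \<in> lin_maps (quot_space M N) P"
  proof (rule lin_mapsI)
    fix S assume "S \<in> carrier (quot_space M N)"
    then obtain x where x: "x \<in> carrier M" "S = N +>\<^bsub>M\<^esub> x" using Q(3) by auto
    then show "g S \<in> carrier P" using g lin_mapsD[OF assms(4)] by auto
    fix c
    have "c \<odot>\<^bsub>quot_space M N\<^esub> S = N +>\<^bsub>M\<^esub> (c \<odot>\<^bsub>M\<^esub> x)" using x lin_mapsD[OF Q(2)] by auto
    then show "g (c \<odot>\<^bsub>quot_space M N\<^esub> S) = c \<odot>\<^bsub>P\<^esub> g S"
      using x g lin_mapsD[OF assms(4)] module_kring_simps[OF assms(1)] by auto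
  next
    fix S Y assume "S \<in> carrier (quot_space M N)" "Y \<in> carrier (quot_space M N)"
    then obtain x y where x: "x \<in> carrier M" "S = N +>\<^bsub>M\<^esub> x" "y \<in> carrier M" "Y = N +>\<^bsub>M\<^esub> y"
      using Q(3) by (metis (lifting) imageE)
    have "S \<oplus>\<^bsub>quot_space M N\<^esub> Y = N +>\<^bsub>M\<^esub> (x \<oplus>\<^bsub>M\<^esub> y)" using x lin_mapsD(2)[OF Q(2)] by auto
    then show "g (S \<oplus>\<^bsub>quot_space M N\<^esub> Y) = g S \<oplus>\<^bsub>P\<^esub> g Y"
      using x g lin_mapsD[OF assms(4)] by auto
  qed
  then show ?thesis using g by blast
qed

subsection \<open>Free spaces and linear extension\<close>

lemma free_space_simps [simp]:
  "carrier (free_space I) = {s. finite {i. s i \<noteq> 0} \<and> {i. s i \<noteq> 0} \<subseteq> I}"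
  "\<zero>\<^bsub>free_space I\<^esub> = (\<lambda>i. 0)" "s \<oplus>\<^bsub>free_space I\<^esub> t = (\<lambda>i. s i + t i)"
  "c \<odot>\<^bsub>free_space I\<^esub> s = (\<lambda>i. c * s i)"
  by (simp_all add: free_space_def)

lemma free_space_add_closed:
  fixes s t :: "'i \<Rightarrow> 'k::field"
  assumes "finite {i. s i \<noteq> 0}" "finite {i. t i \<noteq> 0}"
  shows "finite {i. s i + t i \<noteq> 0}"
  by (rule finite_subset[of _ "{i. s i \<noteq> 0} \<union> {i. t i \<noteq> 0}"]) (use assms in auto)

lemma module_free_space: "module kring (free_space I :: ('k::field, 'i \<Rightarrow> 'k) module)"
proof (rule module_kringI)
  show "abelian_group (free_space I :: ('k::field, 'i \<Rightarrow> 'k) module)"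
  proof (rule abelian_groupI)
    fix s :: "'i \<Rightarrow> 'k" assume "s \<in> carrier (free_space I)"
    then show "\<exists>t\<in>carrier (free_space I). t \<oplus>\<^bsub>free_space I\<^esub> s = \<zero>\<^bsub>free_space I\<^esub>"
      by (intro bexI[of _ "\<lambda>i. - s i"]) auto
  next
    fix s t :: "'i \<Rightarrow> 'k" assume "s \<in> carrier (free_space I)" "t \<in> carrier (free_space I)"
    then show "s \<oplus>\<^bsub>free_space I\<^esub> t \<in> carrier (free_space I)"
      by (auto simp: free_space_add_closed subset_iff) (metis add.right_neutral)
  qed (auto simp: algebra_simps)
qed (auto simp: algebra_simps intro: rev_finite_subset)

lemma bv_in_free_space: "i \<in> I \<Longrightarrow> bv i \<in> carrier (free_space I)"
  by (simp add: bv_def)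

lemma spanning_free_space: "spanning (free_space I :: ('k::field, 'i \<Rightarrow> 'k) module) (bv ` I)"
  unfolding spanning_def
proof (intro conjI allI impI subsetI)
  fix s :: "'i \<Rightarrow> 'k" assume "s \<in> bv ` I"
  then show "s \<in> carrier (free_space I)"
    by (auto simp del: free_space_simps(1) intro: bv_in_free_space)
next
  fix N and s :: "'i \<Rightarrow> 'k"
  assume N: "submodule N kring (free_space I :: ('k, 'i \<Rightarrow> 'k) module)" "bv ` I \<subseteq> N"
    and s: "s \<in> carrier (free_space I)"
  note sub = submodule_kringD[OF module_free_space N(1), simplified]
  have *: "s \<in> N" if "finite F" "F \<subseteq> I" "{i. s i \<noteq> 0} \<subseteq> F" for F and s :: "'i \<Rightarrow> 'k"
    using that
  proof (induction F arbitrary: s)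
    case empty
    then have "s = (\<lambda>i. 0)" by auto
    then show ?case using sub(2) by simp
  next
    case (insert x F)
    have "s(x := 0) \<in> N" by (rule insert.IH) (use insert in auto)
    moreover have "(\<lambda>i. s x * bv x i) \<in> N" using N(2) sub(4) insert(4) by auto
    ultimately have "(\<lambda>i. (s(x := 0)) i + s x * bv x i) \<in> N" by (rule sub(3))
    moreover have "(\<lambda>i. (s(x := 0)) i + s x * bv x i) = s" by (auto simp: bv_def)
    ultimately show ?case by simp
  qed
  show "s \<in> N" using *[of "{i. s i \<noteq> 0}" s] s by simp
qed

text \<open>The linear map on the free space whose values on the basis are given by \<open>f\<close>.\<close>

definition lin_ext :: "('k::field, 'm, 'x) module_scheme \<Rightarrow> ('i \<Rightarrow> 'm) \<Rightarrow> ('i \<Rightarrow> 'k) \<Rightarrow> 'm" where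
  "lin_ext M f s = (\<Oplus>\<^bsub>M\<^esub>i\<in>{i. s i \<noteq> 0}. s i \<odot>\<^bsub>M\<^esub> f i)"

lemma lin_ext_superset:
  assumes "module kring M" "finite J" "{i. s i \<noteq> 0} \<subseteq> J" "f \<in> J \<rightarrow> carrier M"
  shows "lin_ext M f s = (\<Oplus>\<^bsub>M\<^esub>i\<in>J. s i \<odot>\<^bsub>M\<^esub> f i)"
proof -
  interpret M: module kring M by fact
  show ?thesis
    unfolding lin_ext_def
    by (rule M.M.add.finprod_mono_neutral_cong_left[of J "{i. s i \<noteq> 0}", folded finsum_def])
      (use assms module_kring_simps(1,5)[OF assms(1)] in \<open>auto simp: Pi_iff\<close>)
qed

lemma lin_ext_lin_maps:
  fixes M :: "('k::field, 'm, 'x) module_scheme" and f :: "'i \<Rightarrow> 'm"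
  assumes "module kring M" "f \<in> I \<rightarrow> carrier M"
  shows "lin_ext M f \<in> lin_maps (free_space I) M"
proof (rule lin_mapsI)
  interpret M: module kring M by fact
  note ms = module_kring_simps[OF assms(1)]
  fix s :: "'i \<Rightarrow> 'k" assume "s \<in> carrier (free_space I)"
  then have s: "finite {i. s i \<noteq> 0}" "{i. s i \<noteq> 0} \<subseteq> I" by auto
  then have fs: "f \<in> {i. s i \<noteq> 0} \<rightarrow> carrier M" using assms(2) by auto
  show cl: "lin_ext M f s \<in> carrier M"
    unfolding lin_ext_def by (rule M.M.finsum_closed) (use fs ms in \<open>auto simp: Pi_iff\<close>)
  have "lin_ext M f (\<lambda>i. c * s i) = (\<Oplus>\<^bsub>M\<^esub>i\<in>{i. s i \<noteq> 0}. (c * s i) \<odot>\<^bsub>M\<^esub> f i)" for c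
    by (rule lin_ext_superset[OF assms(1) s(1) _ fs]) auto
  also have "\<dots> c = (\<Oplus>\<^bsub>M\<^esub>i\<in>{i. s i \<noteq> 0}. c \<odot>\<^bsub>M\<^esub> (s i \<odot>\<^bsub>M\<^esub> f i))" for c
    by (rule M.M.finsum_cong') (use fs ms in \<open>auto simp: Pi_iff\<close>)
  also have "\<dots> c = c \<odot>\<^bsub>M\<^esub> lin_ext M f s" for c
    unfolding lin_ext_def by (rule M.finsum_smult_ldistr[symmetric]) (use s fs ms in \<open>auto simp: Pi_iff\<close>)
  finally show "lin_ext M f (c \<odot>\<^bsub>free_space I\<^esub> s) = c \<odot>\<^bsub>M\<^esub> lin_ext M f s" for c by simp
  fix t :: "'i \<Rightarrow> 'k" assume "t \<in> carrier (free_space I)"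
  then have t: "finite {i. t i \<noteq> 0}" "{i. t i \<noteq> 0} \<subseteq> I" by auto
  let ?J = "{i. s i \<noteq> 0} \<union> {i. t i \<noteq> 0}"
  have J: "finite ?J" "f \<in> ?J \<rightarrow> carrier M" using s t assms(2) by auto
  have "lin_ext M f (\<lambda>i. s i + t i) = (\<Oplus>\<^bsub>M\<^esub>i\<in>?J. (s i + t i) \<odot>\<^bsub>M\<^esub> f i)"
    by (rule lin_ext_superset[OF assms(1) J(1) _ J(2)]) auto
  also have "\<dots> = (\<Oplus>\<^bsub>M\<^esub>i\<in>?J. s i \<odot>\<^bsub>M\<^esub> f i \<oplus>\<^bsub>M\<^esub> t i \<odot>\<^bsub>M\<^esub> f i)"
    by (rule M.M.finsum_cong') (use J ms in \<open>auto simp: Pi_iff\<close>)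
  also have "\<dots> = (\<Oplus>\<^bsub>M\<^esub>i\<in>?J. s i \<odot>\<^bsub>M\<^esub> f i) \<oplus>\<^bsub>M\<^esub> (\<Oplus>\<^bsub>M\<^esub>i\<in>?J. t i \<odot>\<^bsub>M\<^esub> f i)"
    by (rule M.M.finsum_addf) (use J ms in \<open>auto simp: Pi_iff\<close>)
  also have "(\<Oplus>\<^bsub>M\<^esub>i\<in>?J. s i \<odot>\<^bsub>M\<^esub> f i) = lin_ext M f s"
    by (rule lin_ext_superset[OF assms(1) J(1) _ J(2), symmetric]) auto
  also have "(\<Oplus>\<^bsub>M\<^esub>i\<in>?J. t i \<odot>\<^bsub>M\<^esub> f i) = lin_ext M f t"
    by (rule lin_ext_superset[OF assms(1) J(1) _ J(2), symmetric]) auto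
  finally show "lin_ext M f (s \<oplus>\<^bsub>free_space I\<^esub> t) = lin_ext M f s \<oplus>\<^bsub>M\<^esub> lin_ext M f t" by simp
qed

lemma lin_ext_bv:
  assumes "module kring M" "f i \<in> carrier M"
  shows "lin_ext M f (bv i) = f i"
proof -
  interpret M: module kring M by fact
  have "lin_ext M f (bv i) = (\<Oplus>\<^bsub>M\<^esub>j\<in>{i}. bv i j \<odot>\<^bsub>M\<^esub> f j)"
    by (rule lin_ext_superset) (use assms in \<open>auto simp: bv_def\<close>)
  then show ?thesis using assms module_kring_simps(4)[OF assms] by (simp add: bv_def)
qed

lemma lin_ext_finite:
  assumes "module kring M" "finite I" "f \<in> I \<rightarrow> carrier M" "s \<in> carrier (free_space I)"
  shows "(\<Oplus>\<^bsub>M\<^esub>i\<in>I. s i \<odot>\<^bsub>M\<^esub> f i) = lin_ext M f s"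
  by (rule lin_ext_superset[symmetric]) (use assms in auto)

lemma lin_by_cong:
  assumes "\<And>i. i \<in> I \<Longrightarrow> f i = f' i"
  shows "lin_by M N I gen f = lin_by M N I gen f'"
proof -
  have "(\<forall>i\<in>I. T (gen i) = f i) \<longleftrightarrow> (\<forall>i\<in>I. T (gen i) = f' i)" for T using assms by simp
  then show ?thesis unfolding lin_by_def by simp
qed

text \<open>\<open>lin_by\<close> is a definite description; it has the intended value as soon as the generators span and
  some linear map \<open>T\<close> takes the prescribed values.\<close>

lemma lin_by_unique:
  assumes "module kring M" "module kring N" "spanning M (gen ` I)"
    "T \<in> lin_maps M N" "\<And>i. i \<in> I \<Longrightarrow> T (gen i) = f i"
  shows "lin_by M N I gen f = restrict T (carrier M)"
  unfolding lin_by_def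
proof (rule the_equality)
  have "gen i \<in> carrier M" if "i \<in> I" for i
    using spanning_subset[OF assms(3)] that by auto
  then show "restrict T (carrier M) \<in> lin_maps M N \<and> restrict T (carrier M) \<in> extensional (carrier M) \<and>
      (\<forall>i\<in>I. restrict T (carrier M) (gen i) = f i)"
    using assms(5) lin_maps_cong[OF assms(4,1), of "restrict T (carrier M)"] by simp
next
  fix S assume S: "S \<in> lin_maps M N \<and> S \<in> extensional (carrier M) \<and> (\<forall>i\<in>I. S (gen i) = f i)"
  have "S m = T m" if "m \<in> carrier M" for m
    by (rule lin_maps_eq_on_spanning[OF _ assms(4,1,2,3) _ that]) (use S assms(5) in auto)
  then show "S = restrict T (carrier M)"
    using S by (auto simp: restrict_def extensional_def)
qed

subsection \<open>Tensor products\<close>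

text \<open>Maps that are linear in each of the two arguments, as curried functions; only their values on the
  carriers matter.\<close>

definition bilin :: "('k::field, 'm, 'x) module_scheme \<Rightarrow> ('k, 'n, 'y) module_scheme \<Rightarrow>
    ('k, 'p, 'z) module_scheme \<Rightarrow> ('m \<Rightarrow> 'n \<Rightarrow> 'p) \<Rightarrow> bool" where
  "bilin M N P f \<longleftrightarrow> (\<forall>m\<in>carrier M. f m \<in> lin_maps N P) \<and>
     (\<forall>n\<in>carrier N. (\<lambda>m. f m n) \<in> lin_maps M P)"

lemma bilinD:
  assumes "bilin M N P f"
  shows "m \<in> carrier M \<Longrightarrow> f m \<in> lin_maps N P" "n \<in> carrier N \<Longrightarrow> (\<lambda>m. f m n) \<in> lin_maps M P"
    "m \<in> carrier M \<Longrightarrow> n \<in> carrier N \<Longrightarrow> f m n \<in> carrier P"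
  using assms by (auto simp: bilin_def lin_mapsD)

lemma tensor_rels_cases:
  assumes "x \<in> tensor_rels M N"
  obtains (add_left) m m' n where "m \<in> carrier M" "m' \<in> carrier M" "n \<in> carrier N"
        "x = (\<lambda>p. bv (m \<oplus>\<^bsub>M\<^esub> m', n) p - bv (m, n) p - bv (m', n) p)"
      | (add_right) m n n' where "m \<in> carrier M" "n \<in> carrier N" "n' \<in> carrier N"
        "x = (\<lambda>p. bv (m, n \<oplus>\<^bsub>N\<^esub> n') p - bv (m, n) p - bv (m, n') p)"
      | (smult_left) c m n where "m \<in> carrier M" "n \<in> carrier N"
        "x = (\<lambda>p. bv (c \<odot>\<^bsub>M\<^esub> m, n) p - c * bv (m, n) p)"
      | (smult_right) c m n where "m \<in> carrier M" "n \<in> carrier N"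
        "x = (\<lambda>p. bv (m, c \<odot>\<^bsub>N\<^esub> n) p - c * bv (m, n) p)"
  using assms unfolding tensor_rels_def
  apply (elim UnE CollectE exE conjE)
     apply (rule that(1); assumption)
    apply (rule that(2); assumption)
   apply (rule that(3); assumption)
  apply (rule that(4); assumption)
  done

lemma tensor_relsI:
  "m \<in> carrier M \<Longrightarrow> m' \<in> carrier M \<Longrightarrow> n \<in> carrier N \<Longrightarrow>
    (\<lambda>p. bv (m \<oplus>\<^bsub>M\<^esub> m', n) p - bv (m, n) p - bv (m', n) p) \<in> tensor_rels M N"
  "m \<in> carrier M \<Longrightarrow> n \<in> carrier N \<Longrightarrow> n' \<in> carrier N \<Longrightarrow>
    (\<lambda>p. bv (m, n \<oplus>\<^bsub>N\<^esub> n') p - bv (m, n) p - bv (m, n') p) \<in> tensor_rels M N"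
  "m \<in> carrier M \<Longrightarrow> n \<in> carrier N \<Longrightarrow>
    (\<lambda>p. bv (c \<odot>\<^bsub>M\<^esub> m, n) p - c * bv (m, n) p) \<in> tensor_rels M N"
  "m \<in> carrier M \<Longrightarrow> n \<in> carrier N \<Longrightarrow>
    (\<lambda>p. bv (m, c \<odot>\<^bsub>N\<^esub> n) p - c * bv (m, n) p) \<in> tensor_rels M N"
  unfolding tensor_rels_def
     apply (intro UnI1 CollectI exI conjI; (rule refl | assumption))
    apply (rule UnI1, rule UnI1, rule UnI2, intro CollectI exI conjI; (rule refl | assumption))
   apply (rule UnI1, rule UnI2, intro CollectI exI conjI; (rule refl | assumption))
  apply (rule UnI2, intro CollectI exI conjI; (rule refl | assumption))
  done

lemma tensor_rels_carrier:
  fixes M :: "('k::field, 'm, 'x) module_scheme" and N :: "('k, 'n, 'y) module_scheme"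
  assumes "module kring M" "module kring N"
  shows "tensor_rels M N \<subseteq> carrier (free_space (carrier M \<times> carrier N))"
proof -
  interpret M: module kring M by fact
  interpret N: module kring N by fact
  have 1: "(\<lambda>p. bv a p - bv b p - bv c p) \<in> carrier (free_space I)"
    if "a \<in> I" "b \<in> I" "c \<in> I" for a b c :: "'m \<times> 'n" and I
    using that by (auto simp: bv_def intro: finite_subset[of _ "{a,b,c}"])
  have 2: "(\<lambda>p. bv a p - c * bv b p) \<in> carrier (free_space I)"
    if "a \<in> I" "b \<in> I" for a b :: "'m \<times> 'n" and c I
    using that by (auto simp: bv_def intro: finite_subset[of _ "{a,b}"])
  show ?thesis
  proof
    fix x assume "x \<in> tensor_rels M N"
    then show "x \<in> carrier (free_space (carrier M \<times> carrier N))"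
    proof (cases rule: tensor_rels_cases)
      case add_left
      then show ?thesis by (simp only: add_left(4)) (intro 1 SigmaI M.M.a_closed; assumption)
    next
      case add_right
      then show ?thesis by (simp only: add_right(4)) (intro 1 SigmaI N.M.a_closed; assumption)
    next
      case smult_left
      then show ?thesis
        by (simp only: smult_left(3)) (intro 2 SigmaI module_kring_simps(1)[OF assms(1)]; assumption)
    next
      case smult_right
      then show ?thesis
        by (simp only: smult_right(3)) (intro 2 SigmaI module_kring_simps(1)[OF assms(2)]; assumption)
    qed
  qed
qed

context
  fixes M :: "('k::field, 'm, 'x) module_scheme" and N :: "('k, 'n, 'y) module_scheme"
  assumes M: "module kring M" and N: "module kring N"
begin

lemma submodule_tensor_null:
  "submodule (tensor_null M N) kring (free_space (carrier M \<times> carrier N))"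
  unfolding tensor_null_def
  by (rule subspace_gen_submodule[OF module_free_space tensor_rels_carrier[OF M N]])

lemma module_tensor_space: "module kring (tensor_space M N)"
  unfolding tensor_space_def
  by (rule quot_space_facts(1)[OF module_free_space submodule_tensor_null])

text \<open>A relation of the tensor product identifies two classes.\<close>

lemma tens_class_eq:
  assumes "s \<in> carrier (free_space (carrier M \<times> carrier N))"
    "t \<in> carrier (free_space (carrier M \<times> carrier N))"
    "(\<lambda>p. s p - t p) \<in> tensor_rels M N"
  shows "tensor_null M N +>\<^bsub>free_space (carrier M \<times> carrier N)\<^esub> s =
    tensor_null M N +>\<^bsub>free_space (carrier M \<times> carrier N)\<^esub> t"
proof -
  let ?F = "free_space (carrier M \<times> carrier N) :: ('k, 'm \<times> 'n \<Rightarrow> 'k) module"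
  interpret T: module kring "tensor_space M N" by (rule module_tensor_space)
  note Q = quot_space_facts[OF module_free_space submodule_tensor_null, folded tensor_space_def]
  note L = lin_mapsD[OF Q(2)]
  have d: "(\<lambda>p. s p - t p) \<in> tensor_null M N"
    unfolding tensor_null_def by (rule subsetD[OF subspace_gen_incl assms(3)])
  have dc: "(\<lambda>p. s p - t p) \<in> carrier ?F"
    by (rule subsetD[OF tensor_rels_carrier[OF M N] assms(3)])
  have "tensor_null M N +>\<^bsub>?F\<^esub> (\<lambda>p. (s p - t p) + t p) =
    (tensor_null M N +>\<^bsub>?F\<^esub> (\<lambda>p. s p - t p)) \<oplus>\<^bsub>tensor_space M N\<^esub> (tensor_null M N +>\<^bsub>?F\<^esub> t)"
    using L(2)[OF dc assms(2)] by simp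
  also have "tensor_null M N +>\<^bsub>?F\<^esub> (\<lambda>p. s p - t p) = \<zero>\<^bsub>tensor_space M N\<^esub>"
    using quot_space_zero[OF module_free_space submodule_tensor_null d] by (simp add: tensor_space_def)
  finally show ?thesis using L(1)[OF assms(2)] by simp
qed

lemma bilin_tens: "bilin M N (tensor_space M N) (tens M N)"
proof -
  interpret F: module kring "free_space (carrier M \<times> carrier N) :: ('k, 'm \<times> 'n \<Rightarrow> 'k) module"
    by (rule module_free_space)
  interpret M: module kring M by (rule M)
  interpret N: module kring N by (rule N)
  let ?F = "free_space (carrier M \<times> carrier N) :: ('k, 'm \<times> 'n \<Rightarrow> 'k) module"
  note Q = quot_space_facts[OF module_free_space submodule_tensor_null, folded tensor_space_def]
  note L = lin_mapsD[OF Q(2)]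
  have cl: "bv (m, n) \<in> carrier ?F" if "m \<in> carrier M" "n \<in> carrier N" for m n
    by (rule bv_in_free_space) (use that in auto)
  have add: "(\<lambda>p. s p + t p) \<in> carrier ?F" if "s \<in> carrier ?F" "t \<in> carrier ?F" for s t
    using F.M.a_closed[OF that] by simp
  have sm: "(\<lambda>p. c * s p) \<in> carrier ?F" if "s \<in> carrier ?F" for s c
    using module_kring_simps(1)[OF module_free_space that] by simp
  have T_add: "tens M N m n \<oplus>\<^bsub>tensor_space M N\<^esub> tens M N m' n' =
      tensor_null M N +>\<^bsub>?F\<^esub> (\<lambda>p. bv (m, n) p + bv (m', n') p)"
    if "m \<in> carrier M" "n \<in> carrier N" "m' \<in> carrier M" "n' \<in> carrier N" for m n m' n'
    unfolding tens_def using L(2)[OF cl cl] that by simp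
  have T_sm: "c \<odot>\<^bsub>tensor_space M N\<^esub> tens M N m n = tensor_null M N +>\<^bsub>?F\<^esub> (\<lambda>p. c * bv (m, n) p)"
    if "m \<in> carrier M" "n \<in> carrier N" for m n c
    unfolding tens_def using L(3)[OF cl] that by simp
  have T_cl: "tens M N m n \<in> carrier (tensor_space M N)" if "m \<in> carrier M" "n \<in> carrier N" for m n
    unfolding tens_def by (rule L(1)[OF cl[OF that]])
  have "tens M N m \<in> lin_maps N (tensor_space M N)" if m: "m \<in> carrier M" for m
  proof (rule lin_mapsI)
    fix n n' assume n: "n \<in> carrier N" "n' \<in> carrier N"
    have "(\<lambda>p. bv (m, n \<oplus>\<^bsub>N\<^esub> n') p - (bv (m, n) p + bv (m, n') p) :: 'k) \<in> tensor_rels M N"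
      using tensor_relsI(2)[OF m n] by (simp add: diff_diff_eq)
    then show "tens M N m (n \<oplus>\<^bsub>N\<^esub> n') = tens M N m n \<oplus>\<^bsub>tensor_space M N\<^esub> tens M N m n'"
      unfolding T_add[OF m n(1) m n(2)] unfolding tens_def
      by (intro tens_class_eq add cl) (use m n in auto)
  next
    fix n c assume n: "n \<in> carrier N"
    have "(\<lambda>p. bv (m, c \<odot>\<^bsub>N\<^esub> n) p - c * bv (m, n) p :: 'k) \<in> tensor_rels M N"
      by (rule tensor_relsI(4)[OF m n])
    then show "tens M N m (c \<odot>\<^bsub>N\<^esub> n) = c \<odot>\<^bsub>tensor_space M N\<^esub> tens M N m n"
      unfolding T_sm[OF m n(1)] unfolding tens_def
      by (intro tens_class_eq sm cl) (use m n module_kring_simps(1)[OF N] in auto)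
  qed (rule T_cl[OF m])
  moreover have "(\<lambda>m. tens M N m n) \<in> lin_maps M (tensor_space M N)" if n: "n \<in> carrier N" for n
  proof (rule lin_mapsI)
    fix m m' assume m: "m \<in> carrier M" "m' \<in> carrier M"
    have "(\<lambda>p. bv (m \<oplus>\<^bsub>M\<^esub> m', n) p - (bv (m, n) p + bv (m', n) p) :: 'k) \<in> tensor_rels M N"
      using tensor_relsI(1)[OF m n] by (simp add: diff_diff_eq)
    then show "tens M N (m \<oplus>\<^bsub>M\<^esub> m') n = tens M N m n \<oplus>\<^bsub>tensor_space M N\<^esub> tens M N m' n"
      unfolding T_add[OF m(1) n m(2) n] unfolding tens_def
      by (intro tens_class_eq add cl) (use m n in auto)
  next
    fix m c assume m: "m \<in> carrier M"
    have "(\<lambda>p. bv (c \<odot>\<^bsub>M\<^esub> m, n) p - c * bv (m, n) p :: 'k) \<in> tensor_rels M N"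
      by (rule tensor_relsI(3)[OF m n])
    then show "tens M N (c \<odot>\<^bsub>M\<^esub> m) n = c \<odot>\<^bsub>tensor_space M N\<^esub> tens M N m n"
      unfolding T_sm[OF m n(1)] unfolding tens_def
      by (intro tens_class_eq sm cl) (use m n module_kring_simps(1)[OF M] in auto)
  qed (rule T_cl[OF _ n])
  ultimately show ?thesis unfolding bilin_def by simp
qed

lemma tens_closed: "m \<in> carrier M \<Longrightarrow> n \<in> carrier N \<Longrightarrow> tens M N m n \<in> carrier (tensor_space M N)"
  by (rule bilinD(3)[OF bilin_tens])

lemma spanning_tensor_space:
  "spanning (tensor_space M N) ((\<lambda>(m, n). tens M N m n) ` (carrier M \<times> carrier N))"
proof -
  note Q = quot_space_facts[OF module_free_space submodule_tensor_null, folded tensor_space_def]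
  have "(\<lambda>(m, n). tens M N m n) ` (carrier M \<times> carrier N) =
    (\<lambda>x. tensor_null M N +>\<^bsub>free_space (carrier M \<times> carrier N)\<^esub> x) ` bv ` (carrier M \<times> carrier N)"
    by (simp add: image_image tens_def case_prod_unfold)
  then show ?thesis
    using spanning_image[OF spanning_free_space Q(2,3) module_free_space Q(1)] by simp
qed

text \<open>It suffices to let the first factor run through a spanning set.\<close>

lemma spanning_tensor_left:
  assumes S: "spanning M S"
  shows "spanning (tensor_space M N) ((\<lambda>(m, n). tens M N m n) ` (S \<times> carrier N))"
  unfolding spanning_def
proof (intro conjI allI impI)
  show "(\<lambda>(m, n). tens M N m n) ` (S \<times> carrier N) \<subseteq> carrier (tensor_space M N)"
    using spanning_subset[OF S] tens_closed by auto
next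
  fix K assume K: "submodule K kring (tensor_space M N)" "(\<lambda>(m, n). tens M N m n) ` (S \<times> carrier N) \<subseteq> K"
  have "carrier M \<subseteq> {m \<in> carrier M. tens M N m n \<in> K}" if n: "n \<in> carrier N" for n
    by (rule spanningD[OF S submodule_vimage[OF bilinD(2)[OF bilin_tens n] M module_tensor_space K(1)]])
      (use spanning_subset[OF S] K(2) n in auto)
  then have "(\<lambda>(m, n). tens M N m n) ` (carrier M \<times> carrier N) \<subseteq> K" by auto
  then show "carrier (tensor_space M N) \<subseteq> K" by (rule spanningD[OF spanning_tensor_space K(1)])
qed

lemma tensor_space_ext:
  assumes "module kring P" "f \<in> lin_maps (tensor_space M N) P" "g \<in> lin_maps (tensor_space M N) P"
    "\<And>m n. m \<in> carrier M \<Longrightarrow> n \<in> carrier N \<Longrightarrow> f (tens M N m n) = g (tens M N m n)"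
    "t \<in> carrier (tensor_space M N)"
  shows "f t = g t"
  by (rule lin_maps_eq_on_spanning[OF assms(2,3) module_tensor_space assms(1) spanning_tensor_space _ assms(5)])
    (use assms(4) in auto)

text \<open>Universal property of the tensor product: the linear extension of \<open>f\<close> to the free space kills
  the four families of relations.\<close>

lemma tensor_space_lift:
  assumes P: "module kring P" and f: "bilin M N P f"
  shows "\<exists>T \<in> lin_maps (tensor_space M N) P.
    \<forall>m\<in>carrier M. \<forall>n\<in>carrier N. T (tens M N m n) = f m n"
proof -
  interpret P: module kring P by fact
  interpret M: module kring M by (rule M)
  interpret N: module kring N by (rule N)
  let ?F = "free_space (carrier M \<times> carrier N) :: ('k, 'm \<times> 'n \<Rightarrow> 'k) module"
  let ?g = "lin_ext P (\<lambda>(m, n). f m n)"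
  note fc = bilinD(3)[OF f] and fl = lin_mapsD[OF bilinD(1)[OF f]] and fr = lin_mapsD[OF bilinD(2)[OF f]]
  have g: "?g \<in> lin_maps ?F P"
    by (rule lin_ext_lin_maps[OF P]) (use fc in auto)
  note gl = lin_mapsD[OF g]
  have gb: "?g (bv (m, n)) = f m n" if "m \<in> carrier M" "n \<in> carrier N" for m n
    using lin_ext_bv[OF P, of "\<lambda>(m, n). f m n" "(m, n)"] fc that by simp
  have cl: "bv (m, n) \<in> carrier ?F" if "m \<in> carrier M" "n \<in> carrier N" for m n
    by (rule bv_in_free_space) (use that in auto)
  interpret F: module kring ?F by (rule module_free_space)
  have sub: "?g (\<lambda>p. s p - t p) = \<zero>\<^bsub>P\<^esub>" if "s \<in> carrier ?F" "t \<in> carrier ?F" "?g s = ?g t" for s t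
  proof -
    have m: "(\<lambda>p. (-1) * t p) \<in> carrier ?F" "?g (\<lambda>p. (-1) * t p) = (-1) \<odot>\<^bsub>P\<^esub> ?g t"
      using module_kring_simps(1)[OF module_free_space that(2), of "-1"] gl(3)[OF that(2), of "-1"] by simp_all
    have "?g (\<lambda>p. s p + (-1) * t p) = ?g s \<oplus>\<^bsub>P\<^esub> ?g (\<lambda>p. (-1) * t p)"
      using gl(2)[OF that(1) m(1)] by simp
    also have "\<dots> = \<zero>\<^bsub>P\<^esub>"
      using that gl(1)[OF that(2)] by (simp only: m(2) module_kring_simps(7)[OF P] P.M.r_neg)
    finally show ?thesis by simp
  qed
  have add: "(\<lambda>p. s p + t p) \<in> carrier ?F" if "s \<in> carrier ?F" "t \<in> carrier ?F" for s t
    using F.M.a_closed[OF that] by simp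
  have sm: "(\<lambda>p. c * s p) \<in> carrier ?F" if "s \<in> carrier ?F" for s c
    using module_kring_simps(1)[OF module_free_space that] by simp
  have rels: "?g x = \<zero>\<^bsub>P\<^esub>" if "x \<in> tensor_rels M N" for x
  proof -
    from that show ?thesis
    proof (cases rule: tensor_rels_cases)
      case (add_left m m' n)
      have "?g (\<lambda>p. bv (m \<oplus>\<^bsub>M\<^esub> m', n) p - (bv (m, n) p + bv (m', n) p)) = \<zero>\<^bsub>P\<^esub>"
        using add_left gl(2)[OF cl cl, of m n m' n] by (intro sub cl add) (simp_all add: gb fr)
      then show ?thesis using add_left by (simp add: algebra_simps)
    next
      case (add_right m n n')
      have "?g (\<lambda>p. bv (m, n \<oplus>\<^bsub>N\<^esub> n') p - (bv (m, n) p + bv (m, n') p)) = \<zero>\<^bsub>P\<^esub>"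
        using add_right gl(2)[OF cl cl, of m n m n'] by (intro sub cl add) (simp_all add: gb fl)
      then show ?thesis using add_right by (simp add: algebra_simps)
    next
      case (smult_left c m n)
      have "?g (\<lambda>p. bv (c \<odot>\<^bsub>M\<^esub> m, n) p - c * bv (m, n) p) = \<zero>\<^bsub>P\<^esub>"
        using smult_left gl(3)[OF cl, of m n c] module_kring_simps(1)[OF M, of m c]
        by (intro sub cl sm) (simp_all add: gb fr)
      then show ?thesis using smult_left by simp
    next
      case (smult_right c m n)
      have "?g (\<lambda>p. bv (m, c \<odot>\<^bsub>N\<^esub> n) p - c * bv (m, n) p) = \<zero>\<^bsub>P\<^esub>"
        using smult_right gl(3)[OF cl, of m n c] module_kring_simps(1)[OF N, of n c]
        by (intro sub cl sm) (simp_all add: gb fl)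
      then show ?thesis using smult_right by simp
    qed
  qed
  have "?g x = \<zero>\<^bsub>P\<^esub>" if "x \<in> tensor_null M N" for x
    by (rule lin_maps_vanish_subspace_gen[OF module_free_space P tensor_rels_carrier[OF M N] g])
      (use rels that in \<open>auto simp: tensor_null_def\<close>)
  from quot_space_factor[OF module_free_space submodule_tensor_null P g this]
  obtain T where T: "T \<in> lin_maps (tensor_space M N) P"
    "\<forall>x\<in>carrier ?F. T (tensor_null M N +>\<^bsub>?F\<^esub> x) = ?g x"
    unfolding tensor_space_def by auto
  have "T (tens M N m n) = f m n" if "m \<in> carrier M" "n \<in> carrier N" for m n
    unfolding tens_def using T(2) cl[OF that] gb[OF that] by auto
  then show ?thesis using T(1) by auto
qed

lemma lin_by_tensor:
  assumes P: "module kring P" and f: "bilin M N P f"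
  defines "T \<equiv> lin_by (tensor_space M N) P (carrier M \<times> carrier N) (\<lambda>(m, n). tens M N m n) (\<lambda>(m, n). f m n)"
  shows "T \<in> lin_maps (tensor_space M N) P"
    and "\<And>m n. m \<in> carrier M \<Longrightarrow> n \<in> carrier N \<Longrightarrow> T (tens M N m n) = f m n"
proof -
  obtain S where S: "S \<in> lin_maps (tensor_space M N) P"
    "\<forall>m\<in>carrier M. \<forall>n\<in>carrier N. S (tens M N m n) = f m n"
    using tensor_space_lift[OF P f] by auto
  have T: "T = restrict S (carrier (tensor_space M N))"
    unfolding T_def
    by (rule lin_by_unique[OF module_tensor_space P spanning_tensor_space S(1)]) (use S in auto)
  show "T \<in> lin_maps (tensor_space M N) P"
    by (rule lin_maps_cong[OF S(1) module_tensor_space]) (simp add: T)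
  show "T (tens M N m n) = f m n" if "m \<in> carrier M" "n \<in> carrier N" for m n
    using S(2) that tens_closed[OF that] by (simp add: T)
qed

end

lemma bilinI:
  assumes "\<And>m. m \<in> carrier M \<Longrightarrow> f m \<in> lin_maps N P"
    "\<And>n. n \<in> carrier N \<Longrightarrow> (\<lambda>m. f m n) \<in> lin_maps M P"
  shows "bilin M N P f"
  using assms by (simp add: bilin_def)

lemma bilin_comp:
  assumes "bilin M' N' P f" "g \<in> lin_maps M M'" "h \<in> lin_maps N N'"
  shows "bilin M N P (\<lambda>m n. f (g m) (h n))"
proof (rule bilinI)
  fix m assume "m \<in> carrier M"
  then show "(\<lambda>n. f (g m) (h n)) \<in> lin_maps N P"
    by (intro lin_maps_comp[OF assms(3) bilinD(1)[OF assms(1)]] lin_mapsD(1)[OF assms(2)])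
next
  fix n assume "n \<in> carrier N"
  then show "(\<lambda>m. f (g m) (h n)) \<in> lin_maps M P"
    by (intro lin_maps_comp[OF assms(2) bilinD(2)[OF assms(1)]] lin_mapsD(1)[OF assms(3)])
qed

lemma bilin_smult:
  assumes "bilin M N P f" "module kring M" "module kring N" "module kring P"
  shows "bilin M N P (\<lambda>m n. c \<odot>\<^bsub>P\<^esub> f m n)"
  by (intro bilinI lin_maps_smult assms(2-4) bilinD[OF assms(1)])

lemma bilin_finsum:
  assumes "\<And>i. i \<in> I \<Longrightarrow> bilin M N P (f i)" "module kring M" "module kring N" "module kring P"
  shows "bilin M N P (\<lambda>m n. \<Oplus>\<^bsub>P\<^esub>i\<in>I. f i m n)"
  by (intro bilinI lin_maps_finsum assms(2-4) bilinD[OF assms(1)])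

lemma tensor_map_facts:
  assumes "module kring M" "module kring N" "module kring M'" "module kring N'"
    "f \<in> lin_maps M M'" "g \<in> lin_maps N N'"
  shows "tensor_map M N M' N' f g \<in> lin_maps (tensor_space M N) (tensor_space M' N')"
    "m \<in> carrier M \<Longrightarrow> n \<in> carrier N \<Longrightarrow> tensor_map M N M' N' f g (tens M N m n) = tens M' N' (f m) (g n)"
proof -
  have b: "bilin M N (tensor_space M' N') (\<lambda>m n. tens M' N' (f m) (g n))"
    by (rule bilin_comp[OF bilin_tens[OF assms(3,4)] assms(5,6)])
  note L = lin_by_tensor[OF assms(1,2) module_tensor_space[OF assms(3,4)] b, folded tensor_map_def]
  show "tensor_map M N M' N' f g \<in> lin_maps (tensor_space M N) (tensor_space M' N')"
    "m \<in> carrier M \<Longrightarrow> n \<in> carrier N \<Longrightarrow> tensor_map M N M' N' f g (tens M N m n) = tens M' N' (f m) (g n)"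
    by (rule L; assumption)+
qed

lemma lin_maps_ident: "(\<lambda>x. x) \<in> lin_maps M M"
  by (rule lin_mapsI) simp_all

lemma tensor_map_ident:
  assumes "module kring M" "module kring N" "\<And>m. m \<in> carrier M \<Longrightarrow> f m = m" "\<And>n. n \<in> carrier N \<Longrightarrow> g n = n"
    "t \<in> carrier (tensor_space M N)"
  shows "tensor_map M N M N f g t = t"
proof -
  have f: "f \<in> lin_maps M M" by (rule lin_maps_cong[OF lin_maps_ident assms(1)]) (simp add: assms(3))
  have g: "g \<in> lin_maps N N" by (rule lin_maps_cong[OF lin_maps_ident assms(2)]) (simp add: assms(4))
  note F = tensor_map_facts[OF assms(1,2,1,2) f g]
  show ?thesis
    by (rule tensor_space_ext[OF assms(1,2) module_tensor_space[OF assms(1,2)] F(1) lin_maps_ident _ assms(5)])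
      (simp add: F(2) assms(3,4))
qed

text \<open>Three factors: the elements \<open>(m \<otimes> n) \<otimes> p\<close> span, and the associativity constraint exists.\<close>

context
  fixes M :: "('k::field, 'm, 'x) module_scheme" and N :: "('k, 'n, 'y) module_scheme"
    and P :: "('k, 'p, 'z) module_scheme"
  assumes M: "module kring M" and N: "module kring N" and P: "module kring P"
begin

lemma spanning_tensor3:
  "spanning (tensor_space (tensor_space M N) P)
    ((\<lambda>(m, n, p). tens (tensor_space M N) P (tens M N m n) p) ` (carrier M \<times> carrier N \<times> carrier P))"
proof -
  have "(\<lambda>(m, n, p). tens (tensor_space M N) P (tens M N m n) p) ` (carrier M \<times> carrier N \<times> carrier P) =
    (\<lambda>(t, p). tens (tensor_space M N) P t p) ` ((\<lambda>(m, n). tens M N m n) ` (carrier M \<times> carrier N) \<times> carrier P)"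
    by force
  then show ?thesis
    using spanning_tensor_left[OF module_tensor_space[OF M N] P spanning_tensor_space[OF M N]] by simp
qed

lemma assoc_exists:
  "\<exists>T \<in> lin_maps (tensor_space (tensor_space M N) P) (tensor_space M (tensor_space N P)).
     \<forall>m\<in>carrier M. \<forall>n\<in>carrier N. \<forall>p\<in>carrier P.
       T (tens (tensor_space M N) P (tens M N m n) p) = tens M (tensor_space N P) m (tens N P n p)"
proof -
  let ?Q = "tensor_space M (tensor_space N P)"
  have NP: "module kring (tensor_space N P)" and MN: "module kring (tensor_space M N)"
    by (rule module_tensor_space; rule M N P)+
  have Q: "module kring ?Q" by (rule module_tensor_space[OF M NP])
  have b1: "bilin M N ?Q (\<lambda>m n. tens M (tensor_space N P) m (tens N P n p))" if "p \<in> carrier P" for p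
    by (rule bilin_comp[OF bilin_tens[OF M NP] lin_maps_ident bilinD(2)[OF bilin_tens[OF N P] that]])
  define L where "L p = lin_by (tensor_space M N) ?Q (carrier M \<times> carrier N) (\<lambda>(m, n). tens M N m n)
    (\<lambda>(m, n). tens M (tensor_space N P) m (tens N P n p))" for p
  have L: "L p \<in> lin_maps (tensor_space M N) ?Q" if "p \<in> carrier P" for p
    unfolding L_def by (rule lin_by_tensor(1)[OF M N Q b1[OF that]])
  have Lt: "L p (tens M N m n) = tens M (tensor_space N P) m (tens N P n p)"
    if "p \<in> carrier P" "m \<in> carrier M" "n \<in> carrier N" for p m n
    unfolding L_def by (rule lin_by_tensor(2)[OF M N Q b1[OF that(1)] that(2,3)])
  have lin: "(\<lambda>p. tens M (tensor_space N P) m (tens N P n p)) \<in> lin_maps P ?Q"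
    if "m \<in> carrier M" "n \<in> carrier N" for m n
    by (rule lin_maps_comp[OF bilinD(1)[OF bilin_tens[OF N P] that(2)] bilinD(1)[OF bilin_tens[OF M NP] that(1)]])
  interpret P: module kring P by (rule P)
  have "bilin (tensor_space M N) P ?Q (\<lambda>t p. L p t)"
  proof (rule bilinI)
    fix t assume t: "t \<in> carrier (tensor_space M N)"
    show "(\<lambda>p. L p t) \<in> lin_maps P ?Q"
    proof (rule lin_mapsI)
      fix p assume p: "p \<in> carrier P"
      show "L p t \<in> carrier ?Q" by (rule lin_mapsD(1)[OF L[OF p] t])
      fix q assume q: "q \<in> carrier P"
      have pq: "p \<oplus>\<^bsub>P\<^esub> q \<in> carrier P" using p q by simp
      show "L (p \<oplus>\<^bsub>P\<^esub> q) t = L p t \<oplus>\<^bsub>?Q\<^esub> L q t"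
        by (rule tensor_space_ext[OF M N Q L[OF pq] lin_maps_add[OF L[OF p] L[OF q] MN Q] _ t])
          (simp only: Lt p q pq lin_mapsD(2)[OF lin])
    next
      fix c p assume p: "p \<in> carrier P"
      have cp: "c \<odot>\<^bsub>P\<^esub> p \<in> carrier P" by (rule module_kring_simps(1)[OF P p])
      show "L (c \<odot>\<^bsub>P\<^esub> p) t = c \<odot>\<^bsub>?Q\<^esub> L p t"
        by (rule tensor_space_ext[OF M N Q L[OF cp] lin_maps_smult[OF L[OF p] MN Q] _ t])
          (simp only: Lt p cp lin_mapsD(3)[OF lin])
    qed
  qed (rule L)
  from tensor_space_lift[OF MN P Q this] obtain T where
    "T \<in> lin_maps (tensor_space (tensor_space M N) P) ?Q"
    "\<forall>t\<in>carrier (tensor_space M N). \<forall>p\<in>carrier P. T (tens (tensor_space M N) P t p) = L p t"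
    by auto
  then show ?thesis using Lt tens_closed[OF M N] by (intro bexI[of _ T]) auto
qed

end

section \<open>Modules over a Hopf algebra\<close>

lemma with_act_simps [simp]:
  "carrier (with_act V a) = carrier V" "\<zero>\<^bsub>with_act V a\<^esub> = \<zero>\<^bsub>V\<^esub>"
  "x \<oplus>\<^bsub>with_act V a\<^esub> y = x \<oplus>\<^bsub>V\<^esub> y" "c \<odot>\<^bsub>with_act V a\<^esub> x = c \<odot>\<^bsub>V\<^esub> x" "act (with_act V a) = a"
  by (simp_all add: with_act_def)

lemma F_obj_simps [simp]:
  "carrier (F_obj G \<phi> M) = carrier M" "\<zero>\<^bsub>F_obj G \<phi> M\<^esub> = \<zero>\<^bsub>M\<^esub>"
  "x \<oplus>\<^bsub>F_obj G \<phi> M\<^esub> y = x \<oplus>\<^bsub>M\<^esub> y" "c \<odot>\<^bsub>F_obj G \<phi> M\<^esub> x = c \<odot>\<^bsub>M\<^esub> x"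
  "act (F_obj G \<phi> M) h = act M (dagger G \<phi> h)"
  by (simp_all add: F_obj_def)

lemma lin_maps_with_act [simp]:
  "lin_maps (with_act V a) P = lin_maps V P" "lin_maps P (with_act V a) = lin_maps P V"
  by (simp_all add: lin_maps_def)

lemma lin_maps_F_obj [simp]:
  "lin_maps (F_obj G \<phi> M) P = lin_maps M P" "lin_maps P (F_obj G \<phi> M) = lin_maps P M"
  by (simp_all add: lin_maps_def)

lemma tensor_null_with_act [simp]:
  "tensor_null (with_act V a) P = tensor_null V P" "tensor_null P (with_act V a) = tensor_null P V"
  by (simp_all add: tensor_null_def tensor_rels_def)

lemma tensor_null_F_obj [simp]:
  "tensor_null (F_obj G \<phi> M) P = tensor_null M P" "tensor_null P (F_obj G \<phi> M) = tensor_null P M"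
  by (simp_all add: tensor_null_def tensor_rels_def)

lemma tensor_space_with_act [simp]:
  "tensor_space (with_act V a) P = tensor_space V P" "tensor_space P (with_act V a) = tensor_space P V"
  "tens (with_act V a) P = tens V P" "tens P (with_act V a) = tens P V"
  by (simp_all add: tensor_space_def tens_def fun_eq_iff)

lemma tensor_space_F_obj [simp]:
  "tensor_space (F_obj G \<phi> M) P = tensor_space M P" "tensor_space P (F_obj G \<phi> M) = tensor_space P M"
  "tens (F_obj G \<phi> M) P = tens M P" "tens P (F_obj G \<phi> M) = tens P M"
  by (simp_all add: tensor_space_def tens_def fun_eq_iff)

lemma lin_by_with_act [simp]:
  "lin_by (with_act V a) P I gen f = lin_by V P I gen f"
  "lin_by P (with_act V a) I gen' f' = lin_by P V I gen' f'"
  by (simp_all add: lin_by_def)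

lemma lin_by_F_obj [simp]:
  "lin_by (F_obj G \<phi> M) P I gen f = lin_by M P I gen f"
  "lin_by P (F_obj G \<phi> M) I gen' f' = lin_by P M I gen' f'"
  by (simp_all add: lin_by_def)

lemma tensor_map_F_obj [simp]:
  "tensor_map (F_obj G \<phi> M) N M' N' f g = tensor_map M N M' N' f g"
  "tensor_map M (F_obj G \<phi> N) M' N' f g = tensor_map M N M' N' f g"
  "tensor_map M N (F_obj G \<phi> M') N' f g = tensor_map M N M' N' f g"
  "tensor_map M N M' (F_obj G \<phi> N') f g = tensor_map M N M' N' f g"
  by (simp_all add: tensor_map_def)

lemma tensor_map_with_act [simp]:
  "tensor_map (with_act M a) N M' N' f g = tensor_map M N M' N' f g"
  "tensor_map M (with_act N b) M' N' f g = tensor_map M N M' N' f g"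
  "tensor_map M N (with_act M' c) N' f g = tensor_map M N M' N' f g"
  "tensor_map M N M' (with_act N' d) f g = tensor_map M N M' N' f g"
  by (simp_all add: tensor_map_def)

lemma module_cong:
  fixes M :: "('k::field, 'm, 'x) module_scheme" and M' :: "('k, 'm, 'y) module_scheme"
  assumes "module kring M" "carrier M' = carrier M" "\<zero>\<^bsub>M'\<^esub> = \<zero>\<^bsub>M\<^esub>"
    "\<And>x y. x \<oplus>\<^bsub>M'\<^esub> y = x \<oplus>\<^bsub>M\<^esub> y" "\<And>c x. c \<odot>\<^bsub>M'\<^esub> x = c \<odot>\<^bsub>M\<^esub> x"
  shows "module kring M'"
proof -
  interpret M: module kring M by fact
  have "abelian_group M'"
    by (rule abelian_groupI)
      (use M.M.a_inv_closed M.M.l_neg in \<open>auto simp: assms(2-5) M.M.a_assoc intro: M.M.a_comm\<close>)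
  then show ?thesis
    by (rule module_kringI) (simp_all add: assms(2-5) module_kring_simps[OF assms(1)])
qed

lemma module_F_obj: "module kring M \<Longrightarrow> module kring (F_obj G \<phi> M)"
  by (rule module_cong) simp_all

lemma module_with_act: "module kring V \<Longrightarrow> module kring (with_act V a)"
  by (rule module_cong) simp_all

text \<open>A linear action of the underlying space of \<open>H\<close> for which \<open>1\<close> acts as the identity; for
  trivial tensor structures the multiplicativity of the action plays no role.\<close>

definition lin_action :: "('b, 'k::field) hopf \<Rightarrow> ('k, 'b \<Rightarrow> 'k, 'm) hmodule \<Rightarrow> bool" where
  "lin_action H M \<longleftrightarrow> module kring M \<and> (\<forall>h\<in>hcar H. act M h \<in> lin_maps M M) \<and>
     (\<forall>m\<in>carrier M. (\<lambda>h. act M h m) \<in> lin_maps (free_space (basis H)) M) \<and>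
     (\<forall>m\<in>carrier M. act M (hone H) m = m)"

lemma carrier_free_space_finite:
  assumes "finite I"
  shows "carrier (free_space I :: ('k::field, 'i \<Rightarrow> 'k) module) = {s. \<forall>i. i \<notin> I \<longrightarrow> s i = 0}"
proof -
  have "{i. s i \<noteq> 0} \<subseteq> I \<longleftrightarrow> (\<forall>i. i \<notin> I \<longrightarrow> s i = 0)" for s :: "'i \<Rightarrow> 'k" by auto
  moreover have "{i. s i \<noteq> 0} \<subseteq> I \<Longrightarrow> finite {i. s i \<noteq> 0}" for s :: "'i \<Rightarrow> 'k"
    by (rule finite_subset[OF _ assms])
  ultimately show ?thesis unfolding free_space_simps by auto
qed

lemma hcar_free_space: "finite (basis H) \<Longrightarrow> carrier (free_space (basis H)) = hcar H"
  by (simp only: carrier_free_space_finite hcar_def)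

lemma forms2_free_space: "finite (basis H) \<Longrightarrow> carrier (free_space (basis H \<times> basis H)) = forms2 H"
  by (simp only: carrier_free_space_finite finite_cartesian_product forms2_def)

lemma is_hmodule_lin_action:
  assumes "finite (basis H)" "is_hmodule H M"
  shows "lin_action H M"
proof -
  have "(\<lambda>h. act M h m) \<in> lin_maps (free_space (basis H)) M" if "m \<in> carrier M" for m
    by (rule lin_mapsI; unfold hcar_free_space[OF assms(1)])
      (use assms(2) that in \<open>auto simp: is_hmodule_def lin_mapsD\<close>)
  then show ?thesis using assms(2) unfolding is_hmodule_def lin_action_def by simp
qed

lemma lin_actionD:
  assumes "lin_action H M"
  shows "module kring M" "h \<in> hcar H \<Longrightarrow> act M h \<in> lin_maps M M"
    "m \<in> carrier M \<Longrightarrow> (\<lambda>h. act M h m) \<in> lin_maps (free_space (basis H)) M"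
    "m \<in> carrier M \<Longrightarrow> act M (hone H) m = m"
  using assms unfolding lin_action_def by auto

lemma bv_hcar: "x \<in> basis H \<Longrightarrow> bv x \<in> hcar H"
  by (auto simp: hcar_def bv_def)

lemma tensor_bv: "tensor (bv x) (bv y) = (bv (x, y) :: _ \<Rightarrow> 'k::field)"
  by (auto simp: tensor_def bv_def)

lemma tensor_forms2: "a \<in> hcar H \<Longrightarrow> b \<in> hcar H \<Longrightarrow> tensor a b \<in> forms2 H"
  by (auto simp: tensor_def forms2_def hcar_def)

context
  fixes H :: "('b, 'k::field) hopf" and M :: "('k, 'b \<Rightarrow> 'k, 'm) hmodule"
    and N :: "('k, 'b \<Rightarrow> 'k, 'n) hmodule"
  assumes fin: "finite (basis H)" and M: "lin_action H M" and N: "lin_action H N"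
begin

lemma bilin_act2: "bilin M N (tensor_space M N) (act2 H M N s)"
proof -
  note mM = lin_actionD(1)[OF M] and mN = lin_actionD(1)[OF N]
  have "bilin M N (tensor_space M N) (\<lambda>m n. \<Oplus>\<^bsub>tensor_space M N\<^esub>p\<in>basis H \<times> basis H.
      s p \<odot>\<^bsub>tensor_space M N\<^esub> tens M N (act M (bv (fst p)) m) (act N (bv (snd p)) n))"
    by (intro bilin_finsum bilin_smult bilin_comp[OF bilin_tens] mM mN module_tensor_space
        lin_actionD(2)[OF M] lin_actionD(2)[OF N] bv_hcar) auto
  then show ?thesis unfolding act2_def .
qed

lemma act2_lin:
  assumes "m \<in> carrier M" "n \<in> carrier N"
  shows "(\<lambda>s. act2 H M N s m n) \<in> lin_maps (free_space (basis H \<times> basis H)) (tensor_space M N)"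
    and "x \<in> basis H \<Longrightarrow> y \<in> basis H \<Longrightarrow>
      act2 H M N (bv (x, y)) m n = tens M N (act M (bv x) m) (act N (bv y) n)"
proof -
  note mM = lin_actionD(1)[OF M] and mN = lin_actionD(1)[OF N]
  note mT = module_tensor_space[OF mM mN]
  let ?f = "\<lambda>p. tens M N (act M (bv (fst p)) m) (act N (bv (snd p)) n)"
  have f: "?f \<in> basis H \<times> basis H \<rightarrow> carrier (tensor_space M N)"
    by (intro Pi_I tens_closed mM mN lin_mapsD(1)[OF lin_actionD(2)[OF M]]
        lin_mapsD(1)[OF lin_actionD(2)[OF N]] bv_hcar assms) auto
  have eq: "act2 H M N s m n = lin_ext (tensor_space M N) ?f s"
    if "s \<in> carrier (free_space (basis H \<times> basis H))" for s
    unfolding act2_def by (rule lin_ext_finite[OF mT _ f that]) (use fin in simp)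
  show "(\<lambda>s. act2 H M N s m n) \<in> lin_maps (free_space (basis H \<times> basis H)) (tensor_space M N)"
    by (rule lin_maps_cong[OF lin_ext_lin_maps[OF mT f] module_free_space]) (rule eq[symmetric])
  assume "x \<in> basis H" "y \<in> basis H"
  then show "act2 H M N (bv (x, y)) m n = tens M N (act M (bv x) m) (act N (bv y) n)"
    using eq[OF bv_in_free_space] lin_ext_bv[OF mT, of ?f "(x, y)"] f by (auto simp: Pi_iff)
qed

text \<open>Both sides are linear in \<open>a\<close> and in \<open>b\<close>, so that basis elements suffice.\<close>

lemma act2_tensor:
  assumes m: "m \<in> carrier M" and n: "n \<in> carrier N" and a: "a \<in> hcar H" and b: "b \<in> hcar H"
  shows "act2 H M N (tensor a b) m n = tens M N (act M a m) (act N b n)"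
proof -
  note mM = lin_actionD(1)[OF M] and mN = lin_actionD(1)[OF N]
  note mT = module_tensor_space[OF mM mN]
  let ?F = "free_space (basis H) :: ('k, 'b \<Rightarrow> 'k) module"
  note h = hcar_free_space[OF fin]
  have t1: "(\<lambda>a. tensor a b) \<in> lin_maps ?F (free_space (basis H \<times> basis H))" if "b \<in> hcar H" for b :: "'b \<Rightarrow> 'k"
    by (rule lin_mapsI; unfold h forms2_free_space[OF fin])
      (use that in \<open>auto simp: tensor_forms2, auto simp: tensor_def algebra_simps\<close>)
  have t2: "(\<lambda>b. tensor a b) \<in> lin_maps ?F (free_space (basis H \<times> basis H))" if "a \<in> hcar H" for a :: "'b \<Rightarrow> 'k"
    by (rule lin_mapsI; unfold h forms2_free_space[OF fin])
      (use that in \<open>auto simp: tensor_forms2, auto simp: tensor_def algebra_simps\<close>)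
  have u1: "(\<lambda>a. tens M N (act M a m) (act N b n)) \<in> lin_maps ?F (tensor_space M N)" if "b \<in> hcar H" for b
    by (rule lin_maps_comp[OF lin_actionD(3)[OF M m] bilinD(2)[OF bilin_tens[OF mM mN]]])
      (rule lin_mapsD(1)[OF lin_actionD(2)[OF N that] n])
  have u2: "(\<lambda>b. tens M N (act M a m) (act N b n)) \<in> lin_maps ?F (tensor_space M N)" if "a \<in> hcar H" for a
    by (rule lin_maps_comp[OF lin_actionD(3)[OF N n] bilinD(1)[OF bilin_tens[OF mM mN]]])
      (rule lin_mapsD(1)[OF lin_actionD(2)[OF M that] m])
  note A = act2_lin(1)[OF m n]
  show ?thesis
  proof (rule lin_maps_eq_on_spanning[OF lin_maps_comp[OF t1[OF b] A] u1[OF b] module_free_space mT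
        spanning_free_space _ a[folded h]])
    fix a :: "'b \<Rightarrow> 'k" assume "a \<in> bv ` basis H"
    then obtain x where x: "x \<in> basis H" "a = bv x" by auto
    then have a: "a \<in> hcar H" using bv_hcar by auto
    show "act2 H M N (tensor a b) m n = tens M N (act M a m) (act N b n)"
    proof (rule lin_maps_eq_on_spanning[OF lin_maps_comp[OF t2[OF a] A] u2[OF a] module_free_space mT
          spanning_free_space _ b[folded h]])
      fix b :: "'b \<Rightarrow> 'k" assume "b \<in> bv ` basis H"
      then obtain y where "y \<in> basis H" "b = bv y" by auto
      with x show "act2 H M N (tensor a b) m n = tens M N (act M a m) (act N b n)"
        using act2_lin(2)[OF m n] by (simp add: tensor_bv)
    qed
  qed
qed

text \<open>The description that defines the action on \<open>M \<otimes> N\<close> is met, because \<open>act2\<close> is bilinear.\<close>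

lemma hmod_tensor_act:
  "act (hmod_tensor H M N) h \<in> lin_maps (tensor_space M N) (tensor_space M N)"
  "m \<in> carrier M \<Longrightarrow> n \<in> carrier N \<Longrightarrow>
    act (hmod_tensor H M N) h (tens M N m n) = act2 H M N (comul H h) m n"
proof -
  note mM = lin_actionD(1)[OF M] and mN = lin_actionD(1)[OF N]
  note mT = module_tensor_space[OF mM mN]
  note L = lin_by_tensor[OF mM mN mT bilin_act2[of "comul H h"]]
  show "act (hmod_tensor H M N) h \<in> lin_maps (tensor_space M N) (tensor_space M N)"
    using L(1) by (simp add: hmod_tensor_def)
  show "m \<in> carrier M \<Longrightarrow> n \<in> carrier N \<Longrightarrow>
      act (hmod_tensor H M N) h (tens M N m n) = act2 H M N (comul H h) m n"
    using L(2) by (simp add: hmod_tensor_def)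
qed

lemma lin_action_hmod_tensor:
  assumes one: "hone H \<in> hcar H" "comul H (hone H) = tensor (hone H) (hone H)"
    and forms: "\<And>h. comul H h \<in> forms2 H"
  shows "lin_action H (hmod_tensor H M N)"
proof -
  note mM = lin_actionD(1)[OF M] and mN = lin_actionD(1)[OF N]
  note mT = module_tensor_space[OF mM mN]
  let ?T = "hmod_tensor H M N"
  have car: "carrier ?T = carrier (tensor_space M N)" by (simp add: hmod_tensor_def)
  have lm: "lin_maps ?T P = lin_maps (tensor_space M N) P" "lin_maps P ?T = lin_maps P (tensor_space M N)" for P
    by (simp_all add: hmod_tensor_def)
  have cc: "comul H h \<in> carrier (free_space (basis H \<times> basis H))" for h :: "'b \<Rightarrow> 'k"
    using forms by (simp only: forms2_free_space[OF fin])
  have c1: "comul H (\<lambda>x. h x + h' x) = (\<lambda>p. comul H h p + comul H h' p)" for h h' :: "'b \<Rightarrow> 'k"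
    by (simp add: comul_def algebra_simps sum.distrib)
  have c2: "comul H (\<lambda>x. c * h x) = (\<lambda>p. c * comul H h p)" for c and h :: "'b \<Rightarrow> 'k"
    by (simp add: comul_def sum_distrib_left mult.assoc)
  have "module kring ?T" unfolding hmod_tensor_def by (rule module_with_act[OF mT])
  moreover have "(\<lambda>h. act ?T h t) \<in> lin_maps (free_space (basis H)) (tensor_space M N)"
    if t: "t \<in> carrier (tensor_space M N)" for t
  proof (rule lin_mapsI)
    fix h show "act ?T h t \<in> carrier (tensor_space M N)"
      by (rule lin_mapsD(1)[OF hmod_tensor_act(1) t])
    fix h'
    have "act ?T (\<lambda>x. h x + h' x) t = act ?T h t \<oplus>\<^bsub>tensor_space M N\<^esub> act ?T h' t"
      by (rule tensor_space_ext[OF mM mN mT hmod_tensor_act(1)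
            lin_maps_add[OF hmod_tensor_act(1) hmod_tensor_act(1) mT mT] _ t])
        (use lin_mapsD(2)[OF act2_lin(1) cc cc] in \<open>simp add: hmod_tensor_act(2) c1\<close>)
    then show "act ?T (h \<oplus>\<^bsub>free_space (basis H)\<^esub> h') t = act ?T h t \<oplus>\<^bsub>tensor_space M N\<^esub> act ?T h' t" by simp
  next
    fix c h
    have "act ?T (\<lambda>x. c * h x) t = c \<odot>\<^bsub>tensor_space M N\<^esub> act ?T h t"
      by (rule tensor_space_ext[OF mM mN mT hmod_tensor_act(1)
            lin_maps_smult[OF hmod_tensor_act(1) mT mT] _ t])
        (use lin_mapsD(3)[OF act2_lin(1) cc] in \<open>simp add: hmod_tensor_act(2) c2\<close>)
    then show "act ?T (c \<odot>\<^bsub>free_space (basis H)\<^esub> h) t = c \<odot>\<^bsub>tensor_space M N\<^esub> act ?T h t" by simp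
  qed
  moreover have "act ?T (hone H) t = t" if t: "t \<in> carrier (tensor_space M N)" for t
    by (rule tensor_space_ext[OF mM mN mT hmod_tensor_act(1) lin_maps_ident _ t])
      (simp add: hmod_tensor_act(2) one act2_tensor lin_actionD(4)[OF M] lin_actionD(4)[OF N])
  ultimately show ?thesis
    unfolding lin_action_def lm car using hmod_tensor_act(1) by simp
qed

end

section \<open>The Drinfeld double in coordinates\<close>

text \<open>A finite group; the field stays polymorphic.\<close>

locale fin_group = group G for G (structure) +
  assumes fin: "finite (carrier G)"

lemma sum_of_bool_delta:
  fixes f :: "'a \<Rightarrow> 'k::field"
  assumes "finite A"
  shows "(\<Sum>x\<in>A. of_bool (x = a) * f x) = of_bool (a \<in> A) * f a"
    "(\<Sum>x\<in>A. f x * of_bool (x = a)) = of_bool (a \<in> A) * f a"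
    "(\<Sum>x\<in>A. of_bool (a = x) * f x) = of_bool (a \<in> A) * f a"
    "(\<Sum>x\<in>A. f x * of_bool (a = x)) = of_bool (a \<in> A) * f a"
proof -
  have "of_bool (x = a) * f x = (if x = a then f x else 0)" "f x * of_bool (x = a) = (if x = a then f x else 0)"
    "of_bool (a = x) * f x = (if x = a then f x else 0)" "f x * of_bool (a = x) = (if x = a then f x else 0)" for x
    by auto
  then show "(\<Sum>x\<in>A. of_bool (x = a) * f x) = of_bool (a \<in> A) * f a"
    "(\<Sum>x\<in>A. f x * of_bool (x = a)) = of_bool (a \<in> A) * f a"
    "(\<Sum>x\<in>A. of_bool (a = x) * f x) = of_bool (a \<in> A) * f a"
    "(\<Sum>x\<in>A. f x * of_bool (a = x)) = of_bool (a \<in> A) * f a"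
    using sum.delta[OF assms, of a f] by simp_all
qed

lemma hcarI: "(\<And>x. x \<notin> basis H \<Longrightarrow> a x = 0) \<Longrightarrow> a \<in> hcar H"
  by (simp add: hcar_def)

lemma hcarD: "a \<in> hcar H \<Longrightarrow> x \<notin> basis H \<Longrightarrow> a x = 0"
  by (simp add: hcar_def)

context fin_group
begin

lemma basis_simps [simp]:
  "basis (kG G :: ('a, 'k::field) hopf) = carrier G" "basis (kdG G :: ('a, 'k) hopf) = carrier G"
  "basis (DG G :: ('a \<times> 'a, 'k) hopf) = carrier G \<times> carrier G"
  "basis (DGd G :: ('a \<times> 'a, 'k) hopf) = carrier G \<times> carrier G"
  by (simp_all add: kG_def kdG_def DG_def DGd_def)

lemma hone_simps [simp]:
  "hone (kG G :: ('a, 'k::field) hopf) = bv \<one>" "hone (kdG G :: ('a, 'k) hopf) = (\<lambda>x. of_bool (x \<in> carrier G))"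
  "hone (DG G :: ('a \<times> 'a, 'k) hopf) = (\<lambda>(x, y). of_bool (x \<in> carrier G \<and> y = \<one>))"
  "hone (DGd G :: ('a \<times> 'a, 'k) hopf) = (\<lambda>(x, y). of_bool (x = \<one> \<and> y \<in> carrier G))"
  by (simp_all add: kG_def kdG_def DG_def DGd_def)

lemma hone_DG_hcar [simp]: "hone (DG G :: ('a \<times> 'a, 'k::field) hopf) \<in> hcar (DG G)"
  by (rule hcarI) auto

lemma conj_eq_iff:
  assumes "x \<in> carrier G" "y \<in> carrier G" "g \<in> carrier G"
  shows "x = y \<otimes> g \<otimes> inv y \<longleftrightarrow> g = inv y \<otimes> x \<otimes> y"
proof -
  have "x = y \<otimes> g \<otimes> inv y \<longleftrightarrow> y \<otimes> g = x \<otimes> y"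
    by (rule inv_solve_right) (use assms in simp_all)
  moreover have "g = inv y \<otimes> (x \<otimes> y) \<longleftrightarrow> x \<otimes> y = y \<otimes> g"
    by (rule inv_solve_left) (use assms in simp_all)
  ultimately show ?thesis using assms by (simp only: m_assoc inv_closed) argo
qed

text \<open>A double sum against the structure constants of \<open>DG\<close>: in a product equal to
  \<open>e_{z_1} \<times> z_2\<close> the first factor is \<open>e_{z_1} \<times> y\<close>, and \<open>y\<close> determines the second one.\<close>

lemma DG_sum:
  fixes F :: "'a \<times> 'a \<Rightarrow> 'a \<times> 'a \<Rightarrow> 'k::field"
  shows "(\<Sum>x\<in>carrier G \<times> carrier G. \<Sum>x'\<in>carrier G \<times> carrier G. F x x' * bmul (DG G) x x' (z1, z2)) =
    (if z1 \<in> carrier G \<and> z2 \<in> carrier G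
     then \<Sum>y\<in>carrier G. F (z1, y) (inv y \<otimes> z1 \<otimes> y, inv y \<otimes> z2) else 0)"
proof -
  have fin2: "finite (carrier G \<times> carrier G)" using fin by simp
  have in1: "(\<Sum>x'\<in>carrier G \<times> carrier G. F (x1, x2) x' * bmul (DG G) (x1, x2) x' (z1, z2)) =
      of_bool (z1 = x1) * (of_bool (z1 \<in> carrier G \<and> z2 \<in> carrier G) *
        F (z1, x2) (inv x2 \<otimes> z1 \<otimes> x2, inv x2 \<otimes> z2))"
    if x: "x1 \<in> carrier G" "x2 \<in> carrier G" for x1 x2
  proof -
    have "F (x1, x2) x' * bmul (DG G) (x1, x2) x' (z1, z2) =
      F (x1, x2) x' * of_bool (x' = (inv x2 \<otimes> x1 \<otimes> x2, inv x2 \<otimes> z2)) * of_bool (z1 = x1 \<and> z2 \<in> carrier G)"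
      if x': "x' \<in> carrier G \<times> carrier G" for x'
    proof -
      obtain a b where ab: "x' = (a, b)" "a \<in> carrier G" "b \<in> carrier G" using x' by auto
      have "z2 = x2 \<otimes> b \<longleftrightarrow> z2 \<in> carrier G \<and> b = inv x2 \<otimes> z2"
        using x ab by (metis inv_solve_left m_closed)
      then show ?thesis using ab x conj_eq_iff[of x1 x2 a] by (auto simp: DG_def)
    qed
    then have "(\<Sum>x'\<in>carrier G \<times> carrier G. F (x1, x2) x' * bmul (DG G) (x1, x2) x' (z1, z2)) =
      (\<Sum>x'\<in>carrier G \<times> carrier G. F (x1, x2) x' * of_bool (x' = (inv x2 \<otimes> x1 \<otimes> x2, inv x2 \<otimes> z2))) *
        of_bool (z1 = x1 \<and> z2 \<in> carrier G)"
      unfolding sum_distrib_right by (intro sum.cong) auto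
    then show ?thesis using x by (auto simp: sum_of_bool_delta fin2)
  qed
  have "(\<Sum>x\<in>carrier G \<times> carrier G. \<Sum>x'\<in>carrier G \<times> carrier G. F x x' * bmul (DG G) x x' (z1, z2)) =
    (\<Sum>x1\<in>carrier G. \<Sum>x2\<in>carrier G. of_bool (z1 = x1) * (of_bool (z1 \<in> carrier G \<and> z2 \<in> carrier G) *
        F (z1, x2) (inv x2 \<otimes> z1 \<otimes> x2, inv x2 \<otimes> z2)))"
    by (subst sum.cartesian_product', intro sum.cong refl in1)
  also have "\<dots> = (\<Sum>x1\<in>carrier G. of_bool (z1 = x1) * (\<Sum>x2\<in>carrier G.
      of_bool (z1 \<in> carrier G \<and> z2 \<in> carrier G) * F (z1, x2) (inv x2 \<otimes> z1 \<otimes> x2, inv x2 \<otimes> z2)))"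
    by (simp add: sum_distrib_left)
  also have "\<dots> = of_bool (z1 \<in> carrier G) * (\<Sum>x2\<in>carrier G.
      of_bool (z1 \<in> carrier G \<and> z2 \<in> carrier G) * F (z1, x2) (inv x2 \<otimes> z1 \<otimes> x2, inv x2 \<otimes> z2))"
    by (rule sum_of_bool_delta(3)[OF fin])
  finally show ?thesis by (auto simp: of_bool_def)
qed

lemma mul_DG:
  fixes a b :: "'a \<times> 'a \<Rightarrow> 'k::field"
  shows "mul (DG G) a b (z1, z2) = (if z1 \<in> carrier G \<and> z2 \<in> carrier G
     then \<Sum>y\<in>carrier G. a (z1, y) * b (inv y \<otimes> z1 \<otimes> y, inv y \<otimes> z2) else (0::'k::field))"
  unfolding mul_def basis_simps by (rule DG_sum)

lemma mul2_DG:
  "mul2 (DG G) s t ((z1, z2), (w1, w2)) =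
    (if z1 \<in> carrier G \<and> z2 \<in> carrier G \<and> w1 \<in> carrier G \<and> w2 \<in> carrier G
     then \<Sum>y\<in>carrier G. \<Sum>y'\<in>carrier G. s ((z1, y), (w1, y')) *
        t ((inv y \<otimes> z1 \<otimes> y, inv y \<otimes> z2), (inv y' \<otimes> w1 \<otimes> y', inv y' \<otimes> w2)) else (0::'k::field))"
proof -
  let ?B = "carrier G \<times> carrier G"
  have "mul2 (DG G) s t ((z1, z2), (w1, w2)) =
    (\<Sum>x\<in>?B. \<Sum>y\<in>?B. \<Sum>x'\<in>?B. \<Sum>y'\<in>?B.
      s (x, y) * t (x', y') * bmul (DG G) x x' (z1, z2) * bmul (DG G) y y' (w1, w2))"
    unfolding mul2_def basis_simps prod.case sum.cartesian_product[symmetric] by simp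
  also have "\<dots> = (\<Sum>x\<in>?B. \<Sum>x'\<in>?B. \<Sum>y\<in>?B. \<Sum>y'\<in>?B.
      s (x, y) * t (x', y') * bmul (DG G) x x' (z1, z2) * bmul (DG G) y y' (w1, w2))"
    by (intro sum.cong refl sum.swap)
  also have "\<dots> = (\<Sum>x\<in>?B. \<Sum>x'\<in>?B. (\<Sum>y\<in>?B. \<Sum>y'\<in>?B.
      s (x, y) * t (x', y') * bmul (DG G) y y' (w1, w2)) * bmul (DG G) x x' (z1, z2))"
    unfolding sum_distrib_right by (intro sum.cong refl) (simp add: mult.assoc mult.left_commute mult.commute)
  finally show ?thesis unfolding DG_sum by (auto intro!: sum.cong)
qed

lemma comul_DG:
  "comul (DG G) h ((p, q), (r, s)) =
    (if p \<in> carrier G \<and> q \<in> carrier G \<and> r \<in> carrier G \<and> q = s then h (p \<otimes> r, q) else (0::'k::field))"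
proof -
  have "comul (DG G) h ((p, q), (r, s)) = (\<Sum>x\<in>carrier G \<times> carrier G.
      h x * of_bool (x = (p \<otimes> r, q)) * of_bool (p \<in> carrier G \<and> r \<in> carrier G \<and> q = s))"
    unfolding comul_def basis_simps by (rule sum.cong) (auto simp: DG_def)
  also have "\<dots> = of_bool ((p \<otimes> r, q) \<in> carrier G \<times> carrier G) * h (p \<otimes> r, q) *
      of_bool (p \<in> carrier G \<and> r \<in> carrier G \<and> q = s)"
    unfolding sum_distrib_right[symmetric] using fin by (subst sum_of_bool_delta) auto
  finally show ?thesis by auto
qed

lemma counit_DG: "counit (DG G) h = (\<Sum>y\<in>carrier G. h (\<one>, y) :: 'k::field)"
proof -
  have "counit (DG G) h = (\<Sum>x\<in>carrier G. of_bool (x = \<one>) * (\<Sum>y\<in>carrier G. h (x, y)))"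
    unfolding counit_def basis_simps sum.cartesian_product' sum_distrib_left
    by (intro sum.cong) (auto simp: DG_def)
  then show ?thesis by (simp add: sum_of_bool_delta fin)
qed

lemma mul_DG_hcar [simp]: "mul (DG G) a b \<in> hcar (DG G)"
  by (rule hcarI) (auto simp: mul_DG split: if_splits)

lemma comul_DG_forms2: "comul (DG G :: ('a \<times> 'a, 'k::field) hopf) h \<in> forms2 (DG G)"
  by (auto simp: forms2_def comul_DG)

lemma comul_hone_DG:
  "comul (DG G) (hone (DG G)) = (tensor (hone (DG G)) (hone (DG G)) :: _ \<Rightarrow> 'k::field)"
  by (auto simp: fun_eq_iff comul_DG tensor_def)

lemma mul_DG_one:
  fixes a :: "'a \<times> 'a \<Rightarrow> 'k::field"
  assumes "a \<in> hcar (DG G)"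
  shows "mul (DG G) (hone (DG G)) a = a" "mul (DG G) a (hone (DG G)) = a"
proof -
  have "(\<Sum>y\<in>carrier G. of_bool (y = \<one>) * a (inv y \<otimes> z1 \<otimes> y, inv y \<otimes> z2)) = a (z1, z2)"
    if "z1 \<in> carrier G" "z2 \<in> carrier G" for z1 z2
    using that by (simp add: sum_of_bool_delta fin)
  then show "mul (DG G) (hone (DG G)) a = a"
    using hcarD[OF assms] by (auto simp: fun_eq_iff mul_DG)
  have "(\<Sum>y\<in>carrier G. a (z1, y) * of_bool (inv y \<otimes> z2 = \<one>)) = a (z1, z2)"
    if "z1 \<in> carrier G" "z2 \<in> carrier G" for z1 z2
  proof -
    have "(\<Sum>y\<in>carrier G. a (z1, y) * of_bool (inv y \<otimes> z2 = \<one>)) =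
        (\<Sum>y\<in>carrier G. a (z1, y) * of_bool (y = z2))"
      by (intro sum.cong refl arg_cong2[where f = "(*)"] arg_cong[where f = of_bool])
        (metis that(2) inv_closed inv_inv inv_equality l_inv)
    then show ?thesis using that by (simp add: sum_of_bool_delta fin)
  qed
  then show "mul (DG G) a (hone (DG G)) = a"
    using hcarD[OF assms] by (auto simp: fun_eq_iff mul_DG intro!: sum.cong)
qed

lemma sum_left_translate:
  assumes "x \<in> carrier G"
  shows "(\<Sum>y\<in>carrier G. f y) = (\<Sum>w\<in>carrier G. f (x \<otimes> w) :: 'k::field)"
  by (rule sum.reindex_bij_witness[of _ "\<lambda>w. x \<otimes> w" "\<lambda>y. inv x \<otimes> y"])
    (use assms in \<open>auto simp: m_assoc[symmetric]\<close>)

lemma conj_mult: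
  assumes "x \<in> carrier G" "w \<in> carrier G" "z \<in> carrier G"
  shows "inv (x \<otimes> w) \<otimes> z \<otimes> (x \<otimes> w) = inv w \<otimes> (inv x \<otimes> z \<otimes> x) \<otimes> w"
  using assms by (simp add: inv_mult_group m_assoc)

lemma mul_DG_assoc:
  fixes a b c :: "'a \<times> 'a \<Rightarrow> 'k::field"
  shows "mul (DG G) (mul (DG G) a b) c = mul (DG G) a (mul (DG G) b c)"
proof
  fix z :: "'a \<times> 'a" obtain z1 z2 where z: "z = (z1, z2)" by (cases z)
  show "mul (DG G) (mul (DG G) a b) c z = mul (DG G) a (mul (DG G) b c) z"
  proof (cases "z1 \<in> carrier G \<and> z2 \<in> carrier G")
    case True
    then have T: "z1 \<in> carrier G" "z2 \<in> carrier G" by auto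
    have "mul (DG G) (mul (DG G) a b) c z = (\<Sum>y\<in>carrier G. \<Sum>x\<in>carrier G.
        a (z1, x) * (b (inv x \<otimes> z1 \<otimes> x, inv x \<otimes> y) * c (inv y \<otimes> z1 \<otimes> y, inv y \<otimes> z2)))"
      using T by (simp add: z mul_DG sum_distrib_right mult.assoc)
    also have "\<dots> = (\<Sum>x\<in>carrier G. \<Sum>y\<in>carrier G.
        a (z1, x) * (b (inv x \<otimes> z1 \<otimes> x, inv x \<otimes> y) * c (inv y \<otimes> z1 \<otimes> y, inv y \<otimes> z2)))"
      by (rule sum.swap)
    also have "\<dots> = (\<Sum>x\<in>carrier G. \<Sum>w\<in>carrier G.
        a (z1, x) * (b (inv x \<otimes> z1 \<otimes> x, w) * c (inv w \<otimes> (inv x \<otimes> z1 \<otimes> x) \<otimes> w, inv w \<otimes> (inv x \<otimes> z2))))"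
    proof (rule sum.cong[OF refl])
      fix x assume x: "x \<in> carrier G"
      show "(\<Sum>y\<in>carrier G. a (z1, x) * (b (inv x \<otimes> z1 \<otimes> x, inv x \<otimes> y) * c (inv y \<otimes> z1 \<otimes> y, inv y \<otimes> z2))) =
        (\<Sum>w\<in>carrier G. a (z1, x) * (b (inv x \<otimes> z1 \<otimes> x, w) *
          c (inv w \<otimes> (inv x \<otimes> z1 \<otimes> x) \<otimes> w, inv w \<otimes> (inv x \<otimes> z2))))"
        unfolding sum_left_translate[OF x, of "\<lambda>y. a (z1, x) * (b (inv x \<otimes> z1 \<otimes> x, inv x \<otimes> y) * c (inv y \<otimes> z1 \<otimes> y, inv y \<otimes> z2))"]
        by (intro sum.cong refl) (use x T in \<open>simp add: conj_mult, simp add: inv_mult_group m_assoc[symmetric]\<close>)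
    qed
    also have "\<dots> = mul (DG G) a (mul (DG G) b c) z"
      using T by (auto simp: z mul_DG sum_distrib_left intro!: sum.cong)
    finally show ?thesis .
  qed (auto simp: z mul_DG)
qed

lemma mul2_DG_assoc:
  fixes a b c :: "('a \<times> 'a) \<times> ('a \<times> 'a) \<Rightarrow> 'k::field"
  shows "mul2 (DG G) (mul2 (DG G) a b) c = mul2 (DG G) a (mul2 (DG G) b c)"
proof
  fix zw :: "('a \<times> 'a) \<times> ('a \<times> 'a)"
  obtain z1 z2 w1 w2 where z: "zw = ((z1, z2), (w1, w2))" by (metis surj_pair)
  let ?C = "carrier G"
  show "mul2 (DG G) (mul2 (DG G) a b) c zw = mul2 (DG G) a (mul2 (DG G) b c) zw"
  proof (cases "z1 \<in> ?C \<and> z2 \<in> ?C \<and> w1 \<in> ?C \<and> w2 \<in> ?C")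
    case True
    then have T: "z1 \<in> ?C" "z2 \<in> ?C" "w1 \<in> ?C" "w2 \<in> ?C" by auto
    define F where "F x x' y y' = a ((z1, x), (w1, x')) *
        (b ((inv x \<otimes> z1 \<otimes> x, inv x \<otimes> y), (inv x' \<otimes> w1 \<otimes> x', inv x' \<otimes> y')) *
         c ((inv y \<otimes> z1 \<otimes> y, inv y \<otimes> z2), (inv y' \<otimes> w1 \<otimes> y', inv y' \<otimes> w2)))" for x x' y y'
    have "mul2 (DG G) (mul2 (DG G) a b) c zw = (\<Sum>y\<in>?C. \<Sum>y'\<in>?C. \<Sum>x\<in>?C. \<Sum>x'\<in>?C. F x x' y y')"
      using T by (simp add: z mul2_DG sum_distrib_right mult.assoc F_def)
    also have "\<dots> = (\<Sum>p\<in>?C \<times> ?C. \<Sum>q\<in>?C \<times> ?C. F (fst q) (snd q) (fst p) (snd p))"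
      by (simp add: sum.cartesian_product')
    also have "\<dots> = (\<Sum>q\<in>?C \<times> ?C. \<Sum>p\<in>?C \<times> ?C. F (fst q) (snd q) (fst p) (snd p))"
      by (rule sum.swap)
    also have "\<dots> = (\<Sum>x\<in>?C. \<Sum>x'\<in>?C. \<Sum>y\<in>?C. \<Sum>y'\<in>?C. F x x' y y')"
      by (simp add: sum.cartesian_product')
    also have "\<dots> = (\<Sum>x\<in>?C. \<Sum>x'\<in>?C. \<Sum>y\<in>?C. \<Sum>y'\<in>?C. F x x' (x \<otimes> y) (x' \<otimes> y'))"
    proof (rule sum.cong[OF refl], rule sum.cong[OF refl])
      fix x x' assume x: "x \<in> ?C" "x' \<in> ?C"
      show "(\<Sum>y\<in>?C. \<Sum>y'\<in>?C. F x x' y y') = (\<Sum>y\<in>?C. \<Sum>y'\<in>?C. F x x' (x \<otimes> y) (x' \<otimes> y'))"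
        unfolding sum_left_translate[OF x(1), of "\<lambda>y. \<Sum>y'\<in>?C. F x x' y y'"]
        by (intro sum.cong refl sum_left_translate[OF x(2)])
    qed
    also have "\<dots> = mul2 (DG G) a (mul2 (DG G) b c) zw"
      unfolding F_def z mul2_DG sum_distrib_left using T
      by (auto intro!: sum.cong simp: conj_mult simp: inv_mult_group m_assoc[symmetric] sum_distrib_left)
    finally show ?thesis .
  qed (auto simp: z mul2_DG)
qed

lemma mult_inv_cancel [simp]:
  assumes "x \<in> carrier G" "y \<in> carrier G"
  shows "x \<otimes> (inv x \<otimes> y) = y" "inv x \<otimes> (x \<otimes> y) = y"
  using assms by (simp_all add: m_assoc[symmetric])

lemma conj_hom:
  assumes "x \<in> carrier G" "y \<in> carrier G" "z \<in> carrier G"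
  shows "(inv y \<otimes> x \<otimes> y) \<otimes> (inv y \<otimes> z \<otimes> y) = inv y \<otimes> (x \<otimes> z) \<otimes> y"
  using assms by (simp add: m_assoc)

lemma comul_DG_mult:
  "comul (DG G) (mul (DG G) a b) = (mul2 (DG G) (comul (DG G) a) (comul (DG G) b) :: _ \<Rightarrow> 'k::field)"
proof
  fix zw :: "('a \<times> 'a) \<times> ('a \<times> 'a)"
  obtain p q r s where z: "zw = ((p, q), (r, s))" by (metis surj_pair)
  let ?C = "carrier G"
  show "comul (DG G) (mul (DG G) a b) zw = mul2 (DG G) (comul (DG G) a) (comul (DG G) b) zw"
  proof (cases "p \<in> ?C \<and> q \<in> ?C \<and> r \<in> ?C \<and> s \<in> ?C")
    case True
    then have T: "p \<in> ?C" "q \<in> ?C" "r \<in> ?C" "s \<in> ?C" by auto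
    have "mul2 (DG G) (comul (DG G) a) (comul (DG G) b) zw = (\<Sum>y\<in>?C. \<Sum>y'\<in>?C.
        of_bool (y = y') * (a (p \<otimes> r, y) * (of_bool (q = s) * b (inv y \<otimes> (p \<otimes> r) \<otimes> y, inv y \<otimes> q))))"
    proof -
      have "comul (DG G) a ((p, y), (r, y')) *
          comul (DG G) b ((inv y \<otimes> p \<otimes> y, inv y \<otimes> q), (inv y' \<otimes> r \<otimes> y', inv y' \<otimes> s)) =
        of_bool (y = y') * (a (p \<otimes> r, y) * (of_bool (q = s) * b (inv y \<otimes> (p \<otimes> r) \<otimes> y, inv y \<otimes> q)))"
        if y: "y \<in> ?C" "y' \<in> ?C" for y y'
        using T y by (cases "y = y'") (simp_all add: comul_DG conj_hom)
      then show ?thesis unfolding z mul2_DG using T by (auto intro!: sum.cong)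
    qed
    also have "\<dots> = (\<Sum>y\<in>?C. a (p \<otimes> r, y) * (of_bool (q = s) * b (inv y \<otimes> (p \<otimes> r) \<otimes> y, inv y \<otimes> q)))"
      by (intro sum.cong refl) (simp add: sum_of_bool_delta(3)[OF fin])
    also have "\<dots> = comul (DG G) (mul (DG G) a b) zw"
      using T by (auto simp: z comul_DG mul_DG)
    finally show ?thesis by simp
  qed (auto simp: z mul2_DG comul_DG mul_DG)
qed

lemma counit_DG_mult: "counit (DG G) (mul (DG G) a b) = counit (DG G) a * (counit (DG G) b :: 'k::field)"
proof -
  have "counit (DG G) (mul (DG G) a b) = (\<Sum>z\<in>carrier G. \<Sum>y\<in>carrier G. a (\<one>, y) * b (\<one>, inv y \<otimes> z))"
    by (auto simp: counit_DG mul_DG intro!: sum.cong)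
  also have "\<dots> = (\<Sum>y\<in>carrier G. \<Sum>z\<in>carrier G. a (\<one>, y) * b (\<one>, inv y \<otimes> z))"
    by (rule sum.swap)
  also have "\<dots> = (\<Sum>y\<in>carrier G. \<Sum>z\<in>carrier G. a (\<one>, y) * b (\<one>, z))"
  proof (rule sum.cong[OF refl])
    fix y assume "y \<in> carrier G"
    then show "(\<Sum>z\<in>carrier G. a (\<one>, y) * b (\<one>, inv y \<otimes> z)) = (\<Sum>z\<in>carrier G. a (\<one>, y) * b (\<one>, z))"
      using sum_left_translate[of "inv y" "\<lambda>z. a (\<one>, y) * b (\<one>, z)"] by simp
  qed
  finally show ?thesis by (simp add: counit_DG sum_product)
qed

lemma counit_hone_DG: "counit (DG G) (hone (DG G)) = (1 :: 'k::field)"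
  using sum_of_bool_delta(1)[OF fin, of \<one> "\<lambda>_. 1 :: 'k"] by (simp add: counit_DG)

subsection \<open>The Hopf algebras \<open>kG\<close> and \<open>k\<^sup>G\<close>\<close>

lemma mul_kG:
  "mul (kG G) a b z = (if z \<in> carrier G then \<Sum>x\<in>carrier G. a x * b (inv x \<otimes> z) else (0::'k::field))"
proof -
  have "(\<Sum>y\<in>carrier G. a x * b y * bmul (kG G) x y z) =
      of_bool (z \<in> carrier G) * (a x * b (inv x \<otimes> z))" if x: "x \<in> carrier G" for x
  proof -
    have "(\<Sum>y\<in>carrier G. a x * b y * bmul (kG G) x y z) =
      (\<Sum>y\<in>carrier G. (a x * b y * of_bool (z \<in> carrier G)) * of_bool (y = inv x \<otimes> z))"
    proof (rule sum.cong)
      fix y assume y: "y \<in> carrier G"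
      have "z = x \<otimes> y \<longleftrightarrow> z \<in> carrier G \<and> y = inv x \<otimes> z"
        using x y by (metis inv_solve_left m_closed)
      then show "a x * b y * bmul (kG G) x y z = (a x * b y * of_bool (z \<in> carrier G)) * of_bool (y = inv x \<otimes> z)"
        by (auto simp: kG_def bv_def)
    qed simp
    then show ?thesis using x by (auto simp: sum_of_bool_delta fin)
  qed
  then show ?thesis by (auto simp: mul_def)
qed

lemma mul_kdG: "mul (kdG G) a b z = (if z \<in> carrier G then a z * b z else (0::'k::field))"
proof -
  have "mul (kdG G) a b z = (\<Sum>x\<in>carrier G. \<Sum>y\<in>carrier G. of_bool (x = y) * (a x * b y * of_bool (z = x)))"
    unfolding mul_def basis_simps by (intro sum.cong) (auto simp: kdG_def)
  also have "\<dots> = (\<Sum>x\<in>carrier G. a x * b x * of_bool (z = x))"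
    by (intro sum.cong refl) (simp add: sum_of_bool_delta(3)[OF fin])
  finally show ?thesis by (simp add: sum_of_bool_delta fin)
qed

lemma comul_kG: "comul (kG G) a (p, q) = (if p \<in> carrier G \<and> p = q then a p else (0::'k::field))"
proof -
  have "comul (kG G) a (p, q) = (\<Sum>x\<in>carrier G. (a x * of_bool (q = p)) * of_bool (x = p))"
    unfolding comul_def basis_simps by (intro sum.cong) (auto simp: kG_def bv_def)
  also have "\<dots> = of_bool (p \<in> carrier G) * (a p * of_bool (q = p))"
    by (rule sum_of_bool_delta(2)[OF fin])
  finally show ?thesis by auto
qed

lemma comul_kdG:
  "comul (kdG G) a (p, q) = (if p \<in> carrier G \<and> q \<in> carrier G then a (p \<otimes> q) else (0::'k::field))"
proof -
  have "comul (kdG G) a (p, q) = (\<Sum>x\<in>carrier G. (a x * of_bool (p \<in> carrier G \<and> q \<in> carrier G)) * of_bool (x = p \<otimes> q))"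
    unfolding comul_def basis_simps by (intro sum.cong) (auto simp: kdG_def)
  then show ?thesis by (auto simp: sum_of_bool_delta fin)
qed

lemma counit_kG: "counit (kG G) a = (\<Sum>x\<in>carrier G. a x :: 'k::field)"
  unfolding counit_def basis_simps by (simp add: kG_def)

lemma counit_kdG: "counit (kdG G) a = (a \<one> :: 'k::field)"
proof -
  have "counit (kdG G) a = (\<Sum>x\<in>carrier G. a x * of_bool (x = \<one>))"
    unfolding counit_def basis_simps by (simp add: kdG_def)
  then show ?thesis by (simp add: sum_of_bool_delta fin)
qed

end

section \<open>Automorphisms of the group and of the double\<close>

text \<open>Pull-back of coordinates along a map of the basis \<open>B\<close>.\<close>

definition pull :: "'b set \<Rightarrow> ('b \<Rightarrow> 'b) \<Rightarrow> ('b \<Rightarrow> 'k::field) \<Rightarrow> 'b \<Rightarrow> 'k" where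
  "pull B \<pi> h = (\<lambda>z. if z \<in> B then h (\<pi> z) else 0)"

lemma map2_pull:
  fixes H :: "('b, 'k::field) hopf"
  assumes fin: "finite (basis H)" and into: "\<pi> ` basis H \<subseteq> basis H"
    and f: "\<And>x. x \<in> basis H \<Longrightarrow> f (bv x) = pull (basis H) \<pi> (bv x)"
  shows "map2 H f s = pull (basis H \<times> basis H) (map_prod \<pi> \<pi>) s"
proof
  fix p :: "'b \<times> 'b" obtain z w where p: "p = (z, w)" by (cases p)
  have fx: "f (bv x) y = of_bool (y \<in> basis H \<and> x = \<pi> y)" if "x \<in> basis H" for x y
    using that by (auto simp: f pull_def) (auto simp: bv_def)
  have "map2 H f s p = (\<Sum>x\<in>basis H \<times> basis H.
      (s x * of_bool (z \<in> basis H \<and> w \<in> basis H)) * of_bool (x = (\<pi> z, \<pi> w)))"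
    unfolding map2_def p prod.case
    by (rule sum.cong) (auto simp: fx)
  also have "\<dots> = of_bool ((\<pi> z, \<pi> w) \<in> basis H \<times> basis H) * (s (\<pi> z, \<pi> w) * of_bool (z \<in> basis H \<and> w \<in> basis H))"
    by (rule sum_of_bool_delta(2)) (use fin in simp)
  also have "\<dots> = pull (basis H \<times> basis H) (map_prod \<pi> \<pi>) s p"
    using into by (auto simp: p pull_def)
  finally show "map2 H f s p = pull (basis H \<times> basis H) (map_prod \<pi> \<pi>) s p" .
qed

lemma hopf_mapsD:
  assumes "f \<in> hopf_maps H L"
  shows "a \<in> hcar H \<Longrightarrow> f a \<in> hcar L" "f \<in> extensional (hcar H)"
    "a \<in> hcar H \<Longrightarrow> b \<in> hcar H \<Longrightarrow> f (\<lambda>x. a x + b x) = (\<lambda>x. f a x + f b x)"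
    "a \<in> hcar H \<Longrightarrow> f (\<lambda>x. c * a x) = (\<lambda>x. c * f a x)"
    "a \<in> hcar H \<Longrightarrow> b \<in> hcar H \<Longrightarrow> f (mul H a b) = mul L (f a) (f b)"
    "f (hone H) = hone L" "a \<in> hcar H \<Longrightarrow> comul L (f a) = map2 H f (comul H a)"
    "a \<in> hcar H \<Longrightarrow> counit L (f a) = counit H a"
  using assms by (auto simp: hopf_maps_def PiE_def Pi_iff)

lemma hopf_mapsI:
  assumes "\<And>a. a \<in> hcar H \<Longrightarrow> f a \<in> hcar L"
    "\<And>a b. a \<in> hcar H \<Longrightarrow> b \<in> hcar H \<Longrightarrow> f (\<lambda>x. a x + b x) = (\<lambda>x. f a x + f b x)"
    "\<And>c a. a \<in> hcar H \<Longrightarrow> f (\<lambda>x. c * a x) = (\<lambda>x. c * f a x)"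
    "\<And>a b. a \<in> hcar H \<Longrightarrow> b \<in> hcar H \<Longrightarrow> f (mul H a b) = mul L (f a) (f b)"
    "\<And>a b. a \<in> hcar H \<Longrightarrow> b \<in> hcar H \<Longrightarrow> mul H a b \<in> hcar H"
    "f (hone H) = hone L" "hone H \<in> hcar H"
    "\<And>a. a \<in> hcar H \<Longrightarrow> comul L (f a) = map2 H f (comul H a)"
    "\<And>a. a \<in> hcar H \<Longrightarrow> counit L (f a) = counit H a"
  shows "restrict f (hcar H) \<in> hopf_maps H L"
proof -
  have "map2 H (restrict f (hcar H)) s = map2 H f s" for s
    unfolding map2_def by (auto simp: fun_eq_iff bv_hcar intro!: sum.cong)
  moreover have "(\<lambda>x. a x + b x) \<in> hcar H" if "a \<in> hcar H" "b \<in> hcar H" for a b :: "'a \<Rightarrow> 'b"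
    using that by (simp add: hcar_def)
  moreover have "(\<lambda>x. c * a x) \<in> hcar H" if "a \<in> hcar H" for c and a :: "'a \<Rightarrow> 'b"
    using that by (simp add: hcar_def)
  ultimately show ?thesis
    unfolding hopf_maps_def using assms by (simp add: restrict_PiE_iff)
qed

text \<open>Induction over linear combinations of basis elements.\<close>

lemma hcar_induct:
  fixes H :: "('b, 'k::field) hopf"
  assumes fin: "finite (basis H)" and a: "a \<in> hcar H" and zero: "P (\<lambda>x. 0)"
    and step: "\<And>a c x. a \<in> hcar H \<Longrightarrow> x \<in> basis H \<Longrightarrow> P a \<Longrightarrow> P (\<lambda>y. a y + c * bv x y)"
  shows "P a"
proof -
  have "P a" if "finite F" "F \<subseteq> basis H" "\<And>x. x \<notin> F \<Longrightarrow> a x = 0" for F a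
    using that
  proof (induction F arbitrary: a)
    case empty
    then have "a = (\<lambda>x. 0)" by auto
    with zero show ?case by simp
  next
    case (insert x F)
    have "P (a(x := 0))" by (rule insert.IH) (use insert in auto)
    moreover have "a(x := 0) \<in> hcar H" using insert by (auto simp: hcar_def)
    moreover have "x \<in> basis H" using insert by simp
    ultimately have "P (\<lambda>y. (a(x := 0)) y + a x * bv x y)" by (intro step)
    moreover have "(\<lambda>y. (a(x := 0)) y + a x * bv x y) = a" by (auto simp: bv_def)
    ultimately show ?case by simp
  qed
  from this[OF fin subset_refl] a show ?thesis by (auto simp: hcar_def)
qed

lemma hopf_maps_eqI:
  assumes fin: "finite (basis H)" and f: "f \<in> hopf_maps H L" and g: "g \<in> hopf_maps H L"
    and eq: "\<And>x. x \<in> basis H \<Longrightarrow> f (bv x) = g (bv x)"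
  shows "f = g"
proof (rule extensionalityI[OF hopf_mapsD(2)[OF f] hopf_mapsD(2)[OF g]])
  fix a assume "a \<in> hcar H"
  with fin show "f a = g a"
  proof (rule hcar_induct)
    have z: "(\<lambda>x. 0) \<in> hcar H" by (simp add: hcar_def)
    show "f (\<lambda>x. 0) = g (\<lambda>x. 0)"
      using hopf_mapsD(4)[OF f z, of 0] hopf_mapsD(4)[OF g z, of 0] by simp
  next
    fix a c x assume a: "a \<in> hcar H" "x \<in> basis H" "f a = g a"
    have "(\<lambda>y. c * bv x y) \<in> hcar H" using a(2) by (auto simp: hcar_def bv_def)
    then show "f (\<lambda>y. a y + c * bv x y) = g (\<lambda>y. a y + c * bv x y)"
      using a eq bv_hcar[OF a(2)] by (simp add: hopf_mapsD(3,4)[OF f] hopf_mapsD(3,4)[OF g])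
  qed
qed

context fin_group
begin

text \<open>\<open>Aut(G)\<close> and the inverse of an automorphism.\<close>

abbreviation Aut where "Aut \<equiv> carrier (AutoGroup G)"
abbreviation iA where "iA v \<equiv> inv\<^bsub>AutoGroup G\<^esub> v"

lemma Aut_props:
  assumes "v \<in> Aut"
  shows "x \<in> carrier G \<Longrightarrow> v x \<in> carrier G"
    "x \<in> carrier G \<Longrightarrow> y \<in> carrier G \<Longrightarrow> v (x \<otimes> y) = v x \<otimes> v y"
    "v \<one> = \<one>" "x \<in> carrier G \<Longrightarrow> v (inv x) = inv (v x)"
    "bij_betw v (carrier G) (carrier G)" "v \<in> extensional (carrier G)" "v \<in> hom G G"
proof -
  show h: "v \<in> hom G G" "v \<in> extensional (carrier G)" "bij_betw v (carrier G) (carrier G)"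
    using assms by (auto simp: AutoGroup_def auto_def Bij_def)
  interpret v: group_hom G G v using h by (simp add: group_hom_def group_hom_axioms_def)
  show "v \<one> = \<one>" "x \<in> carrier G \<Longrightarrow> v (inv x) = inv (v x)" "x \<in> carrier G \<Longrightarrow> v x \<in> carrier G"
    "x \<in> carrier G \<Longrightarrow> y \<in> carrier G \<Longrightarrow> v (x \<otimes> y) = v x \<otimes> v y"
    by simp_all
qed

lemma Aut_mult: "v \<in> Aut \<Longrightarrow> w \<in> Aut \<Longrightarrow> v \<otimes>\<^bsub>AutoGroup G\<^esub> w = compose (carrier G) v w"
  by (simp add: AutoGroup_def BijGroup_def auto_def)

lemma Aut_one: "\<one>\<^bsub>AutoGroup G\<^esub> = (\<lambda>x\<in>carrier G. x)"
  by (simp add: AutoGroup_def BijGroup_def)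

lemma Aut_inv:
  assumes "v \<in> Aut"
  shows "iA v \<in> Aut" "x \<in> carrier G \<Longrightarrow> iA v (v x) = x" "x \<in> carrier G \<Longrightarrow> v (iA v x) = x"
proof -
  interpret A: group "AutoGroup G" by (rule AutoGroup)
  show i: "iA v \<in> Aut" using assms by simp
  have "compose (carrier G) (iA v) v = (\<lambda>x\<in>carrier G. x)" "compose (carrier G) v (iA v) = (\<lambda>x\<in>carrier G. x)"
    using A.l_inv[OF assms] A.r_inv[OF assms] i assms by (simp_all add: Aut_mult Aut_one)
  then show "x \<in> carrier G \<Longrightarrow> iA v (v x) = x" "x \<in> carrier G \<Longrightarrow> v (iA v x) = x"
    by (metis compose_eq restrict_apply')+
qed

lemma Aut_eq_iff:
  assumes "v \<in> Aut" "x \<in> carrier G" "y \<in> carrier G"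
  shows "v x = y \<longleftrightarrow> x = iA v y" "v x = v y \<longleftrightarrow> x = y"
  using Aut_inv[OF assms(1)] assms by metis+

lemma Aut_inv_inv: "v \<in> Aut \<Longrightarrow> iA (iA v) = v"
  by (rule group.inv_inv[OF AutoGroup])

lemma sum_Aut:
  assumes "v \<in> Aut"
  shows "(\<Sum>x\<in>carrier G. f (v x)) = (\<Sum>x\<in>carrier G. f x :: 'k::field)"
  by (rule sum.reindex_bij_betw[OF Aut_props(5)[OF assms]])

text \<open>\<open>e_x \<times> y \<mapsto> e_{v^{-1}(x)} \<times> v^{-1}(y)\<close>.\<close>

abbreviation dpull :: "('a \<Rightarrow> 'a) \<Rightarrow> ('a \<times> 'a \<Rightarrow> 'k::field) \<Rightarrow> 'a \<times> 'a \<Rightarrow> 'k" where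
  "dpull v \<equiv> pull (carrier G \<times> carrier G) (map_prod v v)"

abbreviation dpull2 :: "('a \<Rightarrow> 'a) \<Rightarrow> (('a \<times> 'a) \<times> 'a \<times> 'a \<Rightarrow> 'k::field) \<Rightarrow> ('a \<times> 'a) \<times> 'a \<times> 'a \<Rightarrow> 'k" where
  "dpull2 v \<equiv> pull ((carrier G \<times> carrier G) \<times> carrier G \<times> carrier G) (map_prod (map_prod v v) (map_prod v v))"

lemma dpull_hcar [simp]: "dpull v h \<in> hcar (DG G)"
  by (rule hcarI) (auto simp: pull_def)

lemma dpull_mul:
  assumes v: "v \<in> Aut"
  shows "dpull v (mul (DG G) a b) = mul (DG G) (dpull v a) (dpull v b :: _ \<Rightarrow> 'k::field)"
proof
  fix z :: "'a \<times> 'a" obtain z1 z2 where z: "z = (z1, z2)" by (cases z)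
  note vp = Aut_props[OF v]
  show "dpull v (mul (DG G) a b) z = mul (DG G) (dpull v a) (dpull v b) z"
  proof (cases "z1 \<in> carrier G \<and> z2 \<in> carrier G")
    case True
    then have "dpull v (mul (DG G) a b) z =
      (\<Sum>y\<in>carrier G. a (v z1, v y) * b (inv (v y) \<otimes> v z1 \<otimes> v y, inv (v y) \<otimes> v z2))"
      using vp(1) by (simp add: z pull_def mul_DG
        sum_Aut[OF v, where f = "\<lambda>y. a (v z1, y) * b (inv y \<otimes> v z1 \<otimes> y, inv y \<otimes> v z2)"])
    also have "\<dots> = mul (DG G) (dpull v a) (dpull v b) z"
      using True vp by (auto simp: z pull_def mul_DG intro!: sum.cong)
    finally show ?thesis .
  qed (auto simp: z pull_def mul_DG)
qed

lemma dpull2_mul2: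
  assumes v: "v \<in> Aut"
  shows "dpull2 v (mul2 (DG G) s t) = mul2 (DG G) (dpull2 v s) (dpull2 v t :: _ \<Rightarrow> 'k::field)"
proof
  fix zw :: "('a \<times> 'a) \<times> ('a \<times> 'a)"
  obtain z1 z2 w1 w2 where z: "zw = ((z1, z2), (w1, w2))" by (metis surj_pair)
  let ?C = "carrier G"
  note vp = Aut_props[OF v]
  show "dpull2 v (mul2 (DG G) s t) zw = mul2 (DG G) (dpull2 v s) (dpull2 v t) zw"
  proof (cases "z1 \<in> ?C \<and> z2 \<in> ?C \<and> w1 \<in> ?C \<and> w2 \<in> ?C")
    case True
    define F where "F y y' = s ((v z1, y), (v w1, y')) *
      t ((inv y \<otimes> v z1 \<otimes> y, inv y \<otimes> v z2), (inv y' \<otimes> v w1 \<otimes> y', inv y' \<otimes> v w2))" for y y'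
    have "dpull2 v (mul2 (DG G) s t) zw = (\<Sum>y\<in>?C. \<Sum>y'\<in>?C. F y y')"
      using True vp(1) by (simp add: z pull_def mul2_DG F_def)
    also have "\<dots> = (\<Sum>y\<in>?C. \<Sum>y'\<in>?C. F (v y) (v y'))"
      by (simp add: sum_Aut[OF v, where f = "F _"] sum_Aut[OF v, where f = "\<lambda>y. \<Sum>y'\<in>?C. F y y'"])
    also have "\<dots> = mul2 (DG G) (dpull2 v s) (dpull2 v t) zw"
      using True vp by (auto simp: z pull_def mul2_DG F_def intro!: sum.cong)
    finally show ?thesis .
  qed (auto simp: z pull_def mul2_DG)
qed

lemma dpull_comul:
  assumes v: "v \<in> Aut"
  shows "comul (DG G) (dpull v a) = dpull2 v (comul (DG G) a :: _ \<Rightarrow> 'k::field)"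
  by (auto simp: fun_eq_iff comul_DG pull_def Aut_props(1,2)[OF v] Aut_eq_iff(2)[OF v])

lemma dpull_tensor: "dpull2 v (tensor a b) = tensor (dpull v a) (dpull v b)"
  by (auto simp: fun_eq_iff pull_def tensor_def)

lemma dpull_hone:
  assumes v: "v \<in> Aut"
  shows "dpull v (hone (DG G)) = (hone (DG G) :: _ \<Rightarrow> 'k::field)"
  using Aut_props(1,3)[OF v] Aut_eq_iff(2)[OF v, of _ \<one>] by (auto simp: fun_eq_iff pull_def)

lemma dpull_counit:
  assumes v: "v \<in> Aut"
  shows "counit (DG G) (dpull v a) = (counit (DG G) a :: 'k::field)"
  using sum_Aut[OF v, of "\<lambda>y. a (\<one>, y)"] Aut_props(3)[OF v] by (simp add: counit_DG pull_def)

lemma map2_dpull: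
  assumes v: "v \<in> Aut" and f: "\<And>h. h \<in> hcar (DG G) \<Longrightarrow> f h = dpull v h"
  shows "map2 (DG G) f s = dpull2 v (s :: _ \<Rightarrow> 'k::field)"
proof -
  have "map2 (DG G) f s = pull (basis (DG G :: ('a \<times> 'a, 'k) hopf) \<times> basis (DG G :: ('a \<times> 'a, 'k) hopf))
      (map_prod (map_prod v v) (map_prod v v)) s"
    by (rule map2_pull) (use fin Aut_props(1)[OF v] f bv_hcar[of _ "DG G"] in auto)
  then show ?thesis by simp
qed

lemma dpull_hopf_maps:
  assumes v: "v \<in> Aut"
  shows "(\<lambda>h\<in>hcar (DG G). dpull v h) \<in> hopf_maps (DG G) (DG G :: ('a \<times> 'a, 'k::field) hopf)"
  by (rule hopf_mapsI)
    (simp_all add: dpull_mul[OF v] dpull_hone[OF v, simplified] dpull_comul[OF v] dpull_counit[OF v]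
      map2_dpull[OF v] hone_DG_hcar[simplified], auto simp: pull_def)

lemma V_map_eq:
  assumes v: "v \<in> Aut"
  shows "V_map G v = (\<lambda>h\<in>hcar (DG G). dpull (iA v) (h :: _ \<Rightarrow> 'k::field))"
proof -
  have "(\<Sum>(g, h)\<in>carrier G \<times> carrier G. a (g, h) * bv (v g, v h) z) = dpull (iA v) a z" for a :: "'a \<times> 'a \<Rightarrow> 'k" and z
  proof -
    obtain z1 z2 where z: "z = (z1, z2)" by (cases z)
    have "(\<Sum>(g, h)\<in>carrier G \<times> carrier G. a (g, h) * bv (v g, v h) z) =
      (\<Sum>x\<in>carrier G \<times> carrier G. (a x * of_bool (z \<in> carrier G \<times> carrier G)) * of_bool (x = (iA v z1, iA v z2)))"
    proof (rule sum.cong[OF refl], clarify)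
      fix g h assume "g \<in> carrier G" "h \<in> carrier G"
      then have "z1 = v g \<and> z2 = v h \<longleftrightarrow> z1 \<in> carrier G \<and> z2 \<in> carrier G \<and> g = iA v z1 \<and> h = iA v z2"
        using Aut_props(1)[OF v] Aut_inv[OF v] by metis
      then show "a (g, h) * bv (v g, v h) z =
          a (g, h) * of_bool (z \<in> carrier G \<times> carrier G) * of_bool ((g, h) = (iA v z1, iA v z2))"
        by (auto simp: z bv_def)
    qed
    also have "\<dots> = of_bool ((iA v z1, iA v z2) \<in> carrier G \<times> carrier G) *
        (a (iA v z1, iA v z2) * of_bool (z \<in> carrier G \<times> carrier G))"
      by (rule sum_of_bool_delta(2)) (use fin in simp)
    also have "\<dots> = dpull (iA v) a z"
      using Aut_props(1)[OF Aut_inv(1)[OF v]] by (auto simp: z pull_def)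
    finally show ?thesis .
  qed
  then show ?thesis unfolding V_map_def by (auto simp: fun_eq_iff)
qed

lemma sum_bv_V:
  assumes v: "v \<in> Aut"
  shows "(\<lambda>z. \<Sum>(g, h)\<in>carrier G \<times> carrier G. a (g, h) * bv (v g, v h) z) = dpull (iA v) (a :: _ \<Rightarrow> 'k::field)"
proof -
  let ?a = "\<lambda>p. a p * of_bool (p \<in> carrier G \<times> carrier G)"
  have "?a \<in> hcar (DG G)" by (rule hcarI) simp
  then have "V_map G v ?a = dpull (iA v) ?a" by (simp add: V_map_eq[OF v])
  moreover have "V_map G v ?a = (\<lambda>z. \<Sum>(g, h)\<in>carrier G \<times> carrier G. a (g, h) * bv (v g, v h) z)"
    using \<open>?a \<in> hcar (DG G)\<close> unfolding V_map_def by (auto simp: fun_eq_iff intro!: sum.cong)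
  moreover have "dpull (iA v) ?a = dpull (iA v) a"
    using Aut_props(1)[OF Aut_inv(1)[OF v]] by (auto simp: pull_def fun_eq_iff)
  ultimately show ?thesis by simp
qed

subsection \<open>The matrix of the automorphism defined by \<open>v\<close>\<close>

lemma sw_kdG_bv:
  assumes x: "x \<in> carrier G"
  shows "sw (kdG G) (bv x) F = (\<Sum>p\<in>carrier G. F (bv p) (bv (inv p \<otimes> x)) :: 'k::field)"
proof -
  have "sw (kdG G) (bv x) F = (\<Sum>p\<in>carrier G. \<Sum>q\<in>carrier G. of_bool (q = inv p \<otimes> x) * F (bv p) (bv q))"
    unfolding sw_def basis_simps sum.cartesian_product
  proof (rule sum.cong[OF refl], clarify)
    fix p q assume pq: "p \<in> carrier G" "q \<in> carrier G"
    have "p \<otimes> q = x \<longleftrightarrow> q = inv p \<otimes> x" using inv_solve_left[OF pq(2,1) x] by auto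
    then show "comul (kdG G) (bv x) (p, q) * F (bv p) (bv q) = of_bool (q = inv p \<otimes> x) * F (bv p) (bv q)"
      using pq by (simp add: comul_kdG bv_def)
  qed
  also have "\<dots> = (\<Sum>p\<in>carrier G. F (bv p) (bv (inv p \<otimes> x)))"
    by (intro sum.cong refl) (use x in \<open>simp add: sum_of_bool_delta(1)[OF fin]\<close>)
  finally show ?thesis .
qed

lemma mul_kG_bv_right:
  assumes "y \<in> carrier G" "z \<in> carrier G"
  shows "mul (kG G) c (bv y) z = (c (z \<otimes> inv y) :: 'k::field)"
proof -
  have "mul (kG G) c (bv y) z = (\<Sum>x\<in>carrier G. c x * of_bool (x = z \<otimes> inv y))"
    unfolding mul_kG using assms
  proof (simp, intro sum.cong refl)
    fix x assume x: "x \<in> carrier G"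
    have "y = inv x \<otimes> z \<longleftrightarrow> x = z \<otimes> inv y"
      using inv_solve_left[OF assms(1) x assms(2)] inv_solve_right[OF x assms(2,1)] by simp
    then show "c x * bv y (inv x \<otimes> z) = c x * of_bool (x = z \<otimes> inv y)" by (auto simp: bv_def)
  qed
  also have "\<dots> = of_bool (z \<otimes> inv y \<in> carrier G) * c (z \<otimes> inv y)"
    by (rule sum_of_bool_delta(2)[OF fin])
  finally show ?thesis using assms by simp
qed

lemma matrix_map_eval:
  assumes z: "z1 \<in> carrier G" "z2 \<in> carrier G"
  shows "matrix_map G u b a v h (z1, z2) = (\<Sum>(x, g)\<in>carrier G \<times> carrier G. h (x, g) *
      (\<Sum>p\<in>carrier G. u (bv p) z1 * b (bv g) z1 * mul (kG G) (a (bv (inv p \<otimes> x))) (v (bv g)) z2) :: 'k::field)"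
  unfolding matrix_map_def
  by (rule sum.cong[OF refl], clarify) (simp add: sw_kdG_bv tensor_def mul_kdG z)

lemma matrix_map_outside:
  assumes z: "\<not> (z1 \<in> carrier G \<and> z2 \<in> carrier G)"
  shows "matrix_map G u b a v h (z1, z2) = (0 :: 'k::field)"
  unfolding matrix_map_def using z
  by (auto intro!: sum.neutral simp: sw_kdG_bv tensor_def mul_kdG mul_kG)

lemma matrix_map_eval_bv:
  assumes z: "z1 \<in> carrier G" "z2 \<in> carrier G" and x: "x \<in> carrier G" "g \<in> carrier G"
  shows "matrix_map G u b a v (bv (x, g)) (z1, z2) =
      (\<Sum>p\<in>carrier G. u (bv p) z1 * b (bv g) z1 * mul (kG G) (a (bv (inv p \<otimes> x))) (v (bv g)) z2 :: 'k::field)"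
proof -
  have "matrix_map G u b a v (bv (x, g)) (z1, z2) = (\<Sum>y\<in>carrier G \<times> carrier G. of_bool (y = (x, g)) *
      (\<Sum>p\<in>carrier G. u (bv p) z1 * b (bv (snd y)) z1 * mul (kG G) (a (bv (inv p \<otimes> fst y))) (v (bv (snd y))) z2))"
  proof -
    have "bv (x, g) y = (of_bool (y = (x, g)) :: 'k)" for y by (simp add: bv_def)
    then show ?thesis unfolding matrix_map_eval[OF z] case_prod_unfold by simp
  qed
  also have "\<dots> = of_bool ((x, g) \<in> carrier G \<times> carrier G) *
      (\<Sum>p\<in>carrier G. u (bv p) z1 * b (bv (snd (x, g))) z1 * mul (kG G) (a (bv (inv p \<otimes> fst (x, g)))) (v (bv (snd (x, g)))) z2)"
    by (rule sum_of_bool_delta(1)) (use fin in simp)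
  finally show ?thesis using x by simp
qed

text \<open>The case of a trivial off-diagonal, with both diagonal components given by the same map \<open>w\<close>.\<close>

lemma matrix_map_diagonal:
  assumes w: "\<And>x. x \<in> carrier G \<Longrightarrow> w x \<in> carrier G"
    and u: "\<And>x. x \<in> carrier G \<Longrightarrow> u (bv x) = bv (w x)"
    and b: "\<And>g. g \<in> carrier G \<Longrightarrow> b (bv g) = (\<lambda>z. of_bool (z \<in> carrier G))"
    and a: "\<And>x. x \<in> carrier G \<Longrightarrow> a (bv x) = (\<lambda>z. of_bool (x = \<one> \<and> z = \<one>))"
    and v: "\<And>g. g \<in> carrier G \<Longrightarrow> v (bv g) = bv (w g)"
  shows "matrix_map G u b a v h = (\<lambda>z. \<Sum>(x, g)\<in>carrier G \<times> carrier G. h (x, g) * bv (w x, w g) z :: 'k::field)"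
proof
  fix z :: "'a \<times> 'a" obtain z1 z2 where z: "z = (z1, z2)" by (cases z)
  show "matrix_map G u b a v h z = (\<Sum>(x, g)\<in>carrier G \<times> carrier G. h (x, g) * bv (w x, w g) z)"
  proof (cases "z1 \<in> carrier G \<and> z2 \<in> carrier G")
    case True
    then have T: "z1 \<in> carrier G" "z2 \<in> carrier G" by auto
    have "(\<Sum>p\<in>carrier G. u (bv p) z1 * b (bv g) z1 * mul (kG G) (a (bv (inv p \<otimes> x))) (v (bv g)) z2) =
      bv (w x, w g) (z1, z2)" if x: "x \<in> carrier G" "g \<in> carrier G" for x g
    proof -
      have "(\<Sum>p\<in>carrier G. u (bv p) z1 * b (bv g) z1 * mul (kG G) (a (bv (inv p \<otimes> x))) (v (bv g)) z2) =
        (\<Sum>p\<in>carrier G. (bv (w p) z1 * bv (w g) z2) * of_bool (p = x))"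
      proof (rule sum.cong[OF refl])
        fix p assume p: "p \<in> carrier G"
        have 1: "inv p \<otimes> x = \<one> \<longleftrightarrow> p = x"
          using inv_solve_left'[of \<one> p x] p x by auto
        have 2: "z2 \<otimes> inv (w g) = \<one> \<longleftrightarrow> z2 = w g"
          using inv_solve_right'[of \<one> z2 "w g"] T w[OF x(2)] by auto
        show "u (bv p) z1 * b (bv g) z1 * mul (kG G) (a (bv (inv p \<otimes> x))) (v (bv g)) z2 =
            bv (w p) z1 * bv (w g) z2 * of_bool (p = x)"
          using p x T w by (simp add: u b v mul_kG_bv_right a 1 2) (auto simp: bv_def)
      qed
      then show ?thesis using x by (simp only: sum_of_bool_delta(2)[OF fin]) (simp add: bv_def)
    qed
    then show ?thesis unfolding z matrix_map_eval[OF T] by (intro sum.cong) auto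
  next
    case False
    have "bv (w x, w g) z = (0 :: 'k)" if "x \<in> carrier G" "g \<in> carrier G" for x g
      using False w[OF that(1)] w[OF that(2)] by (auto simp: z bv_def)
    then have "(\<Sum>(x, g)\<in>carrier G \<times> carrier G. h (x, g) * bv (w x, w g) z) = 0"
      by (intro sum.neutral) auto
    then show ?thesis using matrix_map_outside[OF False] by (simp add: z)
  qed
qed

text \<open>The components of a Hopf endomorphism are recovered by applying a counit to one tensor
  factor; so \<open>e_x \<times> g \<mapsto> e_{w(x)} \<times> w(g)\<close> has a single matrix.\<close>

lemma matrix_unique:
  fixes u b a :: "('a \<Rightarrow> 'k::field) \<Rightarrow> 'a \<Rightarrow> 'k"
  assumes w: "w \<in> Aut"
    and u: "u \<in> hopf_maps (kdG G) (kdG G)" and b: "b \<in> hopf_maps (kG G) (kdG G)"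
    and a: "a \<in> hopf_maps (kdG G) (kG G)" and v: "v \<in> hom G G" "v \<in> extensional (carrier G)"
    and eq: "\<forall>h\<in>hcar (DG G). V_map G w h = matrix_map G u b a (kmap G v) h"
  shows "x \<in> carrier G \<Longrightarrow> u (bv x) = bv (w x)"
    "g \<in> carrier G \<Longrightarrow> b (bv g) = (\<lambda>z. of_bool (z \<in> carrier G))"
    "x \<in> carrier G \<Longrightarrow> a (bv x) = (\<lambda>z. of_bool (x = \<one> \<and> z = \<one>))"
    "v = w"
proof -
  interpret v: group_hom G G v using v(1) by (simp add: group_hom_def group_hom_axioms_def)
  note wp = Aut_props[OF w]
  have bk: "bv x \<in> hcar (kG G)" "bv x \<in> hcar (kdG G)" if "x \<in> carrier G" for x
    by (rule bv_hcar; use that in simp)+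
  have vb: "kmap G v (bv g) = (bv (v g) :: 'a \<Rightarrow> 'k)" if "g \<in> carrier G" for g
    unfolding kmap_def bv_def[of g] using that by (simp add: fun_eq_iff sum_of_bool_delta(1)[OF fin])
  have main: "(\<Sum>p\<in>carrier G. u (bv p) z1 * b (bv g) z1 * mul (kG G) (a (bv (inv p \<otimes> x))) (bv (v g)) z2) =
      of_bool (z1 = w x \<and> z2 = w g)"
    if x: "x \<in> carrier G" "g \<in> carrier G" and z: "z1 \<in> carrier G" "z2 \<in> carrier G" for x g z1 z2
  proof -
    have m: "bv (x, g) \<in> hcar (DG G)" by (rule bv_hcar) (use x in simp)
    have "matrix_map G u b a (kmap G v) (bv (x, g)) (z1, z2) = V_map G w (bv (x, g)) (z1, z2)"
      by (rule fun_cong[OF bspec[OF eq m], symmetric])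
    also have "\<dots> = of_bool (z1 = w x \<and> z2 = w g)"
      using m x z Aut_eq_iff[OF Aut_inv(1)[OF w]] Aut_inv_inv[OF w]
      by (auto simp: V_map_eq[OF w] pull_def bv_def)
    finally show ?thesis unfolding matrix_map_eval_bv[OF z x] using vb x by simp
  qed
  \<comment> \<open>\<open>\<epsilon>(a(e_q) v(g)) = \<epsilon>(e_q)\<close>\<close>
  have eps: "(\<Sum>z2\<in>carrier G. mul (kG G) (a (bv q)) (bv (v g)) z2) = of_bool (q = \<one>)"
    if q: "q \<in> carrier G" "g \<in> carrier G" for q g
  proof -
    have "(\<Sum>z2\<in>carrier G. mul (kG G) (a (bv q)) (bv (v g)) z2) = (\<Sum>z2\<in>carrier G. a (bv q) (z2 \<otimes> inv (v g)))"
      using q by (intro sum.cong) (auto simp: mul_kG_bv_right)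
    also have "\<dots> = (\<Sum>z\<in>carrier G. a (bv q) z)"
      by (rule sum.reindex_bij_witness[of _ "\<lambda>z. z \<otimes> v g" "\<lambda>z. z \<otimes> inv (v g)"])
        (use q in \<open>auto simp: m_assoc\<close>)
    also have "\<dots> = of_bool (q = \<one>)"
      using hopf_mapsD(8)[OF a bk(2)[OF q(1)]] by (simp add: counit_kG counit_kdG bv_def)
  finally show ?thesis .
  qed
  have b1: "b (bv \<one>) = (\<lambda>x. of_bool (x \<in> carrier G))" using hopf_mapsD(6)[OF b] by simp
  \<comment> \<open>\<open>id \<otimes> \<epsilon>\<close> applied to the image of \<open>e_x \<times> g\<close> leaves \<open>u(e_x) b(g)\<close>.\<close>
  have ub: "u (bv x) z * b (bv g) z = of_bool (z = w x)"
    if x: "x \<in> carrier G" "g \<in> carrier G" and z: "z \<in> carrier G" for x g z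
  proof -
    have "of_bool (z = w x) = (\<Sum>z2\<in>carrier G. of_bool (z = w x \<and> z2 = w g) :: 'k)"
      using sum_of_bool_delta(2)[OF fin, of "\<lambda>_. of_bool (z = w x) :: 'k" "w g"] wp(1)[OF x(2)]
      by (simp add: of_bool_conj)
    also have "\<dots> = (\<Sum>z2\<in>carrier G. \<Sum>p\<in>carrier G. u (bv p) z * b (bv g) z *
        mul (kG G) (a (bv (inv p \<otimes> x))) (bv (v g)) z2)"
      using main[OF x z] by (intro sum.cong) simp_all
    also have "\<dots> = (\<Sum>p\<in>carrier G. u (bv p) z * b (bv g) z *
        (\<Sum>z2\<in>carrier G. mul (kG G) (a (bv (inv p \<otimes> x))) (bv (v g)) z2))"
      by (subst sum.swap) (simp add: sum_distrib_left)
    also have "\<dots> = (\<Sum>p\<in>carrier G. u (bv p) z * b (bv g) z * of_bool (p = x))"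
    proof (rule sum.cong[OF refl])
      fix p assume p: "p \<in> carrier G"
      have "inv p \<otimes> x = \<one> \<longleftrightarrow> p = x" using inv_solve_left'[of \<one> p x] p x by auto
      then show "u (bv p) z * b (bv g) z * (\<Sum>z2\<in>carrier G. mul (kG G) (a (bv (inv p \<otimes> x))) (bv (v g)) z2) =
          u (bv p) z * b (bv g) z * of_bool (p = x)" using eps[of "inv p \<otimes> x" g] p x by simp
    qed
    finally show ?thesis using x by (simp only: sum_of_bool_delta(2)[OF fin]) simp
  qed
  have u': "u (bv x) z = of_bool (z = w x)" if "x \<in> carrier G" "z \<in> carrier G" for x z
    using ub[of x \<one> z] that by (simp add: b1)
  show ux: "u (bv x) = bv (w x)" if x: "x \<in> carrier G" for x
  proof
    fix z show "u (bv x) z = bv (w x) z"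
      using u'[OF x, of z] hcarD[OF hopf_mapsD(1)[OF u bk(2)[OF x]], of z] wp(1)[OF x]
      by (cases "z \<in> carrier G") (auto simp: bv_def)
  qed
  show bg: "b (bv g) = (\<lambda>z. of_bool (z \<in> carrier G))" if g: "g \<in> carrier G" for g
  proof
    fix z show "b (bv g) z = of_bool (z \<in> carrier G)"
    proof (cases "z \<in> carrier G")
      case True
      then have "iA w z \<in> carrier G" using Aut_props(1)[OF Aut_inv(1)[OF w]] by simp
      then show ?thesis using ub[of "iA w z" g z] u'[of "iA w z" z] True g Aut_inv(3)[OF w True] by simp
    next
      case False
      then show ?thesis using hcarD[OF hopf_mapsD(1)[OF b bk(1)[OF g]], of z] by simp
    qed
  qed
  \<comment> \<open>Evaluation of the first factor at 1, which is the counit of \<open>k\<^sup>G\<close>, leaves \<open>a(e_x) v(g)\<close>.\<close>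
  have av: "a (bv x) (z \<otimes> inv (v g)) = of_bool (x = \<one> \<and> z = w g)"
    if x: "x \<in> carrier G" "g \<in> carrier G" and z: "z \<in> carrier G" for x g z
  proof -
    have e: "\<one> = w p \<longleftrightarrow> p = \<one>" if "p \<in> carrier G" for p
      using Aut_eq_iff(2)[OF w that one_closed] wp(3) by auto
    have "of_bool (x = \<one> \<and> z = w g) = (\<Sum>p\<in>carrier G. u (bv p) \<one> * b (bv g) \<one> *
        mul (kG G) (a (bv (inv p \<otimes> x))) (bv (v g)) z)"
      using main[OF x one_closed z] e[OF x(1)] by simp
    also have "\<dots> = (\<Sum>p\<in>carrier G. of_bool (p = \<one>) * a (bv (inv p \<otimes> x)) (z \<otimes> inv (v g)))"
      using x z by (intro sum.cong refl) (simp add: ux bg mul_kG_bv_right bv_def[of "w _"] e)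
    also have "\<dots> = of_bool (\<one> \<in> carrier G) * a (bv (inv \<one> \<otimes> x)) (z \<otimes> inv (v g))"
      by (rule sum_of_bool_delta(1)[OF fin])
    finally show ?thesis using x by simp
  qed
  have a': "a (bv x) z = of_bool (x = \<one> \<and> z = \<one>)" if "x \<in> carrier G" "z \<in> carrier G" for x z
    using av[of x \<one> z] that wp(3) by simp
  show "a (bv x) = (\<lambda>z. of_bool (x = \<one> \<and> z = \<one>))" if x: "x \<in> carrier G" for x
  proof
    fix z show "a (bv x) z = of_bool (x = \<one> \<and> z = \<one>)"
      using a'[OF x, of z] hcarD[OF hopf_mapsD(1)[OF a bk(2)[OF x]], of z]
      by (cases "z \<in> carrier G") auto
  qed
  show "v = w"
  proof (rule extensionalityI[OF v(2) wp(6)])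
    fix g assume g: "g \<in> carrier G"
    have "a (bv \<one>) (w g \<otimes> inv (v g)) = 1" using av[of \<one> g "w g"] wp(1)[OF g] g by simp
    then have "w g \<otimes> inv (v g) = \<one>" using a'[of \<one> "w g \<otimes> inv (v g)"] wp(1)[OF g] g by auto
    then show "v g = w g" using inv_solve_right'[of \<one> "w g" "v g"] wp(1)[OF g] g by auto
  qed
qed

lemma matrix_exists:
  assumes w: "w \<in> Aut"
  defines "u \<equiv> \<lambda>f\<in>hcar (kdG G). pull (carrier G) (iA w) (f :: 'a \<Rightarrow> 'k::field)"
    and "b \<equiv> \<lambda>f\<in>hcar (kG G). (\<lambda>z. of_bool (z \<in> carrier G) * (\<Sum>x\<in>carrier G. f x :: 'k))"
    and "a \<equiv> \<lambda>f\<in>hcar (kdG G). (\<lambda>z. (f \<one> :: 'k) * of_bool (z = \<one>))"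
  shows "u \<in> hopf_maps (kdG G) (kdG G)" "b \<in> hopf_maps (kG G) (kdG G)" "a \<in> hopf_maps (kdG G) (kG G)"
    "\<forall>h\<in>hcar (DG G). V_map G w h = matrix_map G u b a (kmap G w) h"
proof -
  let ?i = "iA w"
  note i = Aut_inv(1)[OF w] note ip = Aut_props[OF i] note wp = Aut_props[OF w]
  have bk: "bv x \<in> hcar (kG G)" "bv x \<in> hcar (kdG G)" if "x \<in> carrier G" for x
    by (rule bv_hcar; use that in simp)+
  show "u \<in> hopf_maps (kdG G) (kdG G)"
    unfolding u_def
  proof (rule hopf_mapsI)
    fix f :: "'a \<Rightarrow> 'k" assume "f \<in> hcar (kdG G)"
    have "map2 (kdG G) (pull (carrier G) ?i) (comul (kdG G) f) =
        pull (basis (kdG G :: ('a, 'k) hopf) \<times> basis (kdG G :: ('a, 'k) hopf)) (map_prod ?i ?i) (comul (kdG G) f)"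
      by (rule map2_pull) (use ip(1) fin in auto)
    then show "comul (kdG G) (pull (carrier G) ?i f) = map2 (kdG G) (pull (carrier G) ?i) (comul (kdG G) f)"
      using ip by (auto simp: fun_eq_iff comul_kdG pull_def)
  qed (use ip in \<open>auto simp: pull_def fun_eq_iff mul_kdG counit_kdG hcar_def split: if_splits\<close>)
  show "b \<in> hopf_maps (kG G) (kdG G)"
    unfolding b_def
  proof (rule hopf_mapsI)
    fix f g :: "'a \<Rightarrow> 'k"
    have "(\<Sum>z\<in>carrier G. mul (kG G) f g z) = (\<Sum>z\<in>carrier G. \<Sum>x\<in>carrier G. f x * g (inv x \<otimes> z))"
      by (intro sum.cong) (simp_all add: mul_kG)
    also have "\<dots> = (\<Sum>x\<in>carrier G. \<Sum>z\<in>carrier G. f x * g (inv x \<otimes> z))" by (rule sum.swap)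
    also have "\<dots> = (\<Sum>x\<in>carrier G. \<Sum>z\<in>carrier G. f x * g z)"
    proof (rule sum.cong[OF refl])
      fix x assume "x \<in> carrier G"
      then show "(\<Sum>z\<in>carrier G. f x * g (inv x \<otimes> z)) = (\<Sum>z\<in>carrier G. f x * g z)"
        using sum_left_translate[of "inv x" "\<lambda>z. f x * g z"] by simp
    qed
    also have "\<dots> = (\<Sum>x\<in>carrier G. f x) * (\<Sum>x\<in>carrier G. g x)" by (simp add: sum_product)
    finally show "(\<lambda>z. of_bool (z \<in> carrier G) * (\<Sum>x\<in>carrier G. mul (kG G) f g x)) =
      mul (kdG G) (\<lambda>z. of_bool (z \<in> carrier G) * (\<Sum>x\<in>carrier G. f x)) (\<lambda>z. of_bool (z \<in> carrier G) * (\<Sum>x\<in>carrier G. g x))"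
      by (auto simp: fun_eq_iff mul_kdG)
    show "comul (kdG G) (\<lambda>z. of_bool (z \<in> carrier G) * (\<Sum>x\<in>carrier G. f x)) =
        map2 (kG G) (\<lambda>f z. of_bool (z \<in> carrier G) * (\<Sum>x\<in>carrier G. f x)) (comul (kG G) f)"
    proof
      fix p :: "'a \<times> 'a" obtain z z' where p: "p = (z, z')" by (cases p)
      have s1: "(\<Sum>y\<in>carrier G. bv x y :: 'k) = of_bool (x \<in> carrier G)" for x
        unfolding bv_def using sum_of_bool_delta(1)[OF fin, of x "\<lambda>_. 1 :: 'k"] by simp
      have "map2 (kG G) (\<lambda>f z. of_bool (z \<in> carrier G) * (\<Sum>x\<in>carrier G. f x)) (comul (kG G) f) p =
        (\<Sum>x\<in>carrier G. \<Sum>y\<in>carrier G. of_bool (x = y) * (f x * of_bool (z \<in> carrier G \<and> z' \<in> carrier G)))"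
        unfolding map2_def p prod.case basis_simps sum.cartesian_product
        by (rule sum.cong) (auto simp: comul_kG s1)
      also have "\<dots> = (\<Sum>x\<in>carrier G. f x * of_bool (z \<in> carrier G \<and> z' \<in> carrier G))"
        by (rule sum.cong[OF refl]) (simp add: sum_of_bool_delta(3)[OF fin])
      finally show "comul (kdG G) (\<lambda>z. of_bool (z \<in> carrier G) * (\<Sum>x\<in>carrier G. f x)) p =
        map2 (kG G) (\<lambda>f z. of_bool (z \<in> carrier G) * (\<Sum>x\<in>carrier G. f x)) (comul (kG G) f) p"
        by (simp add: p comul_kdG sum_distrib_right)
    qed
  next
    show "(\<lambda>z. of_bool (z \<in> carrier G) * (\<Sum>x\<in>carrier G. hone (kG G) x)) = (hone (kdG G) :: 'a \<Rightarrow> 'k)"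
      using sum_of_bool_delta(1)[OF fin, of \<one> "\<lambda>_. 1 :: 'k"] by (simp add: fun_eq_iff bv_def)
  qed (auto simp: fun_eq_iff hcar_def sum.distrib algebra_simps sum_distrib_left mul_kG
      counit_kdG counit_kG bv_def split: if_splits)
  show "a \<in> hopf_maps (kdG G) (kG G)"
    unfolding a_def
  proof (rule hopf_mapsI)
    fix f g :: "'a \<Rightarrow> 'k" assume fg: "f \<in> hcar (kdG G)" "g \<in> hcar (kdG G)"
    have b1: "(\<lambda>z. g \<one> * of_bool (z = \<one>)) = (\<lambda>z. g \<one> * bv \<one> z)" for g :: "'a \<Rightarrow> 'k"
      by (simp add: bv_def)
    have "mul (kG G) (\<lambda>z. f \<one> * of_bool (z = \<one>)) (\<lambda>z. g \<one> * of_bool (z = \<one>)) z = f \<one> * g \<one> * of_bool (z = \<one>)" for z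
    proof (cases "z \<in> carrier G")
      case True
      have "mul (kG G) (\<lambda>z. f \<one> * of_bool (z = \<one>)) (\<lambda>z. g \<one> * of_bool (z = \<one>)) z =
        (\<Sum>x\<in>carrier G. of_bool (x = \<one>) * (f \<one> * (g \<one> * of_bool (inv x \<otimes> z = \<one>))))"
        using True by (simp add: mul_kG mult_ac)
      also have "\<dots> = of_bool (\<one> \<in> carrier G) * (f \<one> * (g \<one> * of_bool (inv \<one> \<otimes> z = \<one>)))"
        by (rule sum_of_bool_delta(1)[OF fin])
      finally show ?thesis using True by simp
    qed (auto simp: mul_kG)
    then show "(\<lambda>z. mul (kdG G) f g \<one> * of_bool (z = \<one>)) =
        mul (kG G) (\<lambda>z. f \<one> * of_bool (z = \<one>)) (\<lambda>z. g \<one> * of_bool (z = \<one>))"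
      by (simp add: fun_eq_iff mul_kdG)
    show "comul (kG G) (\<lambda>z. f \<one> * of_bool (z = \<one>)) = map2 (kdG G) (\<lambda>f z. f \<one> * of_bool (z = \<one>)) (comul (kdG G) f)"
    proof
      fix p :: "'a \<times> 'a" obtain z z' where p: "p = (z, z')" by (cases p)
      have "map2 (kdG G) (\<lambda>f z. f \<one> * of_bool (z = \<one>)) (comul (kdG G) f) p =
        (\<Sum>x\<in>carrier G \<times> carrier G. (f \<one> * of_bool (z = \<one> \<and> z' = \<one>)) * of_bool (x = (\<one>, \<one>)))"
        unfolding map2_def p prod.case basis_simps
        by (rule sum.cong) (auto simp: comul_kdG bv_def)
      also have "\<dots> = of_bool ((\<one>, \<one>) \<in> carrier G \<times> carrier G) * (f \<one> * of_bool (z = \<one> \<and> z' = \<one>))"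
        by (rule sum_of_bool_delta(2)) (use fin in simp)
      finally show "comul (kG G) (\<lambda>z. f \<one> * of_bool (z = \<one>)) p =
          map2 (kdG G) (\<lambda>f z. f \<one> * of_bool (z = \<one>)) (comul (kdG G) f) p"
        by (auto simp: p comul_kG)
    qed
    show "counit (kG G) (\<lambda>z. f \<one> * of_bool (z = \<one>)) = counit (kdG G) f"
      by (simp only: counit_kG counit_kdG sum_of_bool_delta(2)[OF fin]) simp
  qed (auto simp: fun_eq_iff hcar_def mul_kdG algebra_simps bv_def)
  show "\<forall>h\<in>hcar (DG G). V_map G w h = matrix_map G u b a (kmap G w) h"
  proof
    fix h :: "'a \<times> 'a \<Rightarrow> 'k" assume h: "h \<in> hcar (DG G)"
    have "matrix_map G u b a (kmap G w) h =
      (\<lambda>z. \<Sum>(x, g)\<in>carrier G \<times> carrier G. h (x, g) * bv (w x, w g) z)"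
    proof (rule matrix_map_diagonal)
      fix x assume x: "x \<in> carrier G"
      show "w x \<in> carrier G" by (rule wp(1)[OF x])
      show "u (bv x) = bv (w x)"
        unfolding u_def using bk[OF x] Aut_eq_iff(1)[OF i] Aut_inv_inv[OF w] wp(1)[OF x] x
        by (auto simp: fun_eq_iff pull_def bv_def)
      show "b (bv x) = (\<lambda>z. of_bool (z \<in> carrier G))"
        unfolding b_def using bk[OF x] sum_of_bool_delta(1)[OF fin, of x "\<lambda>_. 1 :: 'k"] x
        by (auto simp: fun_eq_iff bv_def)
      show "a (bv x) = (\<lambda>z. of_bool (x = \<one> \<and> z = \<one>))"
        unfolding a_def using bk[OF x] by (auto simp: fun_eq_iff bv_def)
      show "kmap G w (bv x) = (bv (w x) :: 'a \<Rightarrow> 'k)"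
        unfolding kmap_def bv_def[of x] using x by (simp add: fun_eq_iff sum_of_bool_delta(1)[OF fin])
    qed
    then show "V_map G w h = matrix_map G u b a (kmap G w) h" using h by (simp add: V_map_def)
  qed
qed

text \<open>The dual of the matrix of \<open>w\<close> is the matrix of \<open>w\<^sup>-\<^sup>1\<close>.\<close>

lemma dagger_V_map:
  assumes w: "w \<in> Aut"
  shows "dagger G (V_map G w) h = dpull w (h :: _ \<Rightarrow> 'k::field)"
proof -
  define u where "u = (\<lambda>f\<in>hcar (kdG G). pull (carrier G) (iA w) (f :: 'a \<Rightarrow> 'k))"
  define b where "b = (\<lambda>f\<in>hcar (kG G). (\<lambda>z. of_bool (z \<in> carrier G) * (\<Sum>x\<in>carrier G. f x :: 'k)))"
  define a where "a = (\<lambda>f\<in>hcar (kdG G). (\<lambda>z. (f \<one> :: 'k) * of_bool (z = \<one>)))"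
  note ex = matrix_exists[OF w, where 'k = 'k, folded u_def b_def a_def]
  note wp = Aut_props[OF w]
  note un = matrix_unique[OF w ex(1-3) wp(7,6) ex(4)]
  let ?Q = "\<lambda>(u, b, a, v). u \<in> hopf_maps (kdG G) (kdG G) \<and> b \<in> hopf_maps (kG G) (kdG G) \<and>
        a \<in> hopf_maps (kdG G) (kG G) \<and> v \<in> hom G G \<and> v \<in> extensional (carrier G) \<and>
        (\<forall>h\<in>hcar (DG G). V_map G w h = matrix_map G u b a (kmap G v) (h :: _ \<Rightarrow> 'k))"
  have the: "(THE q. ?Q q) = (u, b, a, w)"
  proof (rule the_equality)
    show "?Q (u, b, a, w)" using ex wp by simp
    fix q assume q: "?Q q"
    obtain u' b' a' v' where q': "q = (u', b', a', v')" by (metis surj_pair)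
    have Q: "u' \<in> hopf_maps (kdG G) (kdG G)" "b' \<in> hopf_maps (kG G) (kdG G)"
        "a' \<in> hopf_maps (kdG G) (kG G)" "v' \<in> hom G G" "v' \<in> extensional (carrier G)"
        "\<forall>h\<in>hcar (DG G). V_map G w h = matrix_map G u' b' a' (kmap G v') h"
      using q by (simp_all add: q')
    note un' = matrix_unique[OF w Q]
    have "u' = u" by (rule hopf_maps_eqI[OF _ Q(1) ex(1)]) (use fin un(1) un'(1) in simp_all)
    moreover have "b' = b" by (rule hopf_maps_eqI[OF _ Q(2) ex(2)]) (use fin un(2) un'(2) in simp_all)
    moreover have "a' = a" by (rule hopf_maps_eqI[OF _ Q(3) ex(3)]) (use fin un(3) un'(3) in simp_all)
    ultimately show "q = (u, b, a, w)" using un'(4) by (simp add: q')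
  qed
  have km: "kmap G w (bv x) = (bv (w x) :: 'a \<Rightarrow> 'k)" if "x \<in> carrier G" for x
    unfolding kmap_def bv_def[of x] using that by (simp add: fun_eq_iff sum_of_bool_delta(1)[OF fin])
  note i = Aut_inv(1)[OF w]
  have ew: "y = w x \<longleftrightarrow> x = iA w y" if "x \<in> carrier G" "y \<in> carrier G" for x y
    using Aut_eq_iff(1)[OF w that] by auto
  have d1: "(\<Sum>y\<in>carrier G. bv p y * bv (w x) y) = (of_bool (x = iA w p) :: 'k)"
    if "p \<in> carrier G" "x \<in> carrier G" for p x
    unfolding bv_def[of p] using that by (simp add: sum_of_bool_delta(1)[OF fin] bv_def ew)
  have "dagger G (V_map G w) h = matrix_map G (dual_map (kG G) (kG G) (kmap G w)) (dual_map (kG G) (kdG G) b)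
        (dual_map (kdG G) (kG G) a) (dual_map (kdG G) (kdG G) u) h"
    unfolding dagger_def the prod.case ..
  also have "\<dots> = (\<lambda>z. \<Sum>(x, g)\<in>carrier G \<times> carrier G. h (x, g) * bv (iA w x, iA w g) z)"
  proof (rule matrix_map_diagonal)
    fix p assume p: "p \<in> carrier G"
    show ip: "iA w p \<in> carrier G" by (rule Aut_props(1)[OF i p])
    show "dual_map (kG G) (kG G) (kmap G w) (bv p) = (bv (iA w p) :: 'a \<Rightarrow> 'k)"
      using d1[OF p] ip by (auto simp: dual_map_def fun_eq_iff km bv_def[of "iA w p"])
    show "dual_map (kdG G) (kdG G) u (bv p) = bv (iA w p)"
      using d1[OF p] ip by (auto simp: dual_map_def fun_eq_iff un(1) bv_def[of "iA w p"])
    show "dual_map (kG G) (kdG G) b (bv p) = (\<lambda>z. of_bool (z \<in> carrier G))"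
      unfolding dual_map_def bv_def[of p]
      using p sum_of_bool_delta(1)[OF fin, of p "\<lambda>_. 1 :: 'k"] by (auto simp: fun_eq_iff un(2))
    have "(\<Sum>y\<in>carrier G. bv p y * of_bool (x = \<one> \<and> y = \<one>)) = (of_bool (p = \<one> \<and> x = \<one>) :: 'k)" for x
      unfolding bv_def[of p] using p by (simp only: sum_of_bool_delta(1)[OF fin]) auto
    then show "dual_map (kdG G) (kG G) a (bv p) = (\<lambda>z. of_bool (p = \<one> \<and> z = \<one>))"
      by (auto simp: dual_map_def fun_eq_iff un(3))
  qed
  also have "\<dots> = dpull (iA (iA w)) h" by (rule sum_bv_V[OF i])
  finally show ?thesis by (simp add: Aut_inv_inv[OF w])
qed

end

section \<open>The functor of an automorphism is strict monoidal and braided\<close>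

lemma assoc_facts:
  assumes M: "module kring M" and N: "module kring N" and P: "module kring P"
  shows "assoc H M N P \<in> lin_maps (tensor_space (tensor_space M N) P) (tensor_space M (tensor_space N P))"
proof -
  have MN: "module kring (tensor_space M N)" and NP: "module kring (tensor_space N P)"
    by (rule module_tensor_space; fact)+
  obtain T where T: "T \<in> lin_maps (tensor_space (tensor_space M N) P) (tensor_space M (tensor_space N P))"
    "\<forall>m\<in>carrier M. \<forall>n\<in>carrier N. \<forall>p\<in>carrier P.
       T (tens (tensor_space M N) P (tens M N m n) p) = tens M (tensor_space N P) m (tens N P n p)"
    using assoc_exists[OF M N P] by auto
  have "assoc H M N P = restrict T (carrier (tensor_space (tensor_space M N) P))"
    unfolding assoc_def hmod_tensor_def tensor_space_with_act
    by (rule lin_by_unique[OF module_tensor_space[OF MN P] module_tensor_space[OF M NP]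
          spanning_tensor3[OF M N P] T(1)]) (use T(2) in auto)
  then show ?thesis
    using lin_maps_cong[OF T(1) module_tensor_space[OF MN P], of "assoc H M N P"] by simp
qed

lemma bilin_flip: "bilin M N P f \<Longrightarrow> bilin N M P (\<lambda>n m. f m n)"
  unfolding bilin_def by simp

context fin_group
begin

lemma finite_basis_DG: "finite (basis (DG G :: ('a \<times> 'a, 'k::field) hopf))"
  using fin by simp

lemma lin_action_tensor_DG:
  assumes "lin_action (DG G) M" "lin_action (DG G) N"
  shows "lin_action (DG G) (hmod_tensor (DG G) M N)"
  by (rule lin_action_hmod_tensor[OF finite_basis_DG assms hone_DG_hcar comul_hone_DG comul_DG_forms2])

lemma lin_action_unit: "lin_action (DG G) (hmod_unit (DG G) :: ('k::field, _, _) hmodule)"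
proof -
  let ?U = "hmod_unit (DG G) :: ('k, 'a \<times> 'a \<Rightarrow> 'k, 'k) hmodule"
  have [simp]: "carrier ?U = UNIV" "\<zero>\<^bsub>?U\<^esub> = 0" "x \<oplus>\<^bsub>?U\<^esub> y = x + y" "x \<odot>\<^bsub>?U\<^esub> y = x * y"
    "act ?U h x = counit (DG G) h * x" for x y h by (simp_all add: hmod_unit_def)
  have "abelian_group ?U"
  proof (rule abelian_groupI)
    fix x show "\<exists>y\<in>carrier ?U. y \<oplus>\<^bsub>?U\<^esub> x = \<zero>\<^bsub>?U\<^esub>" by (intro bexI[of _ "- x"]) auto
  qed auto
  then have "module kring ?U" by (rule module_kringI) (auto simp: algebra_simps)
  moreover have "counit (DG G) (\<lambda>x. h x + h' x) = (counit (DG G) h + counit (DG G) h' :: 'k)"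
    "counit (DG G) (\<lambda>x. c * h x) = (c * counit (DG G) h :: 'k)" for h h' :: "'a \<times> 'a \<Rightarrow> 'k" and c
    by (simp_all add: counit_DG sum.distrib sum_distrib_left)
  ultimately show ?thesis
    unfolding lin_action_def
    by (auto intro!: lin_mapsI simp del: free_space_simps(1) hone_simps simp: algebra_simps counit_hone_DG)
qed

lemma finite_GG: "finite (carrier G \<times> carrier G)"
  using fin by simp

lemma counit_DGd_bv: "counit (DGd G) (bv x) = (hone (DG G) x :: 'k::field)"
proof -
  have "counit (DGd G) (bv x) = (\<Sum>y\<in>carrier G \<times> carrier G. of_bool (y = x) * of_bool (snd x = \<one>) :: 'k)"
    unfolding counit_def basis_simps by (rule sum.cong) (auto simp: DGd_def bv_def)
  also have "\<dots> = of_bool (x \<in> carrier G \<times> carrier G) * of_bool (snd x = \<one>)"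
    by (rule sum_of_bool_delta(1)[OF finite_GG])
  finally show ?thesis by (cases x) auto
qed

lemma conv2_one_DGd: "conv2_one (DGd G) = (tensor (hone (DG G)) (hone (DG G)) :: _ \<Rightarrow> 'k::field)"
  unfolding conv2_one_def counit_DGd_bv by (auto simp: tensor_def fun_eq_iff)

lemma Z2L_one: "\<one>\<^bsub>Z2L (DGd G)\<^esub> = (tensor (hone (DG G)) (hone (DG G)) :: _ \<Rightarrow> 'k::field)"
  using conv2_one_DGd by (simp add: Z2L_def)

text \<open>The element \<open>1 \<otimes> 1\<close> acts as the identity.\<close>

lemma J_map_trivial:
  fixes M :: "('k::field, 'a \<times> 'a \<Rightarrow> 'k, 'm) hmodule" and N :: "('k, 'a \<times> 'a \<Rightarrow> 'k, 'n) hmodule"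
  assumes M: "lin_action (DG G) M" and N: "lin_action (DG G) N"
  shows "J_map G \<phi> \<one>\<^bsub>Z2L (DGd G)\<^esub> M N = (\<lambda>t\<in>carrier (tensor_space M N). t)"
proof -
  note mM = lin_actionD(1)[OF M] and mN = lin_actionD(1)[OF N]
  note mT = module_tensor_space[OF mM mN]
  have "J_map G \<phi> \<one>\<^bsub>Z2L (DGd G)\<^esub> M N = lin_by (tensor_space M N) (tensor_space M N) (carrier M \<times> carrier N)
      (\<lambda>(m, n). tens M N m n) (\<lambda>(m, n). act2 (DG G) M N (tensor (hone (DG G)) (hone (DG G))) m n)"
    unfolding J_map_def Z2L_one tensor_space_F_obj lin_by_F_obj by (simp add: hmod_tensor_def)
  also have "\<dots> = (\<lambda>t\<in>carrier (tensor_space M N). t)"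
    by (rule lin_by_unique[OF mT mT spanning_tensor_space[OF mM mN] lin_maps_ident])
      (auto simp: act2_tensor[OF finite_basis_DG M N] lin_actionD(4)[OF M] lin_actionD(4)[OF N]
        simp del: hone_simps)
  finally show ?thesis .
qed

lemma is_hmodule_F_obj:
  assumes v: "v \<in> Aut" and M: "is_hmodule (DG G) (M :: ('k::field, 'a \<times> 'a \<Rightarrow> 'k, 'm) hmodule)"
  shows "is_hmodule (DG G) (F_obj G (V_map G v) M)"
proof -
  have "dpull v (\<lambda>x. h x + h' x) = (\<lambda>x. dpull v h x + dpull v h' x)"
    "dpull v (\<lambda>x. c * h x) = (\<lambda>x. c * dpull v h x)" for h h' :: "'a \<times> 'a \<Rightarrow> 'k" and c
    by (simp_all add: pull_def fun_eq_iff)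
  then show ?thesis
    using M module_F_obj[of M G "V_map G v"]
    unfolding is_hmodule_def by (simp add: dagger_V_map[OF v] dpull_mul[OF v] dpull_hone[OF v] del: hone_simps)
qed

text \<open>Acting by \<open>s\<close> on twisted modules is acting by \<open>(v\<^sup>-\<^sup>1 \<otimes> v\<^sup>-\<^sup>1)(s)\<close> on the original ones.\<close>

lemma act2_F_obj:
  fixes M :: "('k::field, 'a \<times> 'a \<Rightarrow> 'k, 'm) hmodule" and N :: "('k, 'a \<times> 'a \<Rightarrow> 'k, 'n) hmodule"
  assumes v: "v \<in> Aut" and M: "is_hmodule (DG G) M" and N: "is_hmodule (DG G) N"
    and m: "m \<in> carrier M" and n: "n \<in> carrier N" and s: "s \<in> forms2 (DG G)"
  shows "act2 (DG G) (F_obj G (V_map G v) M) (F_obj G (V_map G v) N) s m n = act2 (DG G) M N (dpull2 v s) m n"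
proof -
  let ?B = "basis (DG G :: ('a \<times> 'a, 'k) hopf)"
  let ?F = "free_space (?B \<times> ?B) :: ('k, _) module"
  let ?V = "V_map G v :: ('a \<times> 'a \<Rightarrow> 'k) \<Rightarrow> _"
  note aM = is_hmodule_lin_action[OF finite_basis_DG M] and aN = is_hmodule_lin_action[OF finite_basis_DG N]
  note aFM = is_hmodule_lin_action[OF finite_basis_DG is_hmodule_F_obj[OF v M]]
    and aFN = is_hmodule_lin_action[OF finite_basis_DG is_hmodule_F_obj[OF v N]]
  have "dpull2 v \<in> lin_maps ?F ?F"
    by (rule lin_mapsI; unfold forms2_free_space[OF finite_basis_DG])
      (auto simp: forms2_def pull_def fun_eq_iff)
  note L1 = lin_maps_comp[OF this act2_lin(1)[OF finite_basis_DG aM aN m n]]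
  have L2: "(\<lambda>s. act2 (DG G) (F_obj G ?V M) (F_obj G ?V N) s m n) \<in> lin_maps ?F (tensor_space M N)"
    using act2_lin(1)[OF finite_basis_DG aFM aFN, of m n] m n by simp
  show ?thesis
  proof (rule lin_maps_eq_on_spanning[OF L2 L1 module_free_space
        module_tensor_space[OF lin_actionD(1)[OF aM] lin_actionD(1)[OF aN]] spanning_free_space])
    show "s \<in> carrier ?F" using s unfolding forms2_free_space[OF finite_basis_DG] .
    fix s :: "('a \<times> 'a) \<times> 'a \<times> 'a \<Rightarrow> 'k" assume "s \<in> bv ` (?B \<times> ?B)"
    then obtain x y where xy: "x \<in> ?B" "y \<in> ?B" "s = bv (x, y)" by auto
    have "act2 (DG G) (F_obj G ?V M) (F_obj G ?V N) s m n = tens M N (act M (dpull v (bv x)) m) (act N (dpull v (bv y)) n)"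
      using act2_lin(2)[OF finite_basis_DG aFM aFN _ _ xy(1,2), of m n] m n
      by (simp add: xy(3) dagger_V_map[OF v])
    also have "\<dots> = act2 (DG G) M N (dpull2 v (tensor (bv x) (bv y))) m n"
      unfolding dpull_tensor by (rule act2_tensor[OF finite_basis_DG aM aN m n, symmetric]) simp_all
    finally show "act2 (DG G) (F_obj G ?V M) (F_obj G ?V N) s m n = act2 (DG G) M N (dpull2 v s) m n"
      by (simp only: xy(3) tensor_bv)
  qed
qed

lemma act_hmod_tensor_F_obj:
  assumes v: "v \<in> Aut" and M: "is_hmodule (DG G) M" and N: "is_hmodule (DG G) N"
  shows "act (hmod_tensor (DG G) (F_obj G (V_map G v) M) (F_obj G (V_map G v) N)) h =
    act (hmod_tensor (DG G) M N) (dpull v (h :: _ \<Rightarrow> 'k::field))"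
  unfolding hmod_tensor_def with_act_simps tensor_space_F_obj F_obj_simps
  by (rule lin_by_cong) (auto simp: act2_F_obj[OF v M N _ _ comul_DG_forms2] dpull_comul[OF v])

lemma monoidal_V_map:
  fixes M :: "('k::field, 'a \<times> 'a \<Rightarrow> 'k, 'm) hmodule" and N :: "('k, 'a \<times> 'a \<Rightarrow> 'k, 'n) hmodule"
    and P :: "('k, 'a \<times> 'a \<Rightarrow> 'k, 'p) hmodule" and M' :: "('k, 'a \<times> 'a \<Rightarrow> 'k, 'm1) hmodule"
    and N' :: "('k, 'a \<times> 'a \<Rightarrow> 'k, 'n1) hmodule"
  assumes v: "v \<in> Aut" and M: "is_hmodule (DG G) M" and N: "is_hmodule (DG G) N"
    and P: "is_hmodule (DG G) P" and M': "is_hmodule (DG G) M'" and N': "is_hmodule (DG G) N'"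
  shows "monoidal_functor_at G (V_map G v) \<one>\<^bsub>Z2L (DGd G)\<^esub> M N P M' N'"
proof -
  let ?V = "V_map G v :: ('a \<times> 'a \<Rightarrow> 'k) \<Rightarrow> _" and ?D = "DG G :: ('a \<times> 'a, 'k) hopf"
  let ?U = "hmod_unit ?D"
  note la = is_hmodule_lin_action[OF finite_basis_DG]
  note aM = la[OF M] and aN = la[OF N] and aP = la[OF P] and aM' = la[OF M'] and aN' = la[OF N']
  note mM = lin_actionD(1)[OF aM] and mN = lin_actionD(1)[OF aN] and mP = lin_actionD(1)[OF aP]
    and mM' = lin_actionD(1)[OF aM'] and mN' = lin_actionD(1)[OF aN'] and mU = lin_actionD(1)[OF lin_action_unit]
  note mMN = module_tensor_space[OF mM mN] and mNP = module_tensor_space[OF mN mP]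
  have car: "carrier (hmod_tensor ?D A B) = carrier (tensor_space A B)"
    for A :: "('k, 'a \<times> 'a \<Rightarrow> 'k, 'r) hmodule" and B :: "('k, 'a \<times> 'a \<Rightarrow> 'k, 's) hmodule"
    by (simp add: hmod_tensor_def)
  have tl: "tensor_space (hmod_tensor ?D A B) C = tensor_space (tensor_space A B) C"
      "tensor_map (hmod_tensor ?D A B) C = tensor_map (tensor_space A B) C"
    for A :: "('k, 'a \<times> 'a \<Rightarrow> 'k, 'r) hmodule" and B :: "('k, 'a \<times> 'a \<Rightarrow> 'k, 's) hmodule"
      and C :: "('k, 'c, 'x) module_scheme"
    by (simp_all add: hmod_tensor_def fun_eq_iff)
  have tr: "tensor_space C (hmod_tensor ?D A B) = tensor_space C (tensor_space A B)"
      "tensor_map C (hmod_tensor ?D A B) = tensor_map C (tensor_space A B)"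
    for A :: "('k, 'a \<times> 'a \<Rightarrow> 'k, 'r) hmodule" and B :: "('k, 'a \<times> 'a \<Rightarrow> 'k, 's) hmodule"
      and C :: "('k, 'c, 'x) module_scheme"
    by (simp_all add: hmod_tensor_def fun_eq_iff)
  have tm: "tensor_map A B (hmod_tensor ?D C C') E = tensor_map A B (tensor_space C C') E"
      "tensor_map A B E (hmod_tensor ?D C C') = tensor_map A B E (tensor_space C C')"
    for A :: "('k, 'r, 'xr) module_scheme" and B :: "('k, 's, 'xs) module_scheme"
      and C :: "('k, 'a \<times> 'a \<Rightarrow> 'k, 'c) hmodule" and C' :: "('k, 'a \<times> 'a \<Rightarrow> 'k, 'c1) hmodule"
      and E :: "('k, 'e, 'xe) module_scheme"
    by (simp_all add: hmod_tensor_def fun_eq_iff)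
  note J = J_map_trivial
  have 1: "is_hmodule ?D (F_obj G ?V M)" by (rule is_hmodule_F_obj[OF v M])
  have 2: "hmod_homs ?D M M' \<subseteq> hmod_homs ?D (F_obj G ?V M) (F_obj G ?V M')"
    by (auto simp: hmod_homs_def dagger_V_map[OF v])
  have 3: "J_map G ?V \<one>\<^bsub>Z2L (DGd G)\<^esub> M N \<in> hmod_isos ?D (hmod_tensor ?D (F_obj G ?V M) (F_obj G ?V N))
      (F_obj G ?V (hmod_tensor ?D M N))"
  proof -
    have "(\<lambda>t\<in>carrier (tensor_space M N). t) \<in> lin_maps (tensor_space M N) (tensor_space M N)"
      by (rule lin_maps_cong[OF lin_maps_ident mMN]) simp
    moreover have "act (hmod_tensor ?D M N) h t \<in> carrier (tensor_space M N)"
      if "t \<in> carrier (tensor_space M N)" for h t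
      by (rule lin_mapsD(1)[OF hmod_tensor_act(1)[OF finite_basis_DG aM aN] that])
    moreover have "lin_maps (hmod_tensor ?D (F_obj G ?V M) (F_obj G ?V N)) (F_obj G ?V (hmod_tensor ?D M N)) =
        lin_maps (tensor_space M N) (tensor_space M N)"
      unfolding lin_maps_F_obj unfolding hmod_tensor_def by simp
    ultimately show ?thesis
      unfolding hmod_isos_def hmod_homs_def J[OF aM aN] car F_obj_simps tensor_space_F_obj
      by (simp add: act_hmod_tensor_F_obj[OF v M N] dagger_V_map[OF v] bij_betw_def inj_on_def)
  qed
  have 4: "tensor_map M N M' N' f g (J_map G ?V \<one>\<^bsub>Z2L (DGd G)\<^esub> M N t) =
      J_map G ?V \<one>\<^bsub>Z2L (DGd G)\<^esub> M' N' (tensor_map M N M' N' f g t)"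
    if "f \<in> hmod_homs ?D M M'" "g \<in> hmod_homs ?D N N'" "t \<in> carrier (tensor_space M N)" for f g t
  proof -
    have fg: "f \<in> lin_maps M M'" "g \<in> lin_maps N N'" using that by (auto simp: hmod_homs_def)
    show ?thesis
      using that(3) lin_mapsD(1)[OF tensor_map_facts(1)[OF mM mN mM' mN' fg] that(3)]
      by (simp add: J[OF aM aN] J[OF aM' aN'])
  qed
  have assoc: "assoc ?D (F_obj G ?V M) (F_obj G ?V N) (F_obj G ?V P) = assoc ?D M N P"
    by (simp add: assoc_def hmod_tensor_def)
  have 5: "assoc ?D M N P (J_map G ?V \<one>\<^bsub>Z2L (DGd G)\<^esub> (hmod_tensor ?D M N) P
           (tensor_map (tensor_space M N) P (tensor_space M N) P (J_map G ?V \<one>\<^bsub>Z2L (DGd G)\<^esub> M N) id t)) =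
         J_map G ?V \<one>\<^bsub>Z2L (DGd G)\<^esub> M (hmod_tensor ?D N P)
           (tensor_map M (tensor_space N P) M (tensor_space N P) id (J_map G ?V \<one>\<^bsub>Z2L (DGd G)\<^esub> N P) (assoc ?D M N P t))"
    if t: "t \<in> carrier (tensor_space (tensor_space M N) P)" for t
  proof -
    have a: "assoc ?D M N P t \<in> carrier (tensor_space M (tensor_space N P))"
      by (rule lin_mapsD(1)[OF assoc_facts[OF mM mN mP] t])
    have "tensor_map (tensor_space M N) P (tensor_space M N) P (J_map G ?V \<one>\<^bsub>Z2L (DGd G)\<^esub> M N) id t = t"
      by (rule tensor_map_ident[OF mMN mP _ _ t]) (simp_all add: J[OF aM aN])
    moreover have "tensor_map M (tensor_space N P) M (tensor_space N P) id (J_map G ?V \<one>\<^bsub>Z2L (DGd G)\<^esub> N P)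
        (assoc ?D M N P t) = assoc ?D M N P t"
      by (rule tensor_map_ident[OF mM mNP _ _ a]) (simp_all add: J[OF aN aP])
    ultimately show ?thesis
      using t a by (simp add: J[OF lin_action_tensor_DG[OF aM aN] aP] J[OF aM lin_action_tensor_DG[OF aN aP]] tl tr)
  qed
  have 6: "id \<in> hmod_isos ?D ?U (F_obj G ?V ?U)"
    unfolding hmod_isos_def hmod_homs_def lin_maps_F_obj
    by (auto simp: hmod_unit_def dagger_V_map[OF v] dpull_counit[OF v] lin_maps_def)
  have lu: "lunit ?D (F_obj G ?V M) = lunit ?D M" "runit ?D (F_obj G ?V M) = runit ?D M"
    by (simp_all add: lunit_def runit_def)
  have 7: "lunit ?D M (J_map G ?V \<one>\<^bsub>Z2L (DGd G)\<^esub> ?U M (tensor_map ?U M ?U M id id t)) = lunit ?D M t"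
    if t: "t \<in> carrier (tensor_space ?U M)" for t
    using tensor_map_ident[OF mU mM _ _ t, of id id] t by (simp add: J[OF lin_action_unit aM])
  have 8: "runit ?D M (J_map G ?V \<one>\<^bsub>Z2L (DGd G)\<^esub> M ?U (tensor_map M ?U M ?U id id t)) = runit ?D M t"
    if t: "t \<in> carrier (tensor_space M ?U)" for t
    using tensor_map_ident[OF mM mU _ _ t, of id id] t by (simp add: J[OF aM lin_action_unit])
  show ?thesis
    unfolding monoidal_functor_at_def Let_def tensor_map_F_obj car tensor_space_F_obj lu assoc tl tr tm
    using 1 2 3 4 5 6 7 8 by simp
qed

lemma R_matrix_eq:
  "R_matrix G ((a, b), (x, y)) = (of_bool (a \<in> carrier G \<and> b = \<one> \<and> x \<in> carrier G \<and> y = a) :: 'k::field)"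
proof -
  have "R_matrix G ((a, b), (x, y)) =
      (\<Sum>g\<in>carrier G. of_bool (g = a) * of_bool (b = \<one> \<and> x \<in> carrier G \<and> y = a) :: 'k)"
    unfolding R_matrix_def tensor_def by (rule sum.cong) (auto simp: bv_def)
  also have "\<dots> = of_bool (a \<in> carrier G) * of_bool (b = \<one> \<and> x \<in> carrier G \<and> y = a)"
    by (rule sum_of_bool_delta(1)[OF fin])
  finally show ?thesis by auto
qed

lemma braided_V_map:
  fixes M :: "('k::field, 'a \<times> 'a \<Rightarrow> 'k, 'm) hmodule" and N :: "('k, 'a \<times> 'a \<Rightarrow> 'k, 'n) hmodule"
  assumes v: "v \<in> Aut" and M: "is_hmodule (DG G) M" and N: "is_hmodule (DG G) N"
  shows "braided_at G (V_map G v) \<one>\<^bsub>Z2L (DGd G)\<^esub> M N"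
proof -
  let ?V = "V_map G v :: ('a \<times> 'a \<Rightarrow> 'k) \<Rightarrow> _"
  let ?R = "\<lambda>(p, q). R_matrix G (q, p) :: 'k"
  note aM = is_hmodule_lin_action[OF finite_basis_DG M] and aN = is_hmodule_lin_action[OF finite_basis_DG N]
  note mM = lin_actionD(1)[OF aM] and mN = lin_actionD(1)[OF aN]
  have R: "?R \<in> forms2 (DG G)" by (auto simp: forms2_def R_matrix_eq)
  have "dpull2 v ?R = ?R"
  proof
    fix z :: "('a \<times> 'a) \<times> ('a \<times> 'a)"
    obtain x y a b where z: "z = ((x, y), (a, b))" by (metis surj_pair)
    show "dpull2 v ?R z = ?R z"
      using Aut_props(1)[OF v] Aut_eq_iff(2)[OF v] Aut_eq_iff(2)[OF v _ one_closed]
      by (auto simp: z pull_def R_matrix_eq Aut_props(3)[OF v])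
  qed
  then have br: "braiding G (F_obj G ?V M) (F_obj G ?V N) = braiding G M N"
    unfolding braiding_def tensor_space_F_obj F_obj_simps
    by (intro lin_by_cong) (auto simp: act2_F_obj[OF v N M _ _ R])
  have "braiding G M N \<in> lin_maps (tensor_space M N) (tensor_space N M)"
    unfolding braiding_def
    by (rule lin_by_tensor(1)[OF mM mN module_tensor_space[OF mN mM]
          bilin_flip[OF bilin_act2[OF finite_basis_DG aN aM]]])
  then show ?thesis
    unfolding braided_at_def br
    by (auto simp: hmod_tensor_def J_map_trivial[OF aM aN] J_map_trivial[OF aN aM] dest: lin_mapsD(1))
qed

end

section \<open>Simple objects\<close>

context fin_group
begin

context
  fixes g :: 'a and W :: "('k::field, 'w) module" and \<rho> :: "'a \<Rightarrow> 'w \<Rightarrow> 'w"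
  assumes W: "module kring W" and rho: "\<And>c w. c \<in> Cent G g \<Longrightarrow> w \<in> carrier W \<Longrightarrow> \<rho> c w \<in> carrier W"
begin

abbreviation (input) "FG \<equiv> free_space (carrier G) :: ('k, 'a \<Rightarrow> 'k) module"

lemma module_FG_W: "module kring (tensor_space FG W)"
  by (rule module_tensor_space[OF module_free_space W])

lemma Cent_closed: "c \<in> Cent G g \<Longrightarrow> c \<in> carrier G"
  by (simp add: Cent_def)

lemma tens_FG_closed:
  "y \<in> carrier G \<Longrightarrow> w \<in> carrier W \<Longrightarrow> tens FG W (bv y) w \<in> carrier (tensor_space FG W)"
  by (rule tens_closed[OF module_free_space W bv_in_free_space])

lemma ind_rels_carrier:
  "{tens FG W (bv (y \<otimes> c)) w \<ominus>\<^bsub>tensor_space FG W\<^esub> tens FG W (bv y) (\<rho> c w) | y c w.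
      y \<in> carrier G \<and> c \<in> Cent G g \<and> w \<in> carrier W} \<subseteq> carrier (tensor_space FG W)"
proof -
  interpret T: module kring "tensor_space FG W" by (rule module_FG_W)
  show ?thesis using tens_FG_closed Cent_closed rho by auto
qed

lemma submodule_ind_null: "submodule (ind_null G g W \<rho>) kring (tensor_space FG W)"
  unfolding ind_null_def Let_def by (rule subspace_gen_submodule[OF module_FG_W ind_rels_carrier])

lemmas ind_quot = quot_space_facts[OF module_FG_W submodule_ind_null, folded ind_space_def]

lemma ind_tens_lin: "y \<in> carrier G \<Longrightarrow> ind_tens G g W \<rho> y \<in> lin_maps W (ind_space G g W \<rho>)"
  unfolding ind_tens_def[abs_def]
  by (rule lin_maps_comp[OF bilinD(1)[OF bilin_tens[OF module_free_space W] bv_in_free_space] ind_quot(2)])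

lemma ind_tens_closed:
  "y \<in> carrier G \<Longrightarrow> w \<in> carrier W \<Longrightarrow> ind_tens G g W \<rho> y w \<in> carrier (ind_space G g W \<rho>)"
  by (rule lin_mapsD(1)[OF ind_tens_lin])

lemma ind_tens_balanced:
  assumes y: "y \<in> carrier G" and c: "c \<in> Cent G g" and w: "w \<in> carrier W"
  shows "ind_tens G g W \<rho> (y \<otimes> c) w = ind_tens G g W \<rho> y (\<rho> c w)"
proof -
  interpret T: module kring "tensor_space FG W" by (rule module_FG_W)
  interpret V: module kring "ind_space G g W \<rho>" by (rule ind_quot(1))
  let ?s = "tens FG W (bv (y \<otimes> c)) w" and ?t = "tens FG W (bv y) (\<rho> c w)"
  have s: "?s \<in> carrier (tensor_space FG W)" and t: "?t \<in> carrier (tensor_space FG W)"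
    using assms tens_FG_closed Cent_closed rho by auto
  have "?s \<ominus>\<^bsub>tensor_space FG W\<^esub> ?t \<in> ind_null G g W \<rho>"
    unfolding ind_null_def Let_def
    by (rule subsetD[OF subspace_gen_incl]) (use assms in auto)
  from quot_space_zero[OF module_FG_W submodule_ind_null this]
  have z: "ind_null G g W \<rho> +>\<^bsub>tensor_space FG W\<^esub> (?s \<ominus>\<^bsub>tensor_space FG W\<^esub> ?t) = \<zero>\<^bsub>ind_space G g W \<rho>\<^esub>"
    by (simp only: ind_space_def)
  have "?s = (?s \<ominus>\<^bsub>tensor_space FG W\<^esub> ?t) \<oplus>\<^bsub>tensor_space FG W\<^esub> ?t"
    using s t by (simp add: T.M.minus_eq T.M.a_assoc T.M.l_neg)
  then have "ind_tens G g W \<rho> (y \<otimes> c) w = (ind_null G g W \<rho> +>\<^bsub>tensor_space FG W\<^esub> (?s \<ominus>\<^bsub>tensor_space FG W\<^esub> ?t))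
      \<oplus>\<^bsub>ind_space G g W \<rho>\<^esub> ind_tens G g W \<rho> y (\<rho> c w)"
    unfolding ind_tens_def using lin_mapsD(2)[OF ind_quot(2), of "?s \<ominus>\<^bsub>tensor_space FG W\<^esub> ?t" ?t] s t by simp
  then show ?thesis
    using z ind_tens_closed[OF y rho[OF c w]] by simp
qed

lemma spanning_ind_space:
  "spanning (ind_space G g W \<rho>) ((\<lambda>(y, w). ind_tens G g W \<rho> y w) ` (carrier G \<times> carrier W))"
proof -
  have "(\<lambda>(y, w). ind_tens G g W \<rho> y w) ` (carrier G \<times> carrier W) =
    (\<lambda>x. ind_null G g W \<rho> +>\<^bsub>tensor_space FG W\<^esub> x) ` (\<lambda>(m, n). tens FG W m n) ` (bv ` carrier G \<times> carrier W)"
    by (force simp: ind_tens_def)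
  then show ?thesis
    using spanning_image[OF spanning_tensor_left[OF module_free_space W spanning_free_space] ind_quot(2,3)
        module_FG_W ind_quot(1)] by simp
qed

text \<open>Universal property of \<open>kG \<otimes>\<^bsub>k Cent(g)\<^esub> W\<close>: a family of linear maps \<open>f y\<close> on \<open>W\<close> that is balanced
  over the centralizer extends.\<close>

lemma ind_space_lift:
  fixes P :: "('k, 'p, 'z) module_scheme"
  assumes P: "module kring P" and f: "\<And>y. y \<in> carrier G \<Longrightarrow> f y \<in> lin_maps W P"
    and bal: "\<And>y c w. y \<in> carrier G \<Longrightarrow> c \<in> Cent G g \<Longrightarrow> w \<in> carrier W \<Longrightarrow> f (y \<otimes> c) w = f y (\<rho> c w)"
  shows "\<exists>T \<in> lin_maps (ind_space G g W \<rho>) P.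
    \<forall>y\<in>carrier G. \<forall>w\<in>carrier W. T (ind_tens G g W \<rho> y w) = f y w"
proof -
  interpret P: module kring P by (rule P)
  interpret T: module kring "tensor_space FG W" by (rule module_FG_W)
  have fc: "(\<lambda>y. f y w) \<in> carrier G \<rightarrow> carrier P" if "w \<in> carrier W" for w
    using lin_mapsD(1)[OF f that] by auto
  have ext: "lin_ext P (\<lambda>y. f y w) s = (\<Oplus>\<^bsub>P\<^esub>y\<in>carrier G. s y \<odot>\<^bsub>P\<^esub> f y w)"
    if "s \<in> carrier FG" "w \<in> carrier W" for s w
    by (rule lin_ext_finite[symmetric, OF P fin fc[OF that(2)] that(1)])
  have "bilin FG W P (\<lambda>s w. lin_ext P (\<lambda>y. f y w) s)"
  proof (rule bilinI)
    fix s assume s: "s \<in> carrier FG"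
    have "(\<lambda>w. \<Oplus>\<^bsub>P\<^esub>y\<in>carrier G. s y \<odot>\<^bsub>P\<^esub> f y w) \<in> lin_maps W P"
      by (intro lin_maps_finsum lin_maps_smult f W P)
    then show "(\<lambda>w. lin_ext P (\<lambda>y. f y w) s) \<in> lin_maps W P"
      by (rule lin_maps_cong[OF _ W]) (rule ext[OF s, symmetric])
  next
    fix w assume "w \<in> carrier W"
    then show "(\<lambda>s. lin_ext P (\<lambda>y. f y w) s) \<in> lin_maps FG P"
      by (rule lin_ext_lin_maps[OF P fc])
  qed
  from tensor_space_lift[OF module_free_space W P this] obtain F where
    F: "F \<in> lin_maps (tensor_space FG W) P"
      "\<forall>s\<in>carrier FG. \<forall>w\<in>carrier W. F (tens FG W s w) = lin_ext P (\<lambda>y. f y w) s" by auto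
  have Fb: "F (tens FG W (bv y) w) = f y w" if "y \<in> carrier G" "w \<in> carrier W" for y w
    using F(2)[rule_format, OF bv_in_free_space[OF that(1)] that(2)]
      lin_ext_bv[OF P, of "\<lambda>y. f y w" y] lin_mapsD(1)[OF f[OF that(1)] that(2)] by simp
  have van: "F x = \<zero>\<^bsub>P\<^esub>" if "x \<in> ind_null G g W \<rho>" for x
  proof (rule lin_maps_vanish_subspace_gen[OF module_FG_W P ind_rels_carrier F(1) _ that[unfolded ind_null_def Let_def]])
    fix x assume "x \<in> {tens FG W (bv (y \<otimes> c)) w \<ominus>\<^bsub>tensor_space FG W\<^esub> tens FG W (bv y) (\<rho> c w) | y c w.
      y \<in> carrier G \<and> c \<in> Cent G g \<and> w \<in> carrier W}"
    then obtain y c w where ycw: "y \<in> carrier G" "c \<in> Cent G g" "w \<in> carrier W"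
      "x = tens FG W (bv (y \<otimes> c)) w \<ominus>\<^bsub>tensor_space FG W\<^esub> tens FG W (bv y) (\<rho> c w)" by auto
    have yc: "y \<otimes> c \<in> carrier G" using ycw Cent_closed by simp
    let ?t = "tens FG W (bv y) (\<rho> c w)"
    have t: "?t \<in> carrier (tensor_space FG W)" by (rule tens_FG_closed[OF ycw(1) rho[OF ycw(2,3)]])
    have "x = tens FG W (bv (y \<otimes> c)) w \<oplus>\<^bsub>tensor_space FG W\<^esub> (-1) \<odot>\<^bsub>tensor_space FG W\<^esub> ?t"
      using module_kring_simps(7)[OF module_FG_W t] by (simp add: ycw(4) T.M.minus_eq)
    then have "F x = f (y \<otimes> c) w \<oplus>\<^bsub>P\<^esub> (-1) \<odot>\<^bsub>P\<^esub> f y (\<rho> c w)"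
      using lin_mapsD(2)[OF F(1) tens_FG_closed[OF yc ycw(3)] module_kring_simps(1)[OF module_FG_W t, of "-1"]]
        lin_mapsD(3)[OF F(1) t, of "-1"] Fb[OF yc ycw(3)] Fb[OF ycw(1) rho[OF ycw(2,3)]] by simp
    moreover have "f y (\<rho> c w) \<in> carrier P" by (rule lin_mapsD(1)[OF f[OF ycw(1)] rho[OF ycw(2,3)]])
    ultimately show "F x = \<zero>\<^bsub>P\<^esub>"
      by (simp only: bal[OF ycw(1-3)] module_kring_simps(7)[OF P] P.M.r_neg)
  qed
  from quot_space_factor[OF module_FG_W submodule_ind_null P F(1) van]
  obtain T where T: "T \<in> lin_maps (ind_space G g W \<rho>) P"
    "\<forall>x\<in>carrier (tensor_space FG W). T (ind_null G g W \<rho> +>\<^bsub>tensor_space FG W\<^esub> x) = F x"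
    unfolding ind_space_def by auto
  then show ?thesis
    by (intro bexI[of _ T]) (auto simp: ind_tens_def tens_FG_closed Fb)
qed

text \<open>The action on a simple object is well defined: \<open>(tyc) g (tyc)\<^sup>-\<^sup>1 = (ty) g (ty)\<^sup>-\<^sup>1\<close> for \<open>c\<close>
  in the centralizer of \<open>g\<close>.\<close>

lemma simple_obj_act:
  fixes a :: "'a \<times> 'a \<Rightarrow> 'k"
  assumes g: "g \<in> carrier G"
  defines "V \<equiv> ind_space G g W \<rho>"
  shows "act (simple_obj G g W \<rho>) a \<in> lin_maps V V"
    "\<And>y w. y \<in> carrier G \<Longrightarrow> w \<in> carrier W \<Longrightarrow> act (simple_obj G g W \<rho>) a (ind_tens G g W \<rho> y w) =
      (\<Oplus>\<^bsub>V\<^esub>p\<in>carrier G \<times> carrier G. (a p * of_bool (fst p = (snd p \<otimes> y) \<otimes> g \<otimes> inv (snd p \<otimes> y)))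
        \<odot>\<^bsub>V\<^esub> ind_tens G g W \<rho> (snd p \<otimes> y) w)"
proof -
  have V: "module kring V" unfolding V_def by (rule ind_quot(1))
  interpret V: module kring V by (rule V)
  define f where "f y w = (\<Oplus>\<^bsub>V\<^esub>p\<in>carrier G \<times> carrier G.
      (a p * of_bool (fst p = (snd p \<otimes> y) \<otimes> g \<otimes> inv (snd p \<otimes> y))) \<odot>\<^bsub>V\<^esub> ind_tens G g W \<rho> (snd p \<otimes> y) w)" for y w
  have f: "f y \<in> lin_maps W V" if "y \<in> carrier G" for y
    unfolding f_def[abs_def]
    by (intro lin_maps_finsum lin_maps_smult W V ind_tens_lin[folded V_def]) (use that in auto)
  have bal: "f (y \<otimes> c) w = f y (\<rho> c w)" if "y \<in> carrier G" "c \<in> Cent G g" "w \<in> carrier W" for y c w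
    unfolding f_def
  proof (rule V.M.finsum_cong'[OF refl])
    have c: "c \<in> carrier G" "c \<otimes> g = g \<otimes> c" using that(2) by (auto simp: Cent_def)
    show "(\<lambda>p. (a p * of_bool (fst p = (snd p \<otimes> y) \<otimes> g \<otimes> inv (snd p \<otimes> y))) \<odot>\<^bsub>V\<^esub>
        ind_tens G g W \<rho> (snd p \<otimes> y) (\<rho> c w)) \<in> carrier G \<times> carrier G \<rightarrow> carrier V"
      by (intro Pi_I module_kring_simps(1)[OF V] ind_tens_closed[folded V_def] rho) (use that in auto)
    fix p assume "p \<in> carrier G \<times> carrier G"
    then obtain h t where p: "p = (h, t)" "h \<in> carrier G" "t \<in> carrier G" by auto
    have "(t \<otimes> (y \<otimes> c)) \<otimes> g \<otimes> inv (t \<otimes> (y \<otimes> c)) = (t \<otimes> y) \<otimes> (c \<otimes> g \<otimes> inv c) \<otimes> inv (t \<otimes> y)"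
      using p that(1) c(1) g by (simp add: m_assoc inv_mult_group)
    also have "c \<otimes> g \<otimes> inv c = g" unfolding c(2) using c(1) g by (simp add: m_assoc)
    finally show "(a p * of_bool (fst p = (snd p \<otimes> (y \<otimes> c)) \<otimes> g \<otimes> inv (snd p \<otimes> (y \<otimes> c)))) \<odot>\<^bsub>V\<^esub>
        ind_tens G g W \<rho> (snd p \<otimes> (y \<otimes> c)) w =
      (a p * of_bool (fst p = (snd p \<otimes> y) \<otimes> g \<otimes> inv (snd p \<otimes> y))) \<odot>\<^bsub>V\<^esub> ind_tens G g W \<rho> (snd p \<otimes> y) (\<rho> c w)"
      using ind_tens_balanced[of "t \<otimes> y" c w] p that c(1) by (simp add: m_assoc)
  qed
  obtain T where T: "T \<in> lin_maps V V" "\<forall>y\<in>carrier G. \<forall>w\<in>carrier W. T (ind_tens G g W \<rho> y w) = f y w"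
    using ind_space_lift[OF V f bal, folded V_def] by auto
  have "act (simple_obj G g W \<rho>) a = lin_by V V (carrier G \<times> carrier W) (\<lambda>(y, w). ind_tens G g W \<rho> y w) (\<lambda>(y, w). f y w)"
    unfolding simple_obj_def Let_def V_def[symmetric] f_def by (simp add: case_prod_unfold)
  also have "\<dots> = restrict T (carrier V)"
    by (rule lin_by_unique[OF V V spanning_ind_space[folded V_def] T(1)]) (use T(2) in auto)
  finally have act: "act (simple_obj G g W \<rho>) a = restrict T (carrier V)" .
  show "act (simple_obj G g W \<rho>) a \<in> lin_maps V V"
    by (rule lin_maps_cong[OF T(1) V]) (simp add: act)
  show "act (simple_obj G g W \<rho>) a (ind_tens G g W \<rho> y w) =
      (\<Oplus>\<^bsub>V\<^esub>p\<in>carrier G \<times> carrier G. (a p * of_bool (fst p = (snd p \<otimes> y) \<otimes> g \<otimes> inv (snd p \<otimes> y)))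
        \<odot>\<^bsub>V\<^esub> ind_tens G g W \<rho> (snd p \<otimes> y) w)" if "y \<in> carrier G" "w \<in> carrier W" for y w
    using T(2) that ind_tens_closed[OF that, folded V_def] by (simp add: act f_def)
qed

end

lemma Cent_Aut: "v \<in> Aut \<Longrightarrow> g \<in> carrier G \<Longrightarrow> c \<in> Cent G g \<Longrightarrow> v c \<in> Cent G (v g)"
  using Aut_props(1,2)[of v] by (simp add: Cent_def) metis

text \<open>The map \<open>y \<otimes> w \<mapsto> v(y) \<otimes> w\<close>.\<close>

lemma ind_space_transport:
  fixes W :: "('k::field, 'w) module"
  assumes v: "v \<in> Aut" and g: "g \<in> carrier G" and W: "module kring W"
    and rho: "\<And>c w. c \<in> Cent G g \<Longrightarrow> w \<in> carrier W \<Longrightarrow> \<rho> c w \<in> carrier W"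
    and rho': "\<And>c w. c \<in> Cent G (v g) \<Longrightarrow> w \<in> carrier W \<Longrightarrow> \<rho>' c w \<in> carrier W"
    and eq: "\<And>c w. c \<in> Cent G g \<Longrightarrow> w \<in> carrier W \<Longrightarrow> \<rho>' (v c) w = \<rho> c w"
  shows "\<exists>T \<in> lin_maps (ind_space G g W \<rho>) (ind_space G (v g) W \<rho>').
    \<forall>y\<in>carrier G. \<forall>w\<in>carrier W. T (ind_tens G g W \<rho> y w) = ind_tens G (v g) W \<rho>' (v y) w"
proof (rule ind_space_lift[OF W rho ind_quot(1)[OF W rho']])
  fix y assume y: "y \<in> carrier G"
  show "ind_tens G (v g) W \<rho>' (v y) \<in> lin_maps W (ind_space G (v g) W \<rho>')"
    by (rule ind_tens_lin[OF W rho']) (use Aut_props(1)[OF v y] in auto)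
  fix c w assume c: "c \<in> Cent G g" and w: "w \<in> carrier W"
  then have "c \<in> carrier G" by (simp add: Cent_def)
  then show "ind_tens G (v g) W \<rho>' (v (y \<otimes> c)) w = ind_tens G (v g) W \<rho>' (v y) (\<rho> c w)"
    using ind_tens_balanced[of W "v g" \<rho>', OF W rho' Aut_props(1)[OF v y] Cent_Aut[OF v g c] w] y
    by (simp add: Aut_props(2)[OF v] eq[OF c w])
qed (use rho rho' in auto)

lemma simple_obj_F_obj_iso:
  fixes W :: "('k::field, 'w) module"
  assumes v: "v \<in> Aut" and g: "g \<in> carrier G" and W: "module kring W"
    and rho: "\<And>c w. c \<in> Cent G g \<Longrightarrow> w \<in> carrier W \<Longrightarrow> \<rho> c w \<in> carrier W"
    and rho': "\<And>c w. c \<in> Cent G (v g) \<Longrightarrow> w \<in> carrier W \<Longrightarrow> \<rho>' c w \<in> carrier W"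
    and eq: "\<And>c w. c \<in> Cent G g \<Longrightarrow> w \<in> carrier W \<Longrightarrow> \<rho>' (v c) w = \<rho> c w"
  shows "hmod_isomorphic (DG G) (F_obj G (V_map G v) (simple_obj G g W \<rho>)) (simple_obj G (v g) W \<rho>')"
proof -
  let ?V = "ind_space G g W \<rho>" and ?V' = "ind_space G (v g) W \<rho>'"
  note i = Aut_inv(1)[OF v] note vi = Aut_inv[OF v] and vp = Aut_props[OF v]
  have vg: "v g \<in> carrier G" "iA v (v g) = g" using vp(1) vi g by auto
  have mV: "module kring ?V" by (rule ind_quot(1)[OF W rho])
  have mV': "module kring ?V'" by (rule ind_quot(1)[OF W rho'])
  interpret V: module kring ?V by (rule mV)
  interpret V': module kring ?V' by (rule mV')
  note sp = spanning_ind_space[of W g \<rho>, OF W rho] and sp' = spanning_ind_space[of W "v g" \<rho>', OF W rho']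
  note ic = ind_tens_closed[of W g \<rho>, OF W rho] and ic' = ind_tens_closed[of W "v g" \<rho>', OF W rho']
  obtain T where T: "T \<in> lin_maps ?V ?V'"
    "\<And>y w. y \<in> carrier G \<Longrightarrow> w \<in> carrier W \<Longrightarrow> T (ind_tens G g W \<rho> y w) = ind_tens G (v g) W \<rho>' (v y) w"
    using ind_space_transport[of v g W \<rho> \<rho>', OF v g W rho rho' eq] by auto
  have eq': "\<rho> (iA v c) w = \<rho>' c w" if "c \<in> Cent G (v g)" "w \<in> carrier W" for c w
  proof -
    have c: "c \<in> carrier G" using that(1) by (simp add: Cent_def)
    have "iA v c \<in> Cent G g" using Cent_Aut[OF i vg(1) that(1)] vg(2) by simp
    then show ?thesis using eq[of "iA v c" w] that(2) vi(3)[OF c] by simp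
  qed
  obtain S where S: "S \<in> lin_maps ?V' ?V"
    "\<And>y w. y \<in> carrier G \<Longrightarrow> w \<in> carrier W \<Longrightarrow> S (ind_tens G (v g) W \<rho>' y w) = ind_tens G g W \<rho> (iA v y) w"
    using ind_space_transport[of "iA v" "v g" W \<rho>' \<rho>, unfolded vg(2), OF i vg(1) W rho' rho eq'] by auto
  have ST: "S (T x) = x" if "x \<in> carrier ?V" for x
    by (rule lin_maps_eq_on_spanning[OF lin_maps_comp[OF T(1) S(1)] lin_maps_ident mV mV sp _ that])
      (auto simp: T(2) S(2) vp(1) vi(2))
  have TS: "T (S x) = x" if "x \<in> carrier ?V'" for x
    by (rule lin_maps_eq_on_spanning[OF lin_maps_comp[OF S(1) T(1)] lin_maps_ident mV' mV' sp' _ that])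
      (auto simp: T(2) S(2) Aut_props(1)[OF i] vi(3))
  have bij: "bij_betw T (carrier ?V) (carrier ?V')"
    by (rule bij_betw_byWitness[where f' = S])
      (use ST TS lin_mapsD(1)[OF T(1)] lin_mapsD(1)[OF S(1)] in auto)
  have comm: "T (act (simple_obj G g W \<rho>) (dpull v h) x) = act (simple_obj G (v g) W \<rho>') h (T x)"
    if x: "x \<in> carrier ?V" for h x
  proof (rule lin_maps_eq_on_spanning[OF lin_maps_comp[OF simple_obj_act(1)[of W g \<rho>, OF W rho g] T(1)]
        lin_maps_comp[OF T(1) simple_obj_act(1)[of W "v g" \<rho>', OF W rho' vg(1)]] mV mV' sp _ x])
    fix x assume "x \<in> (\<lambda>(y, w). ind_tens G g W \<rho> y w) ` (carrier G \<times> carrier W)"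
    then obtain y w where y: "y \<in> carrier G" and w: "w \<in> carrier W" and xe: "x = ind_tens G g W \<rho> y w" by auto
    let ?c = "\<lambda>p. dpull v h p * of_bool (fst p = (snd p \<otimes> y) \<otimes> g \<otimes> inv (snd p \<otimes> y))"
    let ?d = "\<lambda>p. h p * of_bool (fst p = (snd p \<otimes> v y) \<otimes> v g \<otimes> inv (snd p \<otimes> v y))"
    let ?k = "\<lambda>p. ?d p \<odot>\<^bsub>?V'\<^esub> ind_tens G (v g) W \<rho>' (snd p \<otimes> v y) w"
    have kc: "?k \<in> carrier G \<times> carrier G \<rightarrow> carrier ?V'"
      by (intro Pi_I module_kring_simps(1)[OF mV'] ic') (use vp(1)[OF y] w in auto)
    have "T (act (simple_obj G g W \<rho>) (dpull v h) x) =
        T (\<Oplus>\<^bsub>?V\<^esub>p\<in>carrier G \<times> carrier G. ?c p \<odot>\<^bsub>?V\<^esub> ind_tens G g W \<rho> (snd p \<otimes> y) w)"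
      unfolding xe by (rule arg_cong[where f = T], rule simple_obj_act(2)[of W g \<rho>, OF W rho g y w])
    also have "\<dots> = (\<Oplus>\<^bsub>?V'\<^esub>p\<in>carrier G \<times> carrier G. T (?c p \<odot>\<^bsub>?V\<^esub> ind_tens G g W \<rho> (snd p \<otimes> y) w))"
      by (rule lin_maps_apply_finsum[OF T(1) mV mV'])
        (intro Pi_I module_kring_simps(1)[OF mV] ic, use y w in auto)
    also have "\<dots> = (\<Oplus>\<^bsub>?V'\<^esub>p\<in>carrier G \<times> carrier G. ?k (map_prod v v p))"
    proof (rule V'.M.finsum_cong'[OF refl])
      show "(\<lambda>p. ?k (map_prod v v p)) \<in> carrier G \<times> carrier G \<rightarrow> carrier ?V'"
        using kc vp(1) by (auto simp: Pi_iff)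
      fix p assume "p \<in> carrier G \<times> carrier G"
      then obtain a t where p: "p = (a, t)" "a \<in> carrier G" "t \<in> carrier G" by auto
      have "a = (t \<otimes> y) \<otimes> g \<otimes> inv (t \<otimes> y) \<longleftrightarrow> v a = v ((t \<otimes> y) \<otimes> g \<otimes> inv (t \<otimes> y))"
        by (rule Aut_eq_iff(2)[OF v, symmetric]) (use p y g in auto)
      also have "v ((t \<otimes> y) \<otimes> g \<otimes> inv (t \<otimes> y)) = (v t \<otimes> v y) \<otimes> v g \<otimes> inv (v t \<otimes> v y)"
        using p y g by (simp add: vp(1,2,4))
      finally have "?c p = ?d (map_prod v v p)" using p by (simp add: pull_def)
      moreover have "T (c \<odot>\<^bsub>?V\<^esub> ind_tens G g W \<rho> (t \<otimes> y) w) = c \<odot>\<^bsub>?V'\<^esub> ind_tens G (v g) W \<rho>' (v t \<otimes> v y) w" for c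
        using lin_mapsD(3)[OF T(1) ic[of "t \<otimes> y" w], of c] T(2)[of "t \<otimes> y" w] p y w vp(2) by simp
      ultimately show "T (?c p \<odot>\<^bsub>?V\<^esub> ind_tens G g W \<rho> (snd p \<otimes> y) w) = ?k (map_prod v v p)"
        by (simp add: p)
    qed
    also have "\<dots> = (\<Oplus>\<^bsub>?V'\<^esub>p\<in>map_prod v v ` (carrier G \<times> carrier G). ?k p)"
    proof (rule V'.M.add.finprod_reindex[folded finsum_def, symmetric])
      show "?k \<in> map_prod v v ` (carrier G \<times> carrier G) \<rightarrow> carrier ?V'"
        using kc vp(1) by (auto simp: Pi_iff)
      show "inj_on (map_prod v v) (carrier G \<times> carrier G)"
        using vp(5) by (intro map_prod_inj_on) (auto simp: bij_betw_def)
    qed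
    also have "map_prod v v ` (carrier G \<times> carrier G) = carrier G \<times> carrier G"
      by (rule map_prod_surj_on) (use vp(5) in \<open>auto simp: bij_betw_def\<close>)
    also have "(\<Oplus>\<^bsub>?V'\<^esub>p\<in>carrier G \<times> carrier G. ?k p) = act (simple_obj G (v g) W \<rho>') h (T x)"
      unfolding xe T(2)[OF y w]
      by (rule simple_obj_act(2)[of W "v g" \<rho>', OF W rho' vg(1) vp(1)[OF y] w, symmetric])
    finally show "T (act (simple_obj G g W \<rho>) (dpull v h) x) = act (simple_obj G (v g) W \<rho>') h (T x)" .
  qed
  have car: "carrier (simple_obj G g W \<rho>) = carrier ?V" "carrier (simple_obj G (v g) W \<rho>') = carrier ?V'"
    by (simp_all add: simple_obj_def Let_def)
  have "lin_maps (simple_obj G g W \<rho>) (simple_obj G (v g) W \<rho>') = lin_maps ?V ?V'"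
    by (simp add: simple_obj_def Let_def)
  then have "T \<in> hmod_isos (DG G) (F_obj G (V_map G v) (simple_obj G g W \<rho>)) (simple_obj G (v g) W \<rho>')"
    using T(1) bij comm by (simp add: hmod_isos_def hmod_homs_def car dagger_V_map[OF v])
  then show ?thesis unfolding hmod_isomorphic_def by auto
qed

lemma irrep_closed:
  assumes "irrep (G\<lparr>carrier := Cent G g\<rparr>) W \<rho>" "c \<in> Cent G g" "w \<in> carrier W"
  shows "\<rho> c w \<in> carrier W"
proof -
  have "\<rho> c \<in> carrier (GL W)" using assms(1,2) unfolding irrep_def hom_def by auto
  then show ?thesis using assms(3) by (auto simp: GL_def dest: lin_mapsD(1))
qed

lemma irrep_transport:
  assumes v: "v \<in> Aut" and g: "g \<in> carrier G" and irr: "irrep (G\<lparr>carrier := Cent G g\<rparr>) W \<rho>"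
  shows "irrep (G\<lparr>carrier := Cent G (v g)\<rparr>) W (\<rho> \<circ> iA v)"
proof -
  note i = Aut_inv(1)[OF v]
  have vg: "v g \<in> carrier G" "iA v (v g) = g" using Aut_props(1)[OF v g] Aut_inv(2)[OF v g] by auto
  have im: "iA v c \<in> Cent G g" if "c \<in> Cent G (v g)" for c
    using Cent_Aut[OF i vg(1) that] vg(2) by simp
  have Cc: "c \<in> carrier G" if "c \<in> Cent G h" for c h using that by (simp add: Cent_def)
  have h: "\<rho> \<in> hom (G\<lparr>carrier := Cent G g\<rparr>) (GL W)" using irr by (simp add: irrep_def)
  have "\<rho> \<circ> iA v \<in> hom (G\<lparr>carrier := Cent G (v g)\<rparr>) (GL W)"
    using h im Aut_props(2)[OF i] Cc unfolding hom_def by (auto simp: Pi_iff)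
  moreover have "U = {\<zero>\<^bsub>W\<^esub>} \<or> U = carrier W"
    if U: "submodule U kring W" "\<forall>c\<in>Cent G (v g). (\<rho> \<circ> iA v) c ` U \<subseteq> U" for U
  proof -
    have "\<rho> c ` U \<subseteq> U" if "c \<in> Cent G g" for c
      using U(2)[rule_format, OF Cent_Aut[OF v g that]] Aut_inv(2)[OF v Cc[OF that]] by simp
    then show ?thesis using irr U(1) unfolding irrep_def by simp
  qed
  ultimately show ?thesis using irr unfolding irrep_def by simp
qed

lemma simple_obj_V_map:
  fixes W :: "('k::field, 'w) module"
  assumes v: "v \<in> Aut" and g: "g \<in> carrier G" and irr: "irrep (G\<lparr>carrier := Cent G g\<rparr>) W \<rho>"
  shows "hmod_isomorphic (DG G) (F_obj G (V_map G v) (simple_obj G g W \<rho>)) (simple_obj G (v g) W (\<rho> \<circ> iA v))"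
proof (rule simple_obj_F_obj_iso[OF v g])
  show "module kring W" using irr by (simp add: irrep_def)
  show "\<rho> c w \<in> carrier W" if "c \<in> Cent G g" "w \<in> carrier W" for c w
    by (rule irrep_closed[OF irr that])
  show "(\<rho> \<circ> iA v) c w \<in> carrier W" if "c \<in> Cent G (v g)" "w \<in> carrier W" for c w
    by (rule irrep_closed[OF irrep_transport[OF v g irr] that])
  show "(\<rho> \<circ> iA v) (v c) w = \<rho> c w" if "c \<in> Cent G g" for c w
    using that Aut_inv(2)[OF v, of c] by (simp add: Cent_def)
qed

end

section \<open>The dual of the double and its lazy coboundaries\<close>

context fin_group
begin

lemma hcar_DGd: "hcar (DGd G :: ('a \<times> 'a, 'k::field) hopf) = hcar (DG G)"
  by (simp add: hcar_def)

lemma forms2_DGd: "forms2 (DGd G :: ('a \<times> 'a, 'k::field) hopf) = forms2 (DG G)"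
  by (simp add: forms2_def)

text \<open>The coproduct of \<open>DG*\<close> is dual to the product of \<open>DG\<close>; hence convolution of forms on \<open>DG*\<close> is
  multiplication in \<open>DG\<close>.\<close>

lemma sw_DGd:
  "sw (DGd G) a F = (\<Sum>(x1, x2)\<in>carrier G \<times> carrier G. a (x1, x2) *
     (\<Sum>y\<in>carrier G. F (bv (x1, y)) (bv (inv y \<otimes> x1 \<otimes> y, inv y \<otimes> x2))) :: 'k::field)"
proof -
  let ?B = "carrier G \<times> carrier G"
  have cm: "comul (DGd G) a (p, q) = (\<Sum>x\<in>?B. a x * bmul (DG G) p q x)" if "p \<in> ?B" "q \<in> ?B" for p q
    unfolding comul_def basis_simps
  proof (rule sum.cong[OF refl])
    fix x assume x: "x \<in> ?B"
    obtain p1 p2 q1 q2 x1 x2 where e: "p = (p1, p2)" "q = (q1, q2)" "x = (x1, x2)" by (metis surj_pair)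
    have G: "p1 \<in> carrier G" "p2 \<in> carrier G" "q1 \<in> carrier G" "q2 \<in> carrier G" "x1 \<in> carrier G"
      using that x by (auto simp: e)
    show "a x * bcomul (DGd G) x (p, q) = a x * bmul (DG G) p q x"
      using conj_eq_iff[OF G(5,2,3)] conj_eq_iff[OF G(1,2,3)] G by (auto simp: e DGd_def DG_def)
  qed
  have "sw (DGd G) a F = (\<Sum>p\<in>?B. \<Sum>q\<in>?B. \<Sum>x\<in>?B. a x * (F (bv p) (bv q) * bmul (DG G) p q x))"
    unfolding sw_def basis_simps sum.cartesian_product[symmetric]
    by (intro sum.cong refl) (simp add: cm sum_distrib_left sum_distrib_right mult_ac)
  also have "\<dots> = (\<Sum>p\<in>?B. \<Sum>x\<in>?B. \<Sum>q\<in>?B. a x * (F (bv p) (bv q) * bmul (DG G) p q x))"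
    by (intro sum.cong refl sum.swap)
  also have "\<dots> = (\<Sum>x\<in>?B. \<Sum>p\<in>?B. \<Sum>q\<in>?B. a x * (F (bv p) (bv q) * bmul (DG G) p q x))"
    by (rule sum.swap)
  also have "\<dots> = (\<Sum>x\<in>?B. a x * (\<Sum>p\<in>?B. \<Sum>q\<in>?B. F (bv p) (bv q) * bmul (DG G) p q x))"
    by (simp add: sum_distrib_left)
  also have "\<dots> = (\<Sum>(x1, x2)\<in>?B. a (x1, x2) *
     (\<Sum>y\<in>carrier G. F (bv (x1, y)) (bv (inv y \<otimes> x1 \<otimes> y, inv y \<otimes> x2))))"
    by (rule sum.cong[OF refl]) (clarsimp simp: DG_sum)
  finally show ?thesis .
qed

lemma sw_DGd_bv:
  "sw (DGd G) (bv (x1, x2)) F = (if x1 \<in> carrier G \<and> x2 \<in> carrier G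
     then \<Sum>y\<in>carrier G. F (bv (x1, y)) (bv (inv y \<otimes> x1 \<otimes> y, inv y \<otimes> x2)) else 0 :: 'k::field)"
proof -
  have "sw (DGd G) (bv (x1, x2)) F = (\<Sum>p\<in>carrier G \<times> carrier G. of_bool (p = (x1, x2)) *
     (\<Sum>y\<in>carrier G. F (bv (fst p, y)) (bv (inv y \<otimes> fst p \<otimes> y, inv y \<otimes> snd p))))"
    unfolding sw_DGd case_prod_unfold by (rule sum.cong[OF refl]) (simp add: bv_def[of "(x1, x2)"])
  also have "\<dots> = of_bool ((x1, x2) \<in> carrier G \<times> carrier G) *
     (\<Sum>y\<in>carrier G. F (bv (fst (x1, x2), y)) (bv (inv y \<otimes> fst (x1, x2) \<otimes> y, inv y \<otimes> snd (x1, x2))))"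
    by (rule sum_of_bool_delta(1)[OF finite_GG])
  finally show ?thesis by simp
qed

lemma ev_bv: "p \<in> carrier G \<times> carrier G \<Longrightarrow> ev (DGd G) \<eta> (bv p) = (\<eta> p :: 'k::field)"
  unfolding ev_def bv_def basis_simps by (simp add: sum_of_bool_delta(2)[OF finite_GG] del: mem_Sigma_iff)

lemma ev2_bv:
  assumes "p \<in> carrier G \<times> carrier G" "q \<in> carrier G \<times> carrier G"
  shows "ev2 (DGd G) \<sigma> (bv p) (bv q) = (\<sigma> (p, q) :: 'k::field)"
proof -
  let ?B = "carrier G \<times> carrier G"
  have "ev2 (DGd G) \<sigma> (bv p) (bv q) = (\<Sum>x\<in>?B \<times> ?B. \<sigma> x * of_bool (x = (p, q)))"
    unfolding ev2_def basis_simps by (rule sum.cong[OF refl]) (auto simp: bv_def)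
  also have "\<dots> = of_bool ((p, q) \<in> ?B \<times> ?B) * \<sigma> (p, q)"
    by (rule sum_of_bool_delta(2)) (use fin in simp)
  finally show ?thesis using assms by simp
qed

lemma conv_DGd: "conv (DGd G) \<eta> \<theta> = (mul (DG G) \<eta> \<theta> :: _ \<Rightarrow> 'k::field)"
  by (auto simp: fun_eq_iff conv_def sw_DGd_bv mul_DG ev_bv intro!: sum.cong)

lemma conv2_DGd: "conv2 (DGd G) \<sigma> \<tau> = (mul2 (DG G) \<sigma> \<tau> :: _ \<Rightarrow> 'k::field)"
  by (auto simp: fun_eq_iff conv2_def sw_DGd_bv mul2_DG ev2_bv intro!: sum.cong)

lemma counit_DGd: "counit (DGd G) a = (\<Sum>x\<in>carrier G \<times> carrier G. a x * hone (DG G) x :: 'k::field)"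
  unfolding counit_def basis_simps by (rule sum.cong) (auto simp: DGd_def)

lemma conv_one_DGd: "conv_one (DGd G) = (hone (DG G) :: _ \<Rightarrow> 'k::field)"
  unfolding conv_one_def counit_DGd_bv ..

lemma mul_DGd_bv:
  assumes "q1 \<in> carrier G" "q2 \<in> carrier G" "r1 \<in> carrier G" "r2 \<in> carrier G"
  shows "mul (DGd G) (bv (q1, q2)) (bv (r1, r2)) z = (of_bool (q2 = r2) * bv (q1 \<otimes> r1, q2) z :: 'k::field)"
proof -
  let ?B = "carrier G \<times> carrier G"
  have "mul (DGd G) (bv (q1, q2)) (bv (r1, r2)) z =
    (\<Sum>p\<in>?B \<times> ?B. (of_bool (q2 = r2) * bv (q1 \<otimes> r1, q2) z :: 'k) * of_bool (p = ((q1, q2), (r1, r2))))"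
    unfolding mul_def basis_simps sum.cartesian_product
  proof (rule sum.cong[OF refl])
    fix p :: "('a \<times> 'a) \<times> 'a \<times> 'a"
    have "bv (q1, q2) (fst p) * bv (r1, r2) (snd p) = (of_bool (p = ((q1, q2), (r1, r2))) :: 'k)"
      by (cases p) (simp add: bv_def)
    then show "(case p of (x, y) \<Rightarrow> bv (q1, q2) x * bv (r1, r2) y * bmul (DGd G) x y z) =
        of_bool (q2 = r2) * bv (q1 \<otimes> r1, q2) z * of_bool (p = ((q1, q2), (r1, r2)))"
      by (cases "p = ((q1, q2), (r1, r2))") (auto simp: case_prod_unfold DGd_def bv_def)
  qed
  also have "\<dots> = of_bool (((q1, q2), (r1, r2)) \<in> ?B \<times> ?B) * (of_bool (q2 = r2) * bv (q1 \<otimes> r1, q2) z)"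
    by (rule sum_of_bool_delta(2)) (use fin in simp)
  finally show ?thesis using assms by simp
qed

lemma ev_mul_DGd_bv:
  assumes "q1 \<in> carrier G" "q2 \<in> carrier G" "r1 \<in> carrier G" "r2 \<in> carrier G"
  shows "ev (DGd G) \<theta> (mul (DGd G) (bv (q1, q2)) (bv (r1, r2))) =
    (comul (DG G) \<theta> ((q1, q2), (r1, r2)) :: 'k::field)"
proof -
  have "ev (DGd G) \<theta> (mul (DGd G) (bv (q1, q2)) (bv (r1, r2))) =
      of_bool (q2 = r2) * ev (DGd G) \<theta> (bv (q1 \<otimes> r1, q2))"
    unfolding ev_def mul_DGd_bv[OF assms] sum_distrib_left by (simp add: mult_ac)
  then show ?thesis using assms by (simp add: ev_bv comul_DG)
qed

lemma counit_mul_DGd_bv: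
  assumes "q \<in> carrier G \<times> carrier G" "r \<in> carrier G \<times> carrier G"
  shows "counit (DGd G) (mul (DGd G) (bv q) (bv r)) = (hone (DG G) q * hone (DG G) r :: 'k::field)"
proof -
  have "ev (DGd G) (hone (DG G)) a = (counit (DGd G) a :: 'k)" for a
    unfolding ev_def counit_DGd basis_simps by (simp only: mult.commute)
  moreover have "ev (DGd G) (hone (DG G)) (mul (DGd G) (bv q) (bv r)) = (comul (DG G) (hone (DG G)) (q, r) :: 'k)"
    by (cases q; cases r) (use assms in \<open>simp add: ev_mul_DGd_bv del: hone_simps\<close>)
  ultimately have "counit (DGd G) (mul (DGd G) (bv q) (bv r)) = (comul (DG G) (hone (DG G)) (q, r) :: 'k)"
    by simp
  then show ?thesis unfolding comul_hone_DG by (simp add: tensor_def)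
qed

text \<open>\<open>\<epsilon>(a\<^sub>1) f(a\<^sub>2) = f(a)\<close>, where the counit of \<open>DG*\<close> is evaluation at the unit of \<open>DG\<close>.\<close>

lemma sw_counit_left:
  assumes "\<And>p q. p \<in> carrier G \<times> carrier G \<Longrightarrow> q \<in> carrier G \<times> carrier G \<Longrightarrow> F (bv p) (bv q) = hone (DG G) p * f q"
  shows "sw (DGd G) a F = (\<Sum>x\<in>carrier G \<times> carrier G. a x * f x :: 'k::field)"
  unfolding sw_DGd
proof (rule sum.cong[OF refl], clarify)
  fix x1 x2 assume x: "x1 \<in> carrier G" "x2 \<in> carrier G"
  have "(\<Sum>y\<in>carrier G. F (bv (x1, y)) (bv (inv y \<otimes> x1 \<otimes> y, inv y \<otimes> x2))) =
    (\<Sum>y\<in>carrier G. of_bool (y = \<one>) * f (inv y \<otimes> x1 \<otimes> y, inv y \<otimes> x2))"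
    using x by (intro sum.cong refl) (simp add: assms)
  also have "\<dots> = f (x1, x2)" using x by (subst sum_of_bool_delta(1)[OF fin]) simp
  finally show "a (x1, x2) * (\<Sum>y\<in>carrier G. F (bv (x1, y)) (bv (inv y \<otimes> x1 \<otimes> y, inv y \<otimes> x2))) = a (x1, x2) * f (x1, x2)"
    by simp
qed

lemma sw_counit_right:
  assumes "\<And>p q. p \<in> carrier G \<times> carrier G \<Longrightarrow> q \<in> carrier G \<times> carrier G \<Longrightarrow> F (bv p) (bv q) = f p * hone (DG G) q"
  shows "sw (DGd G) a F = (\<Sum>x\<in>carrier G \<times> carrier G. a x * f x :: 'k::field)"
  unfolding sw_DGd
proof (rule sum.cong[OF refl], clarify)
  fix x1 x2 assume x: "x1 \<in> carrier G" "x2 \<in> carrier G"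
  have "(\<Sum>y\<in>carrier G. F (bv (x1, y)) (bv (inv y \<otimes> x1 \<otimes> y, inv y \<otimes> x2))) =
    (\<Sum>y\<in>carrier G. f (x1, y) * of_bool (y = x2))"
  proof (rule sum.cong[OF refl])
    fix y assume y: "y \<in> carrier G"
    have "inv y \<otimes> x2 = \<one> \<longleftrightarrow> y = x2" using inv_solve_left'[of \<one> y x2] x y by auto
    then show "F (bv (x1, y)) (bv (inv y \<otimes> x1 \<otimes> y, inv y \<otimes> x2)) = f (x1, y) * of_bool (y = x2)"
      using x y by (simp add: assms)
  qed
  also have "\<dots> = f (x1, x2)" using x by (subst sum_of_bool_delta(2)[OF fin]) simp
  finally show "a (x1, x2) * (\<Sum>y\<in>carrier G. F (bv (x1, y)) (bv (inv y \<otimes> x1 \<otimes> y, inv y \<otimes> x2))) = a (x1, x2) * f (x1, x2)"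
    by simp
qed

lemma forms2D: "s \<in> forms2 H \<Longrightarrow> p \<notin> basis H \<times> basis H \<Longrightarrow> s p = 0"
  unfolding forms2_def by blast

lemma mul2_forms2 [simp]: "mul2 (DG G :: ('a \<times> 'a, 'k::field) hopf) s t \<in> forms2 (DG G)"
  by (auto simp: forms2_def mul2_DG split: if_splits)

lemma mul2_tensor:
  "mul2 (DG G) (tensor a b) (tensor c d) = (tensor (mul (DG G) a c) (mul (DG G) b d) :: _ \<Rightarrow> 'k::field)"
  by (auto simp: fun_eq_iff mul2_DG mul_DG tensor_def sum_product mult_ac intro!: sum.cong)

lemma mul2_as_mul:
  "mul2 (DG G) s t (z, w) = (if z \<in> carrier G \<times> carrier G \<and> w \<in> carrier G \<times> carrier G then
    \<Sum>y\<in>carrier G. mul (DG G) (\<lambda>r. s ((fst z, y), r))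
      (\<lambda>r. t ((inv y \<otimes> fst z \<otimes> y, inv y \<otimes> snd z), r)) w else (0 :: 'k::field))"
  by (cases z; cases w) (auto simp: mul2_DG mul_DG)

lemma mul2_one:
  fixes s :: "('a \<times> 'a) \<times> 'a \<times> 'a \<Rightarrow> 'k::field"
  assumes s: "s \<in> forms2 (DG G)"
  shows "mul2 (DG G) (tensor (hone (DG G)) (hone (DG G))) s = s"
    "mul2 (DG G) s (tensor (hone (DG G)) (hone (DG G))) = s"
proof -
  have h: "(\<lambda>r. s (q, r)) \<in> hcar (DG G)" "(\<lambda>q. s (q, r)) \<in> hcar (DG G)" for q r
    by (rule hcarI, rule forms2D[OF s], simp)+
  let ?B = "carrier G \<times> carrier G"
  have out: "s (z, w) = 0" if "\<not> (z \<in> ?B \<and> w \<in> ?B)" for z w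
    by (rule forms2D[OF s]) (use that in simp)
  have L: "mul (DG G) (\<lambda>r. c * hone (DG G) r) a = (\<lambda>z. c * a z)" if "a \<in> hcar (DG G)" for c and a :: "_ \<Rightarrow> 'k"
  proof -
    have "mul (DG G) (\<lambda>r. c * hone (DG G) r) a = (\<lambda>z. c * mul (DG G) (hone (DG G)) a z)"
      by (simp add: mul_def sum_distrib_left mult.assoc fun_eq_iff del: hone_simps)
    then show ?thesis by (simp only: mul_DG_one(1)[OF that])
  qed
  have R: "mul (DG G) a (\<lambda>r. c * hone (DG G) r) = (\<lambda>z. c * a z)" if "a \<in> hcar (DG G)" for c and a :: "_ \<Rightarrow> 'k"
  proof -
    have "mul (DG G) a (\<lambda>r. c * hone (DG G) r) = (\<lambda>z. c * mul (DG G) a (hone (DG G)) z)"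
      by (simp add: mul_def sum_distrib_left mult_ac fun_eq_iff del: hone_simps)
    then show ?thesis by (simp only: mul_DG_one(2)[OF that])
  qed
  show "mul2 (DG G) (tensor (hone (DG G)) (hone (DG G))) s = s"
  proof
    fix p :: "('a \<times> 'a) \<times> 'a \<times> 'a" obtain z w where p: "p = (z, w)" by (cases p)
    show "mul2 (DG G) (tensor (hone (DG G)) (hone (DG G))) s p = s p"
      using fun_cong[OF mul_DG_one(1)[OF h(2)[of w]], of z] out[of z w]
      by (cases z) (auto simp: p mul2_as_mul tensor_def L[OF h(1)] mul_DG simp del: hone_simps)
  qed
  show "mul2 (DG G) s (tensor (hone (DG G)) (hone (DG G))) = s"
  proof
    fix p :: "('a \<times> 'a) \<times> 'a \<times> 'a" obtain z w where p: "p = (z, w)" by (cases p)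
    show "mul2 (DG G) s (tensor (hone (DG G)) (hone (DG G))) p = s p"
      using fun_cong[OF mul_DG_one(2)[OF h(2)[of w]], of z] out[of z w]
      unfolding p mul2_as_mul tensor_def prod.case R[OF h(1)]
      by (cases z) (auto simp: mul_DG mult.commute simp del: hone_simps)
  qed
qed

text \<open>If \<open>\<eta>\<close> is central in \<open>DG\<close>, then \<open>\<eta> \<otimes> \<eta>\<close> is central in \<open>DG \<otimes> DG\<close>.\<close>

lemma mul2_central:
  fixes s :: "('a \<times> 'a) \<times> 'a \<times> 'a \<Rightarrow> 'k::field"
  assumes s: "s \<in> forms2 (DG G)" and cen: "\<And>a. a \<in> hcar (DG G) \<Longrightarrow> mul (DG G) \<eta> a = mul (DG G) a \<eta>"
  shows "mul2 (DG G) (tensor \<eta> \<eta>) s = mul2 (DG G) s (tensor \<eta> \<eta>)"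
proof
  fix p :: "('a \<times> 'a) \<times> 'a \<times> 'a"
  obtain z1 z2 w where p: "p = ((z1, z2), w)" by (metis surj_pair)
  have h: "(\<lambda>r. s (q, r)) \<in> hcar (DG G)" for q
    by (rule hcarI, rule forms2D[OF s], simp)
  have h': "(\<lambda>q. mul (DG G) (\<lambda>r. s (q, r)) \<eta> w) \<in> hcar (DG G)"
  proof (rule hcarI)
    fix q assume "q \<notin> basis (DG G :: ('a \<times> 'a, 'k) hopf)"
    then have "s (q, r) = 0" for r by (intro forms2D[OF s]) simp
    then show "mul (DG G) (\<lambda>r. s (q, r)) \<eta> w = 0" by (simp add: mul_def)
  qed
  have pull1: "mul (DG G) (\<lambda>r. c * a r) b w = c * mul (DG G) a b w"
    and pull2: "mul (DG G) a (\<lambda>r. b r * c) w = mul (DG G) a b w * c"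
    and pull3: "mul (DG G) a (\<lambda>r. c * b r) w = c * mul (DG G) a b w" for a b :: "_ \<Rightarrow> 'k" and c
    by (cases w; auto simp: mul_DG mult_ac sum_distrib_left)+
  show "mul2 (DG G) (tensor \<eta> \<eta>) s p = mul2 (DG G) s (tensor \<eta> \<eta>) p"
  proof (cases "z1 \<in> carrier G \<and> z2 \<in> carrier G \<and> w \<in> carrier G \<times> carrier G")
    case True
    have "mul2 (DG G) (tensor \<eta> \<eta>) s p = mul (DG G) \<eta> (\<lambda>q. mul (DG G) \<eta> (\<lambda>r. s (q, r)) w) (z1, z2)"
      using True by (simp add: p mul2_as_mul tensor_def pull1) (simp add: mul_DG)
    also have "\<dots> = mul (DG G) (\<lambda>q. mul (DG G) (\<lambda>r. s (q, r)) \<eta> w) \<eta> (z1, z2)"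
      unfolding cen[OF h] cen[OF h'] ..
    also have "\<dots> = mul2 (DG G) s (tensor \<eta> \<eta>) p"
      using True by (simp add: p mul2_as_mul tensor_def pull3) (simp add: mul_DG mult.commute)
    finally show ?thesis .
  qed (auto simp: p mul2_as_mul)
qed

lemma sum_counit_DGd:
  "(\<Sum>x\<in>carrier G \<times> carrier G. a x * (hone (DG G) x * c)) = (counit (DGd G) a * c :: 'k::field)"
  unfolding counit_DGd sum_distrib_right by (simp only: mult.assoc)

text \<open>The trivial cocycle \<open>\<epsilon> \<otimes> \<epsilon>\<close> is a lazy 2-cocycle.\<close>

lemma one_Z2L: "conv2_one (DGd G :: ('a \<times> 'a, 'k::field) hopf) \<in> carrier (Z2L (DGd G))"
proof -
  let ?K = "DGd G :: ('a \<times> 'a, 'k) hopf" and ?h = "hone (DG G) :: _ \<Rightarrow> 'k"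
  let ?s = "tensor ?h ?h" and ?B = "carrier G \<times> carrier G"
  have hh: "?s \<in> forms2 (DG G)" by (rule tensor_forms2[OF hone_DG_hcar hone_DG_hcar])
  have ev2: "ev2 ?K ?s a b = counit ?K a * counit ?K b" for a b
    unfolding ev2_def counit_DGd basis_simps sum_product sum.cartesian_product
    by (rule sum.cong) (auto simp: tensor_def)
  have "counit ?K (hone ?K) = ev ?K ?h (hone ?K)"
    unfolding ev_def counit_DGd by (simp only: mult.commute basis_simps)
  also have "\<dots> = counit (DG G) ?h"
    unfolding ev_def basis_simps by (simp only: counit_def basis_simps) (rule sum.cong, auto simp: DG_def)
  finally have one: "counit ?K (hone ?K) = 1" by (simp only: counit_hone_DG)
  have e: "counit ?K (bv p) = ?h p" for p by (rule counit_DGd_bv)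
  have cocycle: "sw ?K a (\<lambda>a1 a2. sw ?K b (\<lambda>b1 b2. ev2 ?K ?s a1 b1 * ev2 ?K ?s (mul ?K a2 b2) c)) =
      sw ?K b (\<lambda>b1 b2. sw ?K c (\<lambda>c1 c2. ev2 ?K ?s b1 c1 * ev2 ?K ?s a (mul ?K b2 c2)))" for a b c
  proof -
    have "sw ?K a (\<lambda>a1 a2. sw ?K b (\<lambda>b1 b2. ev2 ?K ?s a1 b1 * ev2 ?K ?s (mul ?K a2 b2) c)) =
      (\<Sum>x\<in>?B. a x * (\<Sum>y\<in>?B. b y * (?h x * ?h y * counit ?K c)))"
    proof (rule sw_counit_left)
      fix p q assume pq: "p \<in> ?B" "q \<in> ?B"
      have "sw ?K b (\<lambda>b1 b2. ev2 ?K ?s (bv p) b1 * ev2 ?K ?s (mul ?K (bv q) b2) c) =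
        (\<Sum>y\<in>?B. b y * (?h p * (?h q * ?h y * counit ?K c)))"
        by (rule sw_counit_left)
          (simp only: ev2 e counit_mul_DGd_bv[OF pq(2)] mult_ac)
      then show "sw ?K b (\<lambda>b1 b2. ev2 ?K ?s (bv p) b1 * ev2 ?K ?s (mul ?K (bv q) b2) c) =
        ?h p * (\<Sum>y\<in>?B. b y * (?h q * ?h y * counit ?K c))"
        by (simp only: sum_distrib_left mult_ac)
    qed
    also have "\<dots> = counit ?K a * counit ?K b * counit ?K c"
    proof -
      have "b y * (?h x * ?h y * counit ?K c) = b y * (?h y * (?h x * counit ?K c))" for x y
        by (simp only: mult_ac)
      moreover have "a x * (counit ?K b * (?h x * counit ?K c)) = a x * (?h x * (counit ?K b * counit ?K c))" for x
        by (simp only: mult_ac)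
      ultimately show ?thesis by (simp only: sum_counit_DGd) (simp only: mult_ac)
    qed
    also have "\<dots> = (\<Sum>x\<in>?B. b x * (\<Sum>y\<in>?B. c y * (?h x * ?h y * counit ?K a)))"
    proof -
      have "c y * (?h x * ?h y * counit ?K a) = c y * (?h y * (?h x * counit ?K a))" for x y
        by (simp only: mult_ac)
      moreover have "b x * (counit ?K c * (?h x * counit ?K a)) = b x * (?h x * (counit ?K c * counit ?K a))" for x
        by (simp only: mult_ac)
      ultimately show ?thesis by (simp only: sum_counit_DGd) (simp only: mult_ac)
    qed
    also have "\<dots> = sw ?K b (\<lambda>b1 b2. sw ?K c (\<lambda>c1 c2. ev2 ?K ?s b1 c1 * ev2 ?K ?s a (mul ?K b2 c2)))"
    proof (rule sw_counit_left[symmetric])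
      fix p q assume pq: "p \<in> ?B" "q \<in> ?B"
      have "sw ?K c (\<lambda>c1 c2. ev2 ?K ?s (bv p) c1 * ev2 ?K ?s a (mul ?K (bv q) c2)) =
        (\<Sum>y\<in>?B. c y * (?h p * (?h q * ?h y * counit ?K a)))"
        by (rule sw_counit_left)
          (simp only: ev2 e counit_mul_DGd_bv[OF pq(2)] mult_ac)
      then show "sw ?K c (\<lambda>c1 c2. ev2 ?K ?s (bv p) c1 * ev2 ?K ?s a (mul ?K (bv q) c2)) =
        ?h p * (\<Sum>y\<in>?B. c y * (?h q * ?h y * counit ?K a))"
        by (simp only: sum_distrib_left mult_ac)
    qed
    finally show ?thesis .
  qed
  have lazy: "sw ?K a (\<lambda>a1 a2. sw ?K b (\<lambda>b1 b2. ev2 ?K ?s a1 b1 * mul ?K a2 b2 z)) =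
      sw ?K a (\<lambda>a1 a2. sw ?K b (\<lambda>b1 b2. mul ?K a1 b1 z * ev2 ?K ?s a2 b2))" for a b z
  proof -
    have "sw ?K a (\<lambda>a1 a2. sw ?K b (\<lambda>b1 b2. ev2 ?K ?s a1 b1 * mul ?K a2 b2 z)) =
      (\<Sum>x\<in>?B. a x * (\<Sum>y\<in>?B. b y * mul ?K (bv x) (bv y) z))"
    proof (rule sw_counit_left)
      fix p q assume pq: "p \<in> ?B" "q \<in> ?B"
      have "sw ?K b (\<lambda>b1 b2. ev2 ?K ?s (bv p) b1 * mul ?K (bv q) b2 z) =
        (\<Sum>y\<in>?B. b y * (?h p * mul ?K (bv q) (bv y) z))"
        by (rule sw_counit_left) (simp only: ev2 e mult_ac)
      then show "sw ?K b (\<lambda>b1 b2. ev2 ?K ?s (bv p) b1 * mul ?K (bv q) b2 z) =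
        ?h p * (\<Sum>y\<in>?B. b y * mul ?K (bv q) (bv y) z)"
        by (simp only: sum_distrib_left mult_ac)
    qed
    also have "\<dots> = sw ?K a (\<lambda>a1 a2. sw ?K b (\<lambda>b1 b2. mul ?K a1 b1 z * ev2 ?K ?s a2 b2))"
    proof (rule sw_counit_right[symmetric])
      fix p q assume pq: "p \<in> ?B" "q \<in> ?B"
      have "sw ?K b (\<lambda>b1 b2. mul ?K (bv p) b1 z * ev2 ?K ?s (bv q) b2) =
        (\<Sum>y\<in>?B. b y * (?h q * mul ?K (bv p) (bv y) z))"
        by (rule sw_counit_right) (simp only: ev2 e mult_ac)
      then show "sw ?K b (\<lambda>b1 b2. mul ?K (bv p) b1 z * ev2 ?K ?s (bv q) b2) =
        (\<Sum>y\<in>?B. b y * mul ?K (bv p) (bv y) z) * ?h q"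
        by (simp only: sum_distrib_right sum_distrib_left mult_ac)
    qed
    finally show ?thesis .
  qed
  have "two_cocycle ?K ?s"
    unfolding two_cocycle_def forms2_DGd
  proof (intro conjI ballI)
    show "\<exists>\<tau>\<in>forms2 (DG G). conv2 ?K ?s \<tau> = conv2_one ?K \<and> conv2 ?K \<tau> ?s = conv2_one ?K"
      by (rule bexI[OF _ hh]) (simp only: conv2_DGd conv2_one_DGd mul2_one[OF hh])
    show "ev2 ?K ?s (hone ?K) b = counit ?K b" "ev2 ?K ?s b (hone ?K) = counit ?K b" for b
      by (simp_all only: ev2 one mult_1_left mult_1_right)
  qed (rule hh, rule cocycle)
  moreover have "lazy2 ?K ?s" unfolding lazy2_def using lazy by auto
  ultimately show ?thesis by (simp add: Z2L_def conv2_one_DGd del: hone_simps)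
qed

subsection \<open>Lazy coboundaries\<close>

text \<open>A central element \<open>\<eta>\<close> of \<open>DG\<close> of counit 1, with inverse \<open>\<theta>\<close>.  The elements \<open>\<eta>\<close> are the lazy
  cochains on \<open>DG*\<close>.\<close>

definition central_unit :: "('a \<times> 'a \<Rightarrow> 'k::field) \<Rightarrow> ('a \<times> 'a \<Rightarrow> 'k) \<Rightarrow> bool" where
  "central_unit \<eta> \<theta> \<longleftrightarrow> \<eta> \<in> hcar (DG G) \<and> \<theta> \<in> hcar (DG G) \<and> mul (DG G) \<eta> \<theta> = hone (DG G) \<and>
     mul (DG G) \<theta> \<eta> = hone (DG G) \<and> counit (DG G) \<eta> = 1 \<and> (\<forall>a\<in>hcar (DG G). mul (DG G) \<eta> a = mul (DG G) a \<eta>)"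

lemma central_unitD:
  assumes "central_unit \<eta> \<theta>"
  shows "\<eta> \<in> hcar (DG G)" "\<theta> \<in> hcar (DG G)" "mul (DG G) \<eta> \<theta> = hone (DG G)"
    "mul (DG G) \<theta> \<eta> = hone (DG G)" "counit (DG G) \<eta> = 1"
    "a \<in> hcar (DG G) \<Longrightarrow> mul (DG G) \<eta> a = mul (DG G) a \<eta>"
proof -
  note c = assms[unfolded central_unit_def]
  show "\<eta> \<in> hcar (DG G)" by (rule c[THEN conjunct1])
  show "\<theta> \<in> hcar (DG G)" by (rule c[THEN conjunct2, THEN conjunct1])
  show "mul (DG G) \<eta> \<theta> = hone (DG G)" by (rule c[THEN conjunct2, THEN conjunct2, THEN conjunct1])
  show "mul (DG G) \<theta> \<eta> = hone (DG G)" by (rule c[THEN conjunct2, THEN conjunct2, THEN conjunct2, THEN conjunct1])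
  note c' = c[THEN conjunct2, THEN conjunct2, THEN conjunct2, THEN conjunct2]
  show "counit (DG G) \<eta> = 1" by (rule c'[THEN conjunct1])
  show "a \<in> hcar (DG G) \<Longrightarrow> mul (DG G) \<eta> a = mul (DG G) a \<eta>" by (rule c'[THEN conjunct2, THEN bspec])
qed

text \<open>The element \<open>(\<eta> \<otimes> \<eta>) \<Delta>(\<theta>)\<close> of \<open>DG \<otimes> DG\<close>; for \<open>\<theta> = \<eta>\<^sup>-\<^sup>1\<close> it is the coboundary of
  \<open>\<eta>\<close>.\<close>

definition dcob :: "('a \<times> 'a \<Rightarrow> 'k::field) \<Rightarrow> ('a \<times> 'a \<Rightarrow> 'k) \<Rightarrow> ('a \<times> 'a) \<times> 'a \<times> 'a \<Rightarrow> 'k" where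
  "dcob \<eta> \<theta> = mul2 (DG G) (tensor \<eta> \<eta>) (comul (DG G) \<theta>)"

abbreviation cobounds :: "(('a \<times> 'a) \<times> 'a \<times> 'a \<Rightarrow> 'k::field) set" where
  "cobounds \<equiv> cobound (DGd G) ` Reg1L (DGd G)"

text \<open>Laziness of a cochain, tested on basis elements of \<open>DG*\<close>, says that it commutes with the basis
  elements of \<open>DG\<close>.\<close>

lemma lazy_iff_central:
  fixes \<eta> :: "'a \<times> 'a \<Rightarrow> 'k::field"
  shows "(\<forall>a\<in>hcar (DGd G). \<forall>z. sw (DGd G) a (\<lambda>a1 a2. ev (DGd G) \<eta> a1 * a2 z) =
      sw (DGd G) a (\<lambda>a1 a2. a1 z * ev (DGd G) \<eta> a2)) \<longleftrightarrow>
    (\<forall>a\<in>hcar (DG G). mul (DG G) \<eta> a = mul (DG G) a \<eta>)"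
proof -
  let ?K = "DGd G :: ('a \<times> 'a, 'k) hopf" and ?B = "carrier G \<times> carrier G"
  have sym: "bv p z = (bv z p :: 'k)" for p z :: "'a \<times> 'a" by (simp add: bv_def eq_commute)
  have L: "sw ?K (bv x) (\<lambda>a1 a2. ev ?K \<eta> a1 * a2 z) = mul (DG G) \<eta> (bv z) x"
    and R: "sw ?K (bv x) (\<lambda>a1 a2. a1 z * ev ?K \<eta> a2) = mul (DG G) (bv z) \<eta> x" for x z
    by (cases x; auto simp: sw_DGd_bv mul_DG ev_bv sym[of _ z] intro!: sum.cong)+
  have lin: "sw ?K a F = (\<Sum>x\<in>?B. a x * sw ?K (bv x) F)" for a F
    unfolding sw_DGd[of a] by (rule sum.cong[OF refl]) (clarsimp simp: sw_DGd_bv)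
  show ?thesis
  proof (intro iffI ballI allI)
    assume lz: "\<forall>a\<in>hcar ?K. \<forall>z. sw ?K a (\<lambda>a1 a2. ev ?K \<eta> a1 * a2 z) = sw ?K a (\<lambda>a1 a2. a1 z * ev ?K \<eta> a2)"
    have bz: "mul (DG G) \<eta> (bv z) = mul (DG G) (bv z) \<eta>" for z
    proof
      fix x show "mul (DG G) \<eta> (bv z) x = mul (DG G) (bv z) \<eta> x"
      proof (cases "x \<in> ?B")
        case True
        then have "bv x \<in> hcar ?K" by (intro bv_hcar) simp
        then show ?thesis using lz[rule_format, of "bv x" z] L[of x z] R[of x z] by simp
      next
        case False
        then show ?thesis by (cases x) (auto simp: mul_DG)
      qed
    qed
    fix a :: "'a \<times> 'a \<Rightarrow> 'k" assume "a \<in> hcar (DG G)"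
    then show "mul (DG G) \<eta> a = mul (DG G) a \<eta>"
    proof (rule hcar_induct[OF finite_basis_DG])
      show "mul (DG G) \<eta> (\<lambda>x. 0) = mul (DG G) (\<lambda>x. 0) \<eta>" by (simp add: mul_def)
      fix a :: "'a \<times> 'a \<Rightarrow> 'k" and c x assume "mul (DG G) \<eta> a = mul (DG G) a \<eta>"
      moreover have "mul (DG G) \<eta> (\<lambda>y. a y + c * bv x y) = (\<lambda>z. mul (DG G) \<eta> a z + c * mul (DG G) \<eta> (bv x) z)"
        by (simp add: mul_def fun_eq_iff algebra_simps sum.distrib sum_distrib_left)
      moreover have "mul (DG G) (\<lambda>y. a y + c * bv x y) \<eta> = (\<lambda>z. mul (DG G) a \<eta> z + c * mul (DG G) (bv x) \<eta> z)"
        by (simp add: mul_def fun_eq_iff algebra_simps sum.distrib sum_distrib_left)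
      ultimately show "mul (DG G) \<eta> (\<lambda>y. a y + c * bv x y) = mul (DG G) (\<lambda>y. a y + c * bv x y) \<eta>"
        by (simp only: bz)
    qed
  next
    fix a z assume cen: "\<forall>a\<in>hcar (DG G). mul (DG G) \<eta> a = mul (DG G) a \<eta>"
    have "mul (DG G) \<eta> (bv z) x = mul (DG G) (bv z) \<eta> x" if x: "x \<in> ?B" for x
    proof (cases "z \<in> ?B")
      case True
      then have "bv z \<in> hcar (DG G :: ('a \<times> 'a, 'k) hopf)" by (intro bv_hcar) simp
      then show ?thesis using cen by simp
    next
      case False
      then have "bv z p = (0 :: 'k)" if "p \<in> ?B" for p using that by (auto simp: bv_def)
      then show ?thesis using x by (cases x) (simp add: mul_DG)
    qed
    then show "sw ?K a (\<lambda>a1 a2. ev ?K \<eta> a1 * a2 z) = sw ?K a (\<lambda>a1 a2. a1 z * ev ?K \<eta> a2)"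
      unfolding lin[of a] L R by (intro sum.cong) auto
  qed
qed

lemma ev_hone_DGd: "ev (DGd G) \<eta> (hone (DGd G)) = (counit (DG G) \<eta> :: 'k::field)"
  unfolding ev_def counit_def basis_simps by (rule sum.cong) (auto simp: DG_def)

lemma Reg1L_iff: "\<eta> \<in> Reg1L (DGd G) \<longleftrightarrow> (\<exists>\<theta>. central_unit \<eta> (\<theta> :: _ \<Rightarrow> 'k::field))"
  unfolding Reg1L_def mem_Collect_eq lazy_iff_central
  unfolding ev_hone_DGd conv_DGd conv_one_DGd hcar_DGd central_unit_def by (auto simp del: hone_simps)

lemma conv_inv_eq:
  assumes "central_unit \<eta> (\<theta> :: _ \<Rightarrow> 'k::field)"
  shows "conv_inv (DGd G) \<eta> = \<theta>"
  unfolding conv_inv_def conv_DGd conv_one_DGd hcar_DGd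
proof (rule the_equality)
  note c = central_unitD(1-5)[OF assms]
  show "\<theta> \<in> hcar (DG G) \<and> mul (DG G) \<eta> \<theta> = hone (DG G) \<and> mul (DG G) \<theta> \<eta> = hone (DG G)"
    using c by simp
  fix \<theta>' assume t: "\<theta>' \<in> hcar (DG G) \<and> mul (DG G) \<eta> \<theta>' = hone (DG G) \<and> mul (DG G) \<theta>' \<eta> = hone (DG G)"
  have "\<theta>' = mul (DG G) (mul (DG G) \<theta> \<eta>) \<theta>'" using t c mul_DG_one(1)[of \<theta>'] by (simp del: hone_simps)
  also have "\<dots> = \<theta>" unfolding mul_DG_assoc using t c mul_DG_one(2)[of \<theta>] by (simp del: hone_simps)
  finally show "\<theta>' = \<theta>" .
qed

lemma cobound_eq:
  assumes "central_unit \<eta> (\<theta> :: _ \<Rightarrow> 'k::field)"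
  shows "cobound (DGd G) \<eta> = dcob \<eta> \<theta>"
proof
  fix p :: "('a \<times> 'a) \<times> 'a \<times> 'a"
  obtain z1 z2 w1 w2 where p: "p = ((z1, z2), (w1, w2))" by (metis surj_pair)
  show "cobound (DGd G) \<eta> p = dcob \<eta> \<theta> p"
    unfolding cobound_def dcob_def conv_inv_eq[OF assms]
    by (auto simp: p sw_DGd_bv mul2_DG ev_bv ev_mul_DGd_bv tensor_def mult.assoc intro!: sum.cong)
qed

lemma cobounds_eq: "cobounds = {dcob \<eta> \<theta> | \<eta> (\<theta> :: _ \<Rightarrow> 'k::field). central_unit \<eta> \<theta>}"
proof (intro equalityI subsetI)
  fix s :: "('a \<times> 'a) \<times> 'a \<times> 'a \<Rightarrow> 'k" assume "s \<in> cobounds"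
  then obtain \<eta> \<theta> where "s = cobound (DGd G) \<eta>" "central_unit \<eta> \<theta>" by (auto simp: Reg1L_iff)
  then show "s \<in> {dcob \<eta> \<theta> | \<eta> \<theta>. central_unit \<eta> \<theta>}" using cobound_eq by auto
next
  fix s :: "('a \<times> 'a) \<times> 'a \<times> 'a \<Rightarrow> 'k" assume "s \<in> {dcob \<eta> \<theta> | \<eta> \<theta>. central_unit \<eta> \<theta>}"
  then obtain \<eta> \<theta> where s: "s = dcob \<eta> \<theta>" "central_unit \<eta> \<theta>" by auto
  then show "s \<in> cobounds"
    by (intro image_eqI[of _ _ \<eta>]) (auto simp: cobound_eq Reg1L_iff)
qed

lemma dcob_mult:
  assumes c: "central_unit \<eta> (\<theta> :: _ \<Rightarrow> 'k::field)" and c': "central_unit \<eta>' \<theta>'"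
  shows "mul2 (DG G) (dcob \<eta> \<theta>) (dcob \<eta>' \<theta>') = dcob (mul (DG G) \<eta> \<eta>') (mul (DG G) \<theta> \<theta>')"
proof -
  note d' = central_unitD[OF c']
  let ?m = "mul2 (DG G) :: _ \<Rightarrow> _ \<Rightarrow> _ \<Rightarrow> 'k"
  have "?m (dcob \<eta> \<theta>) (dcob \<eta>' \<theta>') =
      ?m (tensor \<eta> \<eta>) (?m (?m (comul (DG G) \<theta>) (tensor \<eta>' \<eta>')) (comul (DG G) \<theta>'))"
    unfolding dcob_def by (simp only: mul2_DG_assoc)
  also have "?m (comul (DG G) \<theta>) (tensor \<eta>' \<eta>') = ?m (tensor \<eta>' \<eta>') (comul (DG G) \<theta>)"
    by (rule mul2_central[symmetric, OF comul_DG_forms2 d'(6)])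
  also have "?m (tensor \<eta> \<eta>) (?m (?m (tensor \<eta>' \<eta>') (comul (DG G) \<theta>)) (comul (DG G) \<theta>')) =
      ?m (?m (tensor \<eta> \<eta>) (tensor \<eta>' \<eta>')) (?m (comul (DG G) \<theta>) (comul (DG G) \<theta>'))"
    by (simp only: mul2_DG_assoc)
  finally show ?thesis unfolding dcob_def by (simp only: mul2_tensor comul_DG_mult)
qed

lemma central_unit_mult:
  assumes c: "central_unit \<eta> (\<theta> :: _ \<Rightarrow> 'k::field)" and c': "central_unit \<eta>' \<theta>'"
  shows "central_unit (mul (DG G) \<eta> \<eta>') (mul (DG G) \<theta> \<theta>')"
proof -
  note d = central_unitD(1-5)[OF c] and d' = central_unitD(1-5)[OF c']
  let ?m = "mul (DG G) :: _ \<Rightarrow> _ \<Rightarrow> _ \<Rightarrow> 'k"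
  have cen: "?m \<eta> a = ?m a \<eta>" "?m \<eta>' a = ?m a \<eta>'" if "a \<in> hcar (DG G)" for a
    by (rule central_unitD(6)[OF c that], rule central_unitD(6)[OF c' that])
  have "?m (?m \<eta> \<eta>') (?m \<theta> \<theta>') = ?m \<eta> (?m (?m \<eta>' \<theta>) \<theta>')" by (simp only: mul_DG_assoc)
  also have "?m \<eta>' \<theta> = ?m \<theta> \<eta>'" by (rule cen(2)[OF d(2)])
  also have "?m \<eta> (?m (?m \<theta> \<eta>') \<theta>') = ?m (?m \<eta> \<theta>) (?m \<eta>' \<theta>')" by (simp only: mul_DG_assoc)
  also have "\<dots> = hone (DG G)" using d d' mul_DG_one(1)[OF hone_DG_hcar] by (simp del: hone_simps)
  finally have 1: "?m (?m \<eta> \<eta>') (?m \<theta> \<theta>') = hone (DG G)" .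
  have "?m (?m \<theta> \<theta>') (?m \<eta> \<eta>') = ?m \<theta> (?m (?m \<theta>' \<eta>) \<eta>')" by (simp only: mul_DG_assoc)
  also have "?m \<theta>' \<eta> = ?m \<eta> \<theta>'" by (rule cen(1)[OF d'(2), symmetric])
  also have "?m \<theta> (?m (?m \<eta> \<theta>') \<eta>') = ?m (?m \<theta> \<eta>) (?m \<theta>' \<eta>')" by (simp only: mul_DG_assoc)
  also have "\<dots> = hone (DG G)" using d d' mul_DG_one(1)[OF hone_DG_hcar] by (simp del: hone_simps)
  finally have 2: "?m (?m \<theta> \<theta>') (?m \<eta> \<eta>') = hone (DG G)" .
  have 3: "?m (?m \<eta> \<eta>') a = ?m a (?m \<eta> \<eta>')" if a: "a \<in> hcar (DG G)" for a
  proof -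
    have "?m (?m \<eta> \<eta>') a = ?m \<eta> (?m \<eta>' a)" by (rule mul_DG_assoc)
    also have "\<dots> = ?m (?m \<eta> a) \<eta>'" unfolding cen(2)[OF a] by (simp only: mul_DG_assoc)
    also have "\<dots> = ?m a (?m \<eta> \<eta>')" unfolding cen(1)[OF a] by (rule mul_DG_assoc)
    finally show ?thesis .
  qed
  show ?thesis
    unfolding central_unit_def
    by (intro conjI ballI 1 2 3 mul_DG_hcar) (simp_all add: counit_DG_mult d(5) d'(5))
qed

lemma central_unit_inverse:
  assumes c: "central_unit \<eta> (\<theta> :: _ \<Rightarrow> 'k::field)"
  shows "central_unit \<theta> \<eta>"
proof -
  note d = central_unitD(1-5)[OF c] and cen = central_unitD(6)[OF c]
  let ?m = "mul (DG G) :: _ \<Rightarrow> _ \<Rightarrow> _ \<Rightarrow> 'k"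
  have "counit (DG G) \<eta> * counit (DG G) \<theta> = counit (DG G) (?m \<eta> \<theta>)" by (rule counit_DG_mult[symmetric])
  then have 1: "counit (DG G) \<theta> = 1" using d by (simp add: counit_hone_DG del: hone_simps)
  have 2: "?m \<theta> a = ?m a \<theta>" if a: "a \<in> hcar (DG G)" for a
  proof -
    have "?m \<theta> a = ?m \<theta> (?m a (?m \<eta> \<theta>))" using d mul_DG_one(2)[OF a] by (simp del: hone_simps)
    also have "\<dots> = ?m \<theta> (?m (?m a \<eta>) \<theta>)" by (simp only: mul_DG_assoc)
    also have "?m a \<eta> = ?m \<eta> a" by (rule cen[OF a, symmetric])
    also have "?m \<theta> (?m (?m \<eta> a) \<theta>) = ?m (?m \<theta> \<eta>) (?m a \<theta>)" by (simp only: mul_DG_assoc)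
    also have "\<dots> = ?m a \<theta>" using d mul_DG_one(1)[of "?m a \<theta>"] by (simp del: hone_simps)
    finally show ?thesis .
  qed
  show ?thesis unfolding central_unit_def by (intro conjI ballI d 1 2)
qed

lemma central_unit_one: "central_unit (hone (DG G)) (hone (DG G) :: _ \<Rightarrow> 'k::field)"
  unfolding central_unit_def
  by (intro conjI ballI hone_DG_hcar mul_DG_one counit_hone_DG) (simp only: mul_DG_one)

lemma dcob_one: "dcob (hone (DG G)) (hone (DG G)) = (tensor (hone (DG G)) (hone (DG G)) :: _ \<Rightarrow> 'k::field)"
  unfolding dcob_def comul_hone_DG mul2_tensor mul_DG_one[OF hone_DG_hcar] ..

lemma dcob_dpull:
  assumes v: "v \<in> Aut"
  shows "dpull2 v (dcob \<eta> \<theta>) = dcob (dpull v \<eta>) (dpull v (\<theta> :: _ \<Rightarrow> 'k::field))"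
  unfolding dcob_def dpull2_mul2[OF v] dpull_tensor dpull_comul[OF v] ..

lemma dpull_inv:
  assumes v: "v \<in> Aut" and h: "h \<in> hcar (DG G)"
  shows "dpull v (dpull (iA v) h) = (h :: _ \<Rightarrow> 'k::field)"
  using Aut_props(1)[OF v] Aut_inv[OF v] hcarD[OF h] by (auto simp: pull_def fun_eq_iff)

lemma central_unit_dpull:
  assumes v: "v \<in> Aut" and c: "central_unit \<eta> (\<theta> :: _ \<Rightarrow> 'k::field)"
  shows "central_unit (dpull v \<eta>) (dpull v \<theta>)"
proof -
  note d = central_unitD(1-5)[OF c] and cen = central_unitD(6)[OF c]
  have "mul (DG G) (dpull v \<eta>) a = mul (DG G) a (dpull v \<eta>)" if a: "a \<in> hcar (DG G)" for a :: "_ \<Rightarrow> 'k"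
  proof -
    have "dpull v (mul (DG G) \<eta> (dpull (iA v) a)) = dpull v (mul (DG G) (dpull (iA v) a) \<eta>)"
      by (simp only: cen dpull_hcar)
    then show ?thesis by (simp only: dpull_mul[OF v] dpull_inv[OF v a])
  qed
  then show ?thesis
    unfolding central_unit_def using d
    by (simp add: dpull_mul[OF v, symmetric] dpull_hone[OF v] dpull_counit[OF v] del: hone_simps)
qed

text \<open>Together with \<open>one_cobounds\<close> below: the coboundaries form a group, stable under the maps
  \<open>v \<otimes> v\<close>.\<close>

lemma cobounds_closed:
  fixes s t :: "('a \<times> 'a) \<times> 'a \<times> 'a \<Rightarrow> 'k::field"
  assumes s: "s \<in> cobounds"
  shows "t \<in> cobounds \<Longrightarrow> mul2 (DG G) s t \<in> cobounds"
    "v \<in> Aut \<Longrightarrow> dpull2 v s \<in> cobounds"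
    "\<exists>t\<in>cobounds. mul2 (DG G) t s = tensor (hone (DG G)) (hone (DG G))"
    "s \<in> forms2 (DG G)"
proof -
  obtain \<eta> \<theta> where s': "s = dcob \<eta> \<theta>" "central_unit \<eta> \<theta>" using s unfolding cobounds_eq by auto
  show "mul2 (DG G) s t \<in> cobounds" if t: "t \<in> cobounds"
  proof -
    obtain \<eta>' \<theta>' where t': "t = dcob \<eta>' \<theta>'" "central_unit \<eta>' \<theta>'" using t unfolding cobounds_eq by auto
    show ?thesis unfolding cobounds_eq s' t' using dcob_mult[OF s'(2) t'(2)] central_unit_mult[OF s'(2) t'(2)] by auto
  qed
  show "dpull2 v s \<in> cobounds" if "v \<in> Aut"
    unfolding cobounds_eq s' dcob_dpull[OF that] using central_unit_dpull[OF that s'(2)] by auto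
  note i = central_unit_inverse[OF s'(2)]
  have "mul2 (DG G) (dcob \<theta> \<eta>) s = dcob (mul (DG G) \<theta> \<eta>) (mul (DG G) \<eta> \<theta>)"
    unfolding s' by (rule dcob_mult[OF i s'(2)])
  also have "\<dots> = tensor (hone (DG G)) (hone (DG G))"
    by (simp only: central_unitD(3,4)[OF s'(2)] dcob_one)
  finally show "\<exists>t\<in>cobounds. mul2 (DG G) t s = tensor (hone (DG G)) (hone (DG G))"
    using i unfolding cobounds_eq by auto
  show "s \<in> forms2 (DG G)" by (simp add: s' dcob_def)
qed

lemma one_cobounds: "tensor (hone (DG G)) (hone (DG G)) \<in> (cobounds :: (_ \<Rightarrow> 'k::field) set)"
  unfolding cobounds_eq
  by (intro CollectI exI[of _ "hone (DG G)"] conjI dcob_one[symmetric] central_unit_one)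

end

section \<open>Subgroups and outer automorphisms\<close>

text \<open>\<open>m_inv\<close> is a definite description over the whole carrier, so that closure under inverses needs
  uniqueness there.\<close>

lemma subgroupI_unique_inverse:
  assumes "H \<subseteq> carrier G" "\<And>x y. x \<in> H \<Longrightarrow> y \<in> H \<Longrightarrow> x \<otimes>\<^bsub>G\<^esub> y \<in> H" "\<one>\<^bsub>G\<^esub> \<in> H"
    and inv: "\<And>x. x \<in> H \<Longrightarrow> \<exists>y\<in>H. x \<otimes>\<^bsub>G\<^esub> y = \<one>\<^bsub>G\<^esub> \<and> y \<otimes>\<^bsub>G\<^esub> x = \<one>\<^bsub>G\<^esub> \<and>
      (\<forall>z\<in>carrier G. x \<otimes>\<^bsub>G\<^esub> z = \<one>\<^bsub>G\<^esub> \<longrightarrow> z \<otimes>\<^bsub>G\<^esub> x = \<one>\<^bsub>G\<^esub> \<longrightarrow> z = y)"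
  shows "subgroup H G"
proof (rule subgroup.intro[OF assms(1-3)])
  fix x assume "x \<in> H"
  then obtain y where y: "y \<in> H" "x \<otimes>\<^bsub>G\<^esub> y = \<one>\<^bsub>G\<^esub>" "y \<otimes>\<^bsub>G\<^esub> x = \<one>\<^bsub>G\<^esub>"
    "\<forall>z\<in>carrier G. x \<otimes>\<^bsub>G\<^esub> z = \<one>\<^bsub>G\<^esub> \<longrightarrow> z \<otimes>\<^bsub>G\<^esub> x = \<one>\<^bsub>G\<^esub> \<longrightarrow> z = y"
    using inv by meson
  have "inv\<^bsub>G\<^esub> x = y"
    unfolding m_inv_def by (rule the_equality) (use y assms(1) in auto)
  then show "inv\<^bsub>G\<^esub> x \<in> H" using y(1) by simp
qed

lemma Aut_Hopf_simps:
  "carrier (Aut_Hopf H) = hopf_maps H H \<inter> Bij (hcar H)"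
  "x \<in> Bij (hcar H) \<Longrightarrow> y \<in> Bij (hcar H) \<Longrightarrow> x \<otimes>\<^bsub>Aut_Hopf H\<^esub> y = compose (hcar H) x y"
  "\<one>\<^bsub>Aut_Hopf H\<^esub> = (\<lambda>x\<in>hcar H. x)"
  by (simp_all add: Aut_Hopf_def BijGroup_def)

lemma compose_Bij_assoc:
  assumes "x \<in> Bij S" "y \<in> Bij S" "z \<in> Bij S"
  shows "compose S (compose S x y) z = compose S x (compose S y z)"
  using assms by (intro compose_assoc[symmetric] Bij_imp_funcset)

lemma compose_Bij_ident:
  assumes "x \<in> Bij S"
  shows "compose S (\<lambda>x\<in>S. x) x = x" "compose S x (\<lambda>x\<in>S. x) = x"
  by (rule Id_compose[OF Bij_imp_funcset[OF assms] Bij_imp_extensional[OF assms]])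
    (rule compose_Id[OF Bij_imp_funcset[OF assms] Bij_imp_extensional[OF assms]])

context fin_group
begin

lemma V_map_apply:
  "v \<in> Aut \<Longrightarrow> h \<in> hcar (DG G) \<Longrightarrow> V_map G v h = dpull (iA v) (h :: _ \<Rightarrow> 'k::field)"
  by (simp add: V_map_eq)

lemma Aut_compose:
  assumes "v \<in> Aut" "w \<in> Aut"
  shows "compose (carrier G) v w \<in> Aut"
    "x \<in> carrier G \<Longrightarrow> iA (compose (carrier G) v w) x = iA w (iA v x)"
proof -
  interpret A: group "AutoGroup G" by (rule AutoGroup)
  show "compose (carrier G) v w \<in> Aut" using A.m_closed[OF assms] by (simp add: Aut_mult assms)
  have "iA (v \<otimes>\<^bsub>AutoGroup G\<^esub> w) = iA w \<otimes>\<^bsub>AutoGroup G\<^esub> iA v" using assms by (simp add: A.inv_mult_group)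
  then show "x \<in> carrier G \<Longrightarrow> iA (compose (carrier G) v w) x = iA w (iA v x)"
    using assms by (simp add: Aut_mult Aut_inv(1) compose_eq)
qed

lemma V_map_compose:
  assumes v: "v \<in> Aut" and w: "w \<in> Aut"
  shows "compose (hcar (DG G)) (V_map G v) (V_map G w) = (V_map G (compose (carrier G) v w) :: (_ \<Rightarrow> 'k::field) \<Rightarrow> _)"
proof
  fix h :: "'a \<times> 'a \<Rightarrow> 'k"
  note vw = Aut_compose(1)[OF v w]
  show "compose (hcar (DG G)) (V_map G v) (V_map G w) h = V_map G (compose (carrier G) v w) h"
  proof (cases "h \<in> hcar (DG G)")
    case True
    then have "V_map G v (V_map G w h) = V_map G (compose (carrier G) v w) h"
      unfolding V_map_apply[OF w True] V_map_apply[OF vw True] V_map_apply[OF v dpull_hcar]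
      using Aut_compose(2)[OF v w] Aut_props(1)[OF Aut_inv(1)[OF v]]
      by (auto simp: pull_def fun_eq_iff)
    then show ?thesis using True by (simp add: compose_eq)
  qed (simp add: compose_def V_map_def)
qed

lemma V_map_one: "V_map G (\<lambda>x\<in>carrier G. x) = (\<lambda>h\<in>hcar (DG G). h :: _ \<Rightarrow> 'k::field)"
proof -
  interpret A: group "AutoGroup G" by (rule AutoGroup)
  have o: "(\<lambda>x\<in>carrier G. x) \<in> Aut" using A.one_closed by (simp add: Aut_one)
  have i: "iA (\<lambda>x\<in>carrier G. x) = (\<lambda>x\<in>carrier G. x)" using A.inv_one by (simp only: Aut_one)
  have d: "dpull (\<lambda>x\<in>carrier G. x) h = h" if "h \<in> hcar (DG G)" for h :: "_ \<Rightarrow> 'k"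
    using hcarD[OF that] by (auto simp: pull_def fun_eq_iff)
  show ?thesis unfolding V_map_eq[OF o] i by (rule restrict_ext) (rule d)
qed

lemma Aut_compose_inv:
  assumes v: "v \<in> Aut"
  shows "compose (carrier G) v (iA v) = (\<lambda>x\<in>carrier G. x)" "compose (carrier G) (iA v) v = (\<lambda>x\<in>carrier G. x)"
  using Aut_inv[OF v] by (auto simp: compose_def restrict_def)

lemma V_map_carrier:
  assumes v: "v \<in> Aut"
  shows "V_map G v \<in> carrier (Aut_Hopf (DG G :: ('a \<times> 'a, 'k::field) hopf))"
    "V_map G v \<in> Bij (hcar (DG G :: ('a \<times> 'a, 'k) hopf))"
proof -
  let ?H = "hcar (DG G :: ('a \<times> 'a, 'k) hopf)"
  note i = Aut_inv(1)[OF v]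
  have c: "V_map G u h \<in> ?H" if "u \<in> Aut" "h \<in> ?H" for u h using that by (simp add: V_map_apply)
  have inv: "V_map G v (V_map G (iA v) h) = h" "V_map G (iA v) (V_map G v h) = h" if "h \<in> ?H" for h
    using fun_cong[OF V_map_compose[OF v i, where 'k = 'k], of h] fun_cong[OF V_map_compose[OF i v, where 'k = 'k], of h] that
    by (simp_all add: compose_eq Aut_compose_inv[OF v] V_map_one)
  show b: "V_map G v \<in> Bij ?H"
    unfolding Bij_def
    by (intro IntI CollectI bij_betw_byWitness[where f' = "V_map G (iA v)"])
      (use c[OF v] c[OF i] inv in \<open>auto simp: V_map_def\<close>)
  show "V_map G v \<in> carrier (Aut_Hopf (DG G :: ('a \<times> 'a, 'k) hopf))"
    unfolding Aut_Hopf_simps using b dpull_hopf_maps[OF i, where 'k = 'k] by (simp add: V_map_eq[OF v])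
qed

lemma V_map_mult:
  assumes "v \<in> Aut" "w \<in> Aut"
  shows "V_map G v \<otimes>\<^bsub>Aut_Hopf (DG G)\<^esub> V_map G w = (V_map G (v \<otimes>\<^bsub>AutoGroup G\<^esub> w) :: (_ \<Rightarrow> 'k::field) \<Rightarrow> _)"
  using assms by (simp add: Aut_Hopf_simps(2) V_map_carrier(2) V_map_compose Aut_mult)

lemma V_map_inj:
  assumes v: "v \<in> Aut" and w: "w \<in> Aut" and eq: "V_map G v = (V_map G w :: (_ \<Rightarrow> 'k::field) \<Rightarrow> _)"
  shows "v = w"
proof (rule extensionalityI[OF Aut_props(6)[OF v] Aut_props(6)[OF w]])
  fix x assume x: "x \<in> carrier G"
  let ?b = "bv (x, \<one>) :: _ \<Rightarrow> 'k"
  have b: "?b \<in> hcar (DG G)" by (rule bv_hcar) (use x in simp)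
  have "V_map G u ?b (u x, \<one>) = 1" "V_map G u ?b (y, \<one>) = 0" if "u \<in> Aut" "y \<in> carrier G" "y \<noteq> u x" for u y
    using b x that Aut_props(1,3)[OF that(1)] Aut_inv[OF that(1)] Aut_props(3)[OF Aut_inv(1)[OF that(1)]]
      Aut_eq_iff(1)[OF Aut_inv(1)[OF that(1)] that(2) x] Aut_inv_inv[OF that(1)]
    by (auto simp: V_map_apply pull_def bv_def)
  moreover have "V_map G v ?b (v x, \<one>) = 1"
    using b x Aut_props(1,3)[OF v] Aut_inv[OF v] Aut_props(3)[OF Aut_inv(1)[OF v]]
    by (auto simp: V_map_apply[OF v] pull_def bv_def)
  ultimately show "v x = w x" using w Aut_props(1)[OF v x] eq by (metis zero_neq_one)
qed

text \<open>Cancellation in \<open>Bij\<close>; here \<open>z\<close> is any Hopf automorphism.\<close>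

lemma V_map_left_inverse_unique:
  assumes v: "v \<in> Aut" and z: "z \<in> carrier (Aut_Hopf (DG G :: ('a \<times> 'a, 'k::field) hopf))"
    and w: "w \<in> Aut" and eq: "z \<otimes>\<^bsub>Aut_Hopf (DG G)\<^esub> V_map G v = V_map G w"
  shows "z = V_map G (w \<otimes>\<^bsub>AutoGroup G\<^esub> iA v)"
proof -
  let ?H = "hcar (DG G :: ('a \<times> 'a, 'k) hopf)"
  note i = Aut_inv(1)[OF v]
  have zB: "z \<in> Bij ?H" using z by (simp add: Aut_Hopf_simps)
  have vB: "V_map G v \<in> Bij ?H" "V_map G (iA v) \<in> Bij ?H" by (rule V_map_carrier(2)[OF v], rule V_map_carrier(2)[OF i])
  have "z = compose ?H z (compose ?H (V_map G v) (V_map G (iA v)))"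
    by (simp add: V_map_compose[OF v i] Aut_compose_inv[OF v] V_map_one compose_Bij_ident[OF zB])
  also have "\<dots> = compose ?H (compose ?H z (V_map G v)) (V_map G (iA v))"
    by (rule compose_Bij_assoc[OF zB vB, symmetric])
  also have "compose ?H z (V_map G v) = V_map G w"
    using eq by (simp add: Aut_Hopf_simps(2)[OF zB vB(1)])
  finally show ?thesis by (simp add: V_map_compose[OF w i] Aut_mult[OF w i])
qed

lemma subgroup_V_set: "subgroup (V_set G) (Aut_Hopf (DG G :: ('a \<times> 'a, 'k::field) hopf))"
proof (rule subgroupI_unique_inverse)
  interpret A: group "AutoGroup G" by (rule AutoGroup)
  let ?A = "Aut_Hopf (DG G :: ('a \<times> 'a, 'k) hopf)"
  have one: "\<one>\<^bsub>?A\<^esub> = V_map G \<one>\<^bsub>AutoGroup G\<^esub>" by (simp add: Aut_Hopf_simps Aut_one V_map_one)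
  show "V_set G \<subseteq> carrier ?A" unfolding V_set_def using V_map_carrier(1) by auto
  show "\<one>\<^bsub>?A\<^esub> \<in> V_set G" unfolding one V_set_def by simp
  fix x assume "x \<in> (V_set G :: ((_ \<Rightarrow> 'k) \<Rightarrow> _) set)"
  then obtain v where v: "v \<in> Aut" "x = V_map G v" unfolding V_set_def by auto
  show "\<exists>y\<in>V_set G. x \<otimes>\<^bsub>?A\<^esub> y = \<one>\<^bsub>?A\<^esub> \<and> y \<otimes>\<^bsub>?A\<^esub> x = \<one>\<^bsub>?A\<^esub> \<and>
      (\<forall>z\<in>carrier ?A. x \<otimes>\<^bsub>?A\<^esub> z = \<one>\<^bsub>?A\<^esub> \<longrightarrow> z \<otimes>\<^bsub>?A\<^esub> x = \<one>\<^bsub>?A\<^esub> \<longrightarrow> z = y)"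
  proof (intro bexI[of _ "V_map G (iA v)"] conjI ballI impI)
    fix z assume "z \<in> carrier ?A" "z \<otimes>\<^bsub>?A\<^esub> x = \<one>\<^bsub>?A\<^esub>"
    then show "z = V_map G (iA v)"
      using V_map_left_inverse_unique[OF v(1) _ A.one_closed, of z] v by (simp add: one)
  qed (use v in \<open>simp_all add: one V_map_mult V_set_def\<close>)
  fix y assume "y \<in> (V_set G :: ((_ \<Rightarrow> 'k) \<Rightarrow> _) set)"
  then obtain w where "w \<in> Aut" "y = V_map G w" unfolding V_set_def by auto
  then show "x \<otimes>\<^bsub>?A\<^esub> y \<in> V_set G" using v by (simp add: V_map_mult V_set_def)
qed

text \<open>The element \<open>1 \<otimes> 1\<close> of \<open>DG \<otimes> DG\<close>.\<close>

abbreviation one2 :: "('a \<times> 'a) \<times> 'a \<times> 'a \<Rightarrow> 'k::field" where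
  "one2 \<equiv> tensor (hone (DG G)) (hone (DG G))"

lemma map2_dagger: "v \<in> Aut \<Longrightarrow> map2 (DG G) (dagger G (V_map G v)) s = dpull2 v (s :: _ \<Rightarrow> 'k::field)"
  by (rule map2_dpull) (simp_all add: dagger_V_map)

lemma dpull2_one2: "v \<in> Aut \<Longrightarrow> dpull2 v one2 = (one2 :: _ \<Rightarrow> 'k::field)"
  by (simp only: dpull_tensor dpull_hone)

lemma one2_forms2: "one2 \<in> forms2 (DG G :: ('a \<times> 'a, 'k::field) hopf)"
  by (rule tensor_forms2[OF hone_DG_hcar hone_DG_hcar])

lemma Z2L_simps:
  "\<sigma> \<in> carrier (Z2L (DGd G)) \<Longrightarrow> \<sigma> \<in> forms2 (DG G :: ('a \<times> 'a, 'k::field) hopf)"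
  "monoid.mult (Z2L (DGd G)) = (mul2 (DG G) :: _ \<Rightarrow> _ \<Rightarrow> _ \<Rightarrow> 'k)"
  "one2 \<in> carrier (Z2L (DGd G :: ('a \<times> 'a, 'k) hopf))"
  using one_Z2L[where 'k = 'k] unfolding conv2_one_DGd
  by (simp_all add: Z2L_def two_cocycle_def forms2_DGd conv2_DGd fun_eq_iff del: hone_simps)

lemma subgroup_V_L:
  "subgroup (V_L G) (Aut_Z2L G :: ((('a \<times> 'a \<Rightarrow> 'k::field) \<Rightarrow> _) \<times> _) monoid)"
proof (rule subgroupI_unique_inverse)
  interpret A: group "AutoGroup G" by (rule AutoGroup)
  let ?A = "Aut_Hopf (DG G :: ('a \<times> 'a, 'k) hopf)"
  let ?Z = "Aut_Z2L G :: ((('a \<times> 'a \<Rightarrow> 'k) \<Rightarrow> _) \<times> _) monoid"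
  have oneA: "\<one>\<^bsub>?A\<^esub> = V_map G \<one>\<^bsub>AutoGroup G\<^esub>" by (simp add: Aut_Hopf_simps Aut_one V_map_one)
  have VL: "V_L G = {(V_map G v, one2 :: _ \<Rightarrow> 'k) | v. v \<in> Aut}"
    unfolding V_L_def V_set_def Z2L_one by auto
  have one: "\<one>\<^bsub>?Z\<^esub> = (V_map G \<one>\<^bsub>AutoGroup G\<^esub>, one2)" unfolding Aut_Z2L_def Z2L_one oneA by simp
  have car: "carrier ?Z = carrier ?A \<times> carrier (Z2L (DGd G))" by (simp add: Aut_Z2L_def)
  have mult: "(x, s) \<otimes>\<^bsub>?Z\<^esub> (V_map G w, t) = (x \<otimes>\<^bsub>?A\<^esub> V_map G w, mul2 (DG G) t (dpull2 w s))" if "w \<in> Aut" for x s w t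
    using map2_dagger[OF that, of s] by (simp add: Aut_Z2L_def)
  have mult1: "(V_map G v, one2) \<otimes>\<^bsub>?Z\<^esub> (V_map G w, t) = (V_map G (v \<otimes>\<^bsub>AutoGroup G\<^esub> w), t)"
    if "v \<in> Aut" "w \<in> Aut" "t \<in> forms2 (DG G)" for v w t
    unfolding mult[OF that(2)] dpull2_one2[OF that(2)] mul2_one(2)[OF that(3)] V_map_mult[OF that(1,2)] ..
  show "V_L G \<subseteq> carrier ?Z" unfolding VL car using V_map_carrier(1) Z2L_simps(3) by auto
  show "\<one>\<^bsub>?Z\<^esub> \<in> V_L G" unfolding VL one by auto
  fix x assume "x \<in> (V_L G :: (((_ \<Rightarrow> 'k) \<Rightarrow> _) \<times> _) set)"
  then obtain v where v: "v \<in> Aut" "x = (V_map G v, one2)" unfolding VL by auto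
  have i: "iA v \<in> Aut" using v by simp
  show "\<exists>y\<in>V_L G. x \<otimes>\<^bsub>?Z\<^esub> y = \<one>\<^bsub>?Z\<^esub> \<and> y \<otimes>\<^bsub>?Z\<^esub> x = \<one>\<^bsub>?Z\<^esub> \<and>
      (\<forall>z\<in>carrier ?Z. x \<otimes>\<^bsub>?Z\<^esub> z = \<one>\<^bsub>?Z\<^esub> \<longrightarrow> z \<otimes>\<^bsub>?Z\<^esub> x = \<one>\<^bsub>?Z\<^esub> \<longrightarrow> z = y)"
  proof (intro bexI[of _ "(V_map G (iA v), one2)"] conjI ballI impI)
    show "x \<otimes>\<^bsub>?Z\<^esub> (V_map G (iA v), one2) = \<one>\<^bsub>?Z\<^esub>" "(V_map G (iA v), one2) \<otimes>\<^bsub>?Z\<^esub> x = \<one>\<^bsub>?Z\<^esub>"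
      unfolding v(2) mult1[OF v(1) i one2_forms2] mult1[OF i v(1) one2_forms2] one using v(1) by simp_all
    show "(V_map G (iA v), one2 :: _ \<Rightarrow> 'k) \<in> V_L G" unfolding VL using i by auto
    fix z assume z: "z \<in> carrier ?Z" "x \<otimes>\<^bsub>?Z\<^esub> z = \<one>\<^bsub>?Z\<^esub>" "z \<otimes>\<^bsub>?Z\<^esub> x = \<one>\<^bsub>?Z\<^esub>"
    obtain \<phi> \<sigma> where z': "z = (\<phi>, \<sigma>)" "\<phi> \<in> carrier ?A" "\<sigma> \<in> carrier (Z2L (DGd G))"
      using z(1) unfolding car by auto
    have "\<phi> \<otimes>\<^bsub>?A\<^esub> V_map G v = V_map G \<one>\<^bsub>AutoGroup G\<^esub>"
      using z(3) unfolding v(2) z' mult[OF v(1)] one by simp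
    from V_map_left_inverse_unique[OF v(1) z'(2) A.one_closed this]
    have p: "\<phi> = V_map G (iA v)" using v(1) by simp
    have "\<sigma> = one2"
      using z(2) unfolding v(2) z'(1) p mult1[OF v(1) i Z2L_simps(1)[OF z'(3)]] one by simp
    then show "z = (V_map G (iA v), one2)" by (simp add: z' p)
  qed
  fix y assume "y \<in> (V_L G :: (((_ \<Rightarrow> 'k) \<Rightarrow> _) \<times> _) set)"
  then obtain w where w: "w \<in> Aut" "y = (V_map G w, one2)" unfolding VL by auto
  show "x \<otimes>\<^bsub>?Z\<^esub> y \<in> V_L G" unfolding v(2) w(2) mult1[OF v(1) w(1) one2_forms2] unfolding VL using v(1) w(1) by auto
qed

subsection \<open>Inner automorphisms\<close>

text \<open>Conjugation by \<open>g\<close>, extensional on \<open>G\<close>.\<close>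

abbreviation cj :: "'a \<Rightarrow> 'a \<Rightarrow> 'a" where "cj g \<equiv> \<lambda>x\<in>carrier G. g \<otimes> x \<otimes> inv g"

lemma cj_Aut:
  assumes g: "g \<in> carrier G"
  shows "cj g \<in> Aut" "iA (cj g) = cj (inv g)"
proof -
  interpret A: group "AutoGroup G" by (rule AutoGroup)
  have a: "cj h \<in> Aut" if h: "h \<in> carrier G" for h
  proof -
    have "bij_betw (cj h) (carrier G) (carrier G)"
      by (rule bij_betw_byWitness[where f' = "cj (inv h)"]) (use h in \<open>auto simp: m_assoc\<close>)
    moreover have "cj h \<in> hom G G" using h by (auto simp: hom_def m_assoc)
    ultimately show ?thesis by (simp add: AutoGroup_def auto_def Bij_def)
  qed
  show "cj g \<in> Aut" by (rule a[OF g])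
  have "compose (carrier G) (cj (inv g)) (cj g) = (\<lambda>x\<in>carrier G. x)"
    using g by (auto simp: fun_eq_iff compose_def m_assoc)
  then have "cj (inv g) \<otimes>\<^bsub>AutoGroup G\<^esub> cj g = \<one>\<^bsub>AutoGroup G\<^esub>"
    using a g by (simp only: Aut_mult inv_closed Aut_one)
  then show "iA (cj g) = cj (inv g)" by (rule A.inv_equality[OF _ a[OF g] a[OF inv_closed[OF g]]])
qed

lemma Inn_normal: "Inn_group G \<lhd> AutoGroup G"
proof -
  interpret A: group "AutoGroup G" by (rule AutoGroup)
  have I: "Inn_group G = cj ` carrier G" unfolding Inn_group_def by auto
  have m: "cj g \<otimes>\<^bsub>AutoGroup G\<^esub> cj h = cj (g \<otimes> h)" if "g \<in> carrier G" "h \<in> carrier G" for g h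
    using that by (auto simp: Aut_mult cj_Aut(1) fun_eq_iff compose_def m_assoc inv_mult_group)
  interpret c: group_hom G "AutoGroup G" cj
    by (rule group_hom.intro[OF group_axioms A.group_axioms], rule group_hom_axioms.intro)
      (use cj_Aut(1) m in \<open>auto simp: hom_def\<close>)
  have "subgroup (Inn_group G) (AutoGroup G)" unfolding I by (rule c.img_is_subgroup)
  moreover have "v \<otimes>\<^bsub>AutoGroup G\<^esub> i \<otimes>\<^bsub>AutoGroup G\<^esub> iA v \<in> Inn_group G" if v: "v \<in> Aut" and i: "i \<in> Inn_group G" for v i
  proof -
    obtain g where g: "g \<in> carrier G" "i = cj g" using i I by auto
    note vp = Aut_props[OF v]
    have "v \<otimes>\<^bsub>AutoGroup G\<^esub> cj g = cj (v g) \<otimes>\<^bsub>AutoGroup G\<^esub> v"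
      unfolding Aut_mult[OF v cj_Aut(1)[OF g(1)]] Aut_mult[OF cj_Aut(1)[OF vp(1)[OF g(1)]] v]
      using g(1) vp(1,2,4) by (auto simp: fun_eq_iff compose_def)
    then have "v \<otimes>\<^bsub>AutoGroup G\<^esub> i \<otimes>\<^bsub>AutoGroup G\<^esub> iA v = cj (v g)"
      using v cj_Aut(1)[OF vp(1)[OF g(1)]] by (simp only: g(2) A.m_assoc A.inv_closed A.r_inv A.r_one)
    then show ?thesis using I vp(1)[OF g(1)] by auto
  qed
  ultimately show ?thesis by (simp add: A.normal_inv_iff)
qed

text \<open>From \<open>\<Delta>(h) = h \<otimes> h\<close>, the element \<open>h\<close> is \<open>\<chi> \<times> g\<close> with \<open>\<chi>\<close> multiplicative.  Being a class function,
  \<open>\<chi>\<close> takes the same values on both sides.\<close>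

lemma mul_grouplike_commute:
  fixes h :: "'a \<times> 'a \<Rightarrow> 'k::field"
  assumes h: "h \<in> grouplikes (DG G)" and g: "g \<in> carrier G" "h (\<one>, g) \<noteq> 0"
  shows "mul (DG G) h x = mul (DG G) (dpull (iA (cj g)) x) h"
proof -
  have gl: "h (p, q) * h (r, s) = (if q = s then h (p \<otimes> r, q) else 0)"
    if "p \<in> carrier G" "q \<in> carrier G" "r \<in> carrier G" "s \<in> carrier G" for p q r s
  proof -
    have "comul (DG G) h ((p, q), (r, s)) = tensor h h ((p, q), (r, s))" using h by (simp add: grouplikes_def)
    then show ?thesis using that by (simp add: comul_DG tensor_def)
  qed
  \<comment> \<open>The support of \<open>h\<close> lies over the single element \<open>g\<close>.\<close>
  have zero: "h (p, q) = 0" if "p \<in> carrier G" "q \<in> carrier G" "q \<noteq> g" for p q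
    using gl[of p q \<one> g] that g by simp
  \<comment> \<open>\<open>p \<mapsto> h(p, g)\<close> is multiplicative with values in a field, hence a class function.\<close>
  have cls: "h (inv y \<otimes> z \<otimes> y, g) = h (z, g)" if yz: "y \<in> carrier G" "z \<in> carrier G" for y z
  proof -
    have "h (inv y \<otimes> z \<otimes> y, g) = h (inv y, g) * h (z, g) * h (y, g)"
      using yz g by (simp add: gl)
    also have "\<dots> = h (z, g) * (h (inv y, g) * h (y, g))" by (simp only: mult_ac)
    also have "\<dots> = h (z, g)" using yz g by (simp add: gl)
    finally show ?thesis .
  qed
  show ?thesis
  proof
    fix z :: "'a \<times> 'a" obtain z1 z2 where z: "z = (z1, z2)" by (cases z)
    show "mul (DG G) h x z = mul (DG G) (dpull (iA (cj g)) x) h z"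
    proof (cases "z1 \<in> carrier G \<and> z2 \<in> carrier G")
      case True
      then have T: "z1 \<in> carrier G" "z2 \<in> carrier G" by auto
      let ?r = "h (z1, g) * x (inv g \<otimes> z1 \<otimes> g, inv g \<otimes> z2)"
      have "mul (DG G) h x z = (\<Sum>y\<in>carrier G. of_bool (y = g) * (h (z1, y) * x (inv y \<otimes> z1 \<otimes> y, inv y \<otimes> z2)))"
        using T zero by (auto simp: z mul_DG intro!: sum.cong)
      also have "\<dots> = ?r" using g by (subst sum_of_bool_delta(1)[OF fin]) simp
      also have "?r = (\<Sum>y\<in>carrier G. of_bool (y = z2 \<otimes> inv g) *
          (x (inv g \<otimes> z1 \<otimes> g, inv g \<otimes> y \<otimes> g) * h (z1, g)))"
        using T g by (subst sum_of_bool_delta(1)[OF fin]) (simp add: m_assoc)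
      also have "\<dots> = mul (DG G) (dpull (iA (cj g)) x) h z"
      proof -
        have "of_bool (y = z2 \<otimes> inv g) * (x (inv g \<otimes> z1 \<otimes> g, inv g \<otimes> y \<otimes> g) * h (z1, g)) =
          dpull (iA (cj g)) x (z1, y) * h (inv y \<otimes> z1 \<otimes> y, inv y \<otimes> z2)" if y: "y \<in> carrier G" for y
        proof (cases "y = z2 \<otimes> inv g")
          case True
          have "inv y \<otimes> z2 = g" using T g by (simp add: True inv_mult_group m_assoc)
          then show ?thesis using True T g y cls[OF y T(1)] by (simp add: pull_def cj_Aut(2))
        next
          case False
          then have "inv y \<otimes> z2 \<noteq> g"
            using T g y by (metis inv_solve_left' inv_solve_right)
          then have "h (inv y \<otimes> z1 \<otimes> y, inv y \<otimes> z2) = 0" using T y by (intro zero) auto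
          then show ?thesis using False by simp
        qed
        then show ?thesis using T by (simp add: z mul_DG)
      qed
      finally show ?thesis .
    qed (auto simp: z mul_DG)
  qed
qed

lemma conj_grouplike:
  fixes h :: "'a \<times> 'a \<Rightarrow> 'k::field"
  assumes h: "h \<in> grouplikes (DG G)" and g: "g \<in> carrier G" "h (\<one>, g) \<noteq> 0"
    and h': "mul (DG G) h h' = hone (DG G)"
  shows "(\<lambda>x\<in>hcar (DG G). mul (DG G) (mul (DG G) h x) h') = V_map G (cj g)"
  unfolding V_map_eq[OF cj_Aut(1)[OF g(1)]] mul_grouplike_commute[OF h g]
  by (simp only: mul_DG_assoc h' mul_DG_one(2) dpull_hcar)

lemma Inn_Hopf_eq: "Inn_Hopf (DG G) = (V_map G ` Inn_group G :: ((_ \<Rightarrow> 'k::field) \<Rightarrow> _) set)"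
proof (intro equalityI subsetI)
  fix f assume "f \<in> Inn_Hopf (DG G :: ('a \<times> 'a, 'k) hopf)"
  then obtain h h' where h: "f = (\<lambda>x\<in>hcar (DG G). mul (DG G) (mul (DG G) h x) h')"
    "h \<in> grouplikes (DG G)" "mul (DG G) h h' = hone (DG G)" unfolding Inn_Hopf_def by auto
  have "(\<Sum>y\<in>carrier G. h (\<one>, y)) = 1" using h(2) by (simp add: grouplikes_def counit_DG)
  then obtain g where g: "g \<in> carrier G" "h (\<one>, g) \<noteq> 0"
    by (metis sum.neutral zero_neq_one)
  then have "f = V_map G (cj g)" unfolding h(1) by (rule conj_grouplike[OF h(2) _ _ h(3)])
  then show "f \<in> V_map G ` Inn_group G" using g(1) unfolding Inn_group_def by auto
next
  fix f assume "f \<in> (V_map G ` Inn_group G :: ((_ \<Rightarrow> 'k) \<Rightarrow> _) set)"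
  then obtain g where g: "g \<in> carrier G" "f = V_map G (cj g)" unfolding Inn_group_def by auto
  \<comment> \<open>The group-like element \<open>1 \<times> t\<close>.\<close>
  define u :: "'a \<Rightarrow> 'a \<times> 'a \<Rightarrow> 'k" where "u t = (\<lambda>(x, y). of_bool (x \<in> carrier G \<and> y = t))" for t
  have uc: "u t \<in> hcar (DG G)" if "t \<in> carrier G" for t
    by (rule hcarI) (use that in \<open>auto simp: u_def\<close>)
  have um: "mul (DG G) (u s) (u t) = u (s \<otimes> t)" if st: "s \<in> carrier G" "t \<in> carrier G" for s t
  proof
    fix z :: "'a \<times> 'a" obtain z1 z2 where z: "z = (z1, z2)" by (cases z)
    show "mul (DG G) (u s) (u t) z = u (s \<otimes> t) z"
    proof (cases "z1 \<in> carrier G \<and> z2 \<in> carrier G")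
      case True
      then have T: "z1 \<in> carrier G" "z2 \<in> carrier G" by auto
      have "mul (DG G) (u s) (u t) z = (\<Sum>y\<in>carrier G. of_bool (y = s) * of_bool (inv y \<otimes> z2 = t))"
        using T by (simp add: z mul_DG u_def)
      also have "\<dots> = of_bool (inv s \<otimes> z2 = t)" using st by (subst sum_of_bool_delta(1)[OF fin]) simp
      also have "\<dots> = u (s \<otimes> t) z" using T st inv_solve_left'[of t s z2] by (simp add: z u_def)
      finally show ?thesis .
    qed (use st in \<open>auto simp: z mul_DG u_def\<close>)
  qed
  have u1: "u \<one> = hone (DG G)" by (simp add: u_def)
  have gl: "u g \<in> grouplikes (DG G)"
    unfolding grouplikes_def
  proof (intro CollectI conjI uc[OF g(1)])
    show "comul (DG G) (u g) = tensor (u g) (u g)" using g(1) by (auto simp: fun_eq_iff comul_DG tensor_def u_def)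
    show "counit (DG G) (u g) = 1"
      using g(1) sum_of_bool_delta(1)[OF fin, of g "\<lambda>_. 1 :: 'k"] by (simp add: counit_DG u_def)
  qed
  have r: "mul (DG G) (u g) (u (inv g)) = hone (DG G)" "mul (DG G) (u (inv g)) (u g) = hone (DG G)"
    using um[of g "inv g"] um[of "inv g" g] g(1) u1 by (simp_all del: hone_simps)
  have "u g (\<one>, g) \<noteq> 0" by (simp add: u_def)
  from conj_grouplike[OF gl g(1) this r(1)]
  have "f = (\<lambda>x\<in>hcar (DG G). mul (DG G) (mul (DG G) (u g) x) (u (inv g)))" by (simp only: g(2))
  then show "f \<in> Inn_Hopf (DG G)"
    unfolding Inn_Hopf_def using gl r uc[of "inv g"] g(1) by blast
qed

subsection \<open>The image in the quotient\<close>

text \<open>The set of automorphisms of \<open>DG\<close> attached to a set \<open>C\<close> of automorphisms of \<open>G\<close>.\<close>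

abbreviation VC :: "('a \<Rightarrow> 'a) set \<Rightarrow> (('a \<times> 'a \<Rightarrow> 'k::field) \<Rightarrow> 'a \<times> 'a \<Rightarrow> 'k) set" where
  "VC C \<equiv> V_map G ` C"

lemma VC_rcoset:
  assumes v: "v \<in> Aut"
  shows "Inn_Hopf (DG G) #>\<^bsub>Aut_Hopf (DG G)\<^esub> V_map G v = (VC (Inn_group G #>\<^bsub>AutoGroup G\<^esub> v) :: ((_ \<Rightarrow> 'k::field) \<Rightarrow> _) set)"
proof -
  have "i \<in> Aut" if "i \<in> Inn_group G" for i
    using that normal_imp_subgroup[OF Inn_normal] subgroup.subset by auto
  then show ?thesis
    unfolding Inn_Hopf_eq r_coset_def image_UN using V_map_mult[OF _ v] by (auto simp: image_iff)
qed

lemma VC_set_mult: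
  assumes "C \<subseteq> Aut" "D \<subseteq> Aut"
  shows "VC C <#>\<^bsub>Aut_Hopf (DG G)\<^esub> VC D = (VC (C <#>\<^bsub>AutoGroup G\<^esub> D) :: ((_ \<Rightarrow> 'k::field) \<Rightarrow> _) set)"
proof -
  have "V_map G c \<otimes>\<^bsub>Aut_Hopf (DG G)\<^esub> V_map G d = (V_map G (c \<otimes>\<^bsub>AutoGroup G\<^esub> d) :: (_ \<Rightarrow> 'k) \<Rightarrow> _)"
    if "c \<in> C" "d \<in> D" for c d using that assms by (intro V_map_mult) auto
  then show ?thesis unfolding set_mult_def image_UN by (auto simp: image_iff)
qed

lemma VC_inj:
  assumes "C \<subseteq> Aut" "D \<subseteq> Aut" "VC C = (VC D :: ((_ \<Rightarrow> 'k::field) \<Rightarrow> _) set)"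
  shows "C = D"
proof -
  have "inj_on (V_map G :: _ \<Rightarrow> (_ \<Rightarrow> 'k) \<Rightarrow> _) Aut" by (rule inj_onI) (rule V_map_inj)
  then show ?thesis using assms inj_on_image_eq_iff by metis
qed

lemma Out_group_facts:
  "group (Out_group G)" "\<one>\<^bsub>Out_group G\<^esub> = Inn_group G" "C \<otimes>\<^bsub>Out_group G\<^esub> D = C <#>\<^bsub>AutoGroup G\<^esub> D"
  "C \<in> carrier (Out_group G) \<longleftrightarrow> (\<exists>v\<in>Aut. C = Inn_group G #>\<^bsub>AutoGroup G\<^esub> v)"
  using normal.factorgroup_is_group[OF Inn_normal]
  by (auto simp: Out_group_def FactGroup_def RCOSETS_def)

lemma Out_coset:
  assumes "C \<in> carrier (Out_group G)"
  shows "C \<subseteq> Aut" "C \<noteq> {}"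
proof -
  interpret A: group "AutoGroup G" by (rule AutoGroup)
  note sub = normal_imp_subgroup[OF Inn_normal]
  obtain v where v: "v \<in> Aut" "C = Inn_group G #>\<^bsub>AutoGroup G\<^esub> v" using assms Out_group_facts(4) by auto
  show "C \<subseteq> Aut" unfolding v(2) by (rule A.r_coset_subset_G[OF subgroup.subset[OF sub] v(1)])
  show "C \<noteq> {}" using A.rcos_self[OF v(1) sub] v(2) by auto
qed

lemma cobounds_rcoset:
  "(cobounds :: (_ \<Rightarrow> 'k::field) set) #>\<^bsub>Z2L (DGd G)\<^esub> s = (\<lambda>b. mul2 (DG G) b s) ` cobounds"
  unfolding r_coset_def Z2L_simps(2) by auto

lemma cobounds_rcoset_one: "(cobounds :: (_ \<Rightarrow> 'k::field) set) #>\<^bsub>Z2L (DGd G)\<^esub> one2 = cobounds"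
proof -
  have "mul2 (DG G) b one2 = b" if "b \<in> cobounds" for b :: "_ \<Rightarrow> 'k"
    by (rule mul2_one(2)[OF cobounds_closed(4)[OF that]])
  then show ?thesis unfolding cobounds_rcoset by (simp add: del: hone_simps)
qed

text \<open>The second component is always the trivial class.\<close>

lemma V_L_image_eq:
  "V_L_image G = (\<lambda>C. (VC C, cobounds :: (_ \<Rightarrow> 'k::field) set)) ` carrier (Out_group G)"
proof -
  have "V_L_image G = (\<lambda>v. proj_Out G (V_map G v, one2 :: _ \<Rightarrow> 'k)) ` Aut"
    unfolding V_L_image_def V_L_def V_set_def Z2L_one by auto
  also have "\<dots> = (\<lambda>v. (VC (Inn_group G #>\<^bsub>AutoGroup G\<^esub> v), cobounds)) ` Aut"
    by (rule image_cong[OF refl]) (simp only: proj_Out_def prod.case VC_rcoset cobounds_rcoset_one)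
  also have "\<dots> = (\<lambda>C. (VC C, cobounds)) ` carrier (Out_group G)"
  proof -
    have "carrier (Out_group G) = (\<lambda>v. Inn_group G #>\<^bsub>AutoGroup G\<^esub> v) ` Aut"
      using Out_group_facts(4) by auto
    then show ?thesis by (simp only: image_image)
  qed
  finally show ?thesis .
qed

lemma Out_H2L_mult:
  fixes A :: "((_ \<Rightarrow> 'k::field) \<Rightarrow> _) set"
  assumes C: "C \<in> carrier (Out_group G)" and D: "D \<in> carrier (Out_group G)"
  shows "(VC C, cobounds) \<otimes>\<^bsub>Out_H2L G\<^esub> (VC D, cobounds) = (VC (C \<otimes>\<^bsub>Out_group G\<^esub> D), cobounds :: (_ \<Rightarrow> 'k) set)"
proof -
  have "{mul2 (DG G) \<sigma>' (map2 (DG G) (dagger G \<phi>') \<sigma>) | \<sigma> \<sigma>' \<phi>'. \<sigma> \<in> cobounds \<and> \<sigma>' \<in> cobounds \<and> \<phi>' \<in> VC D} =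
      (cobounds :: (_ \<Rightarrow> 'k) set)"
  proof (intro equalityI subsetI)
    fix s :: "_ \<Rightarrow> 'k" assume "s \<in> {mul2 (DG G) \<sigma>' (map2 (DG G) (dagger G \<phi>') \<sigma>) | \<sigma> \<sigma>' \<phi>'.
        \<sigma> \<in> cobounds \<and> \<sigma>' \<in> cobounds \<and> \<phi>' \<in> VC D}"
    then obtain \<sigma> \<sigma>' v where s: "s = mul2 (DG G) \<sigma>' (map2 (DG G) (dagger G (V_map G v)) \<sigma>)"
      "\<sigma> \<in> cobounds" "\<sigma>' \<in> cobounds" "v \<in> D" by auto
    then have v: "v \<in> Aut" using Out_coset(1)[OF D] by auto
    show "s \<in> cobounds" unfolding s(1) map2_dagger[OF v]
      by (rule cobounds_closed(1)[OF s(3) cobounds_closed(2)[OF s(2) v]])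
  next
    fix s :: "_ \<Rightarrow> 'k" assume s: "s \<in> cobounds"
    obtain v where v: "v \<in> D" "v \<in> Aut" using Out_coset[OF D] by auto
    have "s = mul2 (DG G) s (map2 (DG G) (dagger G (V_map G v)) one2)"
      unfolding map2_dagger[OF v(2)] dpull2_one2[OF v(2)] by (rule mul2_one(2)[OF cobounds_closed(4)[OF s], symmetric])
    then show "s \<in> {mul2 (DG G) \<sigma>' (map2 (DG G) (dagger G \<phi>') \<sigma>) | \<sigma> \<sigma>' \<phi>'.
        \<sigma> \<in> cobounds \<and> \<sigma>' \<in> cobounds \<and> \<phi>' \<in> VC D}"
      using s one_cobounds v(1) by blast
  qed
  then show ?thesis
    unfolding Out_H2L_def by (simp add: Out_Hopf_def FactGroup_def VC_set_mult[OF Out_coset(1)[OF C] Out_coset(1)[OF D]]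
      Out_group_facts(3))
qed

lemma Out_H2L_one: "\<one>\<^bsub>Out_H2L G\<^esub> = (VC \<one>\<^bsub>Out_group G\<^esub>, cobounds :: (_ \<Rightarrow> 'k::field) set)"
  by (simp add: Out_H2L_def Out_Hopf_def H2L_def FactGroup_def Out_group_facts(2) Inn_Hopf_eq)

text \<open>Uniqueness of inverses over the whole carrier, where \<open>U\<close> is any class of Hopf automorphisms and
  \<open>S\<close> any class of lazy cocycles.  The first component of \<open>left\<close> puts \<open>U\<close> in the image of \<open>Out(G)\<close>;
  evaluating the second component of \<open>right\<close> at the trivial cocycle makes \<open>S\<close> trivial.\<close>

lemma Out_H2L_inverse_unique:
  fixes U :: "((_ \<Rightarrow> 'k::field) \<Rightarrow> _) set"
  assumes C: "C \<in> carrier (Out_group G)" and XS: "(U, S) \<in> carrier (Out_H2L G)"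
    and right: "(VC C, cobounds) \<otimes>\<^bsub>Out_H2L G\<^esub> (U, S) = \<one>\<^bsub>Out_H2L G\<^esub>"
    and left: "(U, S) \<otimes>\<^bsub>Out_H2L G\<^esub> (VC C, cobounds) = \<one>\<^bsub>Out_H2L G\<^esub>"
  shows "(U, S) = (VC (inv\<^bsub>Out_group G\<^esub> C), cobounds)"
proof -
  interpret A: group "AutoGroup G" by (rule AutoGroup)
  interpret O: group "Out_group G" by (rule Out_group_facts(1))
  note sub = normal_imp_subgroup[OF Inn_normal]
  let ?A = "Aut_Hopf (DG G :: ('a \<times> 'a, 'k) hopf)"
  obtain \<phi> where phi: "\<phi> \<in> carrier ?A" "U = Inn_Hopf (DG G) #>\<^bsub>?A\<^esub> \<phi>"
    using XS by (auto simp: Out_H2L_def Out_Hopf_def FactGroup_def RCOSETS_def)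
  obtain s where s: "s \<in> carrier (Z2L (DGd G))" "S = cobounds #>\<^bsub>Z2L (DGd G)\<^esub> s"
    using XS by (auto simp: Out_H2L_def H2L_def FactGroup_def RCOSETS_def)
  have sf: "s \<in> forms2 (DG G)" by (rule Z2L_simps(1)[OF s(1)])
  obtain v where v: "v \<in> C" "v \<in> Aut" using Out_coset[OF C] by auto
  have fst_left: "U <#>\<^bsub>?A\<^esub> VC C = VC (Inn_group G)"
    using left by (simp add: Out_H2L_one Out_group_facts(2)) (simp add: Out_H2L_def Out_Hopf_def FactGroup_def)
  have "V_map G \<one>\<^bsub>AutoGroup G\<^esub> \<in> Inn_Hopf (DG G :: ('a \<times> 'a, 'k) hopf)"
    unfolding Inn_Hopf_eq using subgroup.one_closed[OF sub] by auto
  moreover have "V_map G \<one>\<^bsub>AutoGroup G\<^esub> \<otimes>\<^bsub>?A\<^esub> \<phi> = \<phi>"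
  proof -
    have "\<phi> \<in> Bij (hcar (DG G))" using phi(1) by (simp add: Aut_Hopf_simps)
    then show ?thesis unfolding Aut_one V_map_one by (simp add: Aut_Hopf_simps(2) id_Bij compose_Bij_ident)
  qed
  ultimately have "\<phi> \<in> U" unfolding phi(2) r_coset_def by force
  then have "\<phi> \<otimes>\<^bsub>?A\<^esub> V_map G v \<in> VC (Inn_group G)" unfolding fst_left[symmetric] set_mult_def using v(1) by auto
  then obtain i where i: "i \<in> Inn_group G" "\<phi> \<otimes>\<^bsub>?A\<^esub> V_map G v = V_map G i" by auto
  have iA': "i \<in> Aut" using i(1) subgroup.subset[OF sub] by auto
  define w where "w = i \<otimes>\<^bsub>AutoGroup G\<^esub> iA v"
  have w: "w \<in> Aut" unfolding w_def using iA' v(2) by simp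
  \<comment> \<open>Hence \<open>\<phi>\<close> itself comes from an automorphism of \<open>G\<close>.\<close>
  have phiw: "\<phi> = V_map G w" unfolding w_def by (rule V_map_left_inverse_unique[OF v(2) phi(1) iA' i(2)])
  define D where "D = Inn_group G #>\<^bsub>AutoGroup G\<^esub> w"
  have D: "D \<in> carrier (Out_group G)" unfolding D_def using Out_group_facts(4) w by auto
  have XD: "U = VC D" unfolding phi(2) phiw D_def by (rule VC_rcoset[OF w])
  have "VC (D <#>\<^bsub>AutoGroup G\<^esub> C) = (VC (Inn_group G) :: ((_ \<Rightarrow> 'k) \<Rightarrow> _) set)"
    using fst_left unfolding XD VC_set_mult[OF Out_coset(1)[OF D] Out_coset(1)[OF C]] .
  moreover have "D <#>\<^bsub>AutoGroup G\<^esub> C \<subseteq> Aut" using Out_coset(1)[OF O.m_closed[OF D C]] by (simp add: Out_group_facts(3))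
  ultimately have "D <#>\<^bsub>AutoGroup G\<^esub> C = Inn_group G"
    using VC_inj[OF _ subgroup.subset[OF sub]] by blast
  then have "D = inv\<^bsub>Out_group G\<^esub> C"
    using O.inv_equality[of D C] C D by (simp add: Out_group_facts(2,3))
  moreover have "S = cobounds"
  proof -
    have snd: "{mul2 (DG G) \<sigma>' (map2 (DG G) (dagger G \<phi>') \<sigma>) | \<sigma> \<sigma>' \<phi>'. \<sigma> \<in> cobounds \<and> \<sigma>' \<in> S \<and> \<phi>' \<in> U} = cobounds"
      using right by (simp add: Out_H2L_one) (simp add: Out_H2L_def)
    have "one2 \<in> (cobounds :: (_ \<Rightarrow> 'k) set)" by (rule one_cobounds)
    moreover have "mul2 (DG G) one2 s = s" by (rule mul2_one(1)[OF sf])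
    ultimately have sS: "s \<in> S" unfolding s(2) cobounds_rcoset by (metis imageI)
    \<comment> \<open>The product of the trivial cocycle with \<open>(\<phi>, s)\<close> has second component \<open>s\<close>.\<close>
    have "mul2 (DG G) s (map2 (DG G) (dagger G \<phi>) one2) \<in> cobounds"
      by (rule subsetD[OF equalityD1[OF snd]]) (use sS \<open>\<phi> \<in> U\<close> one_cobounds in blast)
    then have sB: "s \<in> cobounds"
      unfolding phiw map2_dagger[OF w] dpull2_one2[OF w] mul2_one(2)[OF sf] .
    obtain t where t: "t \<in> cobounds" "mul2 (DG G) t s = one2" using cobounds_closed(3)[OF sB] by auto
    show "S = cobounds"
    proof (intro equalityI subsetI)
      fix b assume "b \<in> S"
      then show "b \<in> cobounds" unfolding s(2) cobounds_rcoset using cobounds_closed(1)[OF _ sB] by auto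
    next
      fix b :: "_ \<Rightarrow> 'k" assume b: "b \<in> cobounds"
      have "b = mul2 (DG G) (mul2 (DG G) b t) s"
        unfolding mul2_DG_assoc t(2) by (rule mul2_one(2)[OF cobounds_closed(4)[OF b], symmetric])
      then show "b \<in> S" unfolding s(2) cobounds_rcoset using cobounds_closed(1)[OF b t(1)] by (rule image_eqI)
    qed
  qed
  ultimately show ?thesis by (simp add: XD)
qed

lemma VC_carrier:
  assumes C: "C \<in> carrier (Out_group G)"
  shows "(VC C, cobounds :: (_ \<Rightarrow> 'k::field) set) \<in> carrier (Out_H2L G)"
proof -
  obtain v where v: "v \<in> Aut" "C = Inn_group G #>\<^bsub>AutoGroup G\<^esub> v" using C Out_group_facts(4) by auto
  have "VC C = Inn_Hopf (DG G) #>\<^bsub>Aut_Hopf (DG G :: ('a \<times> 'a, 'k) hopf)\<^esub> V_map G v"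
    unfolding v(2) by (rule VC_rcoset[OF v(1), symmetric])
  then have "VC C \<in> carrier (Out_Hopf (DG G :: ('a \<times> 'a, 'k) hopf))"
    using V_map_carrier(1)[OF v(1)] by (auto simp: Out_Hopf_def FactGroup_def RCOSETS_def)
  moreover have "(cobounds :: (_ \<Rightarrow> 'k) set) \<in> carrier (H2L (DGd G))"
    using cobounds_rcoset_one[where 'k = 'k, symmetric] Z2L_simps(3)[where 'k = 'k]
    unfolding H2L_def FactGroup_def RCOSETS_def by (simp del: hone_simps) blast
  ultimately show ?thesis by (simp add: Out_H2L_def)
qed

lemma subgroup_V_L_image:
  "subgroup (V_L_image G) (Out_H2L G :: (((_ \<Rightarrow> 'k::field) \<Rightarrow> _) set \<times> _) monoid)"
proof (rule subgroupI_unique_inverse)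
  interpret O: group "Out_group G" by (rule Out_group_facts(1))
  let ?Q = "Out_H2L G :: (((_ \<Rightarrow> 'k) \<Rightarrow> _) set \<times> _) monoid"
  let ?p = "\<lambda>C. (VC C, cobounds :: (_ \<Rightarrow> 'k) set)"
  show "V_L_image G \<subseteq> carrier ?Q" unfolding V_L_image_eq using VC_carrier by auto
  show "\<one>\<^bsub>?Q\<^esub> \<in> V_L_image G" unfolding V_L_image_eq Out_H2L_one by (rule imageI) simp
  fix x assume "x \<in> (V_L_image G :: (((_ \<Rightarrow> 'k) \<Rightarrow> _) set \<times> _) set)"
  then obtain C where C: "C \<in> carrier (Out_group G)" "x = ?p C" unfolding V_L_image_eq by auto
  have i: "inv\<^bsub>Out_group G\<^esub> C \<in> carrier (Out_group G)" using C(1) by simp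
  show "\<exists>y\<in>V_L_image G. x \<otimes>\<^bsub>?Q\<^esub> y = \<one>\<^bsub>?Q\<^esub> \<and> y \<otimes>\<^bsub>?Q\<^esub> x = \<one>\<^bsub>?Q\<^esub> \<and>
      (\<forall>z\<in>carrier ?Q. x \<otimes>\<^bsub>?Q\<^esub> z = \<one>\<^bsub>?Q\<^esub> \<longrightarrow> z \<otimes>\<^bsub>?Q\<^esub> x = \<one>\<^bsub>?Q\<^esub> \<longrightarrow> z = y)"
  proof (intro bexI[of _ "?p (inv\<^bsub>Out_group G\<^esub> C)"] conjI ballI impI)
    show "x \<otimes>\<^bsub>?Q\<^esub> ?p (inv\<^bsub>Out_group G\<^esub> C) = \<one>\<^bsub>?Q\<^esub>" "?p (inv\<^bsub>Out_group G\<^esub> C) \<otimes>\<^bsub>?Q\<^esub> x = \<one>\<^bsub>?Q\<^esub>"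
      unfolding C(2) Out_H2L_mult[OF C(1) i] Out_H2L_mult[OF i C(1)] Out_H2L_one
      using C(1) by (simp_all only: O.r_inv O.l_inv)
    show "?p (inv\<^bsub>Out_group G\<^esub> C) \<in> V_L_image G" unfolding V_L_image_eq using i by (rule imageI)
    fix z assume z: "z \<in> carrier ?Q" "x \<otimes>\<^bsub>?Q\<^esub> z = \<one>\<^bsub>?Q\<^esub>" "z \<otimes>\<^bsub>?Q\<^esub> x = \<one>\<^bsub>?Q\<^esub>"
    obtain U S where xs: "z = (U, S)" by (cases z)
    show "z = ?p (inv\<^bsub>Out_group G\<^esub> C)"
      unfolding xs by (rule Out_H2L_inverse_unique[OF C(1)]) (use z in \<open>simp_all only: xs C(2)\<close>)
  qed
  fix y assume "y \<in> (V_L_image G :: (((_ \<Rightarrow> 'k) \<Rightarrow> _) set \<times> _) set)"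
  then obtain D where D: "D \<in> carrier (Out_group G)" "y = ?p D" unfolding V_L_image_eq by auto
  show "x \<otimes>\<^bsub>?Q\<^esub> y \<in> V_L_image G"
    unfolding C(2) D(2) Out_H2L_mult[OF C(1) D(1)] V_L_image_eq by (rule imageI) (simp add: C(1) D(1))
qed

lemma V_L_image_iso:
  "(Out_H2L G :: (((_ \<Rightarrow> 'k::field) \<Rightarrow> _) set \<times> _) monoid) \<lparr>carrier := V_L_image G\<rparr> \<cong> Out_group G"
proof -
  let ?Q = "(Out_H2L G :: (((_ \<Rightarrow> 'k) \<Rightarrow> _) set \<times> _) monoid) \<lparr>carrier := V_L_image G\<rparr>"
  let ?p = "\<lambda>C. (VC C, cobounds :: (_ \<Rightarrow> 'k) set)"
  have "?p \<in> hom (Out_group G) ?Q"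
    by (rule homI) (simp_all add: V_L_image_eq Out_H2L_mult)
  moreover have "inj_on ?p (carrier (Out_group G))"
    by (rule inj_onI) (metis VC_inj Out_coset(1) prod.inject)
  ultimately have "?p \<in> iso (Out_group G) ?Q"
    by (simp add: iso_def bij_betw_def V_L_image_eq)
  then have "Out_group G \<cong> ?Q" unfolding is_iso_def by auto
  then show ?thesis by (rule group.iso_sym[OF Out_group_facts(1)])
qed

end

theorem proposition4p5:
  fixes G :: "('g, 'x) monoid_scheme"
  assumes "group G" and "finite (carrier G)"
  shows "
    subgroup (V_set G) (Aut_Hopf (DG G ::
      ('g \<times> 'g, 'k::{alg_closed_field, field_char_0}) hopf)) \<and>
    subgroup (V_L G ::
      ((('g \<times> 'g \<Rightarrow> 'k) \<Rightarrow> 'g \<times> 'g \<Rightarrow> 'k) \<times> (('g \<times> 'g) \<times> ('g \<times> 'g) \<Rightarrow> 'k)) set) (Aut_Z2L G) \<and>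
    (\<forall>v \<in> carrier (AutoGroup G).
      (\<forall>(M :: ('k, 'g \<times> 'g \<Rightarrow> 'k, 'm) hmodule) (N :: ('k, 'g \<times> 'g \<Rightarrow> 'k, 'n) hmodule)
        (P :: ('k, 'g \<times> 'g \<Rightarrow> 'k, 'p) hmodule) (M' :: ('k, 'g \<times> 'g \<Rightarrow> 'k, 'm1) hmodule)
        (N' :: ('k, 'g \<times> 'g \<Rightarrow> 'k, 'n1) hmodule).
        is_hmodule (DG G) M \<and> is_hmodule (DG G) N \<and> is_hmodule (DG G) P \<and>
        is_hmodule (DG G) M' \<and> is_hmodule (DG G) N' \<longrightarrow>
          monoidal_functor_at G (V_map G v) \<one>\<^bsub>Z2L (DGd G)\<^esub> M N P M' N' \<and>
          (\<forall>t \<in> carrier (tensor_space M N). J_map G (V_map G v) \<one>\<^bsub>Z2L (DGd G)\<^esub> M N t = t)) \<and>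
      (\<forall>g \<in> carrier G. \<forall>(W :: ('k, 'w) module) \<rho>.
        irrep (G\<lparr>carrier := Cent G g\<rparr>) W \<rho> \<longrightarrow>
          irrep (G\<lparr>carrier := Cent G (v g)\<rparr>) W (\<rho> \<circ> inv\<^bsub>AutoGroup G\<^esub> v) \<and>
          hmod_isomorphic (DG G) (F_obj G (V_map G v) (simple_obj G g W \<rho>))
            (simple_obj G (v g) W (\<rho> \<circ> inv\<^bsub>AutoGroup G\<^esub> v)))) \<and>
    (\<forall>v \<in> carrier (AutoGroup G).
      \<forall>(M :: ('k, 'g \<times> 'g \<Rightarrow> 'k, 'm) hmodule) (N :: ('k, 'g \<times> 'g \<Rightarrow> 'k, 'n) hmodule).
        is_hmodule (DG G) M \<and> is_hmodule (DG G) N \<longrightarrow>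
          braided_at G (V_map G v) \<one>\<^bsub>Z2L (DGd G)\<^esub> M N) \<and>
    subgroup (V_L_image G ::
      ((('g \<times> 'g \<Rightarrow> 'k) \<Rightarrow> 'g \<times> 'g \<Rightarrow> 'k) set \<times> (('g \<times> 'g) \<times> ('g \<times> 'g) \<Rightarrow> 'k) set) set)
      (Out_H2L G) \<and>
    (Out_H2L G :: ((('g \<times> 'g \<Rightarrow> 'k) \<Rightarrow> 'g \<times> 'g \<Rightarrow> 'k) set \<times>
      (('g \<times> 'g) \<times> ('g \<times> 'g) \<Rightarrow> 'k) set) monoid) \<lparr>carrier := V_L_image G\<rparr> \<cong> Out_group G"
proof -
  interpret fin_group G by (rule fin_group.intro[OF assms(1) fin_group_axioms.intro[OF assms(2)]])
  have J: "J_map G (V_map G v) \<one>\<^bsub>Z2L (DGd G)\<^esub> M N t = t"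
    if "is_hmodule (DG G) M" "is_hmodule (DG G) N" "t \<in> carrier (tensor_space M N)"
    for v and M :: "('k, 'g \<times> 'g \<Rightarrow> 'k, 'm) hmodule" and N :: "('k, 'g \<times> 'g \<Rightarrow> 'k, 'n) hmodule" and t
    using that(3) J_map_trivial[of M N, OF is_hmodule_lin_action[OF finite_basis_DG that(1)]
        is_hmodule_lin_action[OF finite_basis_DG that(2)]] by simp
  show ?thesis
    by (intro conjI ballI allI impI subgroup_V_set subgroup_V_L subgroup_V_L_image V_L_image_iso;
        (elim conjE)?; (rule monoidal_V_map braided_V_map irrep_transport simple_obj_V_map J; assumption)?)
qed

end
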